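(* Let $0\le k\le n$ and let $W\subset\mathrm{P}_0\mathrm{LV}_k(\mathbb{R}^n)$ be an affine invariant $C(\mathbb{R}^n)$-submodule. If $W\neq0$, then $W$ is dense in $\mathrm{P}_0\mathrm{LV}_k(\mathbb{R}^n)$ with respect to the compact-to-weak* topology.
   Context: $\mathrm{Conv}(\mathbb{R}^n,\mathbb{R})$ is the space of all finite convex functions $f:\mathbb{R}^n\to\mathbb{R}$ with the topology of locally uniform (equivalently, pointwise) convergence. $\mathcal{M}(\mathbb{R}^n)$ is the space of complex Radon measures, i.e. the topological dual of the space $C_c(\mathbb{R}^n)$ of compactly supported continuous complex-valued functions (with its usual inductive topology), equipped with the weak* topology. A map $\Psi:\mathrm{Conv}(\mathbb{R}^n,\mathbb{R})\to\mathcal{M}(\mathbb{R}^n)$ is a local functional if $f|_U=h|_U$ for an open set $U$ implies $\Psi(f)|_U=\Psi(h)|_U$. Write $\Psi(f;B)$ for the measure of $B$ under $\Psi(f)$ and $\Psi(f;\phi)=\int\phi\,d\Psi(f)$. $\mathrm{P}_0\mathrm{LV}(\mathbb{R}^n)$ is the complex vector space of all continuous local functionals that are polynomial of degree at most $0$, i.e. satisfy $\Psi(f+\ell)=\Psi(f)$ for all $f\in\mathrm{Conv}(\mathbb{R}^n,\mathbb{R})$ and all affine $\ell:\mathbb{R}^n\to\mathbb{R}$. $\mathrm{P}_0\mathrm{LV}_k(\mathbb{R}^n)$ is the subspace of $k$-homogeneous elements: $\Psi(tf)=t^k\Psi(f)$ for $t\ge0$. The group $\mathrm{Aff}(n,\mathbb{R})$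 of invertible affine transformations acts by $[\pi(g)\Psi](f;B)=\Psi(f\circ g;g^{-1}(B))$; a subspace is affine invariant if it is invariant under all $\pi(g)$. The $C(\mathbb{R}^n)$-module structure is $[\psi\bullet\Psi](f;B)=\int_B\psi\,d\Psi(f)$ for $\psi\in C(\mathbb{R}^n)$ and bounded Borel sets $B$. The compact-to-weak* topology is generated by the semi-norms $\Psi\mapsto\sup_{f\in K}|\Psi(f;\phi)|$, for $\phi\in C_c(\mathbb{R}^n)$ and $K\subset\mathrm{Conv}(\mathbb{R}^n,\mathbb{R})$ compact. *)

theory Defs
  imports "HOL-Analysis.Analysis"
begin

section \<open>Finite convex functions\<close>

text \<open>
  The type \<^typ>\<open>'a \<Rightarrow> real\<close> carries the product topology of the library, so that \<^term>\<open>continuous_on\<close>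
  and \<^term>\<open>compact\<close>, used on subsets of \<open>Conv\<close>, refer to pointwise convergence.
\<close>

definition Conv :: "('a::euclidean_space \<Rightarrow> real) set" where
  "Conv = {f. convex_on UNIV f}"

definition affine_map :: "('a::real_vector \<Rightarrow> 'b::real_vector) \<Rightarrow> bool" where
  "affine_map g \<longleftrightarrow> (\<exists>L c. linear L \<and> g = (\<lambda>x. L x + c))"

definition Aff :: "('a::real_vector \<Rightarrow> 'a) set" where
  "Aff = {g. affine_map g \<and> bij g}"


section \<open>The space of test functions and its inductive topology\<close>

definition supp :: "('a::topological_space \<Rightarrow> 'b::zero) \<Rightarrow> 'a set" where
  "supp \<phi> = closure {x. \<phi> x \<noteq> 0}"

definition Cc :: "('a::euclidean_space \<Rightarrow> complex) set" where
  "Cc = {\<phi>. continuous_on UNIV \<phi> \<and> compact (supp \<phi>)}"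

text \<open>
  The finest locally convex topology for which all inclusions of the spaces of continuous functions
  supported in a fixed compact set, with the uniform norm, are continuous: a base of neighbourhoods
  of zero consists of the absolutely convex sets whose trace on each of these spaces is a
  neighbourhood of zero.
\<close>

definition Cc_nhd0 :: "('a::euclidean_space \<Rightarrow> complex) set \<Rightarrow> bool" where
  "Cc_nhd0 V \<longleftrightarrow> V \<subseteq> Cc
     \<and> (\<forall>\<phi>\<in>V. \<forall>\<eta>\<in>V. \<forall>a b. cmod a + cmod b \<le> 1 \<longrightarrow> (\<lambda>x. a * \<phi> x + b * \<eta> x) \<in> V)
     \<and> (\<forall>K. compact K \<longrightarrow>
          (\<exists>\<delta>>0. \<forall>\<phi>\<in>Cc. supp \<phi> \<subseteq> K \<longrightarrow> (\<forall>x. cmod (\<phi> x) < \<delta>) \<longrightarrow> \<phi> \<in> V))"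

definition Cc_topology :: "('a::euclidean_space \<Rightarrow> complex) topology" where
  "Cc_topology = topology (\<lambda>U. U \<subseteq> Cc \<and>
     (\<forall>\<phi>\<in>U. \<exists>V. Cc_nhd0 V \<and> (\<forall>\<eta>\<in>V. (\<lambda>x. \<phi> x + \<eta> x) \<in> U)))"


section \<open>Complex Radon measures\<close>

text \<open>
  Radon measures are continuous linear functionals on \<open>Cc\<close>. As members of a total function type they
  are normalised to vanish outside \<open>Cc\<close>; equality of functions is then equality of measures, and
  the product topology on \<^typ>\<open>('a \<Rightarrow> complex) \<Rightarrow> complex\<close> induces the weak* topology.
\<close>

type_synonym 'a functional = "('a \<Rightarrow> complex) \<Rightarrow> complex"

definition Radon :: "'a::euclidean_space functional set" where
  "Radon = {\<mu>.
     (\<forall>\<phi>\<in>Cc. \<forall>\<eta>\<in>Cc. \<mu> (\<lambda>x. \<phi> x + \<eta> x) = \<mu> \<phi> + \<mu> \<eta>) \<and>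
     (\<forall>c. \<forall>\<phi>\<in>Cc. \<mu> (\<lambda>x. c * \<phi> x) = c * \<mu> \<phi>) \<and>
     continuous_map Cc_topology euclidean \<mu> \<and>
     (\<forall>\<phi>. \<phi> \<notin> Cc \<longrightarrow> \<mu> \<phi> = 0)}"

text \<open>\<open>\<mu>|\<^sub>U = \<nu>|\<^sub>U\<close>\<close>

definition eq_restr :: "'a::euclidean_space set \<Rightarrow> 'a functional \<Rightarrow> 'a functional \<Rightarrow> bool" where
  "eq_restr U \<mu> \<nu> \<longleftrightarrow> (\<forall>\<phi>\<in>Cc. supp \<phi> \<subseteq> U \<longrightarrow> \<mu> \<phi> = \<nu> \<phi>)"

text \<open>The measure \<open>B \<mapsto> \<mu> (g\<^sup>-\<^sup>1 B)\<close>\<close>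

definition radon_push :: "('a::euclidean_space \<Rightarrow> 'a) \<Rightarrow> 'a functional \<Rightarrow> 'a functional" where
  "radon_push g \<mu> = (\<lambda>\<phi>. \<mu> (\<phi> \<circ> g))"

text \<open>The measure \<open>B \<mapsto> \<integral>\<^sub>B \<psi> d\<mu>\<close>\<close>

definition radon_scale :: "('a::euclidean_space \<Rightarrow> complex) \<Rightarrow> 'a functional \<Rightarrow> 'a functional" where
  "radon_scale \<psi> \<mu> = (\<lambda>\<phi>. if \<phi> \<in> Cc then \<mu> (\<lambda>x. \<psi> x * \<phi> x) else 0)"


section \<open>Local functionals\<close>

text \<open>
  \<open>\<Psi> f \<phi>\<close> is the integral of \<open>\<phi>\<close> with respect to \<open>\<Psi>(f)\<close>. Again \<open>\<Psi>\<close> is normalised to vanish off its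
  domain \<open>Conv\<close>.
\<close>

type_synonym 'a local_functional = "('a \<Rightarrow> real) \<Rightarrow> 'a functional"

definition LV :: "'a::euclidean_space local_functional set" where
  "LV = {\<Psi>.
     (\<forall>f\<in>Conv. \<Psi> f \<in> Radon) \<and>
     (\<forall>f. f \<notin> Conv \<longrightarrow> \<Psi> f = (\<lambda>\<phi>. 0)) \<and>
     continuous_on Conv \<Psi> \<and>
     (\<forall>f\<in>Conv. \<forall>h\<in>Conv. \<forall>U. open U \<longrightarrow> (\<forall>x\<in>U. f x = h x) \<longrightarrow> eq_restr U (\<Psi> f) (\<Psi> h))}"

definition P0LV :: "'a::euclidean_space local_functional set" where
  "P0LV = {\<Psi> \<in> LV. \<forall>f\<in>Conv. \<forall>l. affine_map l \<longrightarrow> \<Psi> (\<lambda>x. f x + l x) = \<Psi> f}"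

definition P0LV_hom :: "nat \<Rightarrow> 'a::euclidean_space local_functional set" where
  "P0LV_hom k = {\<Psi> \<in> P0LV. \<forall>f\<in>Conv. \<forall>t\<ge>0. \<forall>\<phi>.
     \<Psi> (\<lambda>x. t * f x) \<phi> = of_real (t ^ k) * \<Psi> f \<phi>}"

definition aff_action ::
    "('a::euclidean_space \<Rightarrow> 'a) \<Rightarrow> 'a local_functional \<Rightarrow> 'a local_functional" where
  "aff_action g \<Psi> = (\<lambda>f. radon_push g (\<Psi> (f \<circ> g)))"

definition affine_invariant :: "'a::euclidean_space local_functional set \<Rightarrow> bool" where
  "affine_invariant W \<longleftrightarrow> (\<forall>g\<in>Aff. \<forall>\<Psi>\<in>W. aff_action g \<Psi> \<in> W)"

definition module_action ::
    "('a::euclidean_space \<Rightarrow> complex) \<Rightarrow> 'a local_functional \<Rightarrow> 'a local_functional" where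
  "module_action \<psi> \<Psi> = (\<lambda>f. radon_scale \<psi> (\<Psi> f))"

definition submodule_of ::
    "'a::euclidean_space local_functional set \<Rightarrow> 'a local_functional set \<Rightarrow> bool" where
  "submodule_of W X \<longleftrightarrow> W \<subseteq> X \<and> (\<lambda>f \<phi>. 0) \<in> W
     \<and> (\<forall>\<Psi>\<in>W. \<forall>\<Phi>\<in>W. (\<lambda>f \<phi>. \<Psi> f \<phi> + \<Phi> f \<phi>) \<in> W)
     \<and> (\<forall>\<psi>. continuous_on UNIV \<psi> \<longrightarrow> (\<forall>\<Psi>\<in>W. module_action \<psi> \<Psi> \<in> W))"

definition cw_seminorm ::
    "('a::euclidean_space \<Rightarrow> real) set \<Rightarrow> ('a \<Rightarrow> complex) \<Rightarrow> 'a local_functional \<Rightarrow> real" where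
  "cw_seminorm K \<phi> \<Psi> = (SUP f\<in>K. cmod (\<Psi> f \<phi>))"

text \<open>
  The empty set is excluded because its supremum is unspecified in \<^typ>\<open>real\<close>; the seminorm
  belonging to it is zero and does not contribute to the topology.
\<close>

definition compact_to_weak_star :: "'a::euclidean_space local_functional topology" where
  "compact_to_weak_star = topology_generated_by
     {{\<Phi> \<in> P0LV. cw_seminorm K \<phi> (\<lambda>f \<eta>. \<Phi> f \<eta> - \<Psi> f \<eta>) < \<epsilon>} | \<Psi> K \<phi> \<epsilon>.
        \<Psi> \<in> P0LV \<and> compact K \<and> K \<subseteq> Conv \<and> K \<noteq> {} \<and> \<phi> \<in> Cc \<and> 0 < \<epsilon>}"


section \<open>Consistency of the definitions\<close>

lemma CcI:
  assumes "continuous_on UNIV \<phi>" "compact K" "supp \<phi> \<subseteq> K"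
  shows "\<phi> \<in> Cc"
proof -
  have "compact (K \<inter> supp \<phi>)"
    using assms(2) by (rule compact_Int_closed) (simp add: supp_def)
  moreover have "K \<inter> supp \<phi> = supp \<phi>"
    using assms(3) by blast
  ultimately show ?thesis
    using assms(1) by (simp add: Cc_def)
qed

lemma Cc_lincomb:
  assumes "\<phi> \<in> Cc" "\<eta> \<in> Cc"
  shows "(\<lambda>x. a * \<phi> x + b * \<eta> x) \<in> Cc"
proof -
  have "supp (\<lambda>x. a * \<phi> x + b * \<eta> x) \<subseteq> closure ({x. \<phi> x \<noteq> 0} \<union> {x. \<eta> x \<noteq> 0})"
    unfolding supp_def by (rule closure_mono) auto
  also have "\<dots> = supp \<phi> \<union> supp \<eta>"
    by (simp add: supp_def)
  finally have "supp (\<lambda>x. a * \<phi> x + b * \<eta> x) \<subseteq> supp \<phi> \<union> supp \<eta>" .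
  moreover have "compact (supp \<phi> \<union> supp \<eta>)" "continuous_on UNIV \<phi>" "continuous_on UNIV \<eta>"
    using assms by (auto simp: Cc_def)
  ultimately show ?thesis
    by (intro CcI[of _ "supp \<phi> \<union> supp \<eta>"] continuous_intros)
qed

lemma Cc_nhd0_Cc: "Cc_nhd0 Cc"
  unfolding Cc_nhd0_def using Cc_lincomb by (auto intro!: exI[of _ "1::real"])

lemma Cc_nhd0_Int:
  assumes V: "Cc_nhd0 V" and V': "Cc_nhd0 V'"
  shows "Cc_nhd0 (V \<inter> V')"
  unfolding Cc_nhd0_def
proof (intro conjI allI impI)
  show "V \<inter> V' \<subseteq> Cc"
    using V by (auto simp: Cc_nhd0_def)
  show "\<forall>\<phi>\<in>V \<inter> V'. \<forall>\<eta>\<in>V \<inter> V'. \<forall>a b. cmod a + cmod b \<le> 1 \<longrightarrow> (\<lambda>x. a * \<phi> x + b * \<eta> x) \<in> V \<inter> V'"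
    using V V' by (simp add: Cc_nhd0_def)
  fix K :: "'a set" assume "compact K"
  then obtain d d' where "d > 0" "d' > 0"
    "\<forall>\<phi>\<in>Cc. supp \<phi> \<subseteq> K \<longrightarrow> (\<forall>x. cmod (\<phi> x) < d) \<longrightarrow> \<phi> \<in> V"
    "\<forall>\<phi>\<in>Cc. supp \<phi> \<subseteq> K \<longrightarrow> (\<forall>x. cmod (\<phi> x) < d') \<longrightarrow> \<phi> \<in> V'"
    using V V' unfolding Cc_nhd0_def by meson
  then show "\<exists>\<delta>>0. \<forall>\<phi>\<in>Cc. supp \<phi> \<subseteq> K \<longrightarrow> (\<forall>x. cmod (\<phi> x) < \<delta>) \<longrightarrow> \<phi> \<in> V \<inter> V'"
    by (intro exI[of _ "min d d'"]) simp
qed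

lemma openin_Cc_topology:
  "openin Cc_topology U \<longleftrightarrow> U \<subseteq> Cc \<and>
     (\<forall>\<phi>\<in>U. \<exists>V. Cc_nhd0 V \<and> (\<forall>\<eta>\<in>V. (\<lambda>x. \<phi> x + \<eta> x) \<in> U))" (is "_ \<longleftrightarrow> ?P U")
proof -
  have "istopology ?P"
    unfolding istopology_def
  proof (intro conjI allI impI)
    fix S T :: "('a \<Rightarrow> complex) set" assume "?P S" "?P T"
    then show "S \<inter> T \<subseteq> Cc" by blast
    show "\<forall>\<phi>\<in>S \<inter> T. \<exists>V. Cc_nhd0 V \<and> (\<forall>\<eta>\<in>V. (\<lambda>x. \<phi> x + \<eta> x) \<in> S \<inter> T)"
    proof
      fix \<phi> assume "\<phi> \<in> S \<inter> T"
      then obtain V V' where "Cc_nhd0 V" "\<forall>\<eta>\<in>V. (\<lambda>x. \<phi> x + \<eta> x) \<in> S"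
        "Cc_nhd0 V'" "\<forall>\<eta>\<in>V'. (\<lambda>x. \<phi> x + \<eta> x) \<in> T"
        using \<open>?P S\<close> \<open>?P T\<close> by blast
      then show "\<exists>V. Cc_nhd0 V \<and> (\<forall>\<eta>\<in>V. (\<lambda>x. \<phi> x + \<eta> x) \<in> S \<inter> T)"
        by (intro exI[of _ "V \<inter> V'"]) (auto intro: Cc_nhd0_Int)
    qed
  next
    fix \<K> :: "('a \<Rightarrow> complex) set set" assume *: "\<forall>S\<in>\<K>. ?P S"
    then show "\<Union>\<K> \<subseteq> Cc" by blast
    show "\<forall>\<phi>\<in>\<Union>\<K>. \<exists>V. Cc_nhd0 V \<and> (\<forall>\<eta>\<in>V. (\<lambda>x. \<phi> x + \<eta> x) \<in> \<Union>\<K>)"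
      using * by (meson UnionE UnionI)
  qed
  then show ?thesis
    unfolding Cc_topology_def by (simp add: topology_inverse')
qed

lemma topspace_Cc_topology [simp]: "topspace Cc_topology = Cc"
proof -
  have "(\<lambda>x. \<phi> x + \<eta> x) \<in> Cc" if "\<phi> \<in> Cc" "\<eta> \<in> Cc" for \<phi> \<eta> :: "'a \<Rightarrow> complex"
    using Cc_lincomb[OF that, of 1 1] by simp
  then have "openin Cc_topology (Cc :: ('a \<Rightarrow> complex) set)"
    unfolding openin_Cc_topology
    by (intro conjI subset_refl ballI exI[of _ Cc] Cc_nhd0_Cc)
  then have "Cc \<subseteq> topspace (Cc_topology :: ('a \<Rightarrow> complex) topology)"
    by (rule openin_subset)
  moreover have "openin Cc_topology (topspace (Cc_topology :: ('a \<Rightarrow> complex) topology))"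
    by (rule openin_topspace)
  then have "topspace (Cc_topology :: ('a \<Rightarrow> complex) topology) \<subseteq> Cc"
    unfolding openin_Cc_topology by (rule conjunct1)
  ultimately show ?thesis by blast
qed

text \<open>Continuity in the inductive topology is boundedness on each space of functions supported in
  a fixed compact set.\<close>

lemma continuous_Cc_iff:
  fixes \<mu> :: "'a::euclidean_space functional"
  assumes add: "\<And>\<phi> \<eta>. \<phi> \<in> Cc \<Longrightarrow> \<eta> \<in> Cc \<Longrightarrow> \<mu> (\<lambda>x. \<phi> x + \<eta> x) = \<mu> \<phi> + \<mu> \<eta>"
    and scale: "\<And>c \<phi>. \<phi> \<in> Cc \<Longrightarrow> \<mu> (\<lambda>x. c * \<phi> x) = c * \<mu> \<phi>"
  shows "continuous_map Cc_topology euclidean \<mu> \<longleftrightarrow>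
    (\<forall>K. compact K \<longrightarrow> (\<exists>C. \<forall>\<phi>\<in>Cc. supp \<phi> \<subseteq> K \<longrightarrow> cmod (\<mu> \<phi>) \<le> C * (SUP x. cmod (\<phi> x))))"
    (is "_ \<longleftrightarrow> ?R")
proof -
  have scale_Cc: "(\<lambda>x. c * \<phi> x) \<in> Cc" if "\<phi> \<in> Cc" for c and \<phi> :: "'a \<Rightarrow> complex"
    using Cc_lincomb[OF that that, of c 0] by simp
  have zero_Cc: "(\<lambda>x::'a. 0::complex) \<in> Cc"
    by (simp add: Cc_def supp_def)
  have \<mu>0: "\<mu> (\<lambda>x. 0) = 0"
    using scale[OF zero_Cc, of 0] by simp
  have bdd: "bdd_above (range (\<lambda>x. cmod (\<phi> x)))" if "\<phi> \<in> Cc" for \<phi> :: "'a \<Rightarrow> complex"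
  proof -
    have "continuous_on UNIV \<phi>" "compact (supp \<phi>)"
      using that by (auto simp: Cc_def)
    then have "compact (\<phi> ` supp \<phi>)"
      by (intro compact_continuous_image) (rule continuous_on_subset, assumption, simp)
    then obtain B where "B > 0" "\<forall>y\<in>\<phi> ` supp \<phi>. cmod y \<le> B"
      using bounded_pos compact_imp_bounded by blast
    then have B: "B > 0" "\<And>x. x \<in> supp \<phi> \<Longrightarrow> cmod (\<phi> x) \<le> B"
      by auto
    have "cmod (\<phi> x) \<le> B" for x
    proof (cases "\<phi> x = 0")
      case False
      then have "x \<in> supp \<phi>"
        using closure_subset[of "{x. \<phi> x \<noteq> 0}"] by (auto simp: supp_def)
      then show ?thesis by (rule B(2))
    qed (use B(1) in simp)
    then show ?thesis
      by (intro bdd_aboveI[of _ B]) auto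
  qed
  have ?R if cont: "continuous_map Cc_topology euclidean \<mu>"
  proof (intro allI impI)
    fix K :: "'a set" assume "compact K"
    have "openin Cc_topology {\<phi> \<in> Cc. \<mu> \<phi> \<in> ball 0 1}"
      using openin_continuous_map_preimage[OF cont, of "ball 0 1"] by simp
    moreover have "(\<lambda>x. 0) \<in> {\<phi> \<in> Cc. \<mu> \<phi> \<in> ball 0 1}"
      using zero_Cc \<mu>0 by simp
    ultimately obtain V where V0: "Cc_nhd0 V"
      "\<forall>\<eta>\<in>V. (\<lambda>x. 0 + \<eta> x) \<in> {\<phi> \<in> Cc. \<mu> \<phi> \<in> ball 0 1}"
      unfolding openin_Cc_topology by blast
    then have V: "Cc_nhd0 V" "\<And>\<eta>. \<eta> \<in> V \<Longrightarrow> cmod (\<mu> \<eta>) < 1"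
      by auto
    obtain \<delta> where \<delta>: "\<delta> > 0"
      "\<And>\<phi>. \<phi> \<in> Cc \<Longrightarrow> supp \<phi> \<subseteq> K \<Longrightarrow> (\<And>x. cmod (\<phi> x) < \<delta>) \<Longrightarrow> \<phi> \<in> V"
      using V(1) \<open>compact K\<close> unfolding Cc_nhd0_def by meson
    show "\<exists>C. \<forall>\<phi>\<in>Cc. supp \<phi> \<subseteq> K \<longrightarrow> cmod (\<mu> \<phi>) \<le> C * (SUP x. cmod (\<phi> x))"
    proof (intro exI[of _ "2 / \<delta>"] ballI impI)
      fix \<phi> :: "'a \<Rightarrow> complex" assume \<phi>: "\<phi> \<in> Cc" "supp \<phi> \<subseteq> K"
      define s where "s = (SUP x. cmod (\<phi> x))"
      have s: "cmod (\<phi> x) \<le> s" for x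
        unfolding s_def by (rule cSUP_upper[OF UNIV_I bdd[OF \<phi>(1)]])
      show "cmod (\<mu> \<phi>) \<le> 2 / \<delta> * (SUP x. cmod (\<phi> x))"
      proof (cases "s = 0")
        case True
        then have "\<phi> = (\<lambda>x. 0)" using s by auto
        then show ?thesis using \<mu>0 by simp
      next
        case False
        then have "s > 0" using s[of 0] norm_ge_zero[of "\<phi> 0"] by linarith
        define c where "c = \<delta> / (2 * s)"
        have "c > 0" using \<delta>(1) \<open>s > 0\<close> by (simp add: c_def)
        have "(\<lambda>x. of_real c * \<phi> x) \<in> V"
        proof (rule \<delta>(2))
          show "(\<lambda>x. of_real c * \<phi> x) \<in> Cc" by (rule scale_Cc) fact
          show "supp (\<lambda>x. of_real c * \<phi> x) \<subseteq> K"
            using \<phi>(2) \<open>c > 0\<close> by (simp add: supp_def)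
          fix x
          have "cmod (of_real c * \<phi> x) \<le> c * s"
            using \<open>c > 0\<close> s[of x] by (simp add: norm_mult)
          also have "c * s < \<delta>" using \<open>s > 0\<close> \<delta>(1) by (simp add: c_def)
          finally show "cmod (of_real c * \<phi> x) < \<delta>" .
        qed
        then have "c * cmod (\<mu> \<phi>) < 1"
          using V(2)[of "\<lambda>x. of_real c * \<phi> x"] scale[OF \<phi>(1)] \<open>c > 0\<close> by (simp add: norm_mult)
        then show ?thesis
          using \<open>s > 0\<close> \<delta>(1) by (simp add: c_def s_def[symmetric] field_simps)
      qed
    qed
  qed
  moreover have "continuous_map Cc_topology euclidean \<mu>" if R: ?R
    unfolding continuous_map_def
  proof (intro conjI allI impI)
    fix U :: "complex set" assume "openin euclidean U"
    then have U: "open U" by simp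
    show "openin Cc_topology {x \<in> topspace Cc_topology. \<mu> x \<in> U}"
      unfolding openin_Cc_topology topspace_Cc_topology
    proof (intro conjI ballI)
      fix \<phi> :: "'a \<Rightarrow> complex" assume "\<phi> \<in> {x \<in> Cc. \<mu> x \<in> U}"
      then have \<phi>: "\<phi> \<in> Cc" "\<mu> \<phi> \<in> U" by auto
      obtain e where e: "e > 0" "ball (\<mu> \<phi>) e \<subseteq> U"
        using openE[OF U \<phi>(2)] by blast
      define V where "V = {\<eta> \<in> Cc. cmod (\<mu> \<eta>) < e}"
      have "Cc_nhd0 V"
        unfolding Cc_nhd0_def
      proof (intro conjI ballI allI impI)
        fix \<eta> \<theta> :: "'a \<Rightarrow> complex" and a b :: complex
        assume V: "\<eta> \<in> V" "\<theta> \<in> V" and ab: "cmod a + cmod b \<le> 1"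
        have "\<mu> (\<lambda>x. a * \<eta> x + b * \<theta> x) = a * \<mu> \<eta> + b * \<mu> \<theta>"
          using V by (simp add: V_def add scale scale_Cc)
        also have "cmod \<dots> \<le> cmod a * cmod (\<mu> \<eta>) + cmod b * cmod (\<mu> \<theta>)"
          by (metis norm_mult norm_triangle_ineq)
        also have "\<dots> \<le> (cmod a + cmod b) * max (cmod (\<mu> \<eta>)) (cmod (\<mu> \<theta>))"
          by (simp add: distrib_right add_mono mult_left_mono)
        also have "\<dots> \<le> 1 * max (cmod (\<mu> \<eta>)) (cmod (\<mu> \<theta>))"
          using ab by (intro mult_right_mono) (auto simp: le_max_iff_disj)
        also have "\<dots> < e" using V by (simp add: V_def)
        finally show "(\<lambda>x. a * \<eta> x + b * \<theta> x) \<in> V"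
          using V Cc_lincomb by (auto simp: V_def)
      next
        fix K :: "'a set" assume "compact K"
        then obtain C where C: "\<And>\<phi>. \<phi> \<in> Cc \<Longrightarrow> supp \<phi> \<subseteq> K \<Longrightarrow> cmod (\<mu> \<phi>) \<le> C * (SUP x. cmod (\<phi> x))"
          using R by meson
        define \<delta> where "\<delta> = e / (2 * (\<bar>C\<bar> + 1))"
        have \<delta>: "\<delta> > 0" using e by (simp add: \<delta>_def add_nonneg_pos)
        have "\<eta> \<in> V" if \<eta>: "\<eta> \<in> Cc" "supp \<eta> \<subseteq> K" "\<And>x. cmod (\<eta> x) < \<delta>" for \<eta>
        proof -
          have "(SUP x. cmod (\<eta> x)) \<le> \<delta>"
            by (rule cSUP_least) (use \<eta>(3) less_imp_le in auto)
          moreover have "0 \<le> (SUP x. cmod (\<eta> x))"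
            by (rule cSUP_upper2[OF bdd[OF \<eta>(1)] UNIV_I norm_ge_zero])
          ultimately have "C * (SUP x. cmod (\<eta> x)) \<le> (\<bar>C\<bar> + 1) * \<delta>"
            by (intro mult_mono) auto
          also have "\<dots> = e / 2" by (simp add: \<delta>_def field_simps add_nonneg_eq_0_iff)
          finally have "cmod (\<mu> \<eta>) \<le> e / 2" using C[OF \<eta>(1,2)] by simp
          then show ?thesis using \<eta> e by (simp add: V_def)
        qed
        then show "\<exists>\<delta>>0. \<forall>\<phi>\<in>Cc. supp \<phi> \<subseteq> K \<longrightarrow> (\<forall>x. cmod (\<phi> x) < \<delta>) \<longrightarrow> \<phi> \<in> V"
          using \<delta> by blast
      qed (auto simp: V_def)
      moreover have "(\<lambda>x. \<phi> x + \<eta> x) \<in> {x \<in> Cc. \<mu> x \<in> U}" if "\<eta> \<in> V" for \<eta>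
      proof -
        have "\<eta> \<in> Cc" "cmod (\<mu> \<eta>) < e" using that by (auto simp: V_def)
        moreover have "(\<lambda>x. \<phi> x + \<eta> x) \<in> Cc"
          using Cc_lincomb[OF \<phi>(1) \<open>\<eta> \<in> Cc\<close>, of 1 1] by simp
        ultimately show ?thesis
          using e(2) add[OF \<phi>(1)] by (auto simp: dist_norm subset_iff)
      qed
      ultimately show "\<exists>V. Cc_nhd0 V \<and> (\<forall>\<eta>\<in>V. (\<lambda>x. \<phi> x + \<eta> x) \<in> {x \<in> Cc. \<mu> x \<in> U})"
        by blast
    qed auto
  qed auto
  ultimately show ?thesis by blast
qed

lemma bdd_above_cw_seminorm:
  assumes "\<Psi> \<in> P0LV" "compact K" "K \<subseteq> Conv"
  shows "bdd_above ((\<lambda>f. cmod (\<Psi> f \<phi>)) ` K)"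
proof -
  have "continuous_on K \<Psi>"
    using assms by (auto simp: P0LV_def LV_def intro: continuous_on_subset)
  then have "continuous_on K (\<lambda>f. \<Psi> f \<phi>)"
    by (rule continuous_on_product_then_coordinatewise)
  then have "continuous_on K (\<lambda>f. cmod (\<Psi> f \<phi>))"
    by (rule continuous_on_norm)
  then show ?thesis
    using assms(2) by (intro bounded_imp_bdd_above compact_imp_bounded compact_continuous_image)
qed

lemma topspace_compact_to_weak_star: "topspace compact_to_weak_star = P0LV"
proof -
  have "\<Psi> \<in> topspace compact_to_weak_star" if "\<Psi> \<in> P0LV" for \<Psi> :: "'a local_functional"
  proof -
    let ?K = "{\<lambda>x::'a. 0::real}" and ?\<phi> = "\<lambda>x::'a. 0::complex"
    let ?U = "{\<Phi> \<in> P0LV. cw_seminorm ?K ?\<phi> (\<lambda>f \<eta>. \<Phi> f \<eta> - \<Psi> f \<eta>) < 1}"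
    have K: "compact ?K" "?K \<subseteq> Conv" "?K \<noteq> {}" "?\<phi> \<in> Cc" "(0::real) < 1"
      by (auto simp: Conv_def Cc_def supp_def convex_on_def)
    have "\<Psi> \<in> ?U"
      using that by (simp add: cw_seminorm_def)
    moreover have "openin compact_to_weak_star ?U"
      unfolding compact_to_weak_star_def
      by (rule topology_generated_by_Basis, rule CollectI, intro exI conjI) (rule refl that K)+
    ultimately show ?thesis
      by (metis (no_types, lifting) openin_subset subsetD)
  qed
  moreover have "topspace compact_to_weak_star \<subseteq> (P0LV :: 'a local_functional set)"
    unfolding compact_to_weak_star_def topology_generated_by_topspace
    by (rule Union_least) auto
  ultimately show ?thesis
    by (intro subset_antisym subsetI) auto
qed


subsection \<open>Measures of bounded Borel sets\<close>

text \<open>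
  By the Riesz representation theorem every Radon functional is integration against a density with
  respect to a positive measure. Its value on a bounded Borel set is independent of the choice of
  such a representation, and on these sets \<^term>\<open>radon_push\<close> and \<^term>\<open>radon_scale\<close> are the
  image under \<open>g\<close> and the multiplication by \<open>\<psi>\<close> of measures.
\<close>

definition radon_density ::
    "'a::euclidean_space functional \<Rightarrow> 'a measure \<Rightarrow> ('a \<Rightarrow> complex) \<Rightarrow> bool" where
  "radon_density \<mu> M h \<longleftrightarrow> sets M = sets borel \<and> h \<in> borel_measurable borel
     \<and> (\<forall>B\<in>sets borel. bounded B \<longrightarrow> set_integrable M B h)
     \<and> (\<forall>\<phi>\<in>Cc. \<mu> \<phi> = (LINT x|M. \<phi> x * h x))"

lemma radon_density_restr_open:
  fixes \<mu> \<nu> :: "'a::euclidean_space functional"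
  assumes \<mu>: "radon_density \<mu> M h" and V: "open V" "bounded V"
  obtains \<theta> :: "nat \<Rightarrow> 'a \<Rightarrow> complex"
  where "\<And>n. \<theta> n \<in> Cc" "\<And>n. supp (\<theta> n) \<subseteq> V"
    "\<And>M h \<mu>. radon_density \<mu> M h \<Longrightarrow> (\<lambda>n. \<mu> (\<theta> n)) \<longlonglongrightarrow> (LINT x:V|M. h x)"
proof (cases "V = UNIV")
  case True
  then show ?thesis using V not_bounded_UNIV by blast
next
  case False
  define r where "r = (\<lambda>n x. max 0 (min 1 (real n * infdist x (- V) - 1)))"
  define \<theta> where "\<theta> = (\<lambda>n x. complex_of_real (r n x))"
  have ne: "- V \<noteq> {}" using False by auto
  have cont: "continuous_on UNIV (\<theta> n)" for n
    unfolding \<theta>_def r_def by (intro continuous_intros)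
  have supp: "supp (\<theta> n) \<subseteq> V" for n
  proof -
    have "{x. \<theta> n x \<noteq> 0} \<subseteq> {x. real n * infdist x (- V) \<ge> 1}"
      by (auto simp: \<theta>_def r_def max_def min_def split: if_splits)
    moreover have "closed {x. real n * infdist x (- V) \<ge> 1}"
      by (intro closed_Collect_le continuous_intros)
    ultimately have "supp (\<theta> n) \<subseteq> {x. real n * infdist x (- V) \<ge> 1}"
      unfolding supp_def by (rule closure_minimal)
    also have "\<dots> \<subseteq> V"
    proof
      fix x assume "x \<in> {x. real n * infdist x (- V) \<ge> 1}"
      then have "infdist x (- V) \<noteq> 0" by auto
      then show "x \<in> V" using infdist_zero[of x "- V"] by blast
    qed
    finally show ?thesis .
  qed
  show ?thesis
  proof
    show "\<theta> n \<in> Cc" for n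
      using cont V(2) supp[of n] closure_subset[of V] by (intro CcI[of _ "closure V"]) auto
    then have Cc: "\<theta> n \<in> Cc" for n .
    show "supp (\<theta> n) \<subseteq> V" for n by (rule supp)
    fix M h and \<mu> :: "'a functional"
    assume d: "radon_density \<mu> M h"
    then have sets: "sets M = sets borel" and h: "h \<in> borel_measurable M"
      by (auto simp: radon_density_def cong: measurable_cong_sets)
    have int: "set_integrable M V h"
      using d V by (simp add: radon_density_def)
    have out: "\<theta> n x = 0" if "x \<notin> V" for n x
      using supp[of n] that closure_subset[of "{x. \<theta> n x \<noteq> 0}"] by (auto simp: supp_def)
    have "(\<lambda>n. LINT x|M. \<theta> n x * h x) \<longlonglongrightarrow> (LINT x|M. indicator V x *\<^sub>R h x)"
    proof (rule integral_dominated_convergence)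
      show "(\<lambda>x. indicator V x *\<^sub>R h x) \<in> borel_measurable M"
        using h V sets by (intro borel_measurable_scaleR borel_measurable_indicator) auto
      have "\<theta> n \<in> borel_measurable M" for n
        using borel_measurable_continuous_onI[OF cont[of n]] sets
        by (simp cong: measurable_cong_sets)
      then show "(\<lambda>x. \<theta> n x * h x) \<in> borel_measurable M" for n
        using h by (intro borel_measurable_times)
      show "integrable M (\<lambda>x. cmod (indicator V x *\<^sub>R h x))"
        using int unfolding set_integrable_def by (rule integrable_norm)
      show "AE x in M. cmod (\<theta> n x * h x) \<le> cmod (indicator V x *\<^sub>R h x)" for n
      proof (rule AE_I2)
        fix x
        have "cmod (\<theta> n x) \<le> 1"
          by (simp add: \<theta>_def r_def)
        then show "cmod (\<theta> n x * h x) \<le> cmod (indicator V x *\<^sub>R h x)"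
          using out[of x n] by (cases "x \<in> V") (auto simp: norm_mult mult_left_le_one_le)
      qed
      show "AE x in M. (\<lambda>n. \<theta> n x * h x) \<longlonglongrightarrow> indicator V x *\<^sub>R h x"
      proof (rule AE_I2)
        fix x
        show "(\<lambda>n. \<theta> n x * h x) \<longlonglongrightarrow> indicator V x *\<^sub>R h x"
        proof (cases "x \<in> V")
          case True
          have "infdist x (- V) > 0"
            using True V(1) ne by (metis Compl_iff closed_Compl in_closed_iff_infdist_zero
                infdist_nonneg less_eq_real_def)
          then obtain N where "real N * infdist x (- V) > 2"
            using reals_Archimedean3 by blast
          then have "eventually (\<lambda>n. \<theta> n x * h x = indicator V x *\<^sub>R h x) sequentially"
          proof (intro eventually_sequentiallyI[of N])
            fix n assume N: "real N * infdist x (- V) > 2" "N \<le> n"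
            then have "real N * infdist x (- V) \<le> real n * infdist x (- V)"
              by (intro mult_right_mono) (auto simp: infdist_nonneg)
            with N have "r n x = 1" by (simp add: r_def)
            then show "\<theta> n x * h x = indicator V x *\<^sub>R h x"
              using True by (simp add: \<theta>_def)
          qed
          then show ?thesis by (rule tendsto_eventually)
        qed (use out[of x] in simp)
      qed
    qed
    moreover have "\<mu> (\<theta> n) = (LINT x|M. \<theta> n x * h x)" for n
      using d Cc by (simp add: radon_density_def)
    ultimately show "(\<lambda>n. \<mu> (\<theta> n)) \<longlonglongrightarrow> (LINT x:V|M. h x)"
      by (simp add: set_lebesgue_integral_def)
  qed
qed

lemma eq_restr_imp_eq_on_sets:
  fixes \<mu> \<nu> :: "'a::euclidean_space functional"
  assumes \<mu>: "radon_density \<mu> M h" and \<nu>: "radon_density \<nu> M' h'"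
    and eq: "eq_restr U \<mu> \<nu>" and U: "open U"
    and B: "B \<in> sets borel" "bounded B" "B \<subseteq> U"
  shows "(LINT x:B|M. h x) = (LINT x:B|M'. h' x)"
proof -
  have opn: "(LINT x:V|M. h x) = (LINT x:V|M'. h' x)" if V: "open V" "bounded V" "V \<subseteq> U" for V
  proof -
    obtain \<theta> where \<theta>: "\<And>n. \<theta> n \<in> Cc" "\<And>n. supp (\<theta> n) \<subseteq> V"
      "\<And>M h \<mu>. radon_density \<mu> M h \<Longrightarrow> (\<lambda>n. \<mu> (\<theta> n)) \<longlonglongrightarrow> (LINT x:V|M. h x)"
      using radon_density_restr_open[OF \<mu> V(1,2)] by metis
    have "\<mu> (\<theta> n) = \<nu> (\<theta> n)" for n
      using eq \<theta>(1,2)[of n] V(3) unfolding eq_restr_def by blast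
    then show ?thesis
      using \<theta>(3)[OF \<mu>] \<theta>(3)[OF \<nu>] LIMSEQ_unique by force
  qed
  obtain R where R: "B \<subseteq> ball 0 R"
    using B(2) by (metis bounded_subset_ballD)
  define V where "V = U \<inter> ball 0 R"
  have V: "open V" "bounded V" "V \<subseteq> U" "B \<subseteq> V"
    using U B R by (auto simp: V_def)
  have setsM: "sets M = sets borel" "sets M' = sets borel"
    using \<mu> \<nu> by (auto simp: radon_density_def)
  have int: "set_integrable M C h" "set_integrable M' C h'" if "C \<in> sets borel" "C \<subseteq> V" for C
    using \<mu> \<nu> that bounded_subset[OF V(2) that(2)] by (auto simp: radon_density_def)
  let ?P = "\<lambda>A. (LINT x:A \<inter> V|M. h x) = (LINT x:A \<inter> V|M'. h' x)"
  have stable: "Int_stable {S :: 'a set. open S}" "{S :: 'a set. open S} \<subseteq> Pow UNIV"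
    by (auto simp: Int_stable_def)
  have "B \<in> sigma_sets UNIV {S. open S}"
    using B(1) by (simp add: borel_def)
  then have "?P B"
  proof (induction rule: sigma_sets_induct_disjoint[OF stable, consumes 1, case_names basic empty compl union])
    case (basic A)
    then show ?case using V by (intro opn) auto
  next
    case (compl A)
    then have A: "A \<in> sets borel" by (simp add: borel_def)
    have *: "(LINT x:V|N. k x) = (LINT x:A \<inter> V|N. k x) + (LINT x:(UNIV - A) \<inter> V|N. k x)"
      if "\<And>C. C \<in> sets borel \<Longrightarrow> C \<subseteq> V \<Longrightarrow> set_integrable N C k" for N and k :: "'a \<Rightarrow> complex"
    proof -
      have "(LINT x:(A \<inter> V) \<union> ((UNIV - A) \<inter> V)|N. k x)
          = (LINT x:A \<inter> V|N. k x) + (LINT x:(UNIV - A) \<inter> V|N. k x)"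
        using A V(1) by (intro set_integral_Un that) auto
      moreover have "(A \<inter> V) \<union> ((UNIV - A) \<inter> V) = V" by blast
      ultimately show ?thesis by simp
    qed
    show ?case
      using *[of M h] *[of M' h'] int compl opn[OF V(1-3)] by simp
  next
    case (union A)
    then have A: "A i \<in> sets borel" for i by (auto simp: borel_def)
    have *: "(LINT x:(\<Union>i. A i \<inter> V)|N. k x) = (\<Sum>i. LINT x:A i \<inter> V|N. k x)"
      if "\<And>C. C \<in> sets borel \<Longrightarrow> C \<subseteq> V \<Longrightarrow> set_integrable N C k" "sets N = sets borel"
      for N and k :: "'a \<Rightarrow> complex"
      using A V(1) union(1)
      by (intro lebesgue_integral_countable_add that)
        (auto simp: that(2) disjoint_family_on_def)
    have "(\<Union>i. A i) \<inter> V = (\<Union>i. A i \<inter> V)" by blast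
    then show ?case
      using *[of M h] *[of M' h'] int setsM union(3) by simp
  qed (simp add: set_lebesgue_integral_def)
  then show ?thesis
    using V(4) by (simp add: Int_absorb2)
qed

definition radon_measure :: "'a::euclidean_space functional \<Rightarrow> 'a set \<Rightarrow> complex" where
  "radon_measure \<mu> B = (THE z. \<exists>M h. radon_density \<mu> M h \<and> z = (LINT x:B|M. h x))"

lemma radon_measure_eq:
  assumes "radon_density \<mu> M h" "B \<in> sets borel" "bounded B"
  shows "radon_measure \<mu> B = (LINT x:B|M. h x)"
  unfolding radon_measure_def
proof (rule the_equality)
  show "\<exists>M' h'. radon_density \<mu> M' h' \<and> (LINT x:B|M. h x) = (LINT x:B|M'. h' x)"
    using assms(1) by blast
  fix z assume "\<exists>M' h'. radon_density \<mu> M' h' \<and> z = (LINT x:B|M'. h' x)"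
  then obtain M' h' where d': "radon_density \<mu> M' h'" and z: "z = (LINT x:B|M'. h' x)"
    by blast
  have "eq_restr UNIV \<mu> \<mu>"
    by (simp add: eq_restr_def)
  then show "z = (LINT x:B|M. h x)"
    unfolding z using d' assms by (intro eq_restr_imp_eq_on_sets[OF d' assms(1), of UNIV]) auto
qed

lemma radon_measure_scale:
  assumes d: "radon_density \<mu> M h" and \<psi>: "continuous_on UNIV \<psi>"
    and B: "B \<in> sets borel" "bounded B"
  shows "radon_measure (radon_scale \<psi> \<mu>) B = (LINT x:B|M. \<psi> x * h x)"
proof (rule radon_measure_eq[OF _ B])
  have sets: "sets M = sets borel" and h: "h \<in> borel_measurable borel"
    using d by (auto simp: radon_density_def)
  have m\<psi>: "\<psi> \<in> borel_measurable borel"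
    using \<psi> by (rule borel_measurable_continuous_onI)
  have "set_integrable M C (\<lambda>x. \<psi> x * h x)" if C: "C \<in> sets borel" "bounded C" for C
  proof -
    have "compact (closure C)" using C by simp
    then have "bounded (\<psi> ` closure C)"
      by (intro compact_imp_bounded compact_continuous_image continuous_on_subset[OF \<psi>]) auto
    then obtain b where b: "\<And>x. x \<in> C \<Longrightarrow> cmod (\<psi> x) \<le> b"
      by (metis bounded_iff closure_subset image_eqI subset_iff)
    have "integrable M (\<lambda>x. indicator C x *\<^sub>R h x)"
      using d C by (simp add: radon_density_def set_integrable_def)
    then have "integrable M (\<lambda>x. b *\<^sub>R (indicator C x *\<^sub>R h x))"
      by (rule integrable_scaleR_right)
    then show ?thesis
      unfolding set_integrable_def
    proof (rule Bochner_Integration.integrable_bound)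
      show "(\<lambda>x. indicator C x *\<^sub>R (\<psi> x * h x)) \<in> borel_measurable M"
        using h m\<psi> C sets by (simp cong: measurable_cong_sets)
      show "AE x in M. norm (indicator C x *\<^sub>R (\<psi> x * h x)) \<le> norm (b *\<^sub>R (indicator C x *\<^sub>R h x))"
        using b by (intro AE_I2) (auto simp: indicator_def norm_mult intro!: mult_right_mono
            order_trans[OF _ abs_ge_self])
    qed
  qed
  moreover have "radon_scale \<psi> \<mu> \<phi> = (LINT x|M. \<phi> x * (\<psi> x * h x))" if \<phi>: "\<phi> \<in> Cc" for \<phi>
  proof -
    have "supp (\<lambda>x. \<psi> x * \<phi> x) \<subseteq> supp \<phi>"
      unfolding supp_def by (rule closure_mono) auto
    then have "(\<lambda>x. \<psi> x * \<phi> x) \<in> Cc"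
      using \<phi> \<psi> by (intro CcI[of _ "supp \<phi>"] continuous_intros) (auto simp: Cc_def)
    then show ?thesis
      using d \<phi> by (simp add: radon_scale_def radon_density_def mult_ac)
  qed
  ultimately show "radon_density (radon_scale \<psi> \<mu>) M (\<lambda>x. \<psi> x * h x)"
    using sets h m\<psi> by (simp add: radon_density_def)
qed

lemma affine_map_continuous: "affine_map g \<Longrightarrow> continuous_on S g"
  for g :: "'a::euclidean_space \<Rightarrow> 'b::euclidean_space"
proof -
  assume "affine_map g"
  then obtain L c where L: "linear L" and g: "g = (\<lambda>x. L x + c)"
    by (auto simp: affine_map_def)
  have "continuous_on S L"
    using L by (simp add: linear_continuous_on linear_conv_bounded_linear)
  then show ?thesis
    unfolding g by (rule continuous_on_add) (rule continuous_on_const)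
qed

lemma affine_map_inv:
  fixes g :: "'a::euclidean_space \<Rightarrow> 'a"
  assumes "g \<in> Aff"
  shows "inv g \<in> Aff"
proof -
  obtain L c where L: "linear L" "g = (\<lambda>x. L x + c)" and "bij g"
    using assms by (auto simp: Aff_def affine_map_def)
  have "inj L" "surj L"
  proof -
    show "inj L"
      using \<open>bij g\<close> by (auto simp: bij_def inj_def L(2))
    then show "surj L"
      using L(1) by (simp add: linear_injective_imp_surjective)
  qed
  have "inv g y = inv L y + inv L (- c)" for y
  proof -
    have "g (inv L y + inv L (- c)) = y"
      using L(1) \<open>surj L\<close> by (simp add: L(2) linear_add surj_f_inv_f)
    then show ?thesis
      using \<open>bij g\<close> by (simp add: inv_f_eq bij_is_inj)
  qed
  moreover have "linear (inv L)"
    using L(1) \<open>inj L\<close> by (rule inj_linear_imp_inv_linear)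
  ultimately show ?thesis
    using \<open>bij g\<close> by (auto simp: Aff_def affine_map_def bij_imp_bij_inv)
qed

lemma radon_measure_push:
  assumes d: "radon_density \<mu> M h" and g: "g \<in> Aff"
    and B: "B \<in> sets borel" "bounded B"
  shows "radon_measure (radon_push g \<mu>) B = radon_measure \<mu> (g -` B)"
proof -
  have sets: "sets M = sets borel" and h: "h \<in> borel_measurable borel"
    using d by (auto simp: radon_density_def)
  have bij: "bij g" using g by (simp add: Aff_def)
  have gi: "inv g (g x) = x" "g (inv g x) = x" for x
    using bij by (auto simp: bij_def inv_f_f surj_f_inv_f)
  have cg: "continuous_on S g" "continuous_on S (inv g)" for S
    using affine_map_continuous g affine_map_inv[OF g] by (auto simp: Aff_def)
  have mg: "g \<in> borel_measurable borel" "inv g \<in> borel_measurable borel"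
    using cg by (auto intro: borel_measurable_continuous_onI)
  have mgM: "g \<in> measurable M borel"
    using mg(1) sets by (simp cong: measurable_cong_sets)
  have vim: "g -` C \<in> sets borel" "bounded (g -` C)" if C: "C \<in> sets borel" "bounded C" for C
  proof -
    show "g -` C \<in> sets borel"
      using measurable_sets[OF mg(1) C(1)] by simp
    have "g -` C \<subseteq> inv g ` closure C"
    proof
      fix x assume "x \<in> g -` C"
      then have "g x \<in> closure C"
        using closure_subset[of C] by auto
      then show "x \<in> inv g ` closure C"
        by (rule rev_image_eqI) (simp add: gi)
    qed
    moreover have "compact (inv g ` closure C)"
      using C by (intro compact_continuous_image cg) simp
    ultimately show "bounded (g -` C)"
      using bounded_subset compact_imp_bounded by blast
  qed
  define M' where "M' = distr M borel g"
  define h' where "h' = h \<circ> inv g"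
  have mh': "h' \<in> borel_measurable borel"
    unfolding h'_def using measurable_comp[OF mg(2) h] .
  have "radon_density (radon_push g \<mu>) M' h'"
    unfolding radon_density_def
  proof (intro conjI ballI impI)
    show "sets M' = sets borel" by (simp add: M'_def)
    show "h' \<in> borel_measurable borel" by fact
  next
    fix C :: "'a set" assume C: "C \<in> sets borel" "bounded C"
    have "integrable M (\<lambda>x. indicator (g -` C) x *\<^sub>R h x)"
      using d vim[OF C] by (simp add: radon_density_def set_integrable_def)
    then have "integrable M (\<lambda>x. indicator C (g x) *\<^sub>R h' (g x))"
      by (simp add: h'_def gi indicator_def vimage_def)
    then show "set_integrable M' C h'"
      unfolding set_integrable_def M'_def using mh' C mgM
      by (subst integrable_distr_eq) auto
  next
    fix \<phi> :: "'a \<Rightarrow> complex" assume \<phi>: "\<phi> \<in> Cc"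
    have "{x. (\<phi> \<circ> g) x \<noteq> 0} \<subseteq> inv g ` supp \<phi>"
    proof
      fix x assume "x \<in> {x. (\<phi> \<circ> g) x \<noteq> 0}"
      then have "g x \<in> supp \<phi>"
        using closure_subset[of "{x. \<phi> x \<noteq> 0}"] by (auto simp: supp_def)
      then show "x \<in> inv g ` supp \<phi>"
        by (rule rev_image_eqI) (simp add: gi)
    qed
    moreover have cpt: "compact (inv g ` supp \<phi>)"
      using \<phi> by (intro compact_continuous_image cg) (simp add: Cc_def)
    ultimately have "supp (\<phi> \<circ> g) \<subseteq> inv g ` supp \<phi>"
      unfolding supp_def[of "\<phi> \<circ> g"] by (intro closure_minimal compact_imp_closed)
    moreover have "continuous_on UNIV (\<phi> \<circ> g)"
      using \<phi> unfolding comp_def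
      by (intro continuous_on_compose2[OF _ cg(1), of UNIV \<phi>]) (auto simp: Cc_def)
    ultimately have "\<phi> \<circ> g \<in> Cc" by (intro CcI[OF _ cpt])
    then have "radon_push g \<mu> \<phi> = (LINT x|M. \<phi> (g x) * h' (g x))"
      using d by (simp add: radon_push_def radon_density_def h'_def gi)
    moreover have "\<phi> \<in> borel_measurable borel"
      using \<phi> by (auto simp: Cc_def intro: borel_measurable_continuous_onI)
    ultimately show "radon_push g \<mu> \<phi> = (LINT x|M'. \<phi> x * h' x)"
      unfolding M'_def using mh' mgM by (subst integral_distr) auto
  qed
  then have "radon_measure (radon_push g \<mu>) B = (LINT x:B|M'. h' x)"
    using B by (rule radon_measure_eq)
  also have "\<dots> = (LINT x|M. indicator B (g x) *\<^sub>R h' (g x))"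
    unfolding set_lebesgue_integral_def M'_def using mh' mgM B
    by (subst integral_distr) auto
  also have "\<dots> = (LINT x:g -` B|M. h x)"
    by (simp add: set_lebesgue_integral_def h'_def gi indicator_def vimage_def)
  also have "\<dots> = radon_measure \<mu> (g -` B)"
    using radon_measure_eq[OF d vim[OF B]] by simp
  finally show ?thesis .
qed

end

theory Submission
  imports Defs "HOL-Computational_Algebra.Polynomial"
begin

text \<open>
  A continuous local functional that is invariant under adding affine functions is controlled by
  its values on quadratic perturbations. Write \<open>s\<^sub>u(x) = (u \<bullet> x)\<^sup>2 / 2\<close>. Locality in the direction
  \<open>u\<close> forces \<open>h \<mapsto> \<Psi>(f + h(u \<bullet> x))\<close> to be an affine function of the convex function \<open>h\<close> (theorem
  \<open>ridge_additive\<close>): of two kinks, one is affine on either side of a suitable hyperplane, and affine parts are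
  invisible. Hence \<open>dir u \<Psi>(f) = \<Psi>(f + s\<^sub>u) - \<Psi>(f)\<close> is a derivative, it lowers the degree of homogeneity
  by one, and it depends quadratically on \<open>u\<close>. If all these derivatives vanish then \<open>\<Psi>\<close> does not see
  any ridge function and is therefore constant (theorem \<open>ridge_invariant_imp_constant\<close>). After \<open>k\<close>
  derivatives a functional of degree \<open>k\<close> becomes a family of measures, one for each multiset of \<open>k\<close>
  pairs of directions, and this family determines the functional (theorem \<open>eq_0_if_iter_pol_eq_0\<close>).

  The values of such a family at a test function satisfy the identities of the \<open>k \<times> k\<close> minors of a
  Hessian: they form what is called a polarised form below, and the space of these forms is an
  irreducible representation of the linear group. Theorem \<open>polarized_irreducible\<close> proves what is needed
  of this by hand: the images of one nonzero form under invertible linear maps span all forms.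

  Averaging the translates of \<open>\<Psi>\<close> with a continuous weight of compact support turns the measures of
  the family into continuous densities, and the average is a limit of combinations of translates.
  Starting from a nonzero element of \<open>W\<close> and applying linear maps, the closure of \<open>W\<close> thus contains
  functionals whose densities at a given point span all polarised forms. By Gaussian elimination
  with continuous coefficients the same is true over a neighbourhood of this point, so the density of
  any functional becomes, after multiplication with a function supported there, a combination of
  densities from the closure of \<open>W\<close> (theorem \<open>local_generation\<close>). A partition of unity and the fact
  that each functional is approximated by its own averages finish the proof.
\<close>

section \<open>Test functions, Radon measures and convex functions\<close>

lemma CcD: "\<phi> \<in> Cc \<Longrightarrow> continuous_on S \<phi>" "\<phi> \<in> Cc \<Longrightarrow> compact (supp \<phi>)"
  by (simp_all add: Cc_def continuous_on_subset[OF _ subset_UNIV])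

lemma not_in_supp: "x \<notin> supp \<phi> \<Longrightarrow> \<phi> x = 0"
  using closure_subset[of "{x. \<phi> x \<noteq> 0}"] by (auto simp: supp_def)

lemma supp_minimal: "closed S \<Longrightarrow> (\<And>x. x \<notin> S \<Longrightarrow> \<phi> x = 0) \<Longrightarrow> supp \<phi> \<subseteq> S"
  unfolding supp_def by (rule closure_minimal) auto

lemma zero_in_Cc: "(\<lambda>x. 0) \<in> Cc"
  by (simp add: Cc_def supp_def)

lemma Cc_add: "\<phi> \<in> Cc \<Longrightarrow> \<eta> \<in> Cc \<Longrightarrow> (\<lambda>x. \<phi> x + \<eta> x) \<in> Cc"
  using Cc_lincomb[of \<phi> \<eta> 1 1] by simp

lemma Cc_diff: "\<phi> \<in> Cc \<Longrightarrow> \<eta> \<in> Cc \<Longrightarrow> (\<lambda>x. \<phi> x - \<eta> x) \<in> Cc"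
  using Cc_lincomb[of \<phi> \<eta> 1 "-1"] by simp

lemma Cc_cmult: "\<phi> \<in> Cc \<Longrightarrow> (\<lambda>x. c * \<phi> x) \<in> Cc"
  using Cc_lincomb[of \<phi> \<phi> c 0] by simp

lemma supp_mult: "supp (\<lambda>x. \<psi> x * \<phi> x) \<subseteq> supp (\<phi> :: 'a::topological_space \<Rightarrow> complex)"
  unfolding supp_def by (rule closure_mono) auto

lemma Cc_mult:
  assumes "\<phi> \<in> Cc" "continuous_on UNIV \<psi>"
  shows "(\<lambda>x. \<psi> x * \<phi> x) \<in> Cc"
  by (rule CcI[OF _ CcD(2)[OF assms(1)] supp_mult]) (intro continuous_intros assms CcD(1))

lemma Cc_bounded:
  assumes "\<phi> \<in> Cc"
  obtains b where "b > 0" "\<And>x. cmod (\<phi> x) \<le> b"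
proof -
  have "bounded (\<phi> ` supp \<phi>)"
    using assms by (intro compact_imp_bounded compact_continuous_image CcD)
  then obtain b where b: "b > 0" "\<forall>y\<in>\<phi> ` supp \<phi>. cmod y \<le> b"
    using bounded_pos by blast
  have "cmod (\<phi> x) \<le> b" for x
    using b not_in_supp[of x \<phi>] by (cases "x \<in> supp \<phi>") auto
  then show ?thesis using b(1) that by blast
qed

lemma RadonD:
  assumes "\<mu> \<in> Radon"
  shows "\<phi> \<in> Cc \<Longrightarrow> \<eta> \<in> Cc \<Longrightarrow> \<mu> (\<lambda>x. \<phi> x + \<eta> x) = \<mu> \<phi> + \<mu> \<eta>"
    "\<phi> \<in> Cc \<Longrightarrow> \<mu> (\<lambda>x. c * \<phi> x) = c * \<mu> \<phi>"
    "\<phi> \<notin> Cc \<Longrightarrow> \<mu> \<phi> = 0"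
    "continuous_map Cc_topology euclidean \<mu>"
proof -
  note * = assms[unfolded Radon_def mem_Collect_eq]
  show "\<phi> \<in> Cc \<Longrightarrow> \<eta> \<in> Cc \<Longrightarrow> \<mu> (\<lambda>x. \<phi> x + \<eta> x) = \<mu> \<phi> + \<mu> \<eta>"
    by (rule conjunct1[OF *, THEN bspec, THEN bspec])
  show "\<phi> \<in> Cc \<Longrightarrow> \<mu> (\<lambda>x. c * \<phi> x) = c * \<mu> \<phi>"
    by (rule conjunct2[OF *, THEN conjunct1, THEN spec, THEN bspec])
  show "\<phi> \<notin> Cc \<Longrightarrow> \<mu> \<phi> = 0"
    by (rule conjunct2[OF *, THEN conjunct2, THEN conjunct2, THEN spec, THEN mp])
  show "continuous_map Cc_topology euclidean \<mu>"
    by (rule conjunct2[OF *, THEN conjunct2, THEN conjunct1])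
qed

lemma Radon_diff:
  assumes "\<mu> \<in> Radon" "\<phi> \<in> Cc" "\<eta> \<in> Cc"
  shows "\<mu> (\<lambda>x. \<phi> x - \<eta> x) = \<mu> \<phi> - \<mu> \<eta>"
  using RadonD(1)[OF assms(1,2) Cc_cmult[OF assms(3), of "-1"]] RadonD(2)[OF assms(1,3), of "-1"]
  by simp

lemma Radon_zero: "\<mu> \<in> Radon \<Longrightarrow> \<mu> (\<lambda>x. 0) = 0"
  using RadonD(2)[OF _ zero_in_Cc, of \<mu> 0] by simp

lemma Radon_bounded:
  assumes "\<mu> \<in> Radon" "compact K"
  obtains C where "C \<ge> 0" "\<And>\<phi> b. \<phi> \<in> Cc \<Longrightarrow> supp \<phi> \<subseteq> K \<Longrightarrow> (\<And>x. cmod (\<phi> x) \<le> b) \<Longrightarrow> cmod (\<mu> \<phi>) \<le> C * b"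
proof -
  have "\<forall>K. compact K \<longrightarrow> (\<exists>C. \<forall>\<phi>\<in>Cc. supp \<phi> \<subseteq> K \<longrightarrow> cmod (\<mu> \<phi>) \<le> C * (SUP x. cmod (\<phi> x)))"
    by (rule continuous_Cc_iff[THEN iffD1, OF RadonD(1)[OF assms(1)] RadonD(2)[OF assms(1)] RadonD(4)[OF assms(1)]])
  then obtain C where C: "\<And>\<phi>. \<phi> \<in> Cc \<Longrightarrow> supp \<phi> \<subseteq> K \<Longrightarrow> cmod (\<mu> \<phi>) \<le> C * (SUP x. cmod (\<phi> x))"
    using assms(2) by metis
  have "cmod (\<mu> \<phi>) \<le> \<bar>C\<bar> * b" if \<phi>: "\<phi> \<in> Cc" "supp \<phi> \<subseteq> K" "\<And>x. cmod (\<phi> x) \<le> b" for \<phi> b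
  proof -
    have "(SUP x. cmod (\<phi> x)) \<le> b" by (rule cSUP_least) (use \<phi>(3) in auto)
    moreover have "0 \<le> (SUP x. cmod (\<phi> x))"
      by (rule cSUP_upper2[where x = 0, OF _ UNIV_I]) (rule bdd_aboveI2[where M = b], rule \<phi>(3), simp)
    ultimately have "C * (SUP x. cmod (\<phi> x)) \<le> \<bar>C\<bar> * b"
      by (intro mult_mono) auto
    with C[OF \<phi>(1,2)] show ?thesis by linarith
  qed
  then show ?thesis by (intro that[of "\<bar>C\<bar>"]) auto
qed

lemma RadonI:
  assumes "\<And>\<phi> \<eta>. \<phi> \<in> Cc \<Longrightarrow> \<eta> \<in> Cc \<Longrightarrow> \<mu> (\<lambda>x. \<phi> x + \<eta> x) = \<mu> \<phi> + \<mu> \<eta>"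
    and "\<And>c \<phi>. \<phi> \<in> Cc \<Longrightarrow> \<mu> (\<lambda>x. c * \<phi> x) = c * \<mu> \<phi>"
    and "\<And>\<phi>. \<phi> \<notin> Cc \<Longrightarrow> \<mu> \<phi> = 0"
    and "\<And>K. compact K \<Longrightarrow> \<exists>C. \<forall>\<phi> b. \<phi> \<in> Cc \<longrightarrow> supp \<phi> \<subseteq> K \<longrightarrow> (\<forall>x. cmod (\<phi> x) \<le> b) \<longrightarrow> cmod (\<mu> \<phi>) \<le> C * b"
  shows "\<mu> \<in> Radon"
proof -
  have "\<exists>C. \<forall>\<phi>\<in>Cc. supp \<phi> \<subseteq> K \<longrightarrow> cmod (\<mu> \<phi>) \<le> C * (SUP x. cmod (\<phi> x))" if K: "compact K" for K
  proof -
    obtain C where C: "\<And>\<phi> b. \<phi> \<in> Cc \<Longrightarrow> supp \<phi> \<subseteq> K \<Longrightarrow> (\<And>x. cmod (\<phi> x) \<le> b) \<Longrightarrow> cmod (\<mu> \<phi>) \<le> C * b"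
      using assms(4)[OF K] by metis
    have "cmod (\<phi> x) \<le> (SUP x. cmod (\<phi> x))" if \<phi>: "\<phi> \<in> Cc" for \<phi> x
    proof -
      obtain b where "\<And>x. cmod (\<phi> x) \<le> b" using Cc_bounded[OF \<phi>] by blast
      then show ?thesis by (intro cSUP_upper[OF UNIV_I] bdd_aboveI2[where M = b]) simp
    qed
    with C show ?thesis by blast
  qed
  then have "continuous_map Cc_topology euclidean \<mu>"
    by (simp add: continuous_Cc_iff[of \<mu>, OF assms(1,2)])
  then show ?thesis
    unfolding Radon_def mem_Collect_eq
    by (intro conjI ballI allI impI) (rule assms, assumption+)+
qed

lemma Cc_uniformly_continuous:
  fixes \<phi> :: "'a::euclidean_space \<Rightarrow> complex"
  assumes "\<phi> \<in> Cc" "\<epsilon> > 0"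
  obtains \<delta> where "\<delta> > 0" "\<And>x y :: 'a. dist x y < \<delta> \<Longrightarrow> cmod (\<phi> x - \<phi> y) < \<epsilon>"
proof -
  define S where "S = {x + y | x y. x \<in> supp \<phi> \<and> y \<in> cball 0 1}"
  have "compact S" unfolding S_def by (rule compact_sums[OF CcD(2)[OF assms(1)] compact_cball])
  then have "uniformly_continuous_on S \<phi>"
    by (intro compact_uniformly_continuous CcD assms)
  then obtain d where d: "d > 0" "\<And>x y. x \<in> S \<Longrightarrow> y \<in> S \<Longrightarrow> dist y x < d \<Longrightarrow> dist (\<phi> y) (\<phi> x) < \<epsilon>"
    using assms(2) unfolding uniformly_continuous_on_def by meson
  have S: "y \<in> S" if "x \<in> supp \<phi>" "dist x y < 1" for x y :: 'a
    unfolding S_def using that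
    by (intro CollectI exI[of _ x] exI[of _ "y - x"]) (simp add: dist_norm norm_minus_commute)
  show ?thesis
  proof (rule that[of "min d 1"])
    fix x y :: 'a assume xy: "dist x y < min d 1"
    show "cmod (\<phi> x - \<phi> y) < \<epsilon>"
    proof (cases "x \<in> supp \<phi> \<or> y \<in> supp \<phi>")
      case True
      then have "x \<in> S" "y \<in> S" using S[of x x] S[of y y] S[of x y] S[of y x] xy by (auto simp: dist_commute)
      then show ?thesis using d(2)[of y x] xy by (simp add: dist_norm)
    next
      case False
      then show ?thesis using assms(2) by (simp add: not_in_supp)
    qed
  qed (use d in auto)
qed

lemma ConvD: "f \<in> Conv \<Longrightarrow> convex_on UNIV f" and ConvI: "convex_on UNIV f \<Longrightarrow> f \<in> Conv"
  by (auto simp: Conv_def)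

lemma Conv_continuous: "f \<in> Conv \<Longrightarrow> continuous_on S f"
  by (rule continuous_on_subset[OF convex_on_continuous[OF open_UNIV] subset_UNIV]) (simp add: Conv_def)

lemma Conv_add: "f \<in> Conv \<Longrightarrow> h \<in> Conv \<Longrightarrow> (\<lambda>x. f x + h x) \<in> Conv"
  by (simp add: Conv_def convex_on_add)

lemma Conv_cmult: "f \<in> Conv \<Longrightarrow> t \<ge> 0 \<Longrightarrow> (\<lambda>x. t * f x) \<in> Conv"
  by (simp add: Conv_def convex_on_cmul)

lemma Conv_comp_affine: "f \<in> Conv \<Longrightarrow> affine_map g \<Longrightarrow> (\<lambda>x. f (g x)) \<in> Conv"
  for g :: "'a::euclidean_space \<Rightarrow> 'b::euclidean_space"
proof (rule ConvI, rule convex_onI)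
  fix t :: real and x y :: 'a assume f: "f \<in> Conv" "affine_map g" and t: "0 < t" "t < 1"
  obtain L c where L: "linear L" "g = (\<lambda>x. L x + c)" using f(2) by (auto simp: affine_map_def)
  have "g ((1 - t) *\<^sub>R x + t *\<^sub>R y) = (1 - t) *\<^sub>R g x + t *\<^sub>R g y"
    using linear_add[OF L(1)] linear_scale[OF L(1)] linear_diff[OF L(1)] by (simp add: L(2) scaleR_add_right scaleR_diff_left)
  then show "f (g ((1 - t) *\<^sub>R x + t *\<^sub>R y)) \<le> (1 - t) * f (g x) + t * f (g y)"
    using convex_onD[OF ConvD[OF f(1)], of t "g x" "g y"] t by simp
qed simp

lemma affine_map_ridge: "affine_map (\<lambda>x. u \<bullet> x)" "affine_map (\<lambda>x. x + c)" "affine_map (\<lambda>x. c)"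
  unfolding affine_map_def
  by (rule exI[of _ "\<lambda>x. u \<bullet> x"], rule exI[of _ 0], simp add: bounded_linear.linear bounded_linear_inner_right)
    (rule exI[of _ "\<lambda>x. x"], rule exI[of _ c], simp add: linear_id[unfolded id_def],
     rule exI[of _ "\<lambda>x. 0"], rule exI[of _ c], simp add: linear_zero)

lemma affine_map_in_Conv: "affine_map l \<Longrightarrow> l \<in> Conv"
  for l :: "'a::euclidean_space \<Rightarrow> real"
proof -
  have "(\<lambda>x::real. x) \<in> Conv" by (simp add: Conv_def convex_on_def)
  from Conv_comp_affine[OF this, of l] show "affine_map l \<Longrightarrow> l \<in> Conv" .
qed

lemma Conv_const: "(\<lambda>x. c) \<in> Conv"
  by (simp add: affine_map_in_Conv affine_map_ridge)

lemma Conv_ridge: "convex_on UNIV h \<Longrightarrow> (\<lambda>x. h (u \<bullet> x)) \<in> Conv"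
  using Conv_comp_affine[of h "\<lambda>x. u \<bullet> x"] affine_map_ridge(1) by (auto simp: Conv_def)

lemma Conv_add_ridge: "f \<in> Conv \<Longrightarrow> convex_on UNIV h \<Longrightarrow> (\<lambda>x. f x + h (u \<bullet> x)) \<in> Conv"
  by (rule Conv_add[OF _ Conv_ridge])

lemma Conv_add_affine: "f \<in> Conv \<Longrightarrow> affine_map l \<Longrightarrow> (\<lambda>x. f x + l x) \<in> Conv"
  by (rule Conv_add[OF _ affine_map_in_Conv])

lemma tendsto_fun_iff:
  "(g \<longlongrightarrow> l) F \<longleftrightarrow> (\<forall>x. ((\<lambda>i. g i x) \<longlongrightarrow> l x) F)" for g :: "'b \<Rightarrow> 'a \<Rightarrow> 'c::topological_space"
proof -
  have "limitin euclidean g l F \<longleftrightarrow> limitin (product_topology (\<lambda>i::'a. euclidean::'c topology) UNIV) g l F"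
    by (simp add: euclidean_product_topology)
  then show ?thesis
    by (simp add: limitin_componentwise)
qed

lemma P0LV_D:
  assumes "\<Psi> \<in> P0LV"
  shows "f \<in> Conv \<Longrightarrow> \<Psi> f \<in> Radon"
    "f \<notin> Conv \<Longrightarrow> \<Psi> f = (\<lambda>\<phi>. 0)"
    "f \<in> Conv \<Longrightarrow> affine_map l \<Longrightarrow> \<Psi> (\<lambda>x. f x + l x) = \<Psi> f"
    "f \<in> Conv \<Longrightarrow> h \<in> Conv \<Longrightarrow> open U \<Longrightarrow> (\<And>x. x \<in> U \<Longrightarrow> f x = h x) \<Longrightarrow> \<phi> \<in> Cc \<Longrightarrow> supp \<phi> \<subseteq> U \<Longrightarrow> \<Psi> f \<phi> = \<Psi> h \<phi>"
proof -
  have LV: "\<Psi> \<in> LV" and aff: "\<forall>f\<in>Conv. \<forall>l. affine_map l \<longrightarrow> \<Psi> (\<lambda>x. f x + l x) = \<Psi> f"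
    using assms by (simp_all add: P0LV_def)
  show "f \<in> Conv \<Longrightarrow> \<Psi> f \<in> Radon" "f \<notin> Conv \<Longrightarrow> \<Psi> f = (\<lambda>\<phi>. 0)"
    using LV unfolding LV_def by blast+
  show "f \<in> Conv \<Longrightarrow> affine_map l \<Longrightarrow> \<Psi> (\<lambda>x. f x + l x) = \<Psi> f"
    using aff by blast
  show "f \<in> Conv \<Longrightarrow> h \<in> Conv \<Longrightarrow> open U \<Longrightarrow> (\<And>x. x \<in> U \<Longrightarrow> f x = h x) \<Longrightarrow> \<phi> \<in> Cc \<Longrightarrow> supp \<phi> \<subseteq> U \<Longrightarrow> \<Psi> f \<phi> = \<Psi> h \<phi>"
    using LV unfolding LV_def eq_restr_def by blast
qed

lemma P0LV_continuous: "\<Psi> \<in> P0LV \<Longrightarrow> continuous_on Conv (\<lambda>f. \<Psi> f \<phi>)"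
  by (rule continuous_on_product_then_coordinatewise[of Conv "\<lambda>f. \<Psi> f"]) (simp add: P0LV_def LV_def)

lemma P0LV_tendsto:
  assumes "\<Psi> \<in> P0LV" "\<And>x. ((\<lambda>i. g i x) \<longlongrightarrow> f x) F" "f \<in> Conv" "\<And>i. g i \<in> Conv"
  shows "((\<lambda>i. \<Psi> (g i) \<phi>) \<longlongrightarrow> \<Psi> f \<phi>) F"
proof (rule continuous_on_tendsto_compose[OF P0LV_continuous[OF assms(1)] _ assms(3)])
  show "(g \<longlongrightarrow> f) F" unfolding tendsto_fun_iff using assms(2) by blast
  show "\<forall>\<^sub>F i in F. g i \<in> Conv" using assms(4) by simp
qed

lemma P0LV_homD:
  assumes "\<Psi> \<in> P0LV_hom k"
  shows "\<Psi> \<in> P0LV" "f \<in> Conv \<Longrightarrow> t \<ge> 0 \<Longrightarrow> \<Psi> (\<lambda>x. t * f x) \<phi> = of_real (t ^ k) * \<Psi> f \<phi>"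
proof -
  note * = assms[unfolded P0LV_hom_def mem_Collect_eq]
  show "\<Psi> \<in> P0LV" by (rule conjunct1[OF *])
  assume f: "f \<in> Conv" and t: "t \<ge> 0"
  show "\<Psi> (\<lambda>x. t * f x) \<phi> = of_real (t ^ k) * \<Psi> f \<phi>"
    by (rule conjunct2[OF *, THEN bspec, OF f, THEN spec, THEN mp, OF t, THEN spec])
qed

lemma eq_off_Cc:
  assumes "\<Psi> \<in> P0LV" "\<phi> \<notin> Cc"
  shows "\<Psi> f \<phi> = 0"
proof (cases "f \<in> Conv")
  case True
  show ?thesis by (rule RadonD(3)[OF P0LV_D(1)[OF assms(1) True] assms(2)])
next
  case False
  show ?thesis unfolding P0LV_D(2)[OF assms(1) False] by (rule refl)
qed

text \<open>A partition of unity in the single variable \<open>u \<bullet> x\<close> splits a test function into parts supported in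
  the two overlapping half spaces.\<close>

lemma Radon_eq_of_strips:
  assumes \<mu>: "\<mu> \<in> Radon" and \<nu>: "\<nu> \<in> Radon" and ab: "a < b"
    and low: "\<And>\<phi>. \<phi> \<in> Cc \<Longrightarrow> supp \<phi> \<subseteq> {x. u \<bullet> x < b} \<Longrightarrow> \<mu> \<phi> = \<nu> \<phi>"
    and high: "\<And>\<phi>. \<phi> \<in> Cc \<Longrightarrow> supp \<phi> \<subseteq> {x. u \<bullet> x > a} \<Longrightarrow> \<mu> \<phi> = \<nu> \<phi>"
    and \<phi>: "\<phi> \<in> Cc"
  shows "\<mu> \<phi> = \<nu> \<phi>"
proof -
  define c where "c = (2 * a + b) / 3"
  define d where "d = (a + 2 * b) / 3"
  have cd: "a < c" "c < d" "d < b" using ab by (auto simp: c_def d_def)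
  define \<psi> :: "'a \<Rightarrow> complex" where "\<psi> x = of_real (max 0 (min 1 ((u \<bullet> x - c) / (d - c))))" for x
  have cont: "continuous_on UNIV \<psi>" "continuous_on UNIV (\<lambda>x. 1 - \<psi> x)"
    unfolding \<psi>_def using cd by (auto intro!: continuous_intros)
  have 1: "(\<lambda>x. \<psi> x * \<phi> x) \<in> Cc" "(\<lambda>x. (1 - \<psi> x) * \<phi> x) \<in> Cc"
    by (intro Cc_mult \<phi> cont)+
  have "supp (\<lambda>x. \<psi> x * \<phi> x) \<subseteq> {x. u \<bullet> x \<ge> c}"
    using cd by (intro supp_minimal closed_halfspace_ge) (auto simp: \<psi>_def divide_nonpos_pos)
  then have h: "supp (\<lambda>x. \<psi> x * \<phi> x) \<subseteq> {x. u \<bullet> x > a}" using cd by auto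
  have "supp (\<lambda>x. (1 - \<psi> x) * \<phi> x) \<subseteq> {x. u \<bullet> x \<le> d}"
    using cd by (intro supp_minimal closed_halfspace_le) (auto simp: \<psi>_def)
  then have l: "supp (\<lambda>x. (1 - \<psi> x) * \<phi> x) \<subseteq> {x. u \<bullet> x < b}" using cd by auto
  have "\<phi> = (\<lambda>x. \<psi> x * \<phi> x + (1 - \<psi> x) * \<phi> x)" by (simp add: algebra_simps)
  then have "\<mu> \<phi> = \<mu> (\<lambda>x. \<psi> x * \<phi> x) + \<mu> (\<lambda>x. (1 - \<psi> x) * \<phi> x)"
    "\<nu> \<phi> = \<nu> (\<lambda>x. \<psi> x * \<phi> x) + \<nu> (\<lambda>x. (1 - \<psi> x) * \<phi> x)"
    using RadonD(1)[OF \<mu> 1] RadonD(1)[OF \<nu> 1] by simp_all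
  with low[OF 1(2) l] high[OF 1(1) h] show ?thesis by simp
qed

lemma Radon_lincomb:
  assumes "\<mu> \<in> Radon" "\<nu> \<in> Radon"
  shows "(\<lambda>\<phi>. a * \<mu> \<phi> + b * \<nu> \<phi>) \<in> Radon"
proof (rule RadonI)
  fix K :: "'a set" assume K: "compact K"
  obtain C where C: "\<And>\<phi> b. \<phi> \<in> Cc \<Longrightarrow> supp \<phi> \<subseteq> K \<Longrightarrow> (\<And>x. cmod (\<phi> x) \<le> b) \<Longrightarrow> cmod (\<mu> \<phi>) \<le> C * b"
    using Radon_bounded[OF assms(1) K] by metis
  obtain C' where C': "\<And>\<phi> b. \<phi> \<in> Cc \<Longrightarrow> supp \<phi> \<subseteq> K \<Longrightarrow> (\<And>x. cmod (\<phi> x) \<le> b) \<Longrightarrow> cmod (\<nu> \<phi>) \<le> C' * b"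
    using Radon_bounded[OF assms(2) K] by metis
  show "\<exists>C. \<forall>\<phi> e. \<phi> \<in> Cc \<longrightarrow> supp \<phi> \<subseteq> K \<longrightarrow> (\<forall>x. cmod (\<phi> x) \<le> e) \<longrightarrow> cmod (a * \<mu> \<phi> + b * \<nu> \<phi>) \<le> C * e"
  proof (intro exI[of _ "cmod a * C + cmod b * C'"] allI impI)
    fix \<phi> e assume \<phi>: "\<phi> \<in> Cc" "supp \<phi> \<subseteq> K" "\<forall>x. cmod (\<phi> x) \<le> e"
    have "cmod (a * \<mu> \<phi> + b * \<nu> \<phi>) \<le> cmod a * cmod (\<mu> \<phi>) + cmod b * cmod (\<nu> \<phi>)"
      by (metis norm_mult norm_triangle_ineq)
    also have "\<dots> \<le> cmod a * (C * e) + cmod b * (C' * e)"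
      using C[OF \<phi>(1,2)] C'[OF \<phi>(1,2)] \<phi>(3) by (intro add_mono mult_left_mono) auto
    finally show "cmod (a * \<mu> \<phi> + b * \<nu> \<phi>) \<le> (cmod a * C + cmod b * C') * e"
      by (simp add: algebra_simps)
  qed
qed (simp_all add: RadonD[OF assms(1)] RadonD[OF assms(2)] algebra_simps)

section \<open>Adding ridge functions\<close>

lemma affine_convex: "convex_on UNIV (\<lambda>t::real. p * t + q)"
proof -
  have "affine_map (\<lambda>t::real. p * t + q)"
    unfolding affine_map_def
    by (intro exI[of _ "\<lambda>x. p * x"] exI[of _ q]) (auto intro!: bounded_linear.linear bounded_linear_intros)
  then show ?thesis using affine_map_in_Conv ConvD by blast
qed

lemma convex_on_max:
  fixes f g :: "'a::real_vector \<Rightarrow> real"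
  assumes "convex_on S f" "convex_on S g"
  shows "convex_on S (\<lambda>x. max (f x) (g x))"
proof (rule convex_onI)
  fix t :: real and x y assume t: "0 < t" "t < 1" and xy: "x \<in> S" "y \<in> S"
  have "(1 - t) * f x + t * f y \<le> (1 - t) * max (f x) (g x) + t * max (f y) (g y)"
    "(1 - t) * g x + t * g y \<le> (1 - t) * max (f x) (g x) + t * max (f y) (g y)"
    using t by (intro add_mono mult_left_mono; simp)+
  then show "max (f ((1 - t) *\<^sub>R x + t *\<^sub>R y)) (g ((1 - t) *\<^sub>R x + t *\<^sub>R y))
      \<le> (1 - t) * max (f x) (g x) + t * max (f y) (g y)"
    using convex_onD[OF assms(1), of t x y] convex_onD[OF assms(2), of t x y] t xy by (simp add: max_def)
qed (use assms in \<open>simp add: convex_on_def\<close>)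

definition ridge_add :: "('a::euclidean_space \<Rightarrow> real) \<Rightarrow> 'a \<Rightarrow> (real \<Rightarrow> real) \<Rightarrow> 'a \<Rightarrow> real" where
  "ridge_add f u h = (\<lambda>x. f x + h (u \<bullet> x))"

lemma ridge_add_Conv: "f \<in> Conv \<Longrightarrow> convex_on UNIV h \<Longrightarrow> ridge_add f u h \<in> Conv"
  unfolding ridge_add_def by (rule Conv_add_ridge)

lemma ridge_add_add: "ridge_add (ridge_add f u h) u g = ridge_add f u (\<lambda>t. h t + g t)"
  by (simp add: ridge_add_def add.assoc)

lemma ridge_add_affine:
  assumes "D \<in> P0LV" "f \<in> Conv" "convex_on UNIV h" "\<And>t. g t = h t + (p * t + q)"
  shows "D (ridge_add f u g) = D (ridge_add f u h)"
proof -
  have a: "affine_map (\<lambda>x. p * (u \<bullet> x) + q)"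
    unfolding affine_map_def
    by (intro exI[of _ "\<lambda>x. p * (u \<bullet> x)"] exI[of _ q])
      (auto intro!: bounded_linear.linear bounded_linear_intros)
  have "ridge_add f u g = (\<lambda>x. ridge_add f u h x + (p * (u \<bullet> x) + q))"
    by (simp add: ridge_add_def assms(4) fun_eq_iff)
  then show ?thesis
    using P0LV_D(3)[OF assms(1) ridge_add_Conv[OF assms(2,3)] a] by simp
qed

lemma ridge_add_local:
  assumes "D \<in> P0LV" "f \<in> Conv" "convex_on UNIV h" "convex_on UNIV g" "open O'"
    "\<And>t. t \<in> O' \<Longrightarrow> g t = h t + (p * t + q)"
    "\<phi> \<in> Cc" "supp \<phi> \<subseteq> {x. u \<bullet> x \<in> O'}"
  shows "D (ridge_add f u g) \<phi> = D (ridge_add f u h) \<phi>"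
proof -
  define h' where "h' = (\<lambda>t. h t + (p * t + q))"
  have c: "convex_on UNIV h'" unfolding h'_def
    by (intro convex_on_add assms(3) affine_convex)
  have "open {x. u \<bullet> x \<in> O'}"
    using continuous_open_vimage[OF assms(5), of "\<lambda>x. u \<bullet> x"] by (simp add: vimage_def)
  then have "D (ridge_add f u g) \<phi> = D (ridge_add f u h') \<phi>"
    by (rule P0LV_D(4)[OF assms(1) ridge_add_Conv[OF assms(2,4)] ridge_add_Conv[OF assms(2) c] _ _ assms(7,8)])
      (simp add: ridge_add_def h'_def assms(6))
  also have "D (ridge_add f u h') = D (ridge_add f u h)"
    by (rule ridge_add_affine[OF assms(1-3)]) (simp add: h'_def)
  finally show ?thesis .
qed

lemma ridge_add_tendsto:
  assumes "D \<in> P0LV" "f \<in> Conv" "\<And>i. convex_on UNIV (h i)" "convex_on UNIV g" "\<And>t. ((\<lambda>i. h i t) \<longlongrightarrow> g t) F"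
  shows "((\<lambda>i. D (ridge_add f u (h i)) \<phi>) \<longlongrightarrow> D (ridge_add f u g) \<phi>) F"
  by (rule P0LV_tendsto[OF assms(1) _ ridge_add_Conv[OF assms(2,4)] ridge_add_Conv[OF assms(2,3)]])
    (unfold ridge_add_def, intro tendsto_intros assms(5))

text \<open>Where \<open>t > a\<close> the function \<open>h\<close> is affine and invisible, where \<open>t < b\<close> the same holds for \<open>g\<close>; the identity
  holds on each of the two half spaces, and these overlap.\<close>

lemma separated_additive:
  assumes D: "D \<in> P0LV" and f: "f \<in> Conv" and c: "convex_on UNIV h" "convex_on UNIV g"
    and ab: "a < b" and h: "\<And>t. t > a \<Longrightarrow> h t = p * t + q" and g: "\<And>t. t < b \<Longrightarrow> g t = r * t + s"
    and \<phi>: "\<phi> \<in> Cc"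
  shows "D (ridge_add f u (\<lambda>t. h t + g t)) \<phi> + D f \<phi> = D (ridge_add f u h) \<phi> + D (ridge_add f u g) \<phi>"
proof -
  have z: "convex_on UNIV (\<lambda>t::real. 0::real)" "f = ridge_add f u (\<lambda>t. 0)"
    by (simp_all add: convex_on_def ridge_add_def)
  have chg: "convex_on UNIV (\<lambda>t. h t + g t)" by (intro convex_on_add c)
  note R = P0LV_D(1)[OF D ridge_add_Conv[OF f, of _ u]]
  have "(\<lambda>\<phi>. 1 * D (ridge_add f u (\<lambda>t. h t + g t)) \<phi> + 1 * D (ridge_add f u (\<lambda>t. 0)) \<phi>) \<phi>
      = (\<lambda>\<phi>. 1 * D (ridge_add f u h) \<phi> + 1 * D (ridge_add f u g) \<phi>) \<phi>"
  proof (rule Radon_eq_of_strips[OF Radon_lincomb Radon_lincomb ab _ _ \<phi>, of _ _ _ _ u];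
      (rule R, rule c chg z)?)
    fix \<theta> :: "'a \<Rightarrow> complex" assume \<theta>: "\<theta> \<in> Cc" "supp \<theta> \<subseteq> {x. u \<bullet> x < b}"
    have s: "supp \<theta> \<subseteq> {x. u \<bullet> x \<in> {..<b}}" using \<theta>(2) by auto
    have "D (ridge_add f u (\<lambda>t. h t + g t)) \<theta> = D (ridge_add f u h) \<theta>"
      by (rule ridge_add_local[OF D f c(1) chg open_lessThan _ \<theta>(1) s, of r s]) (auto simp: g)
    moreover have "D (ridge_add f u g) \<theta> = D (ridge_add f u (\<lambda>t. 0)) \<theta>"
      by (rule ridge_add_local[OF D f z(1) c(2) open_lessThan _ \<theta>(1) s, of r s]) (auto simp: g)
    ultimately show "1 * D (ridge_add f u (\<lambda>t. h t + g t)) \<theta> + 1 * D (ridge_add f u (\<lambda>t. 0)) \<theta>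
      = 1 * D (ridge_add f u h) \<theta> + 1 * D (ridge_add f u g) \<theta>" by simp
  next
    fix \<theta> :: "'a \<Rightarrow> complex" assume \<theta>: "\<theta> \<in> Cc" "supp \<theta> \<subseteq> {x. a < u \<bullet> x}"
    have s: "supp \<theta> \<subseteq> {x. u \<bullet> x \<in> {a<..}}" using \<theta>(2) by auto
    have "D (ridge_add f u (\<lambda>t. h t + g t)) \<theta> = D (ridge_add f u g) \<theta>"
      by (rule ridge_add_local[OF D f c(2) chg open_greaterThan _ \<theta>(1) s, of p q]) (auto simp: h)
    moreover have "D (ridge_add f u h) \<theta> = D (ridge_add f u (\<lambda>t. 0)) \<theta>"
      by (rule ridge_add_local[OF D f z(1) c(1) open_greaterThan _ \<theta>(1) s, of p q]) (auto simp: h)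
    ultimately show "1 * D (ridge_add f u (\<lambda>t. h t + g t)) \<theta> + 1 * D (ridge_add f u (\<lambda>t. 0)) \<theta>
      = 1 * D (ridge_add f u h) \<theta> + 1 * D (ridge_add f u g) \<theta>" by simp
  qed
  then show ?thesis using z(2) by simp
qed

lemma convex_on_shift: "convex_on UNIV g \<Longrightarrow> convex_on UNIV (\<lambda>t::real. g (t - \<epsilon>))" for g :: "real \<Rightarrow> real"
  using Conv_comp_affine[of g "\<lambda>t. t + - \<epsilon>", OF ConvI affine_map_ridge(2)] by (simp add: Conv_def)

text \<open>Moving \<open>g\<close> to the right by a small amount separates the two breaking points; continuity of the
  functional allows to let this amount tend to zero.\<close>

lemma touching_additive:
  assumes D: "D \<in> P0LV" and f: "f \<in> Conv" and c: "convex_on UNIV h" "convex_on UNIV g"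
    and h: "\<And>t. t > a \<Longrightarrow> h t = p * t + q" and g: "\<And>t. t < a \<Longrightarrow> g t = r * t + s"
    and \<phi>: "\<phi> \<in> Cc"
  shows "D (ridge_add f u (\<lambda>t. h t + g t)) \<phi> + D f \<phi> = D (ridge_add f u h) \<phi> + D (ridge_add f u g) \<phi>"
proof -
  define \<epsilon> where "\<epsilon> m = inverse (real (Suc m))" for m
  define G where "G m = (\<lambda>t. g (t - \<epsilon> m))" for m
  have eps: "\<epsilon> \<longlonglongrightarrow> 0" "\<And>m. \<epsilon> m > 0"
    unfolding \<epsilon>_def using LIMSEQ_inverse_real_of_nat by auto
  have cG: "convex_on UNIV (G m)" for m unfolding G_def by (rule convex_on_shift[OF c(2)])
  have lim: "(\<lambda>m. G m t) \<longlonglongrightarrow> g t" for t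
  proof -
    have "(\<lambda>m. t - \<epsilon> m) \<longlonglongrightarrow> t - 0" by (intro tendsto_intros eps)
    moreover have "isCont g t" using Conv_continuous[OF ConvI[OF c(2)], of UNIV]
      by (simp add: continuous_on_eq_continuous_at)
    ultimately show ?thesis unfolding G_def using isCont_tendsto_compose[of t g "\<lambda>m. t - \<epsilon> m"] by simp
  qed
  have eq: "D (ridge_add f u (\<lambda>t. h t + G m t)) \<phi> + D f \<phi> = D (ridge_add f u h) \<phi> + D (ridge_add f u (G m)) \<phi>" for m
    by (rule separated_additive[OF D f c(1) cG _ h _ \<phi>, where b = "a + \<epsilon> m" and r = r and s = "s - r * \<epsilon> m"])
      (auto simp: eps G_def g algebra_simps)
  have "(\<lambda>m. D (ridge_add f u (\<lambda>t. h t + G m t)) \<phi> + D f \<phi>) \<longlonglongrightarrow> D (ridge_add f u (\<lambda>t. h t + g t)) \<phi> + D f \<phi>"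
    by (intro tendsto_intros ridge_add_tendsto[OF D f] convex_on_add c cG lim)
  moreover have "(\<lambda>m. D (ridge_add f u h) \<phi> + D (ridge_add f u (G m)) \<phi>) \<longlonglongrightarrow> D (ridge_add f u h) \<phi> + D (ridge_add f u g) \<phi>"
    by (intro tendsto_intros ridge_add_tendsto[OF D f] c cG lim)
  ultimately show ?thesis unfolding eq by (rule LIMSEQ_unique)
qed

subsection \<open>Piecewise affine functions of one variable\<close>

definition kink :: "real \<Rightarrow> real \<Rightarrow> real" where "kink a t = max 0 (t - a)"

lemma kink_convex: "convex_on UNIV (kink a)"
  using convex_on_max[OF affine_convex[of 0 0] affine_convex[of 1 "- a"]] by (simp add: kink_def[abs_def])

text \<open>Nonnegative combinations of kinks, up to affine functions.\<close>

inductive_set kink_sums :: "(real \<Rightarrow> real) set" where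
  affine: "(\<lambda>t. p * t + q) \<in> kink_sums"
| add: "h \<in> kink_sums \<Longrightarrow> c \<ge> 0 \<Longrightarrow> (\<lambda>t. h t + c * kink a t) \<in> kink_sums"

lemma convex_on_kink_mult: "c \<ge> 0 \<Longrightarrow> convex_on UNIV (\<lambda>t. c * kink a t)"
  by (rule convex_on_cmul[OF _ kink_convex])

lemma kink_sums_convex: "h \<in> kink_sums \<Longrightarrow> convex_on UNIV h"
  by (induction rule: kink_sums.induct) (auto intro!: convex_on_add affine_convex convex_on_kink_mult)


definition ridge_additive :: "'a::euclidean_space local_functional \<Rightarrow> 'a \<Rightarrow> (real \<Rightarrow> real) \<Rightarrow> (real \<Rightarrow> real) \<Rightarrow> bool" where
  "ridge_additive D u h g \<longleftrightarrow> (\<forall>f\<in>Conv. \<forall>\<phi>\<in>Cc.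
     D (ridge_add f u (\<lambda>t. h t + g t)) \<phi> + D f \<phi> = D (ridge_add f u h) \<phi> + D (ridge_add f u g) \<phi>)"

lemma ridge_additive_sym: "ridge_additive D u h g \<longleftrightarrow> ridge_additive D u g h"
  unfolding ridge_additive_def by (simp add: add.commute)

lemma ridge_additive_affine:
  assumes "D \<in> P0LV" "convex_on UNIV g"
  shows "ridge_additive D u (\<lambda>t. p * t + q) g"
  unfolding ridge_additive_def
proof (intro ballI)
  fix f :: "'a \<Rightarrow> real" and \<phi> :: "'a \<Rightarrow> complex" assume f: "f \<in> Conv"
  have z: "convex_on UNIV (\<lambda>t::real. 0::real)" "f = ridge_add f u (\<lambda>t. 0)"
    by (simp_all add: convex_on_def ridge_add_def)
  have "D (ridge_add f u (\<lambda>t. p * t + q + g t)) = D (ridge_add f u g)"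
    "D (ridge_add f u (\<lambda>t. p * t + q)) = D (ridge_add f u (\<lambda>t. 0))"
    by (rule ridge_add_affine[OF assms(1) f assms(2)], simp add: add.commute)
      (rule ridge_add_affine[OF assms(1) f z(1)], simp)
  then show "D (ridge_add f u (\<lambda>t. p * t + q + g t)) \<phi> + D f \<phi>
    = D (ridge_add f u (\<lambda>t. p * t + q)) \<phi> + D (ridge_add f u g) \<phi>"
    using z(2) by simp
qed

lemma ridge_additive_add:
  assumes "convex_on UNIV h'" "ridge_additive D u h g" "ridge_additive D u h' g"
  shows "ridge_additive D u (\<lambda>t. h t + h' t) g"
  unfolding ridge_additive_def
proof (intro ballI)
  fix f :: "'a \<Rightarrow> real" and \<phi> :: "'a \<Rightarrow> complex" assume f: "f \<in> Conv" and \<phi>: "\<phi> \<in> Cc"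
  have f': "ridge_add f u h' \<in> Conv" by (rule ridge_add_Conv[OF f assms(1)])
  have 1: "D (ridge_add (ridge_add f u h') u (\<lambda>t. h t + g t)) \<phi> + D (ridge_add f u h') \<phi>
     = D (ridge_add (ridge_add f u h') u h) \<phi> + D (ridge_add (ridge_add f u h') u g) \<phi>"
    using assms(2) f' \<phi> unfolding ridge_additive_def by blast
  have 2: "D (ridge_add f u (\<lambda>t. h' t + g t)) \<phi> + D f \<phi> = D (ridge_add f u h') \<phi> + D (ridge_add f u g) \<phi>"
    using assms(3) f \<phi> unfolding ridge_additive_def by blast
  have e: "(\<lambda>t. h' t + (h t + g t)) = (\<lambda>t. h t + h' t + g t)" "(\<lambda>t. h' t + h t) = (\<lambda>t. h t + h' t)"
    by (auto simp: add_ac)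
  have *: "x + f0 = y + z" if "x + p = y + w" "w + f0 = p + z" for x f0 y z p w :: complex
  proof -
    have "x + f0 = (x + p) + (w + f0) - (p + w)" by simp
    then show ?thesis unfolding that by simp
  qed
  show "D (ridge_add f u (\<lambda>t. h t + h' t + g t)) \<phi> + D f \<phi>
     = D (ridge_add f u (\<lambda>t. h t + h' t)) \<phi> + D (ridge_add f u g) \<phi>"
    by (rule *[OF 1[unfolded ridge_add_add e] 2])
qed

lemma ridge_additive_tendsto:
  assumes D: "D \<in> P0LV" and c: "\<And>m. convex_on UNIV (H m)" "convex_on UNIV h" "convex_on UNIV g"
    and add: "\<And>m. ridge_additive D u (H m) g" and lim: "\<And>t. (\<lambda>m. H m t) \<longlonglongrightarrow> h t"
  shows "ridge_additive D u h g"
  unfolding ridge_additive_def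
proof (intro ballI)
  fix f :: "'a \<Rightarrow> real" and \<phi> :: "'a \<Rightarrow> complex" assume f: "f \<in> Conv" and \<phi>: "\<phi> \<in> Cc"
  have eq: "D (ridge_add f u (\<lambda>t. H m t + g t)) \<phi> + D f \<phi> = D (ridge_add f u (H m)) \<phi> + D (ridge_add f u g) \<phi>" for m
    using add f \<phi> unfolding ridge_additive_def by blast
  have "(\<lambda>m. D (ridge_add f u (\<lambda>t. H m t + g t)) \<phi> + D f \<phi>) \<longlonglongrightarrow> D (ridge_add f u (\<lambda>t. h t + g t)) \<phi> + D f \<phi>"
    by (intro tendsto_intros ridge_add_tendsto[OF D f] convex_on_add c lim)
  moreover have "(\<lambda>m. D (ridge_add f u (H m)) \<phi> + D (ridge_add f u g) \<phi>) \<longlonglongrightarrow> D (ridge_add f u h) \<phi> + D (ridge_add f u g) \<phi>"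
    by (intro tendsto_intros ridge_add_tendsto[OF D f] c lim)
  ultimately show "D (ridge_add f u (\<lambda>t. h t + g t)) \<phi> + D f \<phi> = D (ridge_add f u h) \<phi> + D (ridge_add f u g) \<phi>"
    unfolding eq by (rule LIMSEQ_unique)
qed

text \<open>To the left of the larger breaking point the kink that breaks there vanishes, to the right of it the other one
  is affine.\<close>

lemma ridge_additive_kinks:
  assumes D: "D \<in> P0LV" and cd: "c \<ge> 0" "d \<ge> 0"
  shows "ridge_additive D u (\<lambda>t. c * kink a t) (\<lambda>t. d * kink b t)"
proof -
  have *: "ridge_additive D u (\<lambda>t. c * kink a t) (\<lambda>t. d * kink b t)" if "c \<ge> 0" "d \<ge> 0" "a \<le> b" for c d a b
    unfolding ridge_additive_def
  proof (intro ballI)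
    fix f :: "'a \<Rightarrow> real" and \<phi> :: "'a \<Rightarrow> complex" assume f: "f \<in> Conv" and \<phi>: "\<phi> \<in> Cc"
    show "D (ridge_add f u (\<lambda>t. c * kink a t + d * kink b t)) \<phi> + D f \<phi>
      = D (ridge_add f u (\<lambda>t. c * kink a t)) \<phi> + D (ridge_add f u (\<lambda>t. d * kink b t)) \<phi>"
      by (rule touching_additive[OF D f convex_on_kink_mult[OF that(1)] convex_on_kink_mult[OF that(2)] _ _ \<phi>,
            where a = b and p = c and q = "- (c * a)" and r = 0 and s = 0])
        (use that in \<open>auto simp: kink_def algebra_simps\<close>)
  qed
  show ?thesis
    using *[OF cd, of a b] *[OF cd(2,1), of b a] ridge_additive_sym[of D u] linear[of a b] by blast
qed

lemma ridge_additive_kink_sums: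
  assumes D: "D \<in> P0LV" and h: "h \<in> kink_sums" and g: "g \<in> kink_sums"
  shows "ridge_additive D u h g"
  using h
proof (induction rule: kink_sums.induct)
  case (affine p q)
  show ?case by (rule ridge_additive_affine[OF D kink_sums_convex[OF g]])
next
  case (add h c a)
  have "ridge_additive D u g (\<lambda>t. c * kink a t)"
    using g
  proof (induction rule: kink_sums.induct)
    case (affine p q)
    show ?case by (rule ridge_additive_affine[OF D convex_on_kink_mult[OF add.hyps(2)]])
  next
    case (add g d b)
    show ?case
      by (rule ridge_additive_add[OF convex_on_kink_mult[OF add.hyps(2)] add.IH
          ridge_additive_kinks[OF D add.hyps(2) \<open>c \<ge> 0\<close>]])
  qed
  then have "ridge_additive D u (\<lambda>t. c * kink a t) g" by (simp add: ridge_additive_sym)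
  then show ?case by (rule ridge_additive_add[OF convex_on_kink_mult[OF add.hyps(2)] add.IH])
qed

text \<open>Slopes of chords of a convex function increase, so a piecewise affine interpolation only has kinks
  with nonnegative coefficients.\<close>

lemma chord_interpolation_kink_sum:
  fixes h :: "real \<Rightarrow> real"
  assumes h: "convex_on UNIV h" and \<delta>: "\<delta> > 0"
  shows "\<exists>H. H \<in> kink_sums \<and> (\<forall>j t. j \<le> n \<longrightarrow> a + real j * \<delta> \<le> t \<longrightarrow> t \<le> a + (real j + 1) * \<delta> \<longrightarrow>
       H t = h (a + real j * \<delta>) + (h (a + (real j + 1) * \<delta>) - h (a + real j * \<delta>)) / \<delta> * (t - (a + real j * \<delta>)))"
proof -
  define A where "A i = a + real i * \<delta>" for i
  define s where "s i = (h (A (Suc i)) - h (A i)) / \<delta>" for i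
  have AS: "A (Suc i) = A i + \<delta>" for i by (simp add: A_def algebra_simps)
  have mono: "s i \<le> s (Suc i)" for i
  proof -
    have "A (Suc i) = (1 - 1/2) *\<^sub>R A i + (1/2) *\<^sub>R A (Suc (Suc i))" by (simp add: AS field_simps)
    then have "h (A (Suc i)) \<le> (1 - 1/2) * h (A i) + 1/2 * h (A (Suc (Suc i)))"
      using convex_onD[OF h, of "1/2" "A i" "A (Suc (Suc i))"] by simp
    then show ?thesis using \<delta> by (simp add: s_def divide_right_mono)
  qed
  have Amono: "A i \<le> A j" if "i \<le> j" for i j using that \<delta> by (simp add: A_def)
  have "\<exists>H\<in>kink_sums. (\<forall>j\<le>n. \<forall>t. A j \<le> t \<longrightarrow> t \<le> A (Suc j) \<longrightarrow> H t = h (A j) + s j * (t - A j))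
      \<and> (\<forall>t\<ge>A n. H t = h (A n) + s n * (t - A n))" for n
  proof (induction n)
    case 0
    have "(\<lambda>t. s 0 * t + (h (A 0) - s 0 * A 0)) \<in> kink_sums" by (rule kink_sums.affine)
    then show ?case by (rule rev_bexI) (auto simp: algebra_simps)
  next
    case (Suc n)
    then obtain H where H: "H \<in> kink_sums" "\<And>j t. j \<le> n \<Longrightarrow> A j \<le> t \<Longrightarrow> t \<le> A (Suc j) \<Longrightarrow> H t = h (A j) + s j * (t - A j)"
      "\<And>t. t \<ge> A n \<Longrightarrow> H t = h (A n) + s n * (t - A n)" by blast
    define G where "G = (\<lambda>t. H t + (s (Suc n) - s n) * kink (A (Suc n)) t)"
    have "G \<in> kink_sums" unfolding G_def using mono[of n] by (intro kink_sums.add H) simp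
    moreover have 2: "G t = h (A (Suc n)) + s (Suc n) * (t - A (Suc n))" if "t \<ge> A (Suc n)" for t
    proof -
      have "G t = h (A n) + s n * (t - A n) + (s (Suc n) - s n) * (t - A (Suc n))"
        using that H(3)[of t] AS[of n] \<delta> by (simp add: G_def kink_def)
      also have "\<dots> = h (A n) + s n * \<delta> + s (Suc n) * (t - A (Suc n))"
        by (simp add: AS algebra_simps)
      also have "s n * \<delta> = h (A (Suc n)) - h (A n)" using \<delta> by (simp add: s_def)
      finally show ?thesis by simp
    qed
    moreover have "G t = h (A j) + s j * (t - A j)" if "j \<le> Suc n" "A j \<le> t" "t \<le> A (Suc j)" for j t
    proof (cases "j = Suc n")
      case False
      then have "j \<le> n" using that by simp
      then have "A (Suc j) \<le> A (Suc n)" by (intro Amono) simp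
      then have "kink (A (Suc n)) t = 0" using that by (simp add: kink_def)
      then show ?thesis using H(2)[OF \<open>j \<le> n\<close> that(2,3)] by (simp add: G_def)
    qed (use 2 that in simp)
    ultimately show ?case by blast
  qed
  from this[of n] obtain H where H: "H \<in> kink_sums"
    "\<forall>j\<le>n. \<forall>t. A j \<le> t \<longrightarrow> t \<le> A (Suc j) \<longrightarrow> H t = h (A j) + s j * (t - A j)"
    by (elim bexE conjE) (rule that)
  show ?thesis
    by (intro exI[of _ H] conjI H(1)) (use H(2) in \<open>simp add: A_def s_def add.commute\<close>)
qed

text \<open>Interpolation on finer and finer grids over larger and larger intervals.\<close>

lemma kink_sums_dense:
  assumes h: "convex_on UNIV h"
  obtains H where "\<And>m. H m \<in> kink_sums" "\<And>t. (\<lambda>m::nat. H m t) \<longlonglongrightarrow> h t"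
proof -
  define M where "M m = real (Suc m)" for m
  define P where "P m H \<longleftrightarrow> H \<in> kink_sums \<and> (\<forall>j t. j \<le> 2 * Suc m ^ 2 \<longrightarrow>
     - M m + real j * (1 / M m) \<le> t \<longrightarrow> t \<le> - M m + (real j + 1) * (1 / M m) \<longrightarrow>
     H t = h (- M m + real j * (1 / M m)) + (h (- M m + (real j + 1) * (1 / M m)) - h (- M m + real j * (1 / M m)))
       / (1 / M m) * (t - (- M m + real j * (1 / M m))))" for m H
  have "\<exists>H. P m H" for m
    unfolding P_def by (rule chord_interpolation_kink_sum[OF h]) (simp add: M_def)
  then obtain H where PH: "\<And>m. P m (H m)" by metis
  have H: "H m \<in> kink_sums" for m
    using PH[of m] by (simp add: P_def)
  have H2: "H m t = h (- M m + real j * (1 / M m)) + (h (- M m + (real j + 1) * (1 / M m)) - h (- M m + real j * (1 / M m)))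
       / (1 / M m) * (t - (- M m + real j * (1 / M m)))"
    if "j \<le> 2 * Suc m ^ 2" "- M m + real j * (1 / M m) \<le> t" "t \<le> - M m + (real j + 1) * (1 / M m)" for m j t
    using PH[of m, unfolded P_def, THEN conjunct2, rule_format, OF that] .
  have "(\<lambda>m. H m t) \<longlonglongrightarrow> h t" for t
  proof (rule LIMSEQ_I)
    fix e :: real assume e: "e > 0"
    have "continuous_on UNIV h" by (rule Conv_continuous[OF ConvI[OF h]])
    then obtain d where d: "d > 0" "\<And>x. dist x t < d \<Longrightarrow> dist (h x) (h t) < e"
      using e unfolding continuous_on_iff by (metis UNIV_I)
    obtain N :: nat where N: "real N > \<bar>t\<bar>" "real N > 1 / d"
      using reals_Archimedean2[of "max \<bar>t\<bar> (1 / d)"] by auto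
    show "\<exists>N. \<forall>m\<ge>N. norm (H m t - h t) < e"
    proof (intro exI[of _ N] allI impI)
      fix m assume m: "N \<le> m"
      have M: "M m > \<bar>t\<bar>" "M m > 1 / d" "M m > 0" using N m by (auto simp: M_def)
      define j where "j = nat \<lfloor>(t + M m) * M m\<rfloor>"
      have pos: "(t + M m) * M m \<ge> 0" using M by (intro mult_nonneg_nonneg) auto
      have j: "real j \<le> (t + M m) * M m" "(t + M m) * M m < real j + 1"
        using pos by (auto simp: j_def of_nat_nat)
      define x where "x = - M m + real j * (1 / M m)"
      define y where "y = - M m + (real j + 1) * (1 / M m)"
      have xt: "x \<le> t" "t \<le> y" "y = x + 1 / M m" using j M by (auto simp: x_def y_def field_simps)
      have "real j \<le> (2 * M m) * M m"
        using j(1) M mult_right_mono[of "t + M m" "2 * M m" "M m"] by linarith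
      then have "real j \<le> real (2 * Suc m ^ 2)" by (simp add: M_def power2_eq_square algebra_simps)
      then have jle: "j \<le> 2 * Suc m ^ 2" by (simp only: of_nat_le_iff)
      have Ht: "H m t = h x + (h y - h x) / (1 / M m) * (t - x)"
        unfolding x_def y_def using xt by (intro H2[OF jle]) (simp_all add: x_def y_def)
      define \<theta> where "\<theta> = (t - x) * M m"
      have \<theta>: "0 \<le> \<theta>" "\<theta> \<le> 1" using xt M by (auto simp: \<theta>_def field_simps)
      have dM: "1 / M m < d" using M(2,3) d(1) by (simp add: field_simps)
      have "\<bar>h x - h t\<bar> < e" "\<bar>h y - h t\<bar> < e"
        using d(2)[of x] d(2)[of y] xt dM by (auto simp: dist_real_def)
      moreover have "H m t - h t = (1 - \<theta>) * (h x - h t) + \<theta> * (h y - h t)"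
        by (simp add: Ht \<theta>_def algebra_simps)
      moreover have "\<bar>(1 - \<theta>) * (h x - h t) + \<theta> * (h y - h t)\<bar> \<le> (1 - \<theta>) * \<bar>h x - h t\<bar> + \<theta> * \<bar>h y - h t\<bar>"
        using \<theta> abs_triangle_ineq[of "(1 - \<theta>) * (h x - h t)" "\<theta> * (h y - h t)"] by (simp add: abs_mult)
      moreover have "(1 - \<theta>) * \<bar>h x - h t\<bar> + \<theta> * \<bar>h y - h t\<bar> < e"
        using calculation(1,2) \<theta> by (intro convex_bound_lt) auto
      ultimately show "norm (H m t - h t) < e" by simp
    qed
  qed
  with H show ?thesis by (rule that)
qed


text \<open>Additivity is inherited from pairs of kinks by sums of kinks, and from these by limits, first in one
  and then in the other argument.\<close>

theorem ridge_additive: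
  assumes D: "D \<in> P0LV" and c: "convex_on UNIV h" "convex_on UNIV g"
  shows "ridge_additive D u h g"
proof -
  obtain H where H: "\<And>m. H m \<in> kink_sums" "\<And>t. (\<lambda>m::nat. H m t) \<longlonglongrightarrow> h t"
    using kink_sums_dense[OF c(1)] by metis
  obtain G where G: "\<And>m. G m \<in> kink_sums" "\<And>t. (\<lambda>m::nat. G m t) \<longlonglongrightarrow> g t"
    using kink_sums_dense[OF c(2)] by metis
  have "ridge_additive D u g (H m)" for m
    by (rule ridge_additive_tendsto[where H = G, OF D kink_sums_convex[OF G(1)] c(2) kink_sums_convex[OF H(1)]
          ridge_additive_kink_sums[OF D G(1) H(1)] G(2)])
  then have "ridge_additive D u (H m) g" for m
    by (subst ridge_additive_sym)
  then show ?thesis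
    by (rule ridge_additive_tendsto[where H = H, OF D kink_sums_convex[OF H(1)] c _ H(2)])
qed

text \<open>Additivity gives linearity for rational multiples, and continuity does the rest.\<close>

lemma ridge_linear:
  assumes D: "D \<in> P0LV" and f: "f \<in> Conv" and h: "convex_on UNIV h" and t: "t \<ge> 0" and \<phi>: "\<phi> \<in> Cc"
  shows "D (ridge_add f u (\<lambda>x. t * h x)) \<phi> = D f \<phi> + of_real t * (D (ridge_add f u h) \<phi> - D f \<phi>)"
proof -
  define G where "G s = D (ridge_add f u (\<lambda>x. s * h x)) \<phi> - D f \<phi>" for s
  have c: "convex_on UNIV (\<lambda>x. s * h x)" if "s \<ge> 0" for s by (rule convex_on_cmul[OF that h])
  have add: "G (s + r) = G s + G r" if "s \<ge> 0" "r \<ge> 0" for s r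
    using ridge_additive[OF D c[OF that(1)] c[OF that(2)], of u, unfolded ridge_additive_def, rule_format, OF f \<phi>]
    by (simp add: G_def distrib_right algebra_simps)
  have G0: "G 0 = 0" by (simp add: G_def ridge_add_def)
  have nat: "G (of_nat n * s) = of_nat n * G s" if "s \<ge> 0" for n s
    by (induction n) (use that in \<open>simp_all add: G0 add distrib_right\<close>)
  define r where "r n = real (nat \<lfloor>t * real (Suc n)\<rfloor>)" for n
  define s where "s n = r n * (1 / real (Suc n))" for n
  have rn: "r n \<le> t * real (Suc n)" "t * real (Suc n) < r n + 1" for n
    using t by (auto simp: r_def of_nat_nat)
  have s: "t - 1 / real (Suc n) \<le> s n" "s n \<le> t" "s n \<ge> 0" for n
  proof -
    have "t \<le> (r n + 1) / real (Suc n)" using rn(2)[of n] by (subst pos_le_divide_eq) auto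
    then show "t - 1 / real (Suc n) \<le> s n" by (simp add: s_def add_divide_distrib)
    show "s n \<le> t" using rn(1)[of n] by (simp add: s_def pos_divide_le_eq)
    show "s n \<ge> 0" by (simp add: s_def r_def)
  qed
  have "(\<lambda>n. t - 1 / real (Suc n)) \<longlonglongrightarrow> t - 0"
    by (intro tendsto_intros LIMSEQ_inverse_real_of_nat[unfolded inverse_eq_divide])
  then have lim: "s \<longlonglongrightarrow> t"
    by (intro tendsto_sandwich[of "\<lambda>n. t - 1 / real (Suc n)" s _ "\<lambda>n. t"]) (simp_all add: s del: of_nat_Suc)
  have "G (s n) = of_real (s n) * G 1" for n
  proof -
    have "G (s n) = of_nat (nat \<lfloor>t * real (Suc n)\<rfloor>) * G (1 / real (Suc n))"
      unfolding s_def r_def by (rule nat) simp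
    moreover have "G 1 = of_nat (Suc n) * G (1 / real (Suc n))"
      using nat[of "1 / real (Suc n)" "Suc n"] by simp
    moreover have "complex_of_real (s n) = of_nat (nat \<lfloor>t * real (Suc n)\<rfloor>) / of_nat (Suc n)"
      by (simp add: s_def r_def)
    ultimately show ?thesis by (simp del: of_nat_Suc)
  qed
  then have "(\<lambda>n. G (s n)) \<longlonglongrightarrow> of_real t * G 1"
    by (simp only:) (intro tendsto_intros lim)
  moreover have "(\<lambda>n. G (s n)) \<longlonglongrightarrow> G t"
    unfolding G_def by (intro tendsto_intros ridge_add_tendsto[OF D f] c s t lim)
  ultimately have "G t = of_real t * G 1" by (metis LIMSEQ_unique)
  then show ?thesis by (simp add: G_def algebra_simps)
qed

subsection \<open>Invariance under squares implies invariance under all ridge functions\<close>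

text \<open>Such a measure is carried by the hyperplane \<open>u \<bullet> x = a\<close>, on which multiplication by \<open>u \<bullet> x\<close> is
  multiplication by \<open>a\<close>.\<close>

lemma Radon_on_hyperplane:
  fixes u :: "'a::euclidean_space"
  assumes \<mu>: "\<mu> \<in> Radon"
    and low: "\<And>\<phi>. \<phi> \<in> Cc \<Longrightarrow> supp \<phi> \<subseteq> {x. u \<bullet> x < a} \<Longrightarrow> \<mu> \<phi> = 0"
    and high: "\<And>\<phi>. \<phi> \<in> Cc \<Longrightarrow> supp \<phi> \<subseteq> {x. u \<bullet> x > a} \<Longrightarrow> \<mu> \<phi> = 0"
    and \<phi>: "\<phi> \<in> Cc"
  shows "\<mu> (\<lambda>x. of_real (u \<bullet> x) * \<phi> x) = of_real a * \<mu> \<phi>"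
proof -
  obtain b where b: "b > 0" "\<And>x. cmod (\<phi> x) \<le> b" using Cc_bounded[OF \<phi>] by metis
  obtain C where C: "C \<ge> 0" "\<And>\<theta> b. \<theta> \<in> Cc \<Longrightarrow> supp \<theta> \<subseteq> supp \<phi> \<Longrightarrow> (\<And>x. cmod (\<theta> x) \<le> b) \<Longrightarrow> cmod (\<mu> \<theta>) \<le> C * b"
    using Radon_bounded[OF \<mu> CcD(2)[OF \<phi>]] by metis
  define \<theta> where "\<theta> = (\<lambda>x. complex_of_real (u \<bullet> x - a) * \<phi> x)"
  have \<theta>: "\<theta> \<in> Cc" unfolding \<theta>_def by (intro Cc_mult \<phi> continuous_intros)
  have "cmod (\<mu> \<theta>) \<le> C * b * \<delta>" if \<delta>: "\<delta> > 0" for \<delta>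
  proof -
    define \<theta>1 where "\<theta>1 = (\<lambda>x. complex_of_real (max 0 (u \<bullet> x - a - \<delta>)) * \<phi> x)"
    define \<theta>2 where "\<theta>2 = (\<lambda>x. complex_of_real (max 0 (a - u \<bullet> x - \<delta>)) * \<phi> x)"
    have Cc: "\<theta>1 \<in> Cc" "\<theta>2 \<in> Cc"
      unfolding \<theta>1_def \<theta>2_def by (intro Cc_mult \<phi> continuous_intros)+
    have "supp \<theta>1 \<subseteq> {x. u \<bullet> x \<ge> a + \<delta>}"
      by (rule supp_minimal[OF closed_halfspace_ge]) (auto simp: \<theta>1_def)
    then have 1: "\<mu> \<theta>1 = 0" using \<delta> by (intro high Cc) auto
    have "supp \<theta>2 \<subseteq> {x. u \<bullet> x \<le> a - \<delta>}"
      by (rule supp_minimal[OF closed_halfspace_le]) (auto simp: \<theta>2_def)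
    then have 2: "\<mu> \<theta>2 = 0" using \<delta> by (intro low Cc) auto
    define \<rho> where "\<rho> = (\<lambda>x. \<theta> x - (\<theta>1 x - \<theta>2 x))"
    have \<rho>: "\<rho> \<in> Cc" unfolding \<rho>_def by (intro Cc_diff \<theta> Cc)
    have "\<mu> \<rho> = \<mu> \<theta>"
      unfolding \<rho>_def using Radon_diff[OF \<mu> \<theta> Cc_diff[OF Cc]] Radon_diff[OF \<mu> Cc] 1 2 by simp
    have \<rho>x: "\<rho> x = of_real (u \<bullet> x - a - (max 0 (u \<bullet> x - a - \<delta>) - max 0 (a - u \<bullet> x - \<delta>))) * \<phi> x" for x
      by (simp add: \<rho>_def \<theta>_def \<theta>1_def \<theta>2_def algebra_simps)
    have "cmod (\<rho> x) \<le> \<delta> * b" for x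
      unfolding \<rho>x norm_mult norm_of_real using \<delta> b by (intro mult_mono) (auto simp: max_def)
    moreover have "supp \<rho> \<subseteq> supp \<phi>"
      by (rule supp_minimal) (simp_all add: \<rho>x not_in_supp, simp add: supp_def)
    ultimately have "cmod (\<mu> \<rho>) \<le> C * (\<delta> * b)" by (intro C(2) \<rho>)
    then show ?thesis using \<open>\<mu> \<rho> = \<mu> \<theta>\<close> by (simp add: mult_ac)
  qed note bound = this
  have "cmod (\<mu> \<theta>) \<le> 0"
  proof (rule field_le_epsilon)
    fix e :: real assume e: "e > 0"
    have "C * b * (e / (C * b + 1)) \<le> e"
    proof -
      have pos: "C * b + 1 > 0" using C(1) b(1) by (simp add: add_nonneg_pos)
      have "C * b * e \<le> e * (C * b + 1)" using e by (simp add: algebra_simps)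
      then show ?thesis using pos by (simp add: pos_divide_le_eq)
    qed
    moreover have "e / (C * b + 1) > 0" using C(1) b(1) e by (simp add: add_nonneg_pos)
    ultimately show "cmod (\<mu> \<theta>) \<le> 0 + e" using bound by fastforce
  qed
  then have "\<mu> \<theta> = 0" by simp
  moreover have "\<theta> = (\<lambda>x. of_real (u \<bullet> x) * \<phi> x - of_real a * \<phi> x)"
    by (simp add: \<theta>_def algebra_simps)
  moreover have "(\<lambda>x. complex_of_real (u \<bullet> x) * \<phi> x) \<in> Cc"
    by (intro Cc_mult \<phi> continuous_intros)
  ultimately show ?thesis
    using Radon_diff[OF \<mu> _ Cc_cmult[OF \<phi>, of "of_real a"], of "\<lambda>x. of_real (u \<bullet> x) * \<phi> x"] RadonD(2)[OF \<mu> \<phi>]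
    by simp
qed

lemma kink_power2_derivative: "((\<lambda>t. (kink a t)\<^sup>2 / 2) has_real_derivative kink a t) (at t)"
proof -
  have bound: "\<bar>((kink a (t + h))\<^sup>2 / 2 - (kink a t)\<^sup>2 / 2) - kink a t * h\<bar> \<le> h\<^sup>2" for h
  proof -
    define p where "p = t - a"
    have "\<bar>(max 0 (p + h))\<^sup>2 / 2 - (max 0 p)\<^sup>2 / 2 - max 0 p * h\<bar> \<le> h\<^sup>2"
    proof (cases "p \<ge> 0"; cases "p + h \<ge> 0")
      assume "p \<ge> 0" "p + h \<ge> 0"
      then show ?thesis by (simp add: max_def power2_eq_square field_simps)
    next
      assume h: "p \<ge> 0" "\<not> p + h \<ge> 0"
      define q where "q = - h"
      have q: "0 \<le> p" "p < q" using h by (auto simp: q_def)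
      have "p * p \<le> p * q" "p * q \<le> q * q" "0 \<le> p * p"
        using q by (auto intro!: mult_left_mono mult_right_mono)
      moreover have "(max 0 (p + h))\<^sup>2 / 2 - (max 0 p)\<^sup>2 / 2 - max 0 p * h = p * q - p * p / 2"
        using h by (simp add: max_def power2_eq_square q_def)
      moreover have "h\<^sup>2 = q * q" by (simp add: q_def power2_eq_square)
      ultimately show ?thesis by linarith
    next
      assume h: "\<not> p \<ge> 0" "p + h \<ge> 0"
      then have "(p + h)\<^sup>2 \<le> h\<^sup>2" by (intro power_mono) auto
      moreover have "0 \<le> (p + h)\<^sup>2" by simp
      moreover have "(max 0 (p + h))\<^sup>2 / 2 - (max 0 p)\<^sup>2 / 2 - max 0 p * h = (p + h)\<^sup>2 / 2"
        using h by (simp add: max_def)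
      ultimately show ?thesis by linarith
    next
      assume "\<not> p \<ge> 0" "\<not> p + h \<ge> 0"
      then show ?thesis by (simp add: max_def)
    qed
    then show ?thesis by (simp add: kink_def p_def algebra_simps)
  qed
  have "(\<lambda>h. ((kink a (t + h))\<^sup>2 / 2 - (kink a t)\<^sup>2 / 2) / h - kink a t) \<midarrow>0\<rightarrow> 0"
  proof (rule Lim_null_comparison)
    show "\<forall>\<^sub>F h in at 0. norm (((kink a (t + h))\<^sup>2 / 2 - (kink a t)\<^sup>2 / 2) / h - kink a t) \<le> \<bar>h\<bar>"
      unfolding eventually_at_filter
    proof (intro always_eventually allI impI)
      fix h :: real assume "h \<noteq> 0"
      then have "norm (((kink a (t + h))\<^sup>2 / 2 - (kink a t)\<^sup>2 / 2) / h - kink a t)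
          = \<bar>((kink a (t + h))\<^sup>2 / 2 - (kink a t)\<^sup>2 / 2) - kink a t * h\<bar> / \<bar>h\<bar>"
        by (simp add: field_simps flip: abs_divide)
      also have "\<dots> \<le> h\<^sup>2 / \<bar>h\<bar>" by (intro divide_right_mono bound) simp
      also have "\<dots> = \<bar>h\<bar>" using \<open>h \<noteq> 0\<close> by (simp add: power2_eq_square abs_if)
      finally show "norm (((kink a (t + h))\<^sup>2 / 2 - (kink a t)\<^sup>2 / 2) / h - kink a t) \<le> \<bar>h\<bar>" .
    qed
  qed (auto intro!: tendsto_eq_intros)
  then show ?thesis unfolding DERIV_def by (rule LIM_zero_cancel)
qed

lemma kink_mono: "s \<le> t \<Longrightarrow> kink a s \<le> kink a t"
  by (simp add: kink_def)

lemma kink_power2_convex: "convex_on UNIV (\<lambda>t. (kink a t)\<^sup>2 / 2)"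
  by (rule convex_on_realI[OF _ kink_power2_derivative kink_mono]) auto

lemma power2_convex: "convex_on UNIV (\<lambda>t::real. t\<^sup>2 / 2)"
  by (rule convex_on_realI[where f' = "\<lambda>t. t"]) (auto intro!: derivative_eq_intros)

lemma smooth_kink_convex:
  assumes "\<delta> > 0"
  shows "convex_on UNIV (\<lambda>t. ((kink a t)\<^sup>2 / 2 - (kink (a + \<delta>) t)\<^sup>2 / 2) / \<delta>)"
proof (rule convex_on_realI[where f' = "\<lambda>t. (kink a t - kink (a + \<delta>) t) / \<delta>"])
  show "((\<lambda>t. ((kink a t)\<^sup>2 / 2 - (kink (a + \<delta>) t)\<^sup>2 / 2) / \<delta>) has_real_derivative (kink a t - kink (a + \<delta>) t) / \<delta>) (at t)" for t
    by (intro DERIV_cdivide DERIV_diff kink_power2_derivative)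
  show "(kink a s - kink (a + \<delta>) s) / \<delta> \<le> (kink a t - kink (a + \<delta>) t) / \<delta>" if "s \<le> t" for s t
    using that assms by (intro divide_right_mono) (auto simp: kink_def)
qed auto

text \<open>The difference quotients of \<open>a \<mapsto> (kink a t)\<^sup>2 / 2\<close> are convex and approximate a kink, which exhibits
  \<open>kink a\<close> as minus the derivative of the half squares with respect to the breaking point.\<close>

lemma smooth_kink_tendsto:
  assumes "\<And>m::nat. \<delta> m > 0" "\<delta> \<longlonglongrightarrow> 0"
  shows "(\<lambda>m. ((kink a t)\<^sup>2 / 2 - (kink (a + \<delta> m) t)\<^sup>2 / 2) / \<delta> m) \<longlonglongrightarrow> kink a t"
proof (rule LIM_zero_cancel[OF Lim_null_comparison[OF _ assms(2)]], intro always_eventually allI)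
  fix m
  define p d where "p = t - a" and "d = \<delta> m"
  have d: "d > 0" using assms(1) d_def by simp
  have "\<bar>(max 0 p)\<^sup>2 / 2 - (max 0 (p - d))\<^sup>2 / 2 - d * max 0 p\<bar> \<le> d * d"
  proof (cases "p \<ge> d")
    case True
    have "p * p / 2 - (p - d) * (p - d) / 2 - d * p = - (d * d) / 2" by (simp add: field_simps)
    then show ?thesis using d True by (simp add: max_def power2_eq_square)
  next
    case F: False
    show ?thesis
    proof (cases "p \<ge> 0")
      case True
      then have "p * p \<le> d * p" "d * p \<le> d * d" "0 \<le> p * p" using F d by (auto intro!: mult_right_mono mult_left_mono)
      moreover have "(max 0 p)\<^sup>2 / 2 - (max 0 (p - d))\<^sup>2 / 2 - d * max 0 p = p * p / 2 - d * p"
        using F True by (simp add: max_def power2_eq_square)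
      ultimately show ?thesis by linarith
    qed (use F d in \<open>simp add: max_def\<close>)
  qed
  then have "\<bar>((max 0 p)\<^sup>2 / 2 - (max 0 (p - d))\<^sup>2 / 2) / d - max 0 p\<bar> \<le> d"
    using d by (simp add: field_simps abs_le_iff)
  then show "norm (((kink a t)\<^sup>2 / 2 - (kink (a + \<delta> m) t)\<^sup>2 / 2) / \<delta> m - kink a t) \<le> \<delta> m"
    by (simp add: kink_def p_def d_def algebra_simps)
qed

text \<open>Put \<open>n(a) = F (sk a)\<close> and \<open>e(a) = F (kink a)\<close>, the effects of adding a half square and a kink with
  breaking point \<open>a\<close>. Invariance under squares makes the measure \<open>n(a)\<close> vanish beyond the hyperplane
  \<open>u \<bullet> x = a\<close>, as it does before, so both \<open>n(a)\<close> and \<open>e(a)\<close> are carried by this hyperplane. Moreover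
  \<open>e = - n'\<close>. Integrating \<open>u \<bullet> x\<close> against \<open>n(a)\<close> gives \<open>a n(a)\<close>; differentiating this in \<open>a\<close>, once under
  the integral and once as a product, yields \<open>n(a) = 0\<close> and hence \<open>e(a) = 0\<close>.\<close>

lemma kink_invariant_of_square_invariant:
  fixes D :: "'a::euclidean_space local_functional"
  assumes D: "D \<in> P0LV"
    and sq: "\<And>f. f \<in> Conv \<Longrightarrow> D (ridge_add f u (\<lambda>t. t\<^sup>2 / 2)) = D f"
    and f: "f \<in> Conv" and \<phi>: "\<phi> \<in> Cc"
  shows "D (ridge_add f u (kink a)) \<phi> = D f \<phi>"
proof -
  define F where "F h \<theta> = D (ridge_add f u h) \<theta> - D f \<theta>" for h \<theta>
  define sk where "sk a = (\<lambda>t. (kink a t)\<^sup>2 / 2)" for a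
  have sk: "convex_on UNIV (sk a)" for a unfolding sk_def by (rule kink_power2_convex)
  have z: "convex_on UNIV (\<lambda>t::real. 0::real)" "f = ridge_add f u (\<lambda>t. 0)"
    by (simp_all add: convex_on_def ridge_add_def)
  have FR: "F h \<in> Radon" if "convex_on UNIV h" for h
    using Radon_lincomb[OF P0LV_D(1)[OF D ridge_add_Conv[OF f that, of u]] P0LV_D(1)[OF D f], of 1 "-1"]
    by (simp add: F_def[abs_def])
  have low: "F h \<theta> = 0" if "convex_on UNIV h" "\<And>t. t < a \<Longrightarrow> h t = 0" "\<theta> \<in> Cc" "supp \<theta> \<subseteq> {x. u \<bullet> x < a}" for h \<theta> a
    unfolding F_def using ridge_add_local[OF D f z(1) that(1) open_lessThan[of a] _ that(3), of 0 0 u] that(2,4) z(2)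
    by auto
  have hk: "F (kink a) \<theta> = 0" if "\<theta> \<in> Cc" "supp \<theta> \<subseteq> {x. u \<bullet> x > a}" for \<theta> a
    unfolding F_def using ridge_add_local[OF D f z(1) kink_convex open_greaterThan[of a] _ that(1), of a 1 "- a" u] that(2) z(2)
    by (auto simp: kink_def)
  have hs: "F (sk a) \<theta> = 0" if "\<theta> \<in> Cc" "supp \<theta> \<subseteq> {x. u \<bullet> x > a}" for \<theta> a
  proof -
    have "D (ridge_add f u (sk a)) \<theta> = D (ridge_add f u (\<lambda>t. t\<^sup>2 / 2)) \<theta>"
      using that
      by (intro ridge_add_local[OF D f power2_convex sk open_greaterThan[of a], where p = "- a" and q = "a\<^sup>2 / 2"])
        (auto simp: sk_def kink_def power2_eq_square field_simps)
    then show ?thesis by (simp add: F_def sq[OF f])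
  qed
  have moment_kink: "F (kink a) (\<lambda>x. of_real (u \<bullet> x) * \<theta> x) = of_real a * F (kink a) \<theta>" if "\<theta> \<in> Cc" for a \<theta>
    by (rule Radon_on_hyperplane[OF FR[OF kink_convex] low[OF kink_convex] hk that]) (auto simp: kink_def)
  have moment_sk: "F (sk a) (\<lambda>x. of_real (u \<bullet> x) * \<theta> x) = of_real a * F (sk a) \<theta>" if "\<theta> \<in> Cc" for a \<theta>
    by (rule Radon_on_hyperplane[OF FR[OF sk] low[OF sk] hs that]) (auto simp: kink_def sk_def)
  define \<delta> where "\<delta> m = inverse (real (Suc m))" for m
  have \<delta>: "\<delta> \<longlonglongrightarrow> 0" "\<And>m. \<delta> m > 0"
    unfolding \<delta>_def using LIMSEQ_inverse_real_of_nat by auto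
  define g where "g a m = (\<lambda>t. (sk a t - sk (a + \<delta> m) t) / \<delta> m)" for a m
  have g: "convex_on UNIV (g a m)" for a m
    unfolding g_def sk_def by (rule smooth_kink_convex[OF \<delta>(2)])
  have glim: "(\<lambda>m. F (g a m) \<theta>) \<longlonglongrightarrow> F (kink a) \<theta>" for a \<theta>
    unfolding F_def
    by (intro tendsto_intros ridge_add_tendsto[OF D f g kink_convex])
      (unfold g_def sk_def, rule smooth_kink_tendsto[OF \<delta>(2,1)])
  have step: "F (sk a) \<theta> = F (sk (a + \<delta> m)) \<theta> + of_real (\<delta> m) * F (g a m) \<theta>" if \<theta>: "\<theta> \<in> Cc" for a m \<theta>
  proof -
    have "convex_on UNIV (\<lambda>t. \<delta> m * g a m t)"
      using \<delta>(2)[of m] by (intro convex_on_cmul g) simp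
    note add = ridge_additive[OF D sk this, of u "a + \<delta> m", unfolded ridge_additive_def, rule_format, OF f \<theta>]
    have "(\<lambda>t. sk (a + \<delta> m) t + \<delta> m * g a m t) = sk a"
      using \<delta>(2)[of m] by (auto simp: g_def)
    with add have "D (ridge_add f u (sk a)) \<theta> + D f \<theta>
      = D (ridge_add f u (sk (a + \<delta> m))) \<theta> + D (ridge_add f u (\<lambda>t. \<delta> m * g a m t)) \<theta>" by simp
    moreover have "D (ridge_add f u (\<lambda>t. \<delta> m * g a m t)) \<theta> = D f \<theta> + of_real (\<delta> m) * (D (ridge_add f u (g a m)) \<theta> - D f \<theta>)"
      by (rule ridge_linear[OF D f g less_imp_le[OF \<delta>(2)] \<theta>])
    ultimately show ?thesis by (simp add: F_def algebra_simps)
  qed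
  have sk0: "F (sk a) \<theta> = 0" if \<theta>: "\<theta> \<in> Cc" for a \<theta>
  proof -
    define \<theta>' where "\<theta>' = (\<lambda>x. complex_of_real (u \<bullet> x) * \<theta> x)"
    have \<theta>': "\<theta>' \<in> Cc" unfolding \<theta>'_def by (intro Cc_mult \<theta> continuous_intros)
    have lim1: "(\<lambda>m. F (sk (a + \<delta> m)) \<theta>) \<longlonglongrightarrow> F (sk a) \<theta> - of_real 0 * F (kink a) \<theta>"
    proof -
      have "F (sk (a + \<delta> m)) \<theta> = F (sk a) \<theta> - of_real (\<delta> m) * F (g a m) \<theta>" for m
        using step[OF \<theta>, of a m] by simp
      then show ?thesis by (simp only:) (intro tendsto_intros \<delta> glim)
    qed
    have "of_real a * F (g a m) \<theta> - F (g a m) \<theta>' = F (sk (a + \<delta> m)) \<theta>" for m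
    proof -
      have "of_real (\<delta> m) * (of_real a * F (g a m) \<theta> - F (g a m) \<theta>' - F (sk (a + \<delta> m)) \<theta>) = 0"
        using step[OF \<theta>, of a m] step[OF \<theta>', of a m] moment_sk[OF \<theta>, of a] moment_sk[OF \<theta>, of "a + \<delta> m"]
        unfolding \<theta>'_def by (simp add: algebra_simps)
      then show ?thesis using \<delta>(2)[of m] by simp
    qed
    then have "(\<lambda>m. F (sk (a + \<delta> m)) \<theta>) \<longlonglongrightarrow> of_real a * F (kink a) \<theta> - F (kink a) \<theta>'"
      by (simp only: flip: \<open>\<And>m. _ = F (sk (a + \<delta> m)) \<theta>\<close>) (intro tendsto_intros glim)
    with lim1 have "F (sk a) \<theta> - of_real 0 * F (kink a) \<theta> = of_real a * F (kink a) \<theta> - F (kink a) \<theta>'"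
      by (rule LIMSEQ_unique)
    also have "\<dots> = 0" using moment_kink[OF \<theta>] by (simp add: \<theta>'_def)
    finally show ?thesis by simp
  qed
  have "F (g a m) \<phi> = 0" for m
    using step[OF \<phi>, of a m] sk0[OF \<phi>] \<delta>(2)[of m] by simp
  then have "F (kink a) \<phi> = 0"
    using glim[of a \<phi>] by (simp add: LIMSEQ_const_iff)
  then show ?thesis by (simp add: F_def)
qed

lemma ridge_invariant_of_square_invariant:
  fixes D :: "'a::euclidean_space local_functional"
  assumes D: "D \<in> P0LV"
    and sq: "\<And>f. f \<in> Conv \<Longrightarrow> D (ridge_add f u (\<lambda>t. t\<^sup>2 / 2)) = D f"
    and f: "f \<in> Conv" and h: "convex_on UNIV h" and \<phi>: "\<phi> \<in> Cc"
  shows "D (ridge_add f u h) \<phi> = D f \<phi>"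
proof -
  have sums: "D (ridge_add f u g) \<phi> = D f \<phi>" if "g \<in> kink_sums" for g
    using that
  proof (induction rule: kink_sums.induct)
    case (affine p q)
    have "convex_on UNIV (\<lambda>t::real. 0::real)" "f = ridge_add f u (\<lambda>t. 0)"
      by (simp_all add: convex_on_def ridge_add_def)
    then show ?case using ridge_add_affine[OF D f, of "\<lambda>t. 0" "\<lambda>t. p * t + q" p q u] by simp
  next
    case (add g c a)
    have f': "ridge_add f u g \<in> Conv" by (rule ridge_add_Conv[OF f kink_sums_convex[OF add.hyps(1)]])
    show ?case
      using ridge_linear[OF D f' kink_convex add.hyps(2) \<phi>, of u a]
        kink_invariant_of_square_invariant[OF D sq f' \<phi>, of a]
      by (simp add: ridge_add_add add.IH)
  qed
  obtain H where H: "\<And>m. H m \<in> kink_sums" "\<And>t. (\<lambda>m::nat. H m t) \<longlonglongrightarrow> h t"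
    using kink_sums_dense[OF h] by metis
  have "(\<lambda>m. D (ridge_add f u (H m)) \<phi>) \<longlonglongrightarrow> D (ridge_add f u h) \<phi>"
    by (rule ridge_add_tendsto[OF D f kink_sums_convex[OF H(1)] h H(2)])
  then show ?thesis by (simp add: sums[OF H(1)] LIMSEQ_const_iff)
qed

section \<open>A functional invariant under ridge functions is constant\<close>

inductive_set ridge_sums :: "('a::euclidean_space \<Rightarrow> real) set" where
  zero: "(\<lambda>x. 0) \<in> ridge_sums"
| add: "z \<in> ridge_sums \<Longrightarrow> convex_on UNIV h \<Longrightarrow> ridge_add z u h \<in> ridge_sums"

lemma ridge_sums_Conv: "z \<in> ridge_sums \<Longrightarrow> z \<in> Conv"
  by (induction rule: ridge_sums.induct) (auto intro: ridge_add_Conv Conv_const)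

lemma ridge_sums_invariant:
  assumes inv: "\<And>f u h. f \<in> Conv \<Longrightarrow> convex_on UNIV h \<Longrightarrow> D (ridge_add f u h) \<phi> = D f \<phi>"
    and z: "z \<in> ridge_sums" and f: "f \<in> Conv"
  shows "D (\<lambda>x. f x + z x) \<phi> = D f \<phi>"
  using z
proof (induction rule: ridge_sums.induct)
  case (add z h u)
  have "D (ridge_add (\<lambda>x. f x + z x) u h) \<phi> = D (\<lambda>x. f x + z x) \<phi>"
    by (rule inv[OF Conv_add[OF f ridge_sums_Conv[OF add.hyps(1)]] add.hyps(2)])
  then show ?case using add.IH by (simp add: ridge_add_def add.assoc)
qed simp

lemma ridge_sums_add:
  assumes "z \<in> ridge_sums" "w \<in> ridge_sums"
  shows "(\<lambda>x. w x + z x) \<in> ridge_sums"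
  using assms(1)
proof (induction rule: ridge_sums.induct)
  case (add z h u)
  then have "ridge_add (\<lambda>x. w x + z x) u h \<in> ridge_sums" by (intro ridge_sums.add)
  then show ?case by (simp add: ridge_add_def add.assoc)
qed (use assms(2) in simp)

lemma norm_square_Basis: "(norm x)\<^sup>2 = (\<Sum>b\<in>Basis. (b \<bullet> x)\<^sup>2)" for x :: "'a::euclidean_space"
  unfolding power2_norm_eq_inner euclidean_inner[of x x] by (simp add: power2_eq_square inner_commute)

lemma norm_square_ridge_sum: "(\<lambda>x::'a::euclidean_space. (norm x)\<^sup>2) \<in> ridge_sums"
proof -
  have c: "convex_on UNIV (\<lambda>t::real. t\<^sup>2)"
    using convex_on_cmul[OF _ power2_convex, of 2] by simp
  have "(\<lambda>x::'a. \<Sum>b\<in>B. (b \<bullet> x)\<^sup>2) \<in> ridge_sums" if "finite B" for B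
    using that
  proof (induction B)
    case (insert b B)
    have "ridge_add (\<lambda>x. \<Sum>b\<in>B. (b \<bullet> x)\<^sup>2) b (\<lambda>t. t\<^sup>2) \<in> ridge_sums"
      by (rule ridge_sums.add[OF insert.IH c])
    then show ?case using insert.hyps by (simp add: ridge_add_def add.commute)
  qed (simp add: ridge_sums.zero)
  from this[OF finite_Basis] show ?thesis
    by (simp add: norm_square_Basis)
qed

inductive_set exp_sums :: "('a::euclidean_space \<Rightarrow> real) set" where
  zero: "(\<lambda>x. 0) \<in> exp_sums"
| add: "w \<in> exp_sums \<Longrightarrow> (\<lambda>x. w x + c * exp (u \<bullet> x)) \<in> exp_sums"

lemma exp_sums_add: "w \<in> exp_sums \<Longrightarrow> v \<in> exp_sums \<Longrightarrow> (\<lambda>x. w x + v x) \<in> exp_sums"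
proof (induction rule: exp_sums.induct)
  case (add w c u)
  then have "(\<lambda>x. (w x + v x) + c * exp (u \<bullet> x)) \<in> exp_sums" by (intro exp_sums.add)
  then show ?case by (simp add: add_ac)
qed simp

lemma exp_sums_single: "(\<lambda>x. c * exp (u \<bullet> x)) \<in> exp_sums"
  using exp_sums.add[OF exp_sums.zero, of c u] by simp

lemma exp_sums_const: "(\<lambda>x. c) \<in> exp_sums"
  using exp_sums_single[of c 0] by simp

lemma exp_sums_mult: "w \<in> exp_sums \<Longrightarrow> v \<in> exp_sums \<Longrightarrow> (\<lambda>x. w x * v x) \<in> exp_sums"
proof (induction rule: exp_sums.induct)
  case (add w c u)
  have "(\<lambda>x. c * exp (u \<bullet> x) * v x) \<in> exp_sums"
    using add.prems
  proof (induction rule: exp_sums.induct)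
    case (add v d s)
    have "(\<lambda>x. c * exp (u \<bullet> x) * v x + (c * d) * exp ((u + s) \<bullet> x)) \<in> exp_sums"
      by (rule exp_sums.add[OF add.IH])
    then show ?case by (simp add: algebra_simps exp_add inner_add_left)
  qed (simp add: exp_sums.zero)
  with add.IH[OF add.prems] have "(\<lambda>x. w x * v x + c * exp (u \<bullet> x) * v x) \<in> exp_sums"
    by (rule exp_sums_add)
  then show ?case by (simp add: distrib_right)
qed (simp add: exp_sums.zero)

lemma exp_sums_power: "w \<in> exp_sums \<Longrightarrow> (\<lambda>x. w x ^ n) \<in> exp_sums"
  by (induction n) (auto intro: exp_sums_const[of 1] exp_sums_mult)

lemma exp_sums_sum: "finite A \<Longrightarrow> (\<And>a. a \<in> A \<Longrightarrow> w a \<in> exp_sums) \<Longrightarrow> (\<lambda>x. \<Sum>a\<in>A. w a x) \<in> exp_sums"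
  by (induction A rule: finite_induct) (auto intro: exp_sums_add exp_sums.zero)

text \<open>Terms with positive coefficients are convex ridge functions; those with negative coefficients are
  moved to the other side.\<close>

lemma exp_sums_difference:
  assumes "w \<in> exp_sums"
  shows "\<exists>p q. p \<in> ridge_sums \<and> q \<in> ridge_sums \<and> (\<forall>x. w x + q x = p x)"
  using assms
proof (induction rule: exp_sums.induct)
  case zero
  show ?case by (intro exI[of _ "\<lambda>x. 0"] conjI ridge_sums.zero) simp
next
  case (add w c u)
  then obtain p q where pq: "p \<in> ridge_sums" "q \<in> ridge_sums" "\<And>x. w x + q x = p x" by blast
  have cexp: "convex_on UNIV (\<lambda>t::real. d * exp t)" if "d \<ge> 0" for d
    by (intro convex_on_cmul that exp_convex)
  show ?case
  proof (cases "c \<ge> 0")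
    case True
    show ?thesis
      by (rule exI[of _ "ridge_add p u (\<lambda>t. c * exp t)"], rule exI[of _ q],
          intro conjI ridge_sums.add pq cexp True)
        (simp add: ridge_add_def flip: pq(3))
  next
    case False
    show ?thesis
      by (rule exI[of _ p], rule exI[of _ "ridge_add q u (\<lambda>t. (- c) * exp t)"],
          intro conjI ridge_sums.add pq cexp)
        (use False in \<open>simp_all add: ridge_add_def flip: pq(3)\<close>)
  qed
qed

lemma integrable_continuous_compact_support:
  fixes g :: "'a::euclidean_space \<Rightarrow> 'b::{banach, second_countable_topology}"
  assumes "continuous_on UNIV g" "compact K" "\<And>x. x \<notin> K \<Longrightarrow> g x = 0"
  shows "integrable lborel g"
proof -
  have "integrable lborel (\<lambda>x. indicator K x *\<^sub>R g x)"
    by (rule borel_integrable_compact[OF assms(2) continuous_on_subset[OF assms(1) subset_UNIV]])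
  moreover have "(\<lambda>x. indicator K x *\<^sub>R g x) = g"
    using assms(3) by (auto simp: indicator_def)
  ultimately show ?thesis by simp
qed

lemma lborel_integral_shift:
  fixes g :: "'a::euclidean_space \<Rightarrow> 'b::{banach, second_countable_topology}"
  assumes "continuous_on UNIV g"
  shows "(\<integral>y. g (c + y) \<partial>lborel) = (\<integral>y. g y \<partial>lborel)"
proof -
  have "(\<integral>y. g y \<partial>lborel) = (\<integral>y. g y \<partial>(distr lborel borel ((+) c)))"
    by (simp add: lborel_distr_plus)
  also have "\<dots> = (\<integral>y. g (c + y) \<partial>lborel)"
    using assms by (intro integral_distr) (auto intro: borel_measurable_continuous_onI)
  finally show ?thesis by simp
qed

text \<open>Each exponential turns a sum into a product, so the variable of integration separates.\<close>

lemma exp_sums_convolution: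
  fixes u :: "'a::euclidean_space \<Rightarrow> real"
  assumes w: "w \<in> exp_sums" and u: "continuous_on UNIV u" "compact K" "\<And>x. x \<notin> K \<Longrightarrow> u x = 0"
  shows "(\<lambda>x. \<integral>z. u z * w (z - x) \<partial>lborel) \<in> exp_sums \<and> continuous_on UNIV w"
  using w
proof (induction rule: exp_sums.induct)
  case (add w c v)
  have c: "continuous_on UNIV (\<lambda>x. w x + c * exp (v \<bullet> x))"
    using add.IH by (intro continuous_intros) simp
  have sh: "continuous_on UNIV (\<lambda>z. w (z - x))" for x
    using add.IH by (auto intro!: continuous_on_compose2[of UNIV w] continuous_intros)
  have i1: "integrable lborel (\<lambda>z. u z * w (z - x))" for x
    by (rule integrable_continuous_compact_support[OF _ u(2)]) (auto intro!: continuous_intros sh u)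
  have i2: "integrable lborel (\<lambda>z. u z * exp (v \<bullet> z))"
    by (rule integrable_continuous_compact_support[OF _ u(2)]) (auto intro!: continuous_intros u)
  have "(\<integral>z. u z * (w (z - x) + c * exp (v \<bullet> (z - x))) \<partial>lborel)
     = (\<integral>z. u z * w (z - x) \<partial>lborel) + (c * (\<integral>z. u z * exp (v \<bullet> z) \<partial>lborel)) * exp ((- v) \<bullet> x)" for x
  proof -
    have e: "u z * (w (z - x) + c * exp (v \<bullet> (z - x))) = u z * w (z - x) + (c * exp ((- v) \<bullet> x)) * (u z * exp (v \<bullet> z))" for z
      by (simp add: inner_diff_right exp_diff exp_minus field_simps)
    show ?thesis unfolding e using i1 i2 by simp
  qed
  then show ?case using c exp_sums.add[OF conjunct1[OF add.IH], of _ "- v"] by simp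
qed (auto intro: exp_sums.zero)

lemma affine_map_inner: "affine_map (\<lambda>x. a * (m \<bullet> x) + c)" for m :: "'a::euclidean_space" and a c :: real
  unfolding affine_map_def
  by (intro exI[of _ "\<lambda>x. a * (m \<bullet> x)"] exI[of _ c]) (auto intro!: bounded_linear.linear bounded_linear_intros)

text \<open>On \<open>U\<close> the function \<open>f\<close> differs from an affine function by a difference of sums of convex ridge
  functions, all of which are invisible to the functional.\<close>

lemma value_at_exp_sum:
  assumes D: "D \<in> P0LV"
    and inv: "\<And>f u h. f \<in> Conv \<Longrightarrow> convex_on UNIV h \<Longrightarrow> D (ridge_add f u h) \<phi> = D f \<phi>"
    and f: "f \<in> Conv" and U: "open U" "supp \<phi> \<subseteq> U" and \<phi>: "\<phi> \<in> Cc" and w: "w \<in> exp_sums"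
    and l: "affine_map l" and eq: "\<And>x. x \<in> U \<Longrightarrow> f x = (norm x)\<^sup>2 + l x + w x"
  shows "D f \<phi> = D (\<lambda>x. 0) \<phi>"
proof -
  obtain p q where pq: "p \<in> ridge_sums" "q \<in> ridge_sums" "\<And>x. w x + q x = p x"
    using exp_sums_difference[OF w] by blast
  have z: "(\<lambda>x. p x + (norm x)\<^sup>2) \<in> ridge_sums" by (rule ridge_sums_add[OF norm_square_ridge_sum pq(1)])
  have zC: "(\<lambda>x. (p x + (norm x)\<^sup>2) + l x) \<in> Conv" by (rule Conv_add_affine[OF ridge_sums_Conv[OF z] l])
  have "D f \<phi> = D (\<lambda>x. f x + q x) \<phi>" by (rule ridge_sums_invariant[OF inv pq(2) f, symmetric])
  also have "\<dots> = D (\<lambda>x. (p x + (norm x)\<^sup>2) + l x) \<phi>"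
    by (rule P0LV_D(4)[OF D Conv_add[OF f ridge_sums_Conv[OF pq(2)]] zC U(1) _ \<phi> U(2)])
      (simp add: eq flip: pq(3))
  also have "\<dots> = D (\<lambda>x. p x + (norm x)\<^sup>2) \<phi>"
    using P0LV_D(3)[OF D ridge_sums_Conv[OF z] l] by simp
  also have "\<dots> = D (\<lambda>x. 0) \<phi>"
    using ridge_sums_invariant[OF inv z Conv_const[of 0]] by simp
  finally show ?thesis .
qed

subsection \<open>An approximate identity made of exponentials\<close>

text \<open>The function \<open>\<Sum> (2 cosh z\<^sub>b - 2)\<close>: a sum of exponentials that vanishes at the origin and is at least
  \<open>|z|\<^sup>2 / 2\<close>.\<close>

definition well :: "'a::euclidean_space \<Rightarrow> real" where
  "well z = (\<Sum>b\<in>Basis. exp (b \<bullet> z) + exp (- (b \<bullet> z)) - 2)"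

lemma well_exp_sum: "well \<in> exp_sums"
proof -
  have "(\<lambda>x::'a. (exp (b \<bullet> x) + exp (- (b \<bullet> x))) - 2) \<in> exp_sums" for b :: 'a
    using exp_sums_add[OF exp_sums_add[OF exp_sums_single[of 1 b] exp_sums_single[of 1 "- b"]] exp_sums_const[of "-2"]]
    by simp
  then show ?thesis unfolding well_def[abs_def] by (intro exp_sums_sum finite_Basis)
qed

lemma well_lower: "(norm z)\<^sup>2 / 2 \<le> well z"
proof -
  have *: "t\<^sup>2 / 2 \<le> exp t + exp (- t) - 2" for t :: real
  proof -
    have "s\<^sup>2 / 2 \<le> exp s + exp (- s) - 2" if "s \<ge> 0" for s :: real
      using exp_lower_Taylor_quadratic[OF that] exp_ge_add_one_self[of "- s"] by linarith
    from this[of t] this[of "- t"] show ?thesis by (cases "t \<ge> 0") auto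
  qed
  have "(norm z)\<^sup>2 / 2 = (\<Sum>b\<in>Basis. (b \<bullet> z)\<^sup>2 / 2)"
    by (simp add: norm_square_Basis sum_divide_distrib)
  also have "\<dots> \<le> well z" unfolding well_def by (intro sum_mono *)
  finally show ?thesis .
qed

lemma well_continuous: "continuous_on S well"
  unfolding well_def[abs_def] by (intro continuous_intros)

lemma well_0: "well 0 = 0"
  by (simp add: well_def)

definition bump :: "real \<Rightarrow> nat \<Rightarrow> 'a::euclidean_space \<Rightarrow> real" where
  "bump C N z = (max 0 (1 - well z / C)) ^ N"

lemma bump_continuous: "continuous_on S (bump C N)" if "C > 0"
  unfolding bump_def[abs_def] using that by (intro continuous_intros well_continuous) auto

lemma bump_nonneg: "bump C N z \<ge> 0"
  by (simp add: bump_def)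

lemma bump_eq_0:
  assumes "C > 0" "N > 0" "z \<notin> cball 0 (sqrt (2 * C))"
  shows "bump C N z = 0"
proof -
  have "(norm z)\<^sup>2 > 2 * C"
    using assms by (auto simp: real_less_rsqrt not_le intro: real_less_lsqrt) (metis norm_ge_zero not_less real_sqrt_le_iff real_sqrt_pow2_iff real_sqrt_power sqrt_le_D)
  then have "1 - well z / C < 0" using well_lower[of z] assms(1) by (simp add: field_simps)
  then show ?thesis using assms(2) by (simp add: bump_def)
qed


lemma bump_integrable:
  fixes g :: "'a::euclidean_space \<Rightarrow> 'b::{banach, second_countable_topology}"
  assumes "C > 0" "N > 0" "continuous_on UNIV g"
  shows "integrable lborel (\<lambda>y. bump C N y *\<^sub>R g y)"
  by (rule integrable_continuous_compact_support[of _ "cball 0 (sqrt (2 * C))"])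
    (auto intro!: continuous_intros bump_continuous assms bump_eq_0[OF assms(1,2)])

lemma bump_integral_lower:
  assumes C: "C > 0" "N > 0" and \<beta>: "\<beta> \<ge> 0" and r: "r > 0" "\<And>y::'a::euclidean_space. norm y < r \<Longrightarrow> well y \<le> C * (1 - \<beta>)"
  shows "\<beta> ^ N * measure lborel (ball (0::'a) r) \<le> (\<integral>y. bump C N y \<partial>(lborel :: 'a measure))"
proof -
  have "\<beta> ^ N * measure lborel (ball (0::'a) r) = (\<integral>y. \<beta> ^ N * indicator (ball 0 r) y \<partial>(lborel :: 'a measure))"
    by simp
  also have "\<dots> \<le> (\<integral>y. bump C N y \<partial>(lborel :: 'a measure))"
  proof (rule integral_mono)
    show "integrable lborel (\<lambda>y::'a. \<beta> ^ N * indicator (ball 0 r) y)"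
      by (intro integrable_mult_right integrable_real_indicator) (auto simp: emeasure_bounded_finite[unfolded infinity_ennreal_def])
    show "integrable lborel (bump C N :: 'a \<Rightarrow> real)"
      using bump_integrable[OF C, of "\<lambda>_. 1::real"] by simp
    fix y :: 'a
    have "\<beta> ^ N \<le> bump C N y" if "norm y < r"
    proof -
      have "well y / C \<le> 1 - \<beta>" using r(2)[OF that] C(1) by (simp add: field_simps)
      then show ?thesis unfolding bump_def using \<beta> by (intro power_mono) auto
    qed
    then show "\<beta> ^ N * indicator (ball 0 r) y \<le> bump C N y"
      using bump_nonneg[of C N y] by (auto simp: indicator_def)
  qed
  finally show ?thesis .
qed

lemma well_small:
  assumes "e > 0"
  obtains r where "r > 0" "\<And>y::'a::euclidean_space. norm y < r \<Longrightarrow> well y \<le> e"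
proof -
  have "\<exists>r>0. \<forall>y. dist y (0::'a) < r \<longrightarrow> dist (well y) (well (0::'a)) < e"
    using well_continuous[of "UNIV :: 'a set"] assms unfolding continuous_on_iff by blast
  then show ?thesis using that by (fastforce simp: well_0 dist_norm)
qed

lemma bump_integral_pos: "C > 0 \<Longrightarrow> N > 0 \<Longrightarrow> (\<integral>y. bump C N y \<partial>(lborel :: 'a::euclidean_space measure)) > 0"
proof -
  assume C: "C > 0" "N > 0"
  obtain r where r: "r > 0" "\<And>y::'a. norm y < r \<Longrightarrow> well y \<le> C / 2"
    using well_small[of "C / 2"] C by auto
  have "0 < (1/2) ^ N * measure lborel (ball (0::'a) r)"
    using content_ball_pos[OF r(1), of "0::'a"] by simp
  also have "\<dots> \<le> (\<integral>y. bump C N y \<partial>(lborel :: 'a measure))"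
    by (rule bump_integral_lower[OF C _ r(1)]) (use r(2) in auto)
  finally show ?thesis .
qed

text \<open>The powers concentrate at the unique maximum of \<open>1 - well / C\<close>, as in the proof of the Weierstrass
  theorem by Landau kernels.\<close>

lemma bump_average_tendsto:
  fixes f :: "'a::euclidean_space \<Rightarrow> real"
  assumes f: "continuous_on UNIV f" and C: "C > 0"
  shows "(\<lambda>N. (\<integral>y. f (x + y) * bump C (Suc N) y \<partial>lborel) / (\<integral>y. bump C (Suc N) y \<partial>(lborel :: 'a measure))) \<longlonglongrightarrow> f x"
proof (rule LIMSEQ_I)
  fix e :: real assume e: "e > 0"
  define I where "I N = (\<integral>y. bump C (Suc N) y \<partial>(lborel :: 'a measure))" for N
  have I: "I N > 0" for N unfolding I_def by (rule bump_integral_pos[OF C]) simp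
  define K where "K = cball (0::'a) (sqrt (2 * C))"
  define g where "g y = f (x + y) - f x" for y
  have g: "continuous_on UNIV g"
    unfolding g_def[abs_def] by (auto intro!: continuous_intros continuous_on_compose2[OF f])
  have "bounded (g ` K)"
    unfolding K_def by (intro compact_imp_bounded compact_continuous_image continuous_on_subset[OF g]) auto
  then obtain B where B: "B > 0" "\<And>y. y \<in> K \<Longrightarrow> \<bar>g y\<bar> \<le> B"
    unfolding bounded_pos by auto
  have "\<exists>r>0. \<forall>y. dist y 0 < r \<longrightarrow> dist (g y) (g 0) < e / 2"
    using g e unfolding continuous_on_iff by (meson UNIV_I half_gt_zero)
  then obtain r where r: "r > 0" "\<And>y. norm y < r \<Longrightarrow> \<bar>g y\<bar> < e / 2"
    by (auto simp: dist_norm g_def)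
  define \<alpha> where "\<alpha> = max 0 (1 - r\<^sup>2 / 2 / C)"
  define \<beta> where "\<beta> = (1 + \<alpha>) / 2"
  have \<alpha>: "0 \<le> \<alpha>" "\<alpha> < 1" using r(1) C by (auto simp: \<alpha>_def)
  have \<beta>: "0 < \<beta>" "\<beta> < 1" "\<alpha> < \<beta>" using \<alpha> by (auto simp: \<beta>_def)
  obtain s where s: "s > 0" "\<And>y::'a. norm y < s \<Longrightarrow> well y \<le> C * (1 - \<beta>)"
    using well_small[of "C * (1 - \<beta>)"] C \<beta> by auto
  define v where "v = measure lborel (ball (0::'a) s)"
  have v: "v > 0" unfolding v_def by (rule content_ball_pos[OF s(1)])
  have lower: "\<beta> ^ Suc N * v \<le> I N" for N
    unfolding I_def v_def by (rule bump_integral_lower[OF C _ _ s]) (use \<beta> in auto)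
  define V where "V = measure lborel K"
  have est: "\<bar>(\<integral>y. f (x + y) * bump C (Suc N) y \<partial>lborel) / I N - f x\<bar> \<le> e / 2 + B * V / v * (\<alpha> / \<beta>) ^ Suc N" for N
  proof -
    have i1: "integrable lborel (\<lambda>y. bump C (Suc N) y * g y)"
      using bump_integrable[OF C _ g, of "Suc N"] by simp
    have i2: "integrable lborel (\<lambda>y::'a. bump C (Suc N) y)"
      using bump_integrable[OF C, of "Suc N" "\<lambda>_. 1::real"] by simp
    have i3: "integrable lborel (\<lambda>y. e / 2 * bump C (Suc N) y + B * \<alpha> ^ Suc N * indicator K y)"
      by (intro Bochner_Integration.integrable_add integrable_mult_right i2 integrable_real_indicator)
        (auto simp: K_def emeasure_bounded_finite[unfolded infinity_ennreal_def])
    have "(\<integral>y. f (x + y) * bump C (Suc N) y \<partial>lborel) = (\<integral>y. bump C (Suc N) y * g y + f x * bump C (Suc N) y \<partial>lborel)"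
      by (simp add: g_def algebra_simps)
    also have "\<dots> = (\<integral>y. bump C (Suc N) y * g y \<partial>lborel) + f x * I N"
      using i1 i2 by (simp add: I_def)
    finally have "(\<integral>y. f (x + y) * bump C (Suc N) y \<partial>lborel) / I N - f x = (\<integral>y. bump C (Suc N) y * g y \<partial>lborel) / I N"
      using I[of N] by (simp add: field_simps)
    moreover have "\<bar>\<integral>y. bump C (Suc N) y * g y \<partial>lborel\<bar> \<le> e / 2 * I N + B * \<alpha> ^ Suc N * V"
    proof -
      have "\<bar>\<integral>y. bump C (Suc N) y * g y \<partial>lborel\<bar> \<le> (\<integral>y. \<bar>bump C (Suc N) y * g y\<bar> \<partial>lborel)"
        by (rule integral_abs_bound)
      also have "\<dots> \<le> (\<integral>y. e / 2 * bump C (Suc N) y + B * \<alpha> ^ Suc N * indicator K y \<partial>lborel)"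
      proof (rule integral_mono)
        fix y :: 'a
        show "\<bar>bump C (Suc N) y * g y\<bar> \<le> e / 2 * bump C (Suc N) y + B * \<alpha> ^ Suc N * indicator K y"
        proof (cases "norm y < r")
          case True
          have "bump C (Suc N) y * \<bar>g y\<bar> \<le> bump C (Suc N) y * (e / 2)"
            using r(2)[OF True] bump_nonneg[of C "Suc N" y] by (intro mult_left_mono) auto
          moreover have "0 \<le> B * \<alpha> ^ Suc N * indicator K y" using B \<alpha> by simp
          ultimately show ?thesis using bump_nonneg[of C "Suc N" y] by (simp add: abs_mult mult.commute)
        next
          case False
          show ?thesis
          proof (cases "y \<in> K")
            case K: True
            have "r\<^sup>2 / 2 \<le> well y"
              using well_lower[of y] False r(1) power_mono[of r "norm y" 2] by linarith
            then have "bump C (Suc N) y \<le> \<alpha> ^ Suc N"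
              unfolding bump_def \<alpha>_def using C by (intro power_mono max.mono diff_left_mono divide_right_mono) auto
            then have "bump C (Suc N) y * \<bar>g y\<bar> \<le> \<alpha> ^ Suc N * B"
              using B(2)[OF K] \<alpha> by (intro mult_mono) auto
            moreover have "0 \<le> e / 2 * bump C (Suc N) y" using e bump_nonneg[of C "Suc N" y] by simp
            ultimately show ?thesis using K bump_nonneg[of C "Suc N" y] by (simp add: abs_mult mult_ac)
          next
            case K: False
            then have "bump C (Suc N) y = 0" unfolding K_def by (intro bump_eq_0 C) auto
            then show ?thesis using K by simp
          qed
        qed
      qed (use i1 i3 in auto)
      also have "\<dots> = e / 2 * I N + B * \<alpha> ^ Suc N * V"
        using i2 i3 by (subst Bochner_Integration.integral_add) (auto simp: I_def V_def K_def emeasure_bounded_finite[unfolded infinity_ennreal_def] intro!: integrable_real_indicator)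
      finally show ?thesis .
    qed
    ultimately have "\<bar>(\<integral>y. f (x + y) * bump C (Suc N) y \<partial>lborel) / I N - f x\<bar> \<le> (e / 2 * I N + B * \<alpha> ^ Suc N * V) / I N"
      using I[of N] by (simp add: divide_right_mono)
    also have "\<dots> = e / 2 + B * \<alpha> ^ Suc N * V / I N"
      using I[of N] by (simp add: add_divide_distrib)
    also have "B * \<alpha> ^ Suc N * V / I N \<le> B * \<alpha> ^ Suc N * V / (\<beta> ^ Suc N * v)"
      using B \<alpha> \<beta> v I[of N]
      by (intro divide_left_mono[OF lower[of N]] mult_pos_pos zero_less_power mult_nonneg_nonneg zero_le_power)
        (auto simp: V_def)
    also have "\<dots> = B * V / v * (\<alpha> / \<beta>) ^ Suc N" by (simp only: power_divide) (simp add: field_simps)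
    finally show ?thesis by simp
  qed
  have "(\<lambda>N. e / 2 + B * V / v * (\<alpha> / \<beta>) ^ Suc N) \<longlonglongrightarrow> e / 2 + B * V / v * 0"
    using \<alpha> \<beta> by (intro tendsto_intros LIMSEQ_Suc[OF LIMSEQ_power_zero]) auto
  from order_tendstoD(2)[OF this, of e]
  have "\<forall>\<^sub>F N in sequentially. e / 2 + B * V / v * (\<alpha> / \<beta>) ^ Suc N < e"
    using e by simp
  then show "\<exists>N0. \<forall>N\<ge>N0. norm ((\<integral>y. f (x + y) * bump C (Suc N) y \<partial>lborel) / (\<integral>y. bump C (Suc N) y \<partial>(lborel :: 'a measure)) - f x) < e"
    unfolding eventually_sequentially I_def[symmetric] real_norm_def using est by (meson le_less_trans)
qed

lemma Conv_average:
  assumes f: "f \<in> Conv" and \<kappa>: "\<And>y. \<kappa> y \<ge> 0" "\<And>g::'a::euclidean_space \<Rightarrow> real. continuous_on UNIV g \<Longrightarrow> integrable lborel (\<lambda>y. g y * \<kappa> y)"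
  shows "(\<lambda>x. \<integral>y. f (x + y) * \<kappa> y \<partial>lborel) \<in> Conv"
proof (rule ConvI, rule convex_onI)
  fix t :: real and x z :: 'a assume t: "0 < t" "t < 1"
  have i: "integrable lborel (\<lambda>y. f (x + y) * \<kappa> y)" for x
    by (intro \<kappa>(2) continuous_on_compose2[OF Conv_continuous[OF f]]) (auto intro!: continuous_intros)
  have "(\<integral>y. f ((1 - t) *\<^sub>R x + t *\<^sub>R z + y) * \<kappa> y \<partial>lborel)
      \<le> (\<integral>y. (1 - t) * (f (x + y) * \<kappa> y) + t * (f (z + y) * \<kappa> y) \<partial>lborel)"
  proof (rule integral_mono)
    fix y
    have "(1 - t) *\<^sub>R x + t *\<^sub>R z + y = (1 - t) *\<^sub>R (x + y) + t *\<^sub>R (z + y)" by (simp add: algebra_simps)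
    then have "f ((1 - t) *\<^sub>R x + t *\<^sub>R z + y) \<le> (1 - t) * f (x + y) + t * f (z + y)"
      using convex_onD[OF ConvD[OF f], of t "x + y" "z + y"] t by simp
    then have "f ((1 - t) *\<^sub>R x + t *\<^sub>R z + y) * \<kappa> y \<le> ((1 - t) * f (x + y) + t * f (z + y)) * \<kappa> y"
      by (rule mult_right_mono[OF _ \<kappa>(1)])
    then show "f ((1 - t) *\<^sub>R x + t *\<^sub>R z + y) * \<kappa> y \<le> (1 - t) * (f (x + y) * \<kappa> y) + t * (f (z + y) * \<kappa> y)"
      by (simp add: algebra_simps)
  qed (use i in \<open>auto intro!: Bochner_Integration.integrable_add integrable_mult_right\<close>)
  also have "\<dots> = (1 - t) * (\<integral>y. f (x + y) * \<kappa> y \<partial>lborel) + t * (\<integral>y. f (z + y) * \<kappa> y \<partial>lborel)"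
    using i by simp
  finally show "(\<integral>y. f ((1 - t) *\<^sub>R x + t *\<^sub>R z + y) * \<kappa> y \<partial>lborel)
    \<le> (1 - t) * (\<integral>y. f (x + y) * \<kappa> y \<partial>lborel) + t * (\<integral>y. f (z + y) * \<kappa> y \<partial>lborel)" .
qed simp

text \<open>The function is averaged with a truncated kernel whose untruncated form is a sum of exponentials.
  Since \<open>f\<close> is a quadratic polynomial outside of a ball, only its part \<open>u\<close> with compact support is
  affected nontrivially, and as long as \<open>x\<close> stays in a fixed ball the truncation is not felt there.
  So the average is a quadratic polynomial plus a sum of exponentials near the support of the test
  function, and \<open>value_at_exp_sum\<close> applies.\<close>

lemma value_at_quadratic_at_infinity:
  fixes D :: "'a::euclidean_space local_functional"
  assumes D: "D \<in> P0LV"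
    and inv: "\<And>f u h. f \<in> Conv \<Longrightarrow> convex_on UNIV h \<Longrightarrow> D (ridge_add f u h) \<phi> = D f \<phi>"
    and f: "f \<in> Conv" and \<rho>: "\<rho> > 0" "\<And>x. norm x \<ge> \<rho> \<Longrightarrow> f x = (norm x)\<^sup>2 - c" and \<phi>: "\<phi> \<in> Cc"
  shows "D f \<phi> = D (\<lambda>x. 0) \<phi>"
proof -
  obtain R where R: "R > 0" "supp \<phi> \<subseteq> ball 0 R"
    using bounded_subset_ballD[OF compact_imp_bounded[OF CcD(2)[OF \<phi>]], of 0] by auto
  have "bounded ((well :: 'a \<Rightarrow> real) ` cball 0 (R + \<rho>))"
    by (intro compact_imp_bounded compact_continuous_image well_continuous compact_cball)
  then obtain C where C': "C > 0" "\<forall>x\<in>(well :: 'a \<Rightarrow> real) ` cball 0 (R + \<rho>). norm x \<le> C"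
    unfolding bounded_pos by blast
  have C: "C > 0" "\<And>z::'a. norm z \<le> R + \<rho> \<Longrightarrow> well z \<le> C"
    using C' by (force simp: abs_le_iff)+
  define \<kappa> where "\<kappa> N = (bump C (Suc N) :: 'a \<Rightarrow> real)" for N
  define I where "I N = (\<integral>y. \<kappa> N y \<partial>lborel)" for N
  have I: "I N > 0" for N unfolding I_def \<kappa>_def by (rule bump_integral_pos[OF C(1)]) simp
  define F where "F N x = (\<integral>y. f (x + y) * \<kappa> N y \<partial>lborel) / I N" for N x
  have int: "integrable lborel (\<lambda>y. g y * \<kappa> N y)" if "continuous_on UNIV g" for g N
    using bump_integrable[OF C(1) _ that, of "Suc N"] by (simp add: \<kappa>_def mult.commute)
  have FC: "F N \<in> Conv" for N
  proof -
    have "(\<lambda>x. \<integral>y. f (x + y) * \<kappa> N y \<partial>lborel) \<in> Conv"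
      by (intro Conv_average f int) (simp add: \<kappa>_def bump_nonneg)
    from Conv_cmult[OF this, of "1 / I N"] show ?thesis using I[of N] by (simp add: F_def[abs_def])
  qed
  define u where "u x = f x - ((norm x)\<^sup>2 - c)" for x
  have u: "continuous_on UNIV u" "\<And>x. x \<notin> cball 0 \<rho> \<Longrightarrow> u x = 0"
    unfolding u_def[abs_def]
    by (intro continuous_intros Conv_continuous[OF f]) (simp add: \<rho>(2))
  have val: "D (F N) \<phi> = D (\<lambda>x. 0) \<phi>" for N
  proof -
    \<comment> \<open>the kernel without truncation\<close>
    define P where "P z = (1 - well z / C) ^ Suc N" for z :: 'a
    have P: "P \<in> exp_sums"
    proof -
      have "(\<lambda>z::'a. 1 + (- 1 / C) * well z) \<in> exp_sums"
        by (rule exp_sums_add[OF exp_sums_const exp_sums_mult[OF exp_sums_const well_exp_sum]])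
      from exp_sums_power[OF this, of "Suc N"] show ?thesis by (simp add: P_def[abs_def])
    qed
    define w where "w x = 1 / I N * (\<integral>z. u z * P (z - x) \<partial>lborel)" for x
    have w: "w \<in> exp_sums"
      unfolding w_def[abs_def]
      by (rule exp_sums_mult[OF exp_sums_const conjunct1[OF exp_sums_convolution[OF P u(1) compact_cball u(2)]]])
    define m where "m = (\<integral>y. \<kappa> N y *\<^sub>R y \<partial>lborel)"
    define c' where "c' = (\<integral>y. ((norm y)\<^sup>2 - c) * \<kappa> N y \<partial>lborel)"
    have "F N x = (norm x)\<^sup>2 + (2 / I N * (m \<bullet> x) + c' / I N) + w x" if x: "x \<in> ball 0 R" for x
    proof -
      have im: "integrable lborel (\<lambda>y. \<kappa> N y *\<^sub>R y)"
        unfolding \<kappa>_def by (rule bump_integrable[OF C(1) _ continuous_on_id]) simp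
      have i1: "integrable lborel (\<lambda>y. (norm x)\<^sup>2 * \<kappa> N y)"
        by (rule int) (intro continuous_intros)
      have i2: "integrable lborel (\<lambda>y. 2 * (\<kappa> N y *\<^sub>R y \<bullet> x))"
        by (intro integrable_mult_right integrable_inner_left im)
      have i3: "integrable lborel (\<lambda>y. ((norm y)\<^sup>2 - c) * \<kappa> N y)"
        by (rule int) (intro continuous_intros)
      have i4: "integrable lborel (\<lambda>y. u (x + y) * \<kappa> N y)"
        by (rule int) (auto intro!: continuous_on_compose2[OF u(1)] continuous_intros)
      have "f (x + y) * \<kappa> N y = ((norm x)\<^sup>2 * \<kappa> N y + 2 * (\<kappa> N y *\<^sub>R y \<bullet> x)) + (((norm y)\<^sup>2 - c) * \<kappa> N y + u (x + y) * \<kappa> N y)" for y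
        by (simp add: u_def power2_norm_eq_inner inner_add_left inner_add_right inner_commute algebra_simps)
      then have "(\<integral>y. f (x + y) * \<kappa> N y \<partial>lborel) = (\<integral>y. (norm x)\<^sup>2 * \<kappa> N y \<partial>lborel)
         + (\<integral>y. 2 * (\<kappa> N y *\<^sub>R y \<bullet> x) \<partial>lborel) + (c' + (\<integral>y. u (x + y) * \<kappa> N y \<partial>lborel))"
        unfolding c'_def using i1 i2 i3 i4
        by (simp only: Bochner_Integration.integral_add Bochner_Integration.integrable_add)
      also have "(\<integral>y. (norm x)\<^sup>2 * \<kappa> N y \<partial>lborel) = (norm x)\<^sup>2 * I N" by (simp add: I_def)
      also have "(\<integral>y. 2 * (\<kappa> N y *\<^sub>R y \<bullet> x) \<partial>lborel) = 2 * (m \<bullet> x)"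
        unfolding m_def using im by (subst integral_mult_right_zero, subst integral_inner_left) auto
      also have "(\<integral>y. u (x + y) * \<kappa> N y \<partial>lborel) = (\<integral>z. u z * \<kappa> N (z - x) \<partial>lborel)"
      proof -
        have "continuous_on UNIV (\<lambda>z. u z * \<kappa> N (z - x))"
          unfolding \<kappa>_def using C(1)
          by (auto intro!: continuous_intros u continuous_on_compose2[OF bump_continuous[of C UNIV]])
        from lborel_integral_shift[OF this, of x] show ?thesis by simp
      qed
      also have "\<dots> = (\<integral>z. u z * P (z - x) \<partial>lborel)"
      proof -
        have "u z * \<kappa> N (z - x) = u z * P (z - x)" for z
        proof (cases "z \<in> cball 0 \<rho>")
          case True
          then have "norm (z - x) \<le> R + \<rho>" using x norm_triangle_ineq4[of z x] by simp
          then have "1 - well (z - x) / C \<ge> 0" using C by (simp add: field_simps)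
          then show ?thesis by (simp add: \<kappa>_def bump_def P_def)
        qed (simp add: u(2))
        then show ?thesis by (simp only:)
      qed
      finally show ?thesis using I[of N] by (simp add: F_def w_def field_simps)
    qed
    from value_at_exp_sum[OF D inv FC open_ball R(2) \<phi> w affine_map_inner this] show ?thesis .
  qed
  have "(\<lambda>N. F N x) \<longlonglongrightarrow> f x" for x
    unfolding F_def I_def \<kappa>_def by (rule bump_average_tendsto[OF Conv_continuous[OF f] C(1)])
  then have "(\<lambda>N. D (F N) \<phi>) \<longlonglongrightarrow> D f \<phi>"
    by (rule P0LV_tendsto[OF D _ f FC])
  then show ?thesis by (simp add: val LIMSEQ_const_iff)
qed

lemma convex_subgradient:
  fixes f :: "'a::euclidean_space \<Rightarrow> real"
  assumes f: "f \<in> Conv"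
  obtains v where "\<And>x. f p + v \<bullet> (x - p) \<le> f x"
proof -
  define T where "T = {z :: 'a \<times> real. f (fst z) < snd z}"
  have "convex T"
    unfolding convex_alt T_def
  proof (intro ballI allI impI)
    fix y z :: "'a \<times> real" and t :: real assume h: "y \<in> {z. f (fst z) < snd z}" "z \<in> {z. f (fst z) < snd z}" "0 \<le> t \<and> t \<le> 1"
    have "f ((1 - t) *\<^sub>R fst y + t *\<^sub>R fst z) \<le> (1 - t) * f (fst y) + t * f (fst z)"
      using convex_onD[OF ConvD[OF f], of t] h by simp
    also have "\<dots> < (1 - t) * snd y + t * snd z"
      using h by (cases "t = 0") (auto intro!: add_le_less_mono mult_left_mono)
    finally show "(1 - t) *\<^sub>R y + t *\<^sub>R z \<in> {z. f (fst z) < snd z}" by simp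
  qed
  moreover have "{(p, f p)} \<inter> T = {}" "T \<noteq> {}"
    by (auto simp: T_def intro!: exI[of _ 0] exI[of _ "f 0 + 1"])
  ultimately obtain a b where ab: "a \<noteq> 0" "a \<bullet> (p, f p) \<le> b" "\<And>z. z \<in> T \<Longrightarrow> b \<le> a \<bullet> z"
    using separating_hyperplane_sets[of "{(p, f p)}" T] convex_singleton by (metis insertI1 insert_not_empty)
  obtain w \<alpha> where a: "a = (w, \<alpha>)" by (cases a)
  have *: "w \<bullet> p + \<alpha> * f p \<le> w \<bullet> x + \<alpha> * y" if "f x < y" for x y
    using ab(2) ab(3)[of "(x, y)"] that by (simp add: a T_def inner_prod_def)
  have "\<alpha> > 0"
  proof (rule ccontr)
    assume "\<not> \<alpha> > 0"
    moreover have "\<alpha> \<ge> 0"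
    proof (rule ccontr)
      assume neg: "\<not> \<alpha> \<ge> 0"
      show False using *[of p "f p + 1"] neg by (simp add: algebra_simps)
    qed
    ultimately have a0: "\<alpha> = 0" by simp
    then have "w \<bullet> p \<le> w \<bullet> (p - w)" using *[of "p - w" "f (p - w) + 1"] by simp
    then have "w = 0" by (simp add: inner_diff_right) (metis inner_gt_zero_iff not_le)
    with a0 show False using ab(1) by (simp add: a zero_prod_def)
  qed
  have "f p + (- (1 / \<alpha>) *\<^sub>R w) \<bullet> (x - p) \<le> f x" for x
  proof (rule field_le_epsilon)
    fix e :: real assume "e > 0"
    then have "w \<bullet> p + \<alpha> * f p \<le> w \<bullet> x + \<alpha> * (f x + e)" by (intro *) simp
    then show "f p + (- (1 / \<alpha>) *\<^sub>R w) \<bullet> (x - p) \<le> f x + e"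
      using \<open>\<alpha> > 0\<close> by (simp add: inner_diff_right field_simps)
  qed
  then show ?thesis by (rule that)
qed

text \<open>Passing to the maximum with \<open>|x|\<^sup>2 - c\<close> does not change \<open>f\<close> near the support of the test function when
  \<open>c\<close> is large, and makes it quadratic at infinity.\<close>

lemma value_at_sublinear_growth:
  fixes D :: "'a::euclidean_space local_functional"
  assumes D: "D \<in> P0LV"
    and inv: "\<And>f u h. f \<in> Conv \<Longrightarrow> convex_on UNIV h \<Longrightarrow> D (ridge_add f u h) \<phi> = D f \<phi>"
    and f: "f \<in> Conv" and M: "M \<ge> 0" "\<And>x. \<bar>f x\<bar> \<le> M * (1 + norm x)" and \<phi>: "\<phi> \<in> Cc"
  shows "D f \<phi> = D (\<lambda>x. 0) \<phi>"
proof -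
  obtain R where R: "R > 0" "supp \<phi> \<subseteq> ball 0 R"
    using bounded_subset_ballD[OF compact_imp_bounded[OF CcD(2)[OF \<phi>]], of 0] by auto
  define c where "c = R\<^sup>2 + M * (1 + R)"
  \<comment> \<open>beyond this radius the quadratic function dominates the linear bound for \<open>f\<close>\<close>
  define \<rho> where "\<rho> = c + 2 * M + 1"
  have c: "c \<ge> 0" using M R by (simp add: c_def)
  define g where "g x = max (f x) ((norm x)\<^sup>2 + - c)" for x
  have q: "(\<lambda>x::'a. (norm x)\<^sup>2 + - c) \<in> Conv"
    by (intro Conv_add ridge_sums_Conv[OF norm_square_ridge_sum] Conv_const)
  have g: "g \<in> Conv"
    unfolding g_def[abs_def] using convex_on_max[OF ConvD[OF f] ConvD[OF q]] by (rule ConvI)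
  have "f x = g x" if "x \<in> ball 0 R" for x
  proof -
    have "(norm x)\<^sup>2 \<le> R\<^sup>2" "M * (1 + norm x) \<le> M * (1 + R)"
      using that M(1) by (auto intro!: power_mono mult_left_mono)
    then show ?thesis using M(2)[of x] by (auto simp: g_def c_def)
  qed
  then have "D f \<phi> = D g \<phi>" by (rule P0LV_D(4)[OF D f g open_ball _ \<phi> R(2)])
  also have "\<dots> = D (\<lambda>x. 0) \<phi>"
  proof (rule value_at_quadratic_at_infinity[OF D inv g _ _ \<phi>])
    show "\<rho> > 0" using c M by (simp add: \<rho>_def)
    fix x :: 'a assume x: "norm x \<ge> \<rho>"
    have "norm x \<ge> 1" using x c M by (simp add: \<rho>_def)
    have "\<rho> * norm x \<le> norm x * norm x" using x by (intro mult_right_mono) auto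
    moreover have "(c + M) * 1 \<le> (c + M) * norm x" using \<open>norm x \<ge> 1\<close> c M by (intro mult_left_mono) auto
    ultimately have "c + M * (1 + norm x) \<le> (norm x)\<^sup>2"
      using \<open>norm x \<ge> 1\<close> by (simp add: \<rho>_def power2_eq_square algebra_simps)
    then show "g x = (norm x)\<^sup>2 - c" using M(2)[of x] by (auto simp: g_def)
  qed
  finally show ?thesis .
qed

text \<open>A convex function is the pointwise limit of the maxima of finitely many of its affine minorants,
  directed by finite sets of contact points, and such maxima grow at most linearly.\<close>

theorem ridge_invariant_imp_constant:
  fixes D :: "'a::euclidean_space local_functional"
  assumes D: "D \<in> P0LV"
    and inv: "\<And>f u h. f \<in> Conv \<Longrightarrow> convex_on UNIV h \<Longrightarrow> D (ridge_add f u h) \<phi> = D f \<phi>"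
    and f: "f \<in> Conv" and \<phi>: "\<phi> \<in> Cc"
  shows "D f \<phi> = D (\<lambda>x. 0) \<phi>"
proof -
  have "\<exists>v. \<forall>x. f p + v \<bullet> (x - p) \<le> f x" for p
    using convex_subgradient[OF f, of p] by metis
  then obtain v where v: "\<And>p x. f p + v p \<bullet> (x - p) \<le> f x" by metis
  define l where "l p x = f p + v p \<bullet> (x - p)" for p x
  have lC: "l p \<in> Conv" for p
  proof -
    have "l p = (\<lambda>x. 1 * (v p \<bullet> x) + (f p - v p \<bullet> p))" by (auto simp: l_def inner_diff_right)
    then show ?thesis using affine_map_in_Conv[OF affine_map_inner[of 1 "v p" "f p - v p \<bullet> p"]] by simp
  qed
  define G where "G P x = Max ((\<lambda>p. l p x) ` insert 0 P)" for P x
  have G_insert: "G (insert p P) x = max (l p x) (G P x)" if "finite P" for p P x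
    using that by (simp add: G_def insert_commute[of 0 p] Max_insert)
  have G: "G P \<in> Conv \<and> (\<exists>M\<ge>0. \<forall>x. \<bar>G P x\<bar> \<le> M * (1 + norm x))" if "finite P" for P
    using that
  proof (induction P)
    have lb: "\<exists>M\<ge>0. \<forall>x. \<bar>l p x\<bar> \<le> M * (1 + norm x)" for p
    proof (intro exI[of _ "\<bar>f p - v p \<bullet> p\<bar> + norm (v p)"] conjI allI)
      fix x
      have "\<bar>l p x\<bar> \<le> \<bar>f p - v p \<bullet> p\<bar> + \<bar>v p \<bullet> x\<bar>" by (auto simp: l_def inner_diff_right)
      also have "\<dots> \<le> \<bar>f p - v p \<bullet> p\<bar> * (1 + norm x) + norm (v p) * (1 + norm x)"
        using Cauchy_Schwarz_ineq2[of "v p" x] norm_ge_zero[of "v p"]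
        by (intro add_mono) (auto simp: algebra_simps intro: order_trans)
      finally show "\<bar>l p x\<bar> \<le> (\<bar>f p - v p \<bullet> p\<bar> + norm (v p)) * (1 + norm x)" by (simp add: algebra_simps)
    qed simp
    case empty
    have "G {} = l 0" by (simp add: G_def fun_eq_iff)
    then show ?case using lC lb by simp
    case (insert p P)
    then obtain M where M: "M \<ge> 0" "\<And>x. \<bar>G P x\<bar> \<le> M * (1 + norm x)" by blast
    obtain M' where M': "M' \<ge> 0" "\<And>x. \<bar>l p x\<bar> \<le> M' * (1 + norm x)" using lb by blast
    have e: "G (insert p P) = (\<lambda>x. max (l p x) (G P x))" by (simp add: G_insert insert.hyps fun_eq_iff)
    have "\<bar>max (l p x) (G P x)\<bar> \<le> (M' + M) * (1 + norm x)" for x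
    proof -
      have "0 \<le> M * (1 + norm x)" "0 \<le> M' * (1 + norm x)" using M M' by auto
      then show ?thesis using M(2)[of x] M'(2)[of x] unfolding distrib_right by linarith
    qed
    then show ?case
      unfolding e using insert.IH lC M M' convex_on_max[OF ConvD[OF lC[of p]] ConvD[of "G P"]]
      by (intro conjI ConvI) (auto intro!: exI[of _ "M' + M"])
  qed
  have GP: "G (if finite P then P else {}) \<in> Conv" for P using G by simp
  have lim: "((\<lambda>P. G (if finite P then P else {}) x) \<longlongrightarrow> f x) (finite_subsets_at_top UNIV)" for x
  proof (rule tendsto_eventually)
    have "\<forall>\<^sub>F P in finite_subsets_at_top UNIV. finite P \<and> {x} \<subseteq> P \<and> P \<subseteq> UNIV"
      unfolding eventually_finite_subsets_at_top by (intro exI[of _ "{x}"]) auto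
    then show "\<forall>\<^sub>F P in finite_subsets_at_top UNIV. G (if finite P then P else {}) x = f x"
    proof (rule eventually_mono)
      fix P assume P: "finite P \<and> {x} \<subseteq> P \<and> P \<subseteq> UNIV"
      have "Max ((\<lambda>p. l p x) ` insert 0 P) = f x"
      proof (rule Max_eqI)
        show "f x \<in> (\<lambda>p. l p x) ` insert 0 P" using P by (auto simp: l_def intro!: image_eqI[of _ _ x])
      qed (use P v[where x = x] v[of 0 x] in \<open>auto simp: l_def\<close>)
      then show "G (if finite P then P else {}) x = f x" using P by (simp add: G_def)
    qed
  qed
  have "((\<lambda>P. D (G (if finite P then P else {})) \<phi>) \<longlongrightarrow> D f \<phi>) (finite_subsets_at_top UNIV)"
    by (rule P0LV_tendsto[OF D lim f GP])
  moreover have "D (G (if finite P then P else {})) \<phi> = D (\<lambda>x. 0) \<phi>" for P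
  proof -
    obtain M where M: "M \<ge> 0" "\<And>x. \<bar>G (if finite P then P else {}) x\<bar> \<le> M * (1 + norm x)"
      using G[of "if finite P then P else {}"] by (metis finite.emptyI)
    show ?thesis by (rule value_at_sublinear_growth[OF D inv GP M \<phi>])
  qed
  ultimately show ?thesis
    by (simp add: tendsto_const_iff)
qed

section \<open>Differentiating along squares\<close>

definition sqf :: "'a::euclidean_space \<Rightarrow> 'a \<Rightarrow> real" where
  "sqf u x = (u \<bullet> x)\<^sup>2 / 2"

lemma ridge_add_sqf: "ridge_add f u (\<lambda>t. t\<^sup>2 / 2) = (\<lambda>x. f x + sqf u x)"
  by (simp add: ridge_add_def sqf_def)

lemma Conv_add_sqf: "f \<in> Conv \<Longrightarrow> (\<lambda>x. f x + sqf u x) \<in> Conv"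
  using ridge_add_Conv[OF _ power2_convex, of f u] by (simp add: ridge_add_sqf)

lemma sqf_Conv: "sqf u \<in> Conv"
  using Conv_add_sqf[OF Conv_const[of 0], of u] by simp

text \<open>A difference quotient with step one, which equals the derivative in the direction \<open>s\<^sub>u\<close> because the
  functional is affine along this direction. Off \<open>Conv\<close> the value is fixed by the
  normalisation of functionals.\<close>

definition dir :: "'a::euclidean_space \<Rightarrow> 'a local_functional \<Rightarrow> 'a local_functional" where
  "dir u D = (\<lambda>f \<phi>. if f \<in> Conv then D (\<lambda>x. f x + sqf u x) \<phi> - D f \<phi> else 0)"

lemma dir_Conv: "f \<in> Conv \<Longrightarrow> dir u D f \<phi> = D (\<lambda>x. f x + sqf u x) \<phi> - D f \<phi>"
  by (simp add: dir_def)

lemma square_linear: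
  assumes "D \<in> P0LV" "f \<in> Conv" "t \<ge> 0" "\<phi> \<in> Cc"
  shows "D (\<lambda>x. f x + t * sqf u x) \<phi> = D f \<phi> + of_real t * dir u D f \<phi>"
  using ridge_linear[OF assms(1,2) power2_convex assms(3,4), of u] assms(2)
  by (simp add: ridge_add_def sqf_def dir_def)

lemma P0LV_hom_I:
  assumes "\<And>f. f \<in> Conv \<Longrightarrow> \<Psi> f \<in> Radon" "\<And>f. f \<notin> Conv \<Longrightarrow> \<Psi> f = (\<lambda>\<phi>. 0)"
    "\<And>\<phi>. \<phi> \<in> Cc \<Longrightarrow> continuous_on Conv (\<lambda>f. \<Psi> f \<phi>)"
    "\<And>f h U \<phi>. f \<in> Conv \<Longrightarrow> h \<in> Conv \<Longrightarrow> open U \<Longrightarrow> (\<And>x. x \<in> U \<Longrightarrow> f x = h x) \<Longrightarrow> \<phi> \<in> Cc \<Longrightarrow> supp \<phi> \<subseteq> U \<Longrightarrow> \<Psi> f \<phi> = \<Psi> h \<phi>"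
    "\<And>f l \<phi>. f \<in> Conv \<Longrightarrow> affine_map l \<Longrightarrow> \<phi> \<in> Cc \<Longrightarrow> \<Psi> (\<lambda>x. f x + l x) \<phi> = \<Psi> f \<phi>"
    "\<And>f t \<phi>. f \<in> Conv \<Longrightarrow> t \<ge> 0 \<Longrightarrow> \<phi> \<in> Cc \<Longrightarrow> \<Psi> (\<lambda>x. t * f x) \<phi> = of_real (t ^ k) * \<Psi> f \<phi>"
  shows "\<Psi> \<in> P0LV_hom k"
proof -
  have off: "\<Psi> f \<phi> = 0" if "\<phi> \<notin> Cc" for f \<phi>
    using assms(2)[of f] RadonD(3)[OF assms(1)[of f] that] by (cases "f \<in> Conv") auto
  have cont: "continuous_on Conv (\<lambda>f. \<Psi> f \<phi>)" for \<phi>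
  proof (cases "\<phi> \<in> Cc")
    case False
    show ?thesis
      by (rule continuous_on_eq[OF continuous_on_const[of _ 0]]) (simp add: off False)
  qed (rule assms(3))
  have "\<Psi> \<in> LV"
    unfolding LV_def mem_Collect_eq
  proof (intro conjI)
    show "\<forall>f\<in>Conv. \<Psi> f \<in> Radon" using assms(1) by blast
    show "\<forall>f. f \<notin> Conv \<longrightarrow> \<Psi> f = (\<lambda>\<phi>. 0)" using assms(2) by blast
    show "continuous_on Conv \<Psi>"
      by (rule continuous_on_coordinatewise_then_product[OF cont])
    show "\<forall>f\<in>Conv. \<forall>h\<in>Conv. \<forall>U. open U \<longrightarrow> (\<forall>x\<in>U. f x = h x) \<longrightarrow> eq_restr U (\<Psi> f) (\<Psi> h)"
      unfolding eq_restr_def by (intro ballI allI impI, rule assms(4)) auto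
  qed
  moreover have "\<Psi> (\<lambda>x. f x + l x) = \<Psi> f" if "f \<in> Conv" "affine_map l" for f l
  proof
    fix \<phi> show "\<Psi> (\<lambda>x. f x + l x) \<phi> = \<Psi> f \<phi>"
      using assms(5)[OF that] off by (cases "\<phi> \<in> Cc") auto
  qed
  moreover have "\<Psi> (\<lambda>x. t * f x) \<phi> = of_real (t ^ k) * \<Psi> f \<phi>" if "f \<in> Conv" "t \<ge> 0" for f t \<phi>
    using assms(6)[OF that] off by (cases "\<phi> \<in> Cc") auto
  ultimately show ?thesis
    unfolding P0LV_hom_def P0LV_def mem_Collect_eq by blast
qed

text \<open>Homogeneity drops by one because \<open>D\<close> is affine in the coefficient of \<open>s\<^sub>u\<close>:
  scaling \<open>f\<close> by \<open>t\<close> amounts to scaling everything by \<open>t\<close> and the coefficient of \<open>s\<^sub>u\<close> by \<open>1 / t\<close>. The case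
  \<open>t = 0\<close> follows by continuity.\<close>

lemma dir_P0LV_hom:
  assumes D: "D \<in> P0LV_hom (Suc k)"
  shows "dir u D \<in> P0LV_hom k"
proof (rule P0LV_hom_I)
  note D0 = P0LV_homD(1)[OF D]
  show "dir u D f \<in> Radon" if f: "f \<in> Conv" for f
    using Radon_lincomb[OF P0LV_D(1)[OF D0 Conv_add_sqf[OF f, of u]] P0LV_D(1)[OF D0 f], of 1 "-1"] f
    by (simp add: dir_def)
  show "dir u D f = (\<lambda>\<phi>. 0)" if "f \<notin> Conv" for f using that by (simp add: dir_def)
  show "continuous_on Conv (\<lambda>f. dir u D f \<phi>)" for \<phi>
  proof -
    have "continuous_on Conv (\<lambda>f x. f x + sqf u x)"
      by (intro continuous_on_coordinatewise_then_product continuous_intros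
          continuous_on_subset[OF continuous_on_product_coordinates subset_UNIV])
    then have "continuous_on Conv (\<lambda>f. D (\<lambda>x. f x + sqf u x) \<phi>)"
      by (rule continuous_on_compose2[OF P0LV_continuous[OF D0]]) (auto intro: Conv_add_sqf)
    then have "continuous_on Conv (\<lambda>f. D (\<lambda>x. f x + sqf u x) \<phi> - D f \<phi>)"
      by (rule continuous_on_diff[OF _ P0LV_continuous[OF D0]])
    then show ?thesis by (rule continuous_on_eq) (simp add: dir_def)
  qed
  show "dir u D f \<phi> = dir u D h \<phi>"
    if "f \<in> Conv" "h \<in> Conv" "open U" "\<And>x. x \<in> U \<Longrightarrow> f x = h x" "\<phi> \<in> Cc" "supp \<phi> \<subseteq> U" for f h U \<phi>
  proof -
    have "D f \<phi> = D h \<phi>" by (rule P0LV_D(4)[OF D0 that])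
    moreover have "D (\<lambda>x. f x + sqf u x) \<phi> = D (\<lambda>x. h x + sqf u x) \<phi>"
      by (rule P0LV_D(4)[OF D0 Conv_add_sqf[OF that(1)] Conv_add_sqf[OF that(2)] that(3) _ that(5,6)])
        (simp add: that(4))
    ultimately show ?thesis using that(1,2) by (simp add: dir_def)
  qed
  show "dir u D (\<lambda>x. f x + l x) \<phi> = dir u D f \<phi>" if "f \<in> Conv" "affine_map l" for f l \<phi>
  proof -
    have "D (\<lambda>x. f x + l x + sqf u x) = D (\<lambda>x. f x + sqf u x)"
      using P0LV_D(3)[OF D0 Conv_add_sqf[OF that(1), of u] that(2)] by (simp add: add_ac)
    then show ?thesis
      using P0LV_D(3)[OF D0 that] that(1) Conv_add_affine[OF that] by (simp add: dir_def)
  qed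
  have pos: "dir u D (\<lambda>x. t * f x) \<phi> = of_real (t ^ k) * dir u D f \<phi>" if f: "f \<in> Conv" "t > 0" "\<phi> \<in> Cc" for f t \<phi>
  proof -
    have "D (\<lambda>x. t * f x + sqf u x) \<phi> = D (\<lambda>x. t * (f x + (1 / t) * sqf u x)) \<phi>"
      using f(2) by (simp add: distrib_left)
    also have "\<dots> = of_real (t ^ Suc k) * D (\<lambda>x. f x + (1 / t) * sqf u x) \<phi>"
      using f by (intro P0LV_homD(2)[OF D] Conv_add Conv_cmult sqf_Conv) auto
    also have "D (\<lambda>x. f x + (1 / t) * sqf u x) \<phi> = D f \<phi> + of_real (1 / t) * dir u D f \<phi>"
      using f by (intro square_linear[OF D0]) auto
    finally have 1: "D (\<lambda>x. t * f x + sqf u x) \<phi> = of_real (t ^ Suc k) * (D f \<phi> + of_real (1 / t) * dir u D f \<phi>)" .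
    have 2: "D (\<lambda>x. t * f x) \<phi> = of_real (t ^ Suc k) * D f \<phi>"
      using f by (intro P0LV_homD(2)[OF D]) auto
    have "(\<lambda>x. t * f x) \<in> Conv" using f by (intro Conv_cmult) auto
    then have "dir u D (\<lambda>x. t * f x) \<phi> = D (\<lambda>x. t * f x + sqf u x) \<phi> - D (\<lambda>x. t * f x) \<phi>"
      by (rule dir_Conv)
    then show ?thesis unfolding 1 2 using f(2) by (simp add: distrib_left)
  qed
  show "dir u D (\<lambda>x. t * f x) \<phi> = of_real (t ^ k) * dir u D f \<phi>" if f: "f \<in> Conv" "t \<ge> 0" "\<phi> \<in> Cc" for f t \<phi>
  proof (cases "t = 0")
    case True
    define \<epsilon> where "\<epsilon> m = inverse (real (Suc m))" for m
    have \<epsilon>: "\<epsilon> \<longlonglongrightarrow> 0" "\<And>m. \<epsilon> m > 0" unfolding \<epsilon>_def using LIMSEQ_inverse_real_of_nat by auto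
    have C: "(\<lambda>x. \<epsilon> m * f x) \<in> Conv" for m using \<epsilon>(2)[of m] by (intro Conv_cmult f) simp
    have "(\<lambda>m. D (\<lambda>x. \<epsilon> m * f x + sqf u x) \<phi> - D (\<lambda>x. \<epsilon> m * f x) \<phi>)
        \<longlonglongrightarrow> D (\<lambda>x. 0 * f x + sqf u x) \<phi> - D (\<lambda>x. 0 * f x) \<phi>"
      by (intro tendsto_diff P0LV_tendsto[OF D0] tendsto_intros \<epsilon>(1) Conv_add_sqf C)
        (simp_all add: sqf_Conv Conv_const)
    then have "(\<lambda>m. dir u D (\<lambda>x. \<epsilon> m * f x) \<phi>) \<longlonglongrightarrow> dir u D (\<lambda>x. 0 * f x) \<phi>"
      using C by (simp add: dir_Conv Conv_const)
    moreover have "(\<lambda>m. dir u D (\<lambda>x. \<epsilon> m * f x) \<phi>) \<longlonglongrightarrow> of_real (0 ^ k) * dir u D f \<phi>"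
      unfolding pos[OF f(1) \<epsilon>(2) f(3)] by (intro tendsto_intros \<epsilon>(1))
    ultimately show ?thesis unfolding True by (rule LIMSEQ_unique)
  qed (use pos f in simp)
qed

text \<open>Invariance under squares propagates to all ridge functions, so the functional is constant, and a
  constant functional of positive degree vanishes.\<close>

theorem eq_0_if_all_dir_eq_0:
  assumes D: "D \<in> P0LV_hom (Suc k)" and 0: "\<And>u f \<phi>. f \<in> Conv \<Longrightarrow> \<phi> \<in> Cc \<Longrightarrow> dir u D f \<phi> = 0"
    and f: "f \<in> Conv" and \<phi>: "\<phi> \<in> Cc"
  shows "D f \<phi> = 0"
proof -
  note D0 = P0LV_homD(1)[OF D]
  have sq: "D (ridge_add f u (\<lambda>t. t\<^sup>2 / 2)) = D f" if f: "f \<in> Conv" for f u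
  proof
    fix \<phi> show "D (ridge_add f u (\<lambda>t. t\<^sup>2 / 2)) \<phi> = D f \<phi>"
    proof (cases "\<phi> \<in> Cc")
      case True
      then show ?thesis using 0[OF f True, of u] f by (simp add: dir_Conv ridge_add_sqf)
    qed (simp add: eq_off_Cc[OF D0])
  qed
  have "D f \<phi> = D (\<lambda>x. 0) \<phi>"
    by (rule ridge_invariant_imp_constant[OF D0 ridge_invariant_of_square_invariant[OF D0 sq _ _ \<phi>] f \<phi>])
  also have "\<dots> = 0"
    using P0LV_homD(2)[OF D Conv_const[of 0], of 0 \<phi>] by simp
  finally show ?thesis .
qed

lemma P0LV_hom_0_constant:
  assumes "D \<in> P0LV_hom 0" "f \<in> Conv"
  shows "D f \<phi> = D (\<lambda>x. 0) \<phi>"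
  using P0LV_homD(2)[OF assms, of 0 \<phi>] by simp

lemma P0LV_hom_lincomb:
  assumes "D \<in> P0LV_hom k" "E \<in> P0LV_hom k"
  shows "(\<lambda>f \<phi>. a * D f \<phi> + b * E f \<phi>) \<in> P0LV_hom k"
proof (rule P0LV_hom_I)
  note D = P0LV_homD(1)[OF assms(1)] and E = P0LV_homD(1)[OF assms(2)]
  show "(\<lambda>\<phi>. a * D f \<phi> + b * E f \<phi>) \<in> Radon" if "f \<in> Conv" for f
    by (rule Radon_lincomb[OF P0LV_D(1)[OF D that] P0LV_D(1)[OF E that]])
  show "(\<lambda>\<phi>. a * D f \<phi> + b * E f \<phi>) = (\<lambda>\<phi>. 0)" if "f \<notin> Conv" for f
    using P0LV_D(2)[OF D that] P0LV_D(2)[OF E that] by simp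
  show "continuous_on Conv (\<lambda>f. a * D f \<phi> + b * E f \<phi>)" for \<phi>
    by (intro continuous_intros P0LV_continuous D E)
  show "a * D f \<phi> + b * E f \<phi> = a * D h \<phi> + b * E h \<phi>"
    if "f \<in> Conv" "h \<in> Conv" "open U" "\<And>x. x \<in> U \<Longrightarrow> f x = h x" "\<phi> \<in> Cc" "supp \<phi> \<subseteq> U" for f h U \<phi>
    using P0LV_D(4)[OF D that] P0LV_D(4)[OF E that] by simp
  show "a * D (\<lambda>x. f x + l x) \<phi> + b * E (\<lambda>x. f x + l x) \<phi> = a * D f \<phi> + b * E f \<phi>"
    if "f \<in> Conv" "affine_map l" for f l \<phi>
    unfolding P0LV_D(3)[OF D that] P0LV_D(3)[OF E that] by (rule refl)
  show "a * D (\<lambda>x. t * f x) \<phi> + b * E (\<lambda>x. t * f x) \<phi> = of_real (t ^ k) * (a * D f \<phi> + b * E f \<phi>)"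
    if "f \<in> Conv" "t \<ge> 0" for f t \<phi>
    unfolding P0LV_homD(2)[OF assms(1) that] P0LV_homD(2)[OF assms(2) that] by (simp add: algebra_simps)
qed


text \<open>An affine function has no second difference.\<close>

lemma dir_dir_self:
  assumes D: "D \<in> P0LV" and f: "f \<in> Conv" and \<phi>: "\<phi> \<in> Cc"
  shows "dir u (dir u D) f \<phi> = 0"
proof -
  have "D (\<lambda>x. f x + sqf u x + sqf u x) \<phi> = D (\<lambda>x. f x + 2 * sqf u x) \<phi>"
    by (simp add: add.assoc)
  also have "\<dots> = D f \<phi> + 2 * dir u D f \<phi>"
    using square_linear[OF D f _ \<phi>, of 2 u] by simp
  finally show ?thesis using f Conv_add_sqf[OF f] by (simp add: dir_Conv)
qed

definition weighted_squares :: "(real \<times> 'a::euclidean_space) list \<Rightarrow> 'a \<Rightarrow> real" where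
  "weighted_squares L x = (\<Sum>(w, u)\<leftarrow>L. w * sqf u x)"

lemma weighted_squares_simps [simp]:
  "weighted_squares [] x = 0"
  "weighted_squares ((w, u) # L) x = w * sqf u x + weighted_squares L x"
  by (simp_all add: weighted_squares_def)

lemma weighted_squares_Conv: "list_all (\<lambda>(w, u). w \<ge> 0) L \<Longrightarrow> (\<lambda>x. weighted_squares L x) \<in> Conv"
proof (induction L)
  case (Cons p L)
  obtain w u where p: "p = (w, u)" by (cases p)
  show ?case unfolding p weighted_squares_simps
    using Cons.prems p by (intro Conv_add Conv_cmult sqf_Conv Cons.IH) auto
next
  case Nil
  have "weighted_squares [] = (\<lambda>x::'a. 0)" by (rule ext) simp
  then show ?case by (simp add: Conv_const)
qed

text \<open>Both sides are the derivative at \<open>0\<close> of \<open>\<epsilon> \<mapsto> D (f + \<epsilon> q)\<close> for the same quadratic form \<open>q\<close>. This makes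
  \<open>dir u\<close> depend on \<open>u\<close> only through the quadratic form \<open>s\<^sub>u\<close>, and linearly so.\<close>

lemma dir_relation:
  assumes D: "D \<in> P0LV" and f: "f \<in> Conv" and \<phi>: "\<phi> \<in> Cc"
    and pos: "list_all (\<lambda>(w, u). w \<ge> 0) L" "list_all (\<lambda>(w, u). w \<ge> 0) L'"
    and eq: "\<And>x. weighted_squares L x = weighted_squares L' x"
  shows "(\<Sum>(w, u)\<leftarrow>L. of_real w * dir u D f \<phi>) = (\<Sum>(w, u)\<leftarrow>L'. of_real w * dir u D f \<phi>)"
proof -
  define \<epsilon> where "\<epsilon> m = inverse (real (Suc m))" for m
  have \<epsilon>: "\<epsilon> \<longlonglongrightarrow> 0" "\<And>m. \<epsilon> m > 0" unfolding \<epsilon>_def using LIMSEQ_inverse_real_of_nat by auto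
  have lim: "(\<lambda>m. (D (\<lambda>x. f x + \<epsilon> m * weighted_squares L x) \<phi> - D f \<phi>) / of_real (\<epsilon> m))
      \<longlonglongrightarrow> (\<Sum>(w, u)\<leftarrow>L. of_real w * dir u D f \<phi>)"
    if "list_all (\<lambda>(w, u). w \<ge> 0) L" for L
    using that
  proof (induction L)
    case (Cons p L)
    obtain w u where p: "p = (w, u)" by (cases p)
    have w: "w \<ge> 0" "list_all (\<lambda>(w, u). w \<ge> 0) L" using Cons.prems p by auto
    have C: "(\<lambda>x. f x + \<epsilon> m * weighted_squares L x) \<in> Conv" for m
      by (intro Conv_add f Conv_cmult weighted_squares_Conv[OF w(2)] less_imp_le[OF \<epsilon>(2)])
    have step: "(D (\<lambda>x. f x + \<epsilon> m * weighted_squares (p # L) x) \<phi> - D f \<phi>) / of_real (\<epsilon> m)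
       = of_real w * dir u D (\<lambda>x. f x + \<epsilon> m * weighted_squares L x) \<phi>
         + (D (\<lambda>x. f x + \<epsilon> m * weighted_squares L x) \<phi> - D f \<phi>) / of_real (\<epsilon> m)" for m
    proof -
      have "D (\<lambda>x. f x + \<epsilon> m * weighted_squares (p # L) x) \<phi>
          = D (\<lambda>x. (f x + \<epsilon> m * weighted_squares L x) + (\<epsilon> m * w) * sqf u x) \<phi>"
        by (simp add: p algebra_simps)
      also have "\<dots> = D (\<lambda>x. f x + \<epsilon> m * weighted_squares L x) \<phi>
          + of_real (\<epsilon> m * w) * dir u D (\<lambda>x. f x + \<epsilon> m * weighted_squares L x) \<phi>"
        using \<epsilon>(2)[of m] w by (intro square_linear[OF D C _ \<phi>]) simp
      finally show ?thesis using \<epsilon>(2)[of m] by (simp add: field_simps)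
    qed
    have l0: "(\<lambda>m. f x + \<epsilon> m * weighted_squares L x) \<longlonglongrightarrow> f x" for x
      by (rule tendsto_eq_intros refl \<epsilon>(1))+ simp
    have "(\<lambda>m. dir u D (\<lambda>x. f x + \<epsilon> m * weighted_squares L x) \<phi>) \<longlonglongrightarrow> dir u D f \<phi>"
      unfolding dir_Conv[OF C] dir_Conv[OF f]
      by (intro tendsto_diff P0LV_tendsto[OF D] tendsto_add l0 tendsto_const Conv_add_sqf C f)
    then have "(\<lambda>m. (D (\<lambda>x. f x + \<epsilon> m * weighted_squares (p # L) x) \<phi> - D f \<phi>) / of_real (\<epsilon> m))
      \<longlonglongrightarrow> of_real w * dir u D f \<phi> + (\<Sum>(w, u)\<leftarrow>L. of_real w * dir u D f \<phi>)"
      unfolding step by (intro tendsto_add tendsto_mult_left Cons.IH[OF w(2)])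
    then show ?case by (simp add: p)
  qed (simp add: tendsto_const_iff)
  show ?thesis
    by (rule LIMSEQ_unique[OF lim[OF pos(1)]]) (use lim[OF pos(2)] in \<open>simp_all add: eq\<close>)
qed

text \<open>The bilinear form in the pair of directions that belongs to the quadratic form \<open>u \<mapsto> dir u D\<close>. It is
  taken on pairs because iterates are indexed by multisets of pairs.\<close>

definition pol :: "'a::euclidean_space \<times> 'a \<Rightarrow> 'a local_functional \<Rightarrow> 'a local_functional" where
  "pol p D = (\<lambda>f \<phi>. (dir (fst p + snd p) D f \<phi> - dir (fst p) D f \<phi> - dir (snd p) D f \<phi>) / 2)"

lemma pol_sym: "pol (u, v) D = pol (v, u) D"
  by (simp add: pol_def add.commute[of u v] diff_diff_eq add.commute[of "dir u D _ _"])

lemma sqf_lin: "sqf (u + v) x = sqf u x + sqf v x + (u \<bullet> x) * (v \<bullet> x)" "sqf (c *\<^sub>R u) x = c\<^sup>2 * sqf u x"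
  by (simp_all add: sqf_def inner_add_left power2_eq_square field_simps)

context
  fixes D :: "'a::euclidean_space local_functional" and f :: "'a \<Rightarrow> real" and \<phi> :: "'a \<Rightarrow> complex"
  assumes D: "D \<in> P0LV" and f: "f \<in> Conv" and \<phi>: "\<phi> \<in> Cc"
begin

lemma dir_scale: "dir (c *\<^sub>R u) D f \<phi> = of_real (c\<^sup>2) * dir u D f \<phi>"
  using dir_relation[OF D f \<phi>, of "[(1, c *\<^sub>R u)]" "[(c\<^sup>2, u)]"] by (auto simp: sqf_lin)

lemma pol_diag: "pol (u, u) D f \<phi> = dir u D f \<phi>"
  using dir_scale[of 2 u] by (simp add: pol_def scaleR_2)

lemma pol_add: "pol (u + u', v) D f \<phi> = pol (u, v) D f \<phi> + pol (u', v) D f \<phi>"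
proof -
  have "dir (u + u' + v) D f \<phi> + (dir u D f \<phi> + (dir u' D f \<phi> + dir v D f \<phi>))
      = dir (u + u') D f \<phi> + (dir (u + v) D f \<phi> + dir (u' + v) D f \<phi>)"
    using dir_relation[OF D f \<phi>, of "[(1, u + u' + v), (1, u), (1, u'), (1, v)]" "[(1, u + u'), (1, u + v), (1, u' + v)]"]
    by (simp add: sqf_lin inner_add_left distrib_left distrib_right)
  then have e: "dir (u + u' + v) D f \<phi> = dir (u + u') D f \<phi> + (dir (u + v) D f \<phi> + dir (u' + v) D f \<phi>)
      - (dir u D f \<phi> + (dir u' D f \<phi> + dir v D f \<phi>))"
    by (rule eq_diff_eq[THEN iffD2])
  show ?thesis unfolding pol_def fst_conv snd_conv e by (simp add: field_simps)
qed

lemma pol_scale: "pol (c *\<^sub>R u, v) D f \<phi> = of_real c * pol (u, v) D f \<phi>"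
proof -
  have e: "dir (c *\<^sub>R u + v) D f \<phi> = of_real (c\<^sup>2) * dir u D f \<phi> + dir v D f \<phi>
     + of_real c * (dir (u + v) D f \<phi> - dir u D f \<phi> - dir v D f \<phi>)"
  proof (cases "c \<ge> 0")
    case True
    then have "dir (c *\<^sub>R u + v) D f \<phi> + (of_real c * dir u D f \<phi> + of_real c * dir v D f \<phi>)
      = of_real (c\<^sup>2) * dir u D f \<phi> + (dir v D f \<phi> + of_real c * dir (u + v) D f \<phi>)"
      using dir_relation[OF D f \<phi>, of "[(1, c *\<^sub>R u + v), (c, u), (c, v)]" "[(c\<^sup>2, u), (1, v), (c, u + v)]"]
      by (simp add: sqf_lin distrib_left)
    then show ?thesis by (simp add: algebra_simps eq_diff_eq)
  next
    case False
    then have "dir (c *\<^sub>R u + v) D f \<phi> + of_real (- c) * dir (u + v) D f \<phi>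
      = of_real (c\<^sup>2) * dir u D f \<phi> + (dir v D f \<phi> + (of_real (- c) * dir u D f \<phi> + of_real (- c) * dir v D f \<phi>))"
      using dir_relation[OF D f \<phi>, of "[(1, c *\<^sub>R u + v), (- c, u + v)]" "[(c\<^sup>2, u), (1, v), (- c, u), (- c, v)]"]
      by (simp add: sqf_lin distrib_left)
    then show ?thesis by (simp add: algebra_simps eq_diff_eq)
  qed
  show ?thesis unfolding pol_def fst_conv snd_conv dir_scale e by (simp add: field_simps)
qed

end

lemma pol_P0LV_hom:
  assumes "D \<in> P0LV_hom (Suc k)"
  shows "pol p D \<in> P0LV_hom k"
proof -
  note d = dir_P0LV_hom[OF assms]
  have "(\<lambda>f \<phi>. 1 * ((1/2) * dir (fst p + snd p) D f \<phi> + (-1/2) * dir (fst p) D f \<phi>) + (-1/2) * dir (snd p) D f \<phi>) \<in> P0LV_hom k"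
    by (rule P0LV_hom_lincomb[OF P0LV_hom_lincomb[OF d d] d])
  then show ?thesis by (simp add: pol_def diff_divide_distrib)
qed

lemma pol_commute: "pol p (pol q D) = pol q (pol p D)"
proof (intro ext)
  fix f \<phi>
  show "pol p (pol q D) f \<phi> = pol q (pol p D) f \<phi>"
  proof (cases "f \<in> Conv")
    case True
    then have C: "(\<lambda>x. f x + sqf u x) \<in> Conv" for u by (rule Conv_add_sqf)
    have e: "(\<lambda>x. f x + sqf u x + sqf v x) = (\<lambda>x. f x + sqf v x + sqf u x)" for u v by (simp add: add_ac)
    define S where "S u v = D (\<lambda>x. f x + sqf u x + sqf v x) \<phi>" for u v
    have S: "S u v = S v u" for u v unfolding S_def e[of u v] ..
    show ?thesis
      unfolding pol_def dir_def using True C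
      by (simp add: S_def[symmetric] S[of "fst p + snd p"] S[of "fst p" "fst q"] S[of "fst p" "snd q"] S[of "fst p" "fst q + snd q"]
        S[of "snd p" "fst q"] S[of "snd p" "snd q"] S[of "snd p" "fst q + snd q"]) (simp add: field_simps)
  qed (simp add: pol_def dir_def)
qed

interpretation pol: comp_fun_commute pol
  by standard (simp add: fun_eq_iff pol_commute)

text \<open>The identity is obtained by polarising \<open>G v v v v = 0\<close>, which says that the complete symmetrisation of
  \<open>G\<close> vanishes: \<open>G x x y z + 2 G x y x z = 0\<close>.\<close>

lemma quartic_polarization:
  fixes G :: "'a::real_vector \<Rightarrow> 'a \<Rightarrow> 'a \<Rightarrow> 'a \<Rightarrow> complex"
  assumes add: "\<And>a b c d e. G (a + b) c d e = G a c d e + G b c d e"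
    and sym: "\<And>a b c d. G a b c d = G b a c d" "\<And>a b c d. G a b c d = G c d a b"
    and zero: "\<And>v. G v v v v = 0"
  shows "G x y x z = - 1 / 2 * G x x y z"
proof -
  have add2: "G c (a + b) d e = G c a d e + G c b d e" for a b c d e
    by (metis add sym(1))
  have add3: "G d e (a + b) c = G d e a c + G d e b c" for a b c d e
    by (metis add sym(2))
  have add4: "G d e c (a + b) = G d e c a + G d e c b" for a b c d e
    by (metis add2 sym(2))
  note lin = add add2 add3 add4
  have neg: "G (- a) c d e = - G a c d e" for a c d e
    using add[of a "- a" c d e] add[of 0 0 c d e] by (simp add: eq_neg_iff_add_eq_0 add.commute)
  have neg2: "G c (- a) d e = - G c a d e" for a c d e
    by (metis neg sym(1))
  have neg3: "G d e (- a) c = - G d e a c" for a c d e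
    by (metis neg sym(2))
  have neg4: "G d e c (- a) = - G d e c a" for a c d e
    by (metis neg2 sym(2))
  have s34: "G a b c d = G a b d c" for a b c d by (metis sym)
  have even: "G x x y y + 2 * G x y x y = 0" for x y
  proof -
    have p: "0 = G (x + y) (x + y) (x + y) (x + y)" "0 = G (x + - y) (x + - y) (x + - y) (x + - y)"
      by (simp_all add: zero del: add_uminus_conv_diff)
    have e: "G x x y x = G x x x y" "G x y x x = G x x x y" "G y x x x = G x x x y"
      "G y y x x = G x x y y" "G y x x y = G x y x y" "G x y y x = G x y x y" "G y x y x = G x y x y"
      "G y y y x = G y y x y" "G x y y y = G y y x y" "G y x y y = G y y x y"
      by (metis sym)+
    show ?thesis
      using p unfolding lin neg neg2 neg3 neg4 e by (simp add: zero) algebra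
  qed
  have "G x x (y + z) (y + z) + 2 * G x (y + z) x (y + z) = 0" by (rule even)
  then have "2 * (G x x y z + 2 * G x y x z) + (G x x y y + 2 * G x y x y) + (G x x z z + 2 * G x z x z) = 0"
    unfolding lin s34[of x x z y] sym(2)[of x z x y] by (simp add: algebra_simps)
  then have "2 * (G x x y z + 2 * G x y x z) = 0" unfolding even by simp
  then have "2 * G x y x z + G x x y z = 0"
    unfolding mult_eq_0_iff by (simp add: add.commute)
  then have "2 * G x y x z = - G x x y z"
    by (rule eq_neg_iff_add_eq_0[THEN iffD2])
  then have "(2 * G x y x z) / 2 = (- G x x y z) / 2" by (rule arg_cong)
  then show ?thesis by simp
qed

lemma pol_pol_relation:
  assumes D: "D \<in> P0LV_hom (Suc (Suc k))" and f: "f \<in> Conv" and \<phi>: "\<phi> \<in> Cc"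
  shows "pol (x, y) (pol (x, z) D) f \<phi> = - 1 / 2 * pol (x, x) (pol (y, z) D) f \<phi>"
proof (rule quartic_polarization[where G = "\<lambda>a b c d. pol (a, b) (pol (c, d) D) f \<phi>"])
  fix a b c d e :: 'a
  have P: "pol q D \<in> P0LV" for q by (rule P0LV_homD(1)[OF pol_P0LV_hom[OF D]])
  show "pol (a + b, c) (pol (d, e) D) f \<phi> = pol (a, c) (pol (d, e) D) f \<phi> + pol (b, c) (pol (d, e) D) f \<phi>"
    by (rule pol_add[OF P f \<phi>])
  show "pol (a, b) (pol (c, d) D) f \<phi> = pol (b, a) (pol (c, d) D) f \<phi>" by (simp add: pol_sym)
  show "pol (a, b) (pol (c, d) D) f \<phi> = pol (c, d) (pol (a, b) D) f \<phi>" by (simp add: pol_commute)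
  have "pol (a, a) (pol (a, a) D) f \<phi> = dir a (pol (a, a) D) f \<phi>" by (rule pol_diag[OF P f \<phi>])
  also have "\<dots> = dir a (dir a D) f \<phi>"
    using pol_diag[OF P0LV_homD(1)[OF D] _ \<phi>, of _ a] f Conv_add_sqf[OF f] by (simp add: dir_Conv)
  also have "\<dots> = 0" by (rule dir_dir_self[OF P0LV_homD(1)[OF D] f \<phi>])
  finally show "pol (a, a) (pol (a, a) D) f \<phi> = 0" .
qed

text \<open>Multisets reflect that the operators \<open>pol p\<close> commute (lemma \<open>pol_commute\<close>), which is what makes the fold
  well defined.\<close>

definition iter_pol :: "('a::euclidean_space \<times> 'a) multiset \<Rightarrow> 'a local_functional \<Rightarrow> 'a local_functional" where
  "iter_pol M D = fold_mset pol D M"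

lemma iter_pol_empty [simp]: "iter_pol {#} D = D"
  by (simp add: iter_pol_def)

lemma iter_pol_add: "iter_pol (add_mset p M) D = pol p (iter_pol M D)"
  by (simp add: iter_pol_def)

lemma iter_pol_add': "iter_pol (add_mset p M) D = iter_pol M (pol p D)"
  by (induction M arbitrary: D) (simp_all add: iter_pol_add pol_commute add_mset_commute[of p])

lemma iter_pol_P0LV_hom:
  assumes "D \<in> P0LV_hom (size M + k)"
  shows "iter_pol M D \<in> P0LV_hom k"
  using assms by (induction M arbitrary: k) (simp_all add: iter_pol_add pol_P0LV_hom)


text \<open>Induction on the degree. Since \<open>dir u = pol (u, u)\<close>, the hypothesis passes to all \<open>dir u D\<close>, which have
  smaller degree; their vanishing is the hypothesis of \<open>eq_0_if_all_dir_eq_0\<close>.\<close>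

theorem eq_0_if_iter_pol_eq_0:
  assumes "D \<in> P0LV_hom k" "\<And>M \<phi>. size M = k \<Longrightarrow> \<phi> \<in> Cc \<Longrightarrow> iter_pol M D (\<lambda>x. 0) \<phi> = 0"
    and "f \<in> Conv" "\<phi> \<in> Cc"
  shows "D f \<phi> = 0"
  using assms
proof (induction k arbitrary: D f \<phi>)
  case 0
  then show ?case using P0LV_hom_0_constant[of D f \<phi>] by (metis iter_pol_empty size_empty)
next
  case (Suc k)
  show ?case
  proof (rule eq_0_if_all_dir_eq_0[OF Suc.prems(1) _ Suc.prems(3,4)])
    fix u :: 'a and f :: "'a \<Rightarrow> real" and \<phi> :: "'a \<Rightarrow> complex" assume f: "f \<in> Conv" "\<phi> \<in> Cc"
    have "pol (u, u) D f \<phi> = 0"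
      by (rule Suc.IH[OF pol_P0LV_hom[OF Suc.prems(1)] _ f])
        (simp add: iter_pol_add'[symmetric] Suc.prems(2))
    then show "dir u D f \<phi> = 0" by (simp add: pol_diag[OF P0LV_homD(1)[OF Suc.prems(1)] f])
  qed
qed

section \<open>Translations act continuously on convex functions\<close>

definition cube :: "'a::euclidean_space \<Rightarrow> real \<Rightarrow> 'a set" where
  "cube c r = cbox (c - (\<Sum>i\<in>Basis. r *\<^sub>R i)) (c + (\<Sum>i\<in>Basis. r *\<^sub>R i))"

lemma mem_cube: "y \<in> cube c r \<longleftrightarrow> (\<forall>i\<in>Basis. \<bar>(y - c) \<bullet> i\<bar> \<le> r)"
  by (auto simp: cube_def mem_box inner_diff_left inner_add_left inner_sum_left inner_Basis if_distrib sum.delta cong: if_cong)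

lemma cube_reflect: "y \<in> cube c r \<Longrightarrow> 2 *\<^sub>R c - y \<in> cube c r"
  by (simp add: mem_cube inner_diff_left algebra_simps abs_le_iff)

lemma cube_center: "r \<ge> 0 \<Longrightarrow> c \<in> cube c r"
  by (simp add: mem_cube)

lemma cube_subset_ball:
  fixes c :: "'a::euclidean_space"
  assumes "y \<in> cube c r"
  shows "norm (y - c) \<le> r * real DIM('a)"
proof -
  have "norm (y - c) \<le> (\<Sum>i\<in>Basis. \<bar>(y - c) \<bullet> i\<bar>)" by (rule norm_le_l1)
  also have "\<dots> \<le> (\<Sum>i\<in>(Basis :: 'a set). r)" using assms by (intro sum_mono) (simp add: mem_cube)
  finally show ?thesis by (simp add: mult.commute)
qed

lemma ball_subset_cube: "dist y c \<le> r \<Longrightarrow> y \<in> cube c r"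
  unfolding mem_cube dist_norm by (meson Basis_le_norm order_trans)

definition cube_points :: "'a::euclidean_space \<Rightarrow> real \<Rightarrow> 'a set" where
  "cube_points c r = (SOME S. finite S \<and> cube c r = convex hull S)"

lemma cube_points:
  assumes "r > 0"
  shows "finite (cube_points c r)" "cube c r = convex hull (cube_points c r)"
proof -
  have "\<exists>S. finite S \<and> cube c r = convex hull S"
    unfolding cube_def using cube_convex_hull[OF assms] by metis
  from someI_ex[OF this] show "finite (cube_points c r)" "cube c r = convex hull (cube_points c r)"
    by (simp_all add: cube_points_def)
qed

text \<open>A convex function on a cube is controlled by finitely many of its values: it is bounded above by the
  values at the vertices, and, reflecting in the center, bounded below by means of the value there.\<close>

lemma convex_cube_control:
  assumes h: "h \<in> Conv" and r: "r > 0"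
    and close: "\<And>p. p \<in> insert c (cube_points c r) \<Longrightarrow> \<bar>h p - f p\<bar> \<le> \<delta>"
    and f: "\<And>y. y \<in> cube c r \<Longrightarrow> \<bar>f y - a\<bar> \<le> \<eta>" and x: "x \<in> cube c r"
  shows "\<bar>h x - a\<bar> \<le> 3 * (\<delta> + \<eta>)"
proof -
  have sub: "cube_points c r \<subseteq> cube c r" unfolding cube_points(2)[OF r] by (rule hull_subset)
  have up: "h y \<le> a + (\<delta> + \<eta>)" if "y \<in> cube c r" for y
  proof -
    have "convex_on (convex hull (cube_points c r)) h"
      by (rule convex_on_subset[OF ConvD[OF h] subset_UNIV convex_convex_hull])
    moreover have "h p \<le> a + (\<delta> + \<eta>)" if "p \<in> cube_points c r" for p
      using close[of p] f[of p] that sub by (auto simp: abs_le_iff)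
    ultimately show ?thesis
      using that unfolding cube_points(2)[OF r] by (rule_tac convex_on_convex_hull_bound[THEN bspec]) auto
  qed
  have "c = (1 - 1/2) *\<^sub>R x + (1/2) *\<^sub>R (2 *\<^sub>R c - x)" by (simp add: algebra_simps)
  then have "h c \<le> (1 - 1/2) * h x + 1/2 * h (2 *\<^sub>R c - x)"
    using convex_onD[OF ConvD[OF h], of "1/2" x "2 *\<^sub>R c - x"] by simp
  moreover have "h (2 *\<^sub>R c - x) \<le> a + (\<delta> + \<eta>)" by (rule up[OF cube_reflect[OF x]])
  moreover have "h c \<ge> a - (\<delta> + \<eta>)"
    using close[of c] f[of c] cube_center[of r c] r by (auto simp: abs_le_iff)
  ultimately show ?thesis using up[OF x] by (auto simp: abs_le_iff)
qed

lemma continuous_on_cube: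
  fixes x :: "'a::euclidean_space" and f :: "'a \<Rightarrow> real"
  assumes "continuous_on UNIV f" "\<eta> > 0"
  obtains d where "d > 0" "\<And>c r y. norm (c - x) + r * real DIM('a) < d \<Longrightarrow> y \<in> cube c r \<Longrightarrow> \<bar>f y - f x\<bar> \<le> (\<eta>::real)"
proof -
  obtain d where d: "d > 0" "\<And>y. dist y x < d \<Longrightarrow> dist (f y) (f x) < \<eta>"
    using assms unfolding continuous_on_iff by (metis UNIV_I)
  show ?thesis
  proof (rule that[OF d(1)])
    fix c r y assume h: "norm (c - x) + r * real DIM('a) < d" "y \<in> cube c r"
    have "norm (y - x) \<le> norm (y - c) + norm (c - x)" using norm_triangle_ineq[of "y - c" "c - x"] by simp
    then have "dist y x < d" using cube_subset_ball[OF h(2)] h(1) by (simp add: dist_norm)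
    then show "\<bar>f y - f x\<bar> \<le> \<eta>" using d(2)[of y] by (simp add: dist_real_def)
  qed
qed

lemma open_finite_control: "finite P \<Longrightarrow> open {h :: 'a \<Rightarrow> real. \<forall>p\<in>P. \<bar>h p - f p\<bar> < \<delta>}"
proof -
  assume "finite P"
  then have "open (\<Inter>p\<in>P. {h :: 'a \<Rightarrow> real. \<bar>h p - f p\<bar> < \<delta>})"
    by (intro open_INT ballI open_Collect_less continuous_intros continuous_on_product_coordinates)
  also have "(\<Inter>p\<in>P. {h :: 'a \<Rightarrow> real. \<bar>h p - f p\<bar> < \<delta>}) = {h. \<forall>p\<in>P. \<bar>h p - f p\<bar> < \<delta>}" by auto
  finally show ?thesis .
qed

definition tr :: "'a::ab_group_add \<Rightarrow> ('a \<Rightarrow> 'b) \<Rightarrow> 'a \<Rightarrow> 'b" where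
  "tr y f = (\<lambda>x. f (x + y))"

lemma tr_Conv: "f \<in> Conv \<Longrightarrow> tr y f \<in> Conv"
  unfolding tr_def using Conv_comp_affine[OF _ affine_map_ridge(2)] by blast

lemma tr_0 [simp]: "tr 0 f = f"
  by (simp add: tr_def)

lemma supp_tr: "supp (tr y \<phi>) = (\<lambda>x. x - y) ` supp \<phi>" for \<phi> :: "'a::euclidean_space \<Rightarrow> complex"
proof -
  have "{x. tr y \<phi> x \<noteq> 0} = (\<lambda>x. - y + x) ` {x. \<phi> x \<noteq> 0}"
    by (auto simp: tr_def image_iff intro!: exI[of _ "_ + y"])
  then show ?thesis
    unfolding supp_def using closure_translation[of "- y" "{x. \<phi> x \<noteq> 0}"] by simp
qed

lemma tr_Cc: "\<phi> \<in> Cc \<Longrightarrow> tr y \<phi> \<in> Cc"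
proof -
  assume \<phi>: "\<phi> \<in> Cc"
  have "compact (supp (tr y \<phi>))"
    unfolding supp_tr by (intro compact_continuous_image CcD(2)[OF \<phi>] continuous_intros)
  moreover have "continuous_on UNIV (tr y \<phi>)"
    unfolding tr_def by (intro continuous_on_compose2[OF CcD(1)[OF \<phi>, of UNIV]] continuous_intros) auto
  ultimately show ?thesis by (simp add: Cc_def)
qed

text \<open>Pointwise convergence of convex functions is locally uniform.\<close>

lemma translation_continuous:
  "continuous_on (UNIV \<times> Conv) (\<lambda>(y, f). tr y f)"
proof -
  have "continuous_on (UNIV \<times> Conv) (\<lambda>p. tr (fst p) (snd p) x)" for x :: 'a
    unfolding continuous_on_topological
  proof (intro ballI allI impI)
    fix p :: "'a \<times> ('a \<Rightarrow> real)" and B assume p: "p \<in> UNIV \<times> Conv" and B: "open B" "tr (fst p) (snd p) x \<in> B"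
    obtain y0 f where pf: "p = (y0, f)" by (cases p)
    have f: "f \<in> Conv" using p pf by simp
    obtain e where e: "e > 0" "\<And>z. dist z (f (x + y0)) < e \<Longrightarrow> z \<in> B"
      using B pf unfolding open_dist tr_def by auto
    obtain d where d: "d > 0" "\<And>c r y. norm (c - (x + y0)) + r * real DIM('a) < d \<Longrightarrow> y \<in> cube c r \<Longrightarrow> \<bar>f y - f (x + y0)\<bar> \<le> e / 12"
      using continuous_on_cube[OF Conv_continuous[OF f], of "e / 12" "x + y0"] e by auto
    define r where "r = d / (2 * DIM('a))"
    have r: "r > 0" "norm (x + y0 - (x + y0)) + r * real DIM('a) < d" using d(1) by (simp_all add: r_def)
    define A where "A = ball y0 r \<times> {h. \<forall>q\<in>insert (x + y0) (cube_points (x + y0) r). \<bar>h q - f q\<bar> < e / 12}"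
    have "open A" unfolding A_def using cube_points(1)[OF r(1)]
      by (intro open_Times open_ball open_finite_control) simp
    moreover have "p \<in> A" using r e by (simp add: A_def pf)
    moreover have "tr (fst q) (snd q) x \<in> B" if q: "q \<in> UNIV \<times> Conv" "q \<in> A" for q
    proof -
      have "x + fst q \<in> cube (x + y0) r"
        using q r by (intro ball_subset_cube) (auto simp: A_def dist_commute dist_norm norm_minus_commute)
      moreover have "\<bar>snd q p - f p\<bar> \<le> e / 12" if "p \<in> insert (x + y0) (cube_points (x + y0) r)" for p
        using q(2) that unfolding A_def mem_Times_iff by (auto intro: less_imp_le)
      moreover have "snd q \<in> Conv" using q(1) by auto
      ultimately have "\<bar>snd q (x + fst q) - f (x + y0)\<bar> \<le> 3 * (e / 12 + e / 12)"
        using convex_cube_control[where h = "snd q" and f = f and c = "x + y0", OF _ r(1) _ d(2)[OF r(2)]] by blast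
      then show ?thesis using e(1) by (intro e(2)) (simp add: dist_real_def tr_def)
    qed
    ultimately show "\<exists>A. open A \<and> p \<in> A \<and> (\<forall>q\<in>UNIV \<times> Conv. q \<in> A \<longrightarrow> tr (fst q) (snd q) x \<in> B)" by blast
  qed
  then show ?thesis
    unfolding case_prod_beta' by (rule continuous_on_coordinatewise_then_product)
qed

text \<open>Pointwise convergence of finite convex functions is decided on a countable dense set, so \<open>Conv\<close> is
  first countable although the surrounding product space is not.\<close>

lemma continuous_on_Conv_sequentially:
  fixes G :: "('a::euclidean_space \<Rightarrow> real) \<Rightarrow> complex"
  assumes seq: "\<And>f g. f \<in> Conv \<Longrightarrow> (\<And>m::nat. g m \<in> Conv) \<Longrightarrow> (\<And>x. (\<lambda>m. g m x) \<longlonglongrightarrow> f x) \<Longrightarrow> (\<lambda>m. G (g m)) \<longlonglongrightarrow> G f"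
  shows "continuous_on Conv G"
  unfolding continuous_on_topological
proof (intro ballI allI impI, rule ccontr)
  fix f :: "'a \<Rightarrow> real" and B assume f: "f \<in> Conv" and B: "open B" "G f \<in> B"
    and no: "\<not> (\<exists>A. open A \<and> f \<in> A \<and> (\<forall>h\<in>Conv. h \<in> A \<longrightarrow> G h \<in> B))"
  obtain D0 :: "'a set" where D0: "countable D0" "\<And>X. open X \<Longrightarrow> X \<noteq> {} \<Longrightarrow> \<exists>d\<in>D0. d \<in> X"
    using countable_dense_setE by blast
  define r where "r n = inverse (real (Suc n))" for n
  have r: "r n > 0" "r \<longlonglongrightarrow> 0" for n unfolding r_def using LIMSEQ_inverse_real_of_nat by auto
  define D where "D = (\<Union>c\<in>D0. \<Union>n. insert c (cube_points c (r n)))"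
  have cD: "countable D"
    unfolding D_def by (intro countable_UN D0(1) countable_insert countableI_type countable_finite[OF cube_points(1)[OF r(1)]])
  obtain d0 where "d0 \<in> D0" using D0(2)[of UNIV] by auto
  then have "D \<noteq> {}" by (auto simp: D_def)
  define p where "p i = from_nat_into D i" for i
  have p: "\<exists>i. p i = q" if "q \<in> D" for q
    using from_nat_into_surj[OF cD that] by (simp add: p_def)
  have "\<exists>h. h \<in> Conv \<and> (\<forall>i<m. \<bar>h (p i) - f (p i)\<bar> < r m) \<and> G h \<notin> B" for m
  proof -
    define A where "A = {h. \<forall>q\<in>p ` {..<m}. \<bar>h q - f q\<bar> < r m}"
    have A: "open A" "f \<in> A" unfolding A_def by (intro open_finite_control) (simp_all add: r(1))
    have "\<not> (\<forall>h\<in>Conv. h \<in> A \<longrightarrow> G h \<in> B)"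
    proof
      assume "\<forall>h\<in>Conv. h \<in> A \<longrightarrow> G h \<in> B"
      with A have "\<exists>A. open A \<and> f \<in> A \<and> (\<forall>h\<in>Conv. h \<in> A \<longrightarrow> G h \<in> B)" by (intro exI[of _ A] conjI)
      with no show False by (rule notE)
    qed
    then show ?thesis by (auto simp: A_def)
  qed
  then have "\<exists>g. \<forall>m. g m \<in> Conv \<and> (\<forall>i<m. \<bar>g m (p i) - f (p i)\<bar> < r m) \<and> G (g m) \<notin> B"
    by (intro choice allI)
  then obtain g where g': "\<forall>m. g m \<in> Conv \<and> (\<forall>i<m. \<bar>g m (p i) - f (p i)\<bar> < r m) \<and> G (g m) \<notin> B" ..
  then have g: "g m \<in> Conv" "i < m \<Longrightarrow> \<bar>g m (p i) - f (p i)\<bar> < r m" "G (g m) \<notin> B" for m i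
    by simp_all
  have "(\<lambda>m. g m x) \<longlonglongrightarrow> f x" for x
  proof (rule LIMSEQ_I)
    fix e :: real assume e: "e > 0"
    obtain d where d: "d > 0" "\<And>c s y. norm (c - x) + s * real DIM('a) < d \<Longrightarrow> y \<in> cube c s \<Longrightarrow> \<bar>f y - f x\<bar> \<le> e / 12"
      using continuous_on_cube[OF Conv_continuous[OF f], of "e / 12" x] e by auto
    have "d / (2 * DIM('a)) > 0" using d by simp
    then obtain n where n: "r n < d / (2 * DIM('a))"
      using order_tendstoD(2)[OF r(2)] by (auto simp: eventually_sequentially)
    define \<rho> where "\<rho> = min (d / 2) (r n)"
    have \<rho>: "\<rho> > 0" using d r by (simp add: \<rho>_def)
    then obtain c where c: "c \<in> D0" "dist x c < \<rho>" using D0(2)[of "ball x \<rho>"] by auto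
    have xc: "x \<in> cube c (r n)" using c by (intro ball_subset_cube) (simp add: \<rho>_def)
    have "norm (c - x) + r n * real DIM('a) < d"
    proof -
      have "r n * real DIM('a) < d / 2" using n by (simp add: field_simps)
      then show ?thesis using c(2) by (simp add: \<rho>_def dist_norm norm_minus_commute)
    qed
    note fc = d(2)[OF this]
    define P where "P = insert c (cube_points c (r n))"
    have P: "finite P" "P \<subseteq> D" unfolding P_def D_def using cube_points(1)[OF r(1)] c(1) by auto
    have "\<forall>q\<in>P. \<exists>i. p i = q" using p P by blast
    then obtain idx where idx: "\<And>q. q \<in> P \<Longrightarrow> p (idx q) = q" by metis
    obtain m0 where m0: "r m < e / 12" if "m \<ge> m0" for m
      using order_tendstoD(2)[OF r(2), of "e / 12"] e by (auto simp: eventually_sequentially)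
    define m1 where "m1 = max m0 (Suc (Max (idx ` P)))"
    show "\<exists>no. \<forall>m\<ge>no. norm (g m x - f x) < e"
    proof (intro exI[of _ m1] allI impI)
      fix m assume m: "m1 \<le> m"
      have "\<bar>g m q - f q\<bar> \<le> e / 12" if "q \<in> P" for q
      proof -
        have "idx q \<le> Max (idx ` P)" using P that by simp
        then have "idx q < m" using m by (simp add: m1_def)
        then have "\<bar>g m q - f q\<bar> < r m" using g(2)[of "idx q" m] idx[OF that] by simp
        moreover have "r m < e / 12" using m by (intro m0) (simp add: m1_def)
        ultimately show ?thesis by simp
      qed
      then have "\<bar>g m x - f x\<bar> \<le> 3 * (e / 12 + e / 12)"
        by (intro convex_cube_control[OF g(1) r(1) _ fc xc]) (simp_all add: P_def)
      then show "norm (g m x - f x) < e" using e by simp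
    qed
  qed
  from seq[OF f g(1) this] have "(\<lambda>m. G (g m)) \<longlonglongrightarrow> G f" .
  then have "eventually (\<lambda>m. G (g m) \<in> B) sequentially" using B by (rule topological_tendstoD)
  then show False using g(3) by (simp add: eventually_sequentially)
qed

lemma compact_sequence_limit_fun:
  fixes f :: "'a \<Rightarrow> real"
  assumes "\<And>x. (\<lambda>m. g m x) \<longlonglongrightarrow> f x"
  shows "compact (insert f (range g))"
proof -
  have "limitin euclidean g f sequentially" using assms by (simp add: tendsto_fun_iff)
  from compactin_sequence_with_limit[OF this order_refl] show ?thesis by simp
qed

section \<open>Uniform boundedness\<close>

text \<open>A gliding hump argument. If the norms are unbounded, choose functionals \<open>\<mu> (i n)\<close> with norm beyond \<open>4\<^sup>n\<close> and functions almost
  attaining them, and add these up with coefficients \<open>\<plusminus> 3\<^sup>-\<^sup>n\<close>. The signs are chosen one after the other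
  so that the earlier terms do not cancel the new one, and the later terms are too small to
  do so. The values of the functionals at the sum are then unbounded.\<close>

lemma Radon_uniform_boundedness:
  fixes \<mu> :: "'i \<Rightarrow> 'a::euclidean_space functional"
  assumes R: "\<And>i. i \<in> I \<Longrightarrow> \<mu> i \<in> Radon" and K: "compact K"
    and pt: "\<And>\<phi>. \<phi> \<in> Cc \<Longrightarrow> supp \<phi> \<subseteq> K \<Longrightarrow> \<exists>C. \<forall>i\<in>I. cmod (\<mu> i \<phi>) \<le> C"
  shows "\<exists>C\<ge>0. \<forall>i\<in>I. \<forall>\<phi> b. \<phi> \<in> Cc \<longrightarrow> supp \<phi> \<subseteq> K \<longrightarrow> (\<forall>x. cmod (\<phi> x) \<le> b) \<longrightarrow> cmod (\<mu> i \<phi>) \<le> C * b"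
proof -
  define U where "U = {\<phi> \<in> Cc. supp \<phi> \<subseteq> K \<and> (\<forall>x. cmod (\<phi> x) \<le> 1)}"
  define nrm where "nrm i = (SUP \<phi>\<in>U. cmod (\<mu> i \<phi>))" for i
  have zU: "(\<lambda>x. 0) \<in> U" by (simp add: U_def zero_in_Cc supp_def)
  have bdd: "bdd_above ((\<lambda>\<phi>. cmod (\<mu> i \<phi>)) ` U)" if i: "i \<in> I" for i
  proof -
    obtain C where C: "\<And>\<phi> b. \<phi> \<in> Cc \<Longrightarrow> supp \<phi> \<subseteq> K \<Longrightarrow> (\<And>x. cmod (\<phi> x) \<le> b) \<Longrightarrow> cmod (\<mu> i \<phi>) \<le> C * b"
      using Radon_bounded[OF R[OF i] K] by metis
    show ?thesis by (rule bdd_aboveI2[where M = "C * 1"]) (rule C, auto simp: U_def)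
  qed
  have nrm: "cmod (\<mu> i \<phi>) \<le> nrm i * b" if i: "i \<in> I" and \<phi>: "\<phi> \<in> Cc" "supp \<phi> \<subseteq> K" "\<And>x. cmod (\<phi> x) \<le> b" for i \<phi> b
  proof (cases "b > 0")
    case True
    have "(\<lambda>x. of_real (1 / b) * \<phi> x) \<in> U"
      unfolding U_def mem_Collect_eq
    proof (intro conjI allI)
      show "(\<lambda>x. of_real (1 / b) * \<phi> x) \<in> Cc" by (rule Cc_cmult[OF \<phi>(1)])
      show "supp (\<lambda>x. of_real (1 / b) * \<phi> x) \<subseteq> K"
        using supp_mult[of "\<lambda>x. of_real (1 / b)" \<phi>] \<phi>(2) by blast
      show "cmod (of_real (1 / b) * \<phi> x) \<le> 1" for x
        using \<phi>(3)[of x] True by (simp add: norm_mult norm_divide)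
    qed
    then have "cmod (\<mu> i (\<lambda>x. of_real (1 / b) * \<phi> x)) \<le> nrm i"
      unfolding nrm_def by (rule cSUP_upper[OF _ bdd[OF i]])
    then have "cmod (of_real (1 / b) * \<mu> i \<phi>) \<le> nrm i"
      unfolding RadonD(2)[OF R[OF i] \<phi>(1)] .
    then show ?thesis using True by (simp add: norm_mult norm_divide pos_divide_le_eq)
  next
    case False
    have "cmod (\<phi> x) \<le> 0" for x using \<phi>(3)[of x] False by linarith
    then have "\<phi> = (\<lambda>x. 0)" by auto
    moreover have "b = 0" using False order_trans[OF norm_ge_zero \<phi>(3)] by (simp add: order_antisym)
    ultimately show ?thesis using Radon_zero[OF R[OF i]] by simp
  qed
  have nrm0: "nrm i \<ge> 0" if "i \<in> I" for i
    using nrm[OF that zero_in_Cc, of 1] Radon_zero[OF R[OF that]] by (simp add: supp_def)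
  have "\<exists>C. \<forall>i\<in>I. nrm i \<le> C"
  proof (rule ccontr)
    assume "\<not> (\<exists>C. \<forall>i\<in>I. nrm i \<le> C)"
    then have "\<exists>i\<in>I. nrm i > 4 ^ n" for n :: nat by (meson not_le)
    then obtain i where i: "\<And>n. i n \<in> I" "\<And>n::nat. nrm (i n) > 4 ^ n" by metis
    have "\<exists>\<theta>\<in>U. cmod (\<mu> (i n) \<theta>) > 2/3 * nrm (i n)" for n
    proof -
      have "0 < nrm (i n)" using i(2)[of n] by (meson less_trans zero_less_numeral zero_less_power)
      then have "2/3 * nrm (i n) < nrm (i n)" by simp
      moreover have "U \<noteq> {}" using zU by (rule ex_in_conv[THEN iffD1, OF exI])
      ultimately show ?thesis unfolding nrm_def[of "i n"] using less_cSUP_iff[OF _ bdd[OF i(1)]] by metis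
    qed
    then obtain \<theta> where \<theta>: "\<And>n. \<theta> n \<in> U" "\<And>n. cmod (\<mu> (i n) (\<theta> n)) > 2/3 * nrm (i n)" by metis
    have \<theta>U: "\<theta> n \<in> Cc" "supp (\<theta> n) \<subseteq> K" "cmod (\<theta> n x) \<le> 1" for n x using \<theta>(1)[of n] by (auto simp: U_def)
    define s where "s n \<psi> = (if cmod (\<mu> (i n) (\<lambda>x. \<psi> x + (1/3) ^ n * \<theta> n x)) \<ge> cmod (\<mu> (i n) (\<lambda>x. (1/3) ^ n * \<theta> n x)) then 1 else - 1 :: complex)" for n \<psi>
    define ph where "ph = rec_nat (\<lambda>x. 0) (\<lambda>n \<psi> x. \<psi> x + s n \<psi> * ((1/3) ^ n * \<theta> n x))"
    have ph0: "ph 0 = (\<lambda>x. 0)" and phS: "ph (Suc n) = (\<lambda>x. ph n x + s n (ph n) * ((1/3) ^ n * \<theta> n x))" for n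
      by (simp_all add: ph_def)
    define a where "a n x = s n (ph n) * ((1/3) ^ n * \<theta> n x)" for n x
    have phsum: "ph n x = (\<Sum>m<n. a m x)" for n x
      by (induction n) (simp_all add: ph0 phS a_def)
    have s1: "cmod (s n \<psi>) = 1" for n \<psi> by (simp add: s_def)
    have abound: "cmod (a n x) \<le> (1/3) ^ n" for n x
      using \<theta>U(3)[of n x] s1 by (simp add: a_def norm_mult norm_power norm_divide mult_left_le)
    have tCc: "(\<lambda>x. (1/3) ^ n * \<theta> n x) \<in> Cc" for n by (rule Cc_cmult[OF \<theta>U(1)])
    have aCc: "a n \<in> Cc" "(\<lambda>x. (1/3) ^ n * \<theta> n x) \<in> Cc" for n
      unfolding a_def[abs_def] by (rule Cc_cmult[OF tCc], rule tCc)
    have phCc: "ph n \<in> Cc" for n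
      by (induction n) (use aCc in \<open>auto simp: ph0 phS zero_in_Cc a_def[abs_def] intro!: Cc_add\<close>)
    define \<phi> where "\<phi> x = (\<Sum>n. a n x)" for x
    have sg: "summable (\<lambda>n. (1/3 :: real) ^ n)" by (rule summable_geometric) simp
    have sa: "summable (\<lambda>n. a n x)" for x
      by (rule summable_comparison_test'[OF sg, of 0]) (rule abound)
    have ul: "uniform_limit UNIV (\<lambda>n x. \<Sum>m<n. a m x) (\<lambda>x. suminf (\<lambda>m. a m x)) sequentially"
      by (rule Weierstrass_m_test[OF abound sg])
    have "continuous_on UNIV (\<lambda>x. suminf (\<lambda>m. a m x))"
      by (rule uniform_limit_theorem[OF _ ul]) (intro always_eventually allI continuous_on_sum CcD(1)[OF aCc(1)], simp)
    then have c\<phi>: "continuous_on UNIV \<phi>" by (simp add: \<phi>_def[abs_def])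
    have zero: "\<theta> n x = 0" if "x \<notin> K" for n x using not_in_supp \<theta>U(2) that by blast
    have s\<phi>: "supp \<phi> \<subseteq> K"
      by (rule supp_minimal[OF compact_imp_closed[OF K]]) (simp add: \<phi>_def a_def zero)
    have \<phi>Cc: "\<phi> \<in> Cc" by (rule CcI[OF c\<phi> K s\<phi>])
    obtain C where C: "\<And>i. i \<in> I \<Longrightarrow> cmod (\<mu> i \<phi>) \<le> C" using pt[OF \<phi>Cc s\<phi>] by blast
    have "(4/3) ^ n / 6 \<le> C" for n
    proof -
      note Rn = R[OF i(1)[of n]]
      let ?t = "\<lambda>x. (1/3) ^ n * \<theta> n x"
      have "cmod (\<mu> (i n) (ph (Suc n))) \<ge> cmod (\<mu> (i n) ?t)"
      proof (cases "cmod (\<mu> (i n) (\<lambda>x. ph n x + (1/3) ^ n * \<theta> n x)) \<ge> cmod (\<mu> (i n) ?t)")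
        case True
        then show ?thesis by (simp add: phS s_def)
      next
        case False
        have m: "\<mu> (i n) (ph (Suc n)) = \<mu> (i n) (ph n) - \<mu> (i n) ?t"
          using False Radon_diff[OF Rn phCc[of n] aCc(2)[of n]] by (simp add: phS s_def)
        have p: "\<mu> (i n) (\<lambda>x. ph n x + (1/3) ^ n * \<theta> n x) = \<mu> (i n) (ph n) + \<mu> (i n) ?t"
          by (rule RadonD(1)[OF Rn phCc aCc(2)])
        have "2 * cmod (\<mu> (i n) ?t) \<le> cmod (\<mu> (i n) (ph n) + \<mu> (i n) ?t) + cmod (\<mu> (i n) (ph n) - \<mu> (i n) ?t)"
          using norm_triangle_ineq4[of "\<mu> (i n) (ph n) + \<mu> (i n) ?t" "\<mu> (i n) (ph n) - \<mu> (i n) ?t"]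
          by (simp add: norm_mult[of 2, symmetric])
        then show ?thesis using False unfolding m p by simp
      qed
      moreover have "cmod (\<mu> (i n) ?t) = (1/3) ^ n * cmod (\<mu> (i n) (\<theta> n))"
        by (simp add: RadonD(2)[OF Rn \<theta>U(1)] norm_mult norm_power norm_divide)
      moreover have "(1/3) ^ n * cmod (\<mu> (i n) (\<theta> n)) \<ge> (1/3) ^ n * (2/3 * nrm (i n))"
        using \<theta>(2)[of n] by (intro mult_left_mono) auto
      moreover have "cmod (\<mu> (i n) (\<lambda>x. \<phi> x - ph (Suc n) x)) \<le> nrm (i n) * (1/2 * (1/3) ^ n)"
      proof (rule nrm[OF i(1)])
        show "(\<lambda>x. \<phi> x - ph (Suc n) x) \<in> Cc" by (rule Cc_diff[OF \<phi>Cc phCc])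
        show "supp (\<lambda>x. \<phi> x - ph (Suc n) x) \<subseteq> K"
          by (rule supp_minimal[OF compact_imp_closed[OF K]]) (simp add: \<phi>_def a_def phsum zero)
        fix x
        have "\<phi> x - ph (Suc n) x = (\<Sum>m. a (m + Suc n) x)"
          unfolding \<phi>_def phsum by (rule suminf_minus_initial_segment[OF sa, symmetric])
        also have "cmod \<dots> \<le> (\<Sum>m. (1/3) ^ (m + Suc n))"
        proof (rule norm_suminf_le)
          show "summable (\<lambda>m. (1/3 :: real) ^ (m + Suc n))"
            using sg by (subst summable_iff_shift)
        qed (rule abound)
        also have "\<dots> = (1/3) ^ Suc n * (\<Sum>m. (1/3) ^ m)"
          using suminf_mult[OF sg, of "(1/3) ^ Suc n"] by (simp only: power_add mult.commute)
        also have "\<dots> = 1/2 * (1/3) ^ n" by (simp add: suminf_geometric)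
        finally show "cmod (\<phi> x - ph (Suc n) x) \<le> 1/2 * (1/3) ^ n" .
      qed
      moreover have "cmod (\<mu> (i n) (ph (Suc n))) \<le> cmod (\<mu> (i n) \<phi>) + cmod (\<mu> (i n) (\<lambda>x. \<phi> x - ph (Suc n) x))"
        unfolding Radon_diff[OF Rn \<phi>Cc phCc]
        using norm_triangle_sub[of "\<mu> (i n) (ph (Suc n))" "\<mu> (i n) \<phi>"] by (simp add: norm_minus_commute)
      ultimately have "(1/3) ^ n * (2/3 * nrm (i n)) - nrm (i n) * (1/2 * (1/3) ^ n) \<le> cmod (\<mu> (i n) \<phi>)"
        by linarith
      then have "(1/3) ^ n * nrm (i n) / 6 \<le> C" using C[OF i(1), of n] by (simp add: algebra_simps)
      moreover have "(1/3) ^ n * 4 ^ n \<le> (1/3) ^ n * nrm (i n)" using i(2)[of n] by (intro mult_left_mono) auto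
      moreover have "(1/3 :: real) ^ n * 4 ^ n = (4/3) ^ n" by (simp add: power_mult_distrib[symmetric])
      ultimately show ?thesis by linarith
    qed
    note growth = this
    obtain n where "(4/3 :: real) ^ n > 6 * C" using real_arch_pow[of "4/3" "6 * C"] by auto
    with growth[of n] show False by linarith
  qed
  then obtain C where C: "\<And>i. i \<in> I \<Longrightarrow> nrm i \<le> C" by blast
  show ?thesis
  proof (intro exI[of _ "\<bar>C\<bar>"] conjI ballI allI impI)
    fix i \<phi> b assume h: "i \<in> I" "\<phi> \<in> Cc" "supp \<phi> \<subseteq> K" "\<forall>x. cmod (\<phi> x) \<le> b"
    have "b \<ge> 0" using h(4) norm_ge_zero order_trans by blast
    then have "nrm i * b \<le> \<bar>C\<bar> * b" using C[OF h(1)] by (intro mult_right_mono) auto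
    then show "cmod (\<mu> i \<phi>) \<le> \<bar>C\<bar> * b" using nrm[OF h(1-3), of b] h(4) by simp
  qed simp
qed

section \<open>Mollification\<close>

lemma P0LV_uniform_bound:
  assumes D: "D \<in> P0LV" and A: "compact A" "A \<subseteq> Conv" and K: "compact K"
  obtains C where "C \<ge> 0" "\<And>f \<phi> b. f \<in> A \<Longrightarrow> \<phi> \<in> Cc \<Longrightarrow> supp \<phi> \<subseteq> K \<Longrightarrow> (\<And>x. cmod (\<phi> x) \<le> b) \<Longrightarrow> cmod (D f \<phi>) \<le> C * b"
proof -
  have "\<exists>C\<ge>0. \<forall>f\<in>A. \<forall>\<phi> b. \<phi> \<in> Cc \<longrightarrow> supp \<phi> \<subseteq> K \<longrightarrow> (\<forall>x. cmod (\<phi> x) \<le> b) \<longrightarrow> cmod (D f \<phi>) \<le> C * b"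
  proof (rule Radon_uniform_boundedness[OF _ K])
    show "D f \<in> Radon" if "f \<in> A" for f using P0LV_D(1)[OF D] A(2) that by blast
    fix \<phi>
    have "bounded ((\<lambda>f. D f \<phi>) ` A)"
      by (intro compact_imp_bounded compact_continuous_image A continuous_on_subset[OF P0LV_continuous[OF D] A(2)])
    then show "\<exists>C. \<forall>f\<in>A. cmod (D f \<phi>) \<le> C" unfolding bounded_iff by blast
  qed
  then obtain C where C: "C \<ge> 0" "\<forall>f\<in>A. \<forall>\<phi> b. \<phi> \<in> Cc \<longrightarrow> supp \<phi> \<subseteq> K \<longrightarrow> (\<forall>x. cmod (\<phi> x) \<le> b) \<longrightarrow> cmod (D f \<phi>) \<le> C * b"
    by blast
  show ?thesis by (rule that[OF C(1)]) (use C(2) in simp)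
qed

lemma tr_apply: "tr y f x = f (x + y)"
  by (simp add: tr_def)

lemma tr_uniformly_close:
  assumes "\<phi> \<in> Cc" "\<epsilon> > 0"
  obtains \<delta> where "\<delta> > 0" "\<And>y y' x. dist y y' < \<delta> \<Longrightarrow> cmod (tr y \<phi> x - tr y' \<phi> x) < \<epsilon>"
proof -
  obtain \<delta> where \<delta>: "\<delta> > 0" "\<And>x y. dist x y < \<delta> \<Longrightarrow> cmod (\<phi> x - \<phi> y) < \<epsilon>"
    using Cc_uniformly_continuous[OF assms] by metis
  show ?thesis by (rule that[OF \<delta>(1)]) (simp add: tr_def \<delta>(2))
qed

text \<open>Continuity in the convex function alone is given; the dependence of the test function on \<open>y\<close> is
  absorbed by the uniform bound for the measures \<open>D f\<close> over compact sets of functions.\<close>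

lemma joint_continuity:
  assumes D: "D \<in> P0LV" and A: "compact A" "A \<subseteq> Conv" and \<phi>: "\<phi> \<in> Cc"
  shows "continuous_on (UNIV \<times> A) (\<lambda>p. D (tr (fst p) (snd p)) (tr (fst p) \<phi>))"
  unfolding continuous_on_def
proof
  fix p0 :: "'a \<times> ('a \<Rightarrow> real)" assume p0: "p0 \<in> UNIV \<times> A"
  obtain y0 f0 where p0e: "p0 = (y0, f0)" by (cases p0)
  have trc: "continuous_on (UNIV \<times> A) (\<lambda>p. tr (fst p) (snd p))"
    using continuous_on_subset[OF translation_continuous, of "UNIV \<times> A"] A(2) by (auto simp: case_prod_beta')
  define A1 where "A1 = (\<lambda>p. tr (fst p) (snd p)) ` (cball y0 1 \<times> A)"
  have A1: "compact A1" "A1 \<subseteq> Conv"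
    unfolding A1_def using A by (auto intro!: compact_continuous_image continuous_on_subset[OF trc] compact_Times tr_Conv)
  define K where "K = {x + y | x y. x \<in> supp \<phi> \<and> y \<in> uminus ` cball y0 1}"
  have K: "compact K" unfolding K_def
    by (intro compact_sums CcD(2)[OF \<phi>] compact_continuous_image continuous_intros compact_cball)
  have suppK: "supp (tr y \<phi>) \<subseteq> K" if "dist y0 y \<le> 1" for y
    unfolding supp_tr K_def using that by force
  obtain C where C: "C \<ge> 0" "\<And>f \<theta> b. f \<in> A1 \<Longrightarrow> \<theta> \<in> Cc \<Longrightarrow> supp \<theta> \<subseteq> K \<Longrightarrow> (\<And>x. cmod (\<theta> x) \<le> b) \<Longrightarrow> cmod (D f \<theta>) \<le> C * b"
    using P0LV_uniform_bound[OF D A1 K] by metis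
  define \<theta> where "\<theta> = tr y0 \<phi>"
  have \<theta>: "\<theta> \<in> Cc" unfolding \<theta>_def by (rule tr_Cc[OF \<phi>])
  have c1: "continuous_on (UNIV \<times> A) (\<lambda>p. D (tr (fst p) (snd p)) \<theta>)"
    by (rule continuous_on_compose2[OF P0LV_continuous[OF D] trc]) (use A(2) in \<open>auto intro!: tr_Conv\<close>)
  then have l1: "((\<lambda>p. D (tr (fst p) (snd p)) \<theta>) \<longlongrightarrow> D (tr y0 f0) \<theta>) (at p0 within UNIV \<times> A)"
    using p0 unfolding continuous_on_def p0e by fastforce
  have l2: "((\<lambda>p. D (tr (fst p) (snd p)) (tr (fst p) \<phi>) - D (tr (fst p) (snd p)) \<theta>) \<longlongrightarrow> 0) (at p0 within UNIV \<times> A)"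
  proof (rule tendstoI)
    fix e :: real assume e: "e > 0"
    obtain \<delta> where \<delta>: "\<delta> > 0" "\<And>y y' x. dist y y' < \<delta> \<Longrightarrow> cmod (tr y \<phi> x - tr y' \<phi> x) < e / (C + 1)"
      using tr_uniformly_close[OF \<phi>, of "e / (C + 1)"] e C(1) by (metis add_nonneg_pos divide_pos_pos zero_less_one)
    have "eventually (\<lambda>p. fst p \<in> ball y0 (min \<delta> 1)) (at p0 within UNIV \<times> A)"
    proof (rule topological_tendstoD[OF _ open_ball])
      show "(fst \<longlongrightarrow> y0) (at p0 within UNIV \<times> A)" unfolding p0e by (rule tendsto_eq_intros refl)+ simp
      show "y0 \<in> ball y0 (min \<delta> 1)" using \<delta>(1) by simp
    qed
    moreover have "eventually (\<lambda>p. p \<in> UNIV \<times> A) (at p0 within UNIV \<times> A)"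
      by (simp add: eventually_at_filter)
    ultimately show "eventually (\<lambda>p. dist (D (tr (fst p) (snd p)) (tr (fst p) \<phi>) - D (tr (fst p) (snd p)) \<theta>) 0 < e) (at p0 within UNIV \<times> A)"
    proof eventually_elim
      case (elim p)
      define y f where "y = fst p" and "f = snd p"
      have yf: "f \<in> A" "dist y0 y < \<delta>" "dist y0 y \<le> 1" using elim by (auto simp: y_def f_def)
      have mem: "tr y f \<in> A1" unfolding A1_def using yf by (auto intro!: image_eqI[of _ _ "(y, f)"])
      have "cmod (D (tr y f) (\<lambda>x. tr y \<phi> x - \<theta> x)) \<le> C * (e / (C + 1))"
      proof (rule C(2)[OF mem])
        show "(\<lambda>x. tr y \<phi> x - \<theta> x) \<in> Cc" by (rule Cc_diff[OF tr_Cc[OF \<phi>] \<theta>])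
        show "supp (\<lambda>x. tr y \<phi> x - \<theta> x) \<subseteq> K"
        proof (rule supp_minimal[OF compact_imp_closed[OF K]])
          fix x assume "x \<notin> K"
          then have "x \<notin> supp (tr y \<phi>)" "x \<notin> supp (tr y0 \<phi>)" using suppK[OF yf(3)] suppK[of y0] by auto
          then show "tr y \<phi> x - \<theta> x = 0" by (simp add: not_in_supp \<theta>_def)
        qed
        show "cmod (tr y \<phi> x - \<theta> x) \<le> e / (C + 1)" for x
          unfolding \<theta>_def using \<delta>(2)[of y y0 x] yf(2) by (simp add: dist_commute less_imp_le)
      qed
      also have "\<dots> < e"
      proof -
        have "C * e < e * (C + 1)" using e by (simp add: algebra_simps)
        moreover have "C + 1 > 0" using C(1) by simp
        ultimately show ?thesis by (simp add: pos_divide_less_eq)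
      qed
      finally have "cmod (D (tr y f) (\<lambda>x. tr y \<phi> x - \<theta> x)) < e" .
      moreover have "D (tr y f) (\<lambda>x. tr y \<phi> x - \<theta> x) = D (tr y f) (tr y \<phi>) - D (tr y f) \<theta>"
        using A(2) yf(1) by (intro Radon_diff[OF P0LV_D(1)[OF D tr_Conv]] tr_Cc \<phi> \<theta>) auto
      ultimately show ?case by (simp add: y_def f_def)
    qed
  qed
  have "((\<lambda>p. D (tr (fst p) (snd p)) \<theta> + (D (tr (fst p) (snd p)) (tr (fst p) \<phi>) - D (tr (fst p) (snd p)) \<theta>)) \<longlongrightarrow> D (tr y0 f0) \<theta> + 0) (at p0 within UNIV \<times> A)"
    by (intro tendsto_add l1 l2)
  then show "((\<lambda>p. D (tr (fst p) (snd p)) (tr (fst p) \<phi>)) \<longlongrightarrow> D (tr (fst p0) (snd p0)) (tr (fst p0) \<phi>)) (at p0 within UNIV \<times> A)"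
    by (simp add: p0e \<theta>_def)
qed

lemma translate_continuous:
  assumes D: "D \<in> P0LV" and f: "f \<in> Conv" and \<phi>: "\<phi> \<in> Cc"
  shows "continuous_on UNIV (\<lambda>y. D (tr y f) (tr y \<phi>))"
proof -
  have "continuous_on (UNIV \<times> {f}) (\<lambda>p. D (tr (fst p) (snd p)) (tr (fst p) \<phi>))"
    by (rule joint_continuity[OF D _ _ \<phi>]) (use f in auto)
  moreover have "continuous_on UNIV (\<lambda>y. (y, f))" by (intro continuous_intros)
  moreover have "range (\<lambda>y. (y, f)) \<subseteq> UNIV \<times> {f}" by blast
  ultimately have "continuous_on UNIV (\<lambda>y. D (tr (fst (y, f)) (snd (y, f))) (tr (fst (y, f)) \<phi>))"
    by (rule continuous_on_compose2)
  then show ?thesis by simp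
qed

lemma Cc_integrable_mult:
  assumes \<eta>: "\<eta> \<in> Cc" and g: "continuous_on UNIV g"
  shows "integrable lborel (\<lambda>y. \<eta> y * (g y :: complex))"
  by (rule integrable_continuous_compact_support[OF _ CcD(2)[OF \<eta>]])
    (auto intro!: continuous_intros CcD(1)[OF \<eta>] g simp: not_in_supp)

lemmas Cc_integrable = Cc_integrable_mult[where g = "\<lambda>_. 1", simplified]

definition mollify :: "('a::euclidean_space \<Rightarrow> complex) \<Rightarrow> 'a local_functional \<Rightarrow> 'a local_functional" where
  "mollify \<eta> D = (\<lambda>f \<phi>. if f \<in> Conv \<and> \<phi> \<in> Cc then \<integral>y. \<eta> y * D (tr y f) (tr y \<phi>) \<partial>lborel else 0)"

lemma mollify_integrable:
  assumes "D \<in> P0LV" "\<eta> \<in> Cc" "f \<in> Conv" "\<phi> \<in> Cc"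
  shows "integrable lborel (\<lambda>y. \<eta> y * D (tr y f) (tr y \<phi>))"
  by (rule Cc_integrable_mult[OF assms(2) translate_continuous[OF assms(1,3,4)]])

lemma supp_tr_bound:
  assumes S: "compact S" and K: "compact K"
  obtains K' where "compact K'" "\<And>y \<phi> :: 'a::euclidean_space \<Rightarrow> complex. y \<in> S \<Longrightarrow> supp \<phi> \<subseteq> K \<Longrightarrow> supp (tr y \<phi>) \<subseteq> K'"
proof (rule that[of "{x + y | x y. x \<in> K \<and> y \<in> uminus ` S}"])
  show "compact {x + y | x y. x \<in> K \<and> y \<in> uminus ` S}"
    by (intro compact_sums K compact_continuous_image continuous_intros S)
  fix y and \<phi> :: "'a \<Rightarrow> complex" assume "y \<in> S" "supp \<phi> \<subseteq> K"
  then show "supp (tr y \<phi>) \<subseteq> {x + y | x y. x \<in> K \<and> y \<in> uminus ` S}"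
    unfolding supp_tr by force
qed

lemma affine_tr: "affine_map l \<Longrightarrow> affine_map (tr y l)"
proof -
  assume "affine_map l"
  then obtain L c where L: "linear L" "l = (\<lambda>x. L x + c)" unfolding affine_map_def by blast
  have "tr y l = (\<lambda>x. L x + (L y + c))" unfolding tr_def L(2) by (simp add: linear_add[OF L(1)] add.assoc)
  then show ?thesis using L(1) unfolding affine_map_def by blast
qed

lemma tr_add: "tr y (\<lambda>x. f x + h x) = (\<lambda>x. tr y f x + tr y h x)"
  and tr_mult: "tr y (\<lambda>x. f x * h x) = (\<lambda>x. tr y f x * tr y h x)"
  by (simp_all add: tr_def)

lemma mollify_P0LV_hom:
  fixes D :: "'a::euclidean_space local_functional"
  assumes D: "D \<in> P0LV_hom k" and \<eta>: "\<eta> \<in> Cc"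
  shows "mollify \<eta> D \<in> P0LV_hom k"
proof (rule P0LV_hom_I)
  note D0 = P0LV_homD(1)[OF D]
  note int = mollify_integrable[OF D0 \<eta>]
  show "mollify \<eta> D f \<in> Radon" if f: "f \<in> Conv" for f
  proof (rule RadonI)
    fix \<phi> \<theta> :: "'a \<Rightarrow> complex" assume Cc: "\<phi> \<in> Cc" "\<theta> \<in> Cc"
    have "D (tr y f) (tr y (\<lambda>x. \<phi> x + \<theta> x)) = D (tr y f) (tr y \<phi>) + D (tr y f) (tr y \<theta>)" for y
      unfolding tr_add by (intro RadonD(1)[OF P0LV_D(1)[OF D0 tr_Conv[OF f]]] tr_Cc Cc)
    note ad = this
    have "mollify \<eta> D f (\<lambda>x. \<phi> x + \<theta> x) = (\<integral>y. \<eta> y * D (tr y f) (tr y \<phi>) + \<eta> y * D (tr y f) (tr y \<theta>) \<partial>lborel)"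
      by (simp only: mollify_def f Cc Cc_add[OF Cc] ad simp_thms if_True distrib_left)
    also have "\<dots> = mollify \<eta> D f \<phi> + mollify \<eta> D f \<theta>"
      by (simp only: mollify_def f Cc simp_thms if_True Bochner_Integration.integral_add[OF int[OF f Cc(1)] int[OF f Cc(2)]])
    finally show "mollify \<eta> D f (\<lambda>x. \<phi> x + \<theta> x) = mollify \<eta> D f \<phi> + mollify \<eta> D f \<theta>" .
  next
    fix c and \<phi> :: "'a \<Rightarrow> complex" assume Cc: "\<phi> \<in> Cc"
    have "D (tr y f) (tr y (\<lambda>x. c * \<phi> x)) = c * D (tr y f) (tr y \<phi>)" for y
      unfolding tr_mult by (simp add: tr_def[of y "\<lambda>x. c"] RadonD(2)[OF P0LV_D(1)[OF D0 tr_Conv[OF f]] tr_Cc[OF Cc]])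
    note sc = this
    have "mollify \<eta> D f (\<lambda>x. c * \<phi> x) = (\<integral>y. \<eta> y * (c * D (tr y f) (tr y \<phi>)) \<partial>lborel)"
      by (simp only: mollify_def f Cc Cc_cmult[OF Cc] sc simp_thms if_True)
    also have "\<dots> = (\<integral>y. c * (\<eta> y * D (tr y f) (tr y \<phi>)) \<partial>lborel)"
      by (simp only: mult.left_commute)
    also have "\<dots> = c * mollify \<eta> D f \<phi>"
      by (simp only: mollify_def f Cc simp_thms if_True integral_mult_right_zero)
    finally show "mollify \<eta> D f (\<lambda>x. c * \<phi> x) = c * mollify \<eta> D f \<phi>" .
  next
    show "mollify \<eta> D f \<phi> = 0" if "\<phi> \<notin> Cc" for \<phi> using that by (simp add: mollify_def)
  next
    fix K :: "'a set" assume K: "compact K"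
    obtain K' where K': "compact K'" "\<And>y \<phi> :: 'a \<Rightarrow> complex. y \<in> supp \<eta> \<Longrightarrow> supp \<phi> \<subseteq> K \<Longrightarrow> supp (tr y \<phi>) \<subseteq> K'"
      using supp_tr_bound[OF CcD(2)[OF \<eta>] K] by (metis (no_types))
    define A where "A = (\<lambda>p. tr (fst p) (snd p)) ` (supp \<eta> \<times> {f})"
    have trc: "continuous_on (supp \<eta> \<times> {f}) (\<lambda>p. tr (fst p) (snd p))"
      using continuous_on_subset[OF translation_continuous, of "supp \<eta> \<times> {f}"] f by (auto simp: case_prod_beta')
    have A: "compact A" "A \<subseteq> Conv"
      unfolding A_def using f
      by (intro compact_continuous_image[OF trc] compact_Times CcD(2)[OF \<eta>] finite_imp_compact)
        (simp_all add: image_subset_iff tr_Conv[OF f])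
    obtain C where C: "C \<ge> 0" "\<And>f \<theta> b. f \<in> A \<Longrightarrow> \<theta> \<in> Cc \<Longrightarrow> supp \<theta> \<subseteq> K' \<Longrightarrow> (\<And>x. cmod (\<theta> x) \<le> b) \<Longrightarrow> cmod (D f \<theta>) \<le> C * b"
      using P0LV_uniform_bound[OF D0 A K'(1)] by (metis (no_types))
    have "cmod (mollify \<eta> D f \<phi>) \<le> (C * (\<integral>y. cmod (\<eta> y) \<partial>lborel)) * b"
      if \<phi>: "\<phi> \<in> Cc" "supp \<phi> \<subseteq> K" "\<And>x. cmod (\<phi> x) \<le> b" for \<phi> b
    proof -
      have "cmod (mollify \<eta> D f \<phi>) \<le> (\<integral>y. cmod (\<eta> y * D (tr y f) (tr y \<phi>)) \<partial>lborel)"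
        using f \<phi>(1) by (simp add: mollify_def integral_norm_bound del: norm_mult)
      also have "\<dots> \<le> (\<integral>y. (C * b) * cmod (\<eta> y) \<partial>lborel)"
      proof (rule integral_mono)
        fix y
        show "cmod (\<eta> y * D (tr y f) (tr y \<phi>)) \<le> C * b * cmod (\<eta> y)"
        proof (cases "y \<in> supp \<eta>")
          case True
          have "tr y f \<in> A" unfolding A_def by (rule image_eqI[of _ _ "(y, f)"]) (simp_all add: True)
          moreover have "cmod (tr y \<phi> x) \<le> b" for x unfolding tr_apply by (rule \<phi>(3))
          ultimately have "cmod (D (tr y f) (tr y \<phi>)) \<le> C * b"
            by (intro C(2)[OF _ tr_Cc[OF \<phi>(1)] K'(2)[OF True \<phi>(2)]])
          then have "cmod (\<eta> y) * cmod (D (tr y f) (tr y \<phi>)) \<le> cmod (\<eta> y) * (C * b)"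
            by (rule mult_left_mono) simp
          then show ?thesis by (simp add: norm_mult mult_ac)
        qed (simp add: not_in_supp)
      qed (use int[OF f \<phi>(1)] Cc_integrable[OF \<eta>] in auto)
      finally show ?thesis by (simp add: mult_ac)
    qed
    then show "\<exists>C. \<forall>\<phi> b. \<phi> \<in> Cc \<longrightarrow> supp \<phi> \<subseteq> K \<longrightarrow> (\<forall>x. cmod (\<phi> x) \<le> b) \<longrightarrow> cmod (mollify \<eta> D f \<phi>) \<le> C * b"
      by (intro exI[of _ "C * (\<integral>y. cmod (\<eta> y) \<partial>lborel)"] allI impI) simp
  qed
  show "mollify \<eta> D f = (\<lambda>\<phi>. 0)" if "f \<notin> Conv" for f using that by (simp add: mollify_def)
  show "continuous_on Conv (\<lambda>f. mollify \<eta> D f \<phi>)" if \<phi>: "\<phi> \<in> Cc" for \<phi>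
  proof (rule continuous_on_Conv_sequentially)
    fix f :: "'a \<Rightarrow> real" and g :: "nat \<Rightarrow> 'a \<Rightarrow> real"
    assume f: "f \<in> Conv" and g: "\<And>m. g m \<in> Conv" and lim: "\<And>x. (\<lambda>m. g m x) \<longlonglongrightarrow> f x"
    define A where "A = insert f (range g)"
    have A: "compact A" "A \<subseteq> Conv" unfolding A_def using compact_sequence_limit_fun[OF lim] f g by auto
    have "bounded ((\<lambda>p. D (tr (fst p) (snd p)) (tr (fst p) \<phi>)) ` (supp \<eta> \<times> A))"
      by (intro compact_imp_bounded compact_continuous_image compact_Times CcD(2)[OF \<eta>] A(1)
          continuous_on_subset[OF joint_continuity[OF D0 A \<phi>]]) auto
    then obtain B where B: "\<And>y h. y \<in> supp \<eta> \<Longrightarrow> h \<in> A \<Longrightarrow> cmod (D (tr y h) (tr y \<phi>)) \<le> B"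
      unfolding bounded_iff by fastforce
    have "(\<lambda>m. \<integral>y. \<eta> y * D (tr y (g m)) (tr y \<phi>) \<partial>lborel) \<longlonglongrightarrow> (\<integral>y. \<eta> y * D (tr y f) (tr y \<phi>) \<partial>lborel)"
    proof (rule integral_dominated_convergence)
      show "(\<lambda>y. \<eta> y * D (tr y f) (tr y \<phi>)) \<in> borel_measurable lborel"
        using int[OF f \<phi>] by (rule borel_measurable_integrable)
      show "(\<lambda>y. \<eta> y * D (tr y (g m)) (tr y \<phi>)) \<in> borel_measurable lborel" for m
        using int[OF g \<phi>] by (rule borel_measurable_integrable)
      show "integrable lborel (\<lambda>y. B * cmod (\<eta> y))" using Cc_integrable[OF \<eta>] by simp
      show "AE y in lborel. (\<lambda>m. \<eta> y * D (tr y (g m)) (tr y \<phi>)) \<longlonglongrightarrow> \<eta> y * D (tr y f) (tr y \<phi>)"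
        by (intro AE_I2 tendsto_intros P0LV_tendsto[OF D0 _ tr_Conv[OF f] tr_Conv[OF g]]) (simp add: tr_def lim)
      show "AE y in lborel. norm (\<eta> y * D (tr y (g m)) (tr y \<phi>)) \<le> B * cmod (\<eta> y)" for m
      proof (rule AE_I2)
        fix y
        show "norm (\<eta> y * D (tr y (g m)) (tr y \<phi>)) \<le> B * cmod (\<eta> y)"
        proof (cases "y \<in> supp \<eta>")
          case True
          have "cmod (D (tr y (g m)) (tr y \<phi>)) \<le> B" by (rule B[OF True]) (simp add: A_def)
          then have "cmod (\<eta> y) * cmod (D (tr y (g m)) (tr y \<phi>)) \<le> cmod (\<eta> y) * B"
            by (rule mult_left_mono) simp
          then show ?thesis by (simp add: norm_mult mult_ac)
        qed (simp add: not_in_supp)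
      qed
    qed
    then show "(\<lambda>m. mollify \<eta> D (g m) \<phi>) \<longlonglongrightarrow> mollify \<eta> D f \<phi>" using f g \<phi> by (simp add: mollify_def)
  qed
  show "mollify \<eta> D f \<phi> = mollify \<eta> D h \<phi>"
    if h: "f \<in> Conv" "h \<in> Conv" "open U" "\<And>x. x \<in> U \<Longrightarrow> f x = h x" "\<phi> \<in> Cc" "supp \<phi> \<subseteq> U" for f h U \<phi>
  proof -
    have "D (tr y f) (tr y \<phi>) = D (tr y h) (tr y \<phi>)" for y
    proof (rule P0LV_D(4)[OF D0 tr_Conv[OF h(1)] tr_Conv[OF h(2)] _ _ tr_Cc[OF h(5)]])
      have "(\<lambda>x. x - y) ` U = (\<lambda>x. - y + x) ` U" by auto
      then show "open ((\<lambda>x. x - y) ` U)" using open_translation[OF h(3), of "- y"] by simp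
      show "supp (tr y \<phi>) \<subseteq> (\<lambda>x. x - y) ` U" unfolding supp_tr using h(6) by blast
      show "tr y f x = tr y h x" if "x \<in> (\<lambda>x. x - y) ` U" for x using that h(4) by (auto simp: tr_def)
    qed
    then show ?thesis using h by (simp add: mollify_def)
  qed
  show "mollify \<eta> D (\<lambda>x. f x + l x) \<phi> = mollify \<eta> D f \<phi>" if "f \<in> Conv" "affine_map l" for f l \<phi>
  proof -
    have "D (tr y (\<lambda>x. f x + l x)) = D (tr y f)" for y
      unfolding tr_add by (rule P0LV_D(3)[OF D0 tr_Conv[OF that(1)] affine_tr[OF that(2)]])
    then show ?thesis using that Conv_add_affine[OF that] by (simp add: mollify_def)
  qed
  show "mollify \<eta> D (\<lambda>x. t * f x) \<phi> = of_real (t ^ k) * mollify \<eta> D f \<phi>" if "f \<in> Conv" "t \<ge> 0" for f t \<phi>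
  proof -
    have sc: "D (tr y (\<lambda>x. t * f x)) \<theta> = of_real (t ^ k) * D (tr y f) \<theta>" for y \<theta>
      using P0LV_homD(2)[OF D tr_Conv[OF that(1)] that(2), of y \<theta>] by (simp only: tr_def)
    show ?thesis
    proof (cases "\<phi> \<in> Cc")
      case True
      show ?thesis
        by (simp only: mollify_def that(1) Conv_cmult[OF that] True sc simp_thms if_True mult.left_commute[of "\<eta> _"] integral_mult_right_zero)
    qed (simp add: mollify_def)
  qed
qed

subsection \<open>Discretising the integral\<close>

text \<open>The support of \<open>\<eta>\<close> is cut into finitely many Borel pieces on which no member of the family varies by more than
  \<open>\<epsilon>\<close>; the weights are the integrals of \<open>\<eta>\<close> over the pieces and do not depend on the member.\<close>

lemma integral_discretization:
  fixes \<eta> :: "'a::euclidean_space \<Rightarrow> complex"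
  assumes \<eta>: "\<eta> \<in> Cc" and \<epsilon>: "\<epsilon> > 0"
    and cont: "\<And>F. F \<in> \<F> \<Longrightarrow> continuous_on UNIV F"
    and equi: "\<And>y0. \<exists>U. open U \<and> y0 \<in> U \<and> (\<forall>F\<in>\<F>. \<forall>y\<in>U. cmod (F y - F y0) \<le> \<epsilon>)"
  shows "\<exists>Y w. finite Y \<and> Y \<subseteq> supp \<eta> \<and> (\<forall>F\<in>\<F>. cmod ((\<integral>y. \<eta> y * F y \<partial>lborel) - (\<Sum>y\<in>Y. w y * F y)) \<le> \<epsilon> * (\<integral>y. cmod (\<eta> y) \<partial>lborel))"
proof -
  obtain U where U: "\<And>y. open (U y)" "\<And>y. y \<in> U y" "\<And>y0 F y. F \<in> \<F> \<Longrightarrow> y \<in> U y0 \<Longrightarrow> cmod (F y - F y0) \<le> \<epsilon>"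
    using equi by metis
  have "supp \<eta> \<subseteq> (\<Union>y\<in>supp \<eta>. U y)" using U(2) by blast
  then obtain Y where Y: "finite Y" "supp \<eta> \<subseteq> (\<Union>y\<in>Y. U y)" and Ys: "Y \<subseteq> supp \<eta>"
    using compactE_image[OF CcD(2)[OF \<eta>], of "supp \<eta>" U] U(1) by metis
  obtain ys where ys: "set ys = Y" "distinct ys" using finite_distinct_list[OF Y(1)] by blast
  have "\<exists>B. (\<forall>y\<in>set ys. B y \<in> sets borel \<and> B y \<subseteq> U y) \<and> disjoint_family_on B (set ys) \<and> (\<Union>y\<in>set ys. B y) = (\<Union>y\<in>set ys. U y)"
    using ys(2)
  proof (induction ys)
    case (Cons a ys)
    then obtain B where B: "\<forall>y\<in>set ys. B y \<in> sets borel \<and> B y \<subseteq> U y" "disjoint_family_on B (set ys)"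
      "(\<Union>y\<in>set ys. B y) = (\<Union>y\<in>set ys. U y)" by auto
    define B' where "B' = B(a := U a - (\<Union>y\<in>set ys. U y))"
    have B'ys: "B' y = B y" if "y \<in> set ys" for y using that Cons.prems by (auto simp: B'_def)
    have "U a - (\<Union>y\<in>set ys. U y) \<in> sets borel" using U(1) by (intro sets.Diff borel_open open_UN ballI) auto
    then have "\<forall>y\<in>set (a # ys). B' y \<in> sets borel \<and> B' y \<subseteq> U y" using B(1) by (auto simp: B'_def)
    moreover have "disjoint_family_on B' (set (a # ys))"
      using B(2,3) Cons.prems unfolding disjoint_family_on_def by (auto simp: B'_def)
    moreover have "(\<Union>y\<in>set (a # ys). B' y) = (\<Union>y\<in>set (a # ys). U y)"
    proof -
      have "(\<Union>y\<in>set ys. B' y) = (\<Union>y\<in>set ys. B y)" using B'ys by auto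
      then show ?thesis using B(3) by (auto simp: B'_def)
    qed
    ultimately show ?case by blast
  qed (simp add: disjoint_family_on_def)
  then obtain B where B: "\<And>y. y \<in> Y \<Longrightarrow> B y \<in> sets borel" "\<And>y. y \<in> Y \<Longrightarrow> B y \<subseteq> U y" "disjoint_family_on B Y"
    "(\<Union>y\<in>Y. B y) = (\<Union>y\<in>Y. U y)" unfolding ys(1) by auto
  have sep: "(indicator (B z) y :: complex) = (if z = y' then 1 else 0)" if "y' \<in> Y" "y \<in> B y'" "z \<in> Y" for y y' z
    using disjoint_family_onD[OF B(3) that(3) that(1)] that(2) by (cases "z = y'") (auto simp: indicator_def)
  have one: "(\<Sum>y'\<in>Y. indicator (B y') y) = (1::complex)" if "y \<in> supp \<eta>" for y
  proof -
    from that have "y \<in> (\<Union>y\<in>Y. B y)" unfolding B(4) by (rule subsetD[OF Y(2)])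
    then obtain y' where y': "y' \<in> Y" "y \<in> B y'" by (rule UN_E)
    have "(\<Sum>z\<in>Y. indicator (B z) y) = (\<Sum>z\<in>Y. if z = y' then 1 else (0::complex))"
      by (rule sum.cong[OF refl sep[OF y']])
    then show ?thesis using Y(1) y' by simp
  qed
  define w where "w y' = (\<integral>y. indicator (B y') y * \<eta> y \<partial>lborel)" for y'
  have iB: "integrable lborel (\<lambda>y. indicator (B y') y * (\<eta> y * g y))" if "y' \<in> Y" "continuous_on UNIV g" for y' and g :: "'a \<Rightarrow> complex"
  proof -
    have "(\<lambda>y. indicator (B y') y *\<^sub>R (\<eta> y * g y)) = (\<lambda>y. indicator (B y') y * (\<eta> y * g y))"
      by (rule ext) (simp add: indicator_def)
    moreover have "integrable lborel (\<lambda>y. indicator (B y') y *\<^sub>R (\<eta> y * g y))"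
      by (rule integrable_mult_indicator[OF _ Cc_integrable_mult[OF \<eta> that(2)]]) (simp add: B(1)[OF that(1)])
    ultimately show ?thesis by simp
  qed
  have "cmod ((\<integral>y. \<eta> y * F y \<partial>lborel) - (\<Sum>y'\<in>Y. w y' * F y')) \<le> \<epsilon> * (\<integral>y. cmod (\<eta> y) \<partial>lborel)" if F: "F \<in> \<F>" for F
  proof -
    have i: "integrable lborel (\<lambda>y. indicator (B y') y * (\<eta> y * (F y - F y')))" if "y' \<in> Y" for y'
      by (intro iB that continuous_intros cont F)
    have i0: "integrable lborel (\<lambda>y. indicator (B y') y * \<eta> y)" if "y' \<in> Y" for y'
      using iB[OF that continuous_on_const[of _ 1]] by simp
    have "\<eta> y * F y = (\<Sum>y'\<in>Y. indicator (B y') y * (\<eta> y * (F y - F y'))) + (\<Sum>y'\<in>Y. (indicator (B y') y * \<eta> y) * F y')" for y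
    proof (cases "y \<in> supp \<eta>")
      case True
      have "\<eta> y * F y = (\<Sum>y'\<in>Y. indicator (B y') y) * (\<eta> y * F y)" by (simp add: one[OF True])
      also have "\<dots> = (\<Sum>y'\<in>Y. indicator (B y') y * (\<eta> y * (F y - F y')) + (indicator (B y') y * \<eta> y) * F y')"
        unfolding sum_distrib_right by (rule sum.cong) (simp_all add: algebra_simps)
      finally show ?thesis by (simp only: sum.distrib)
    qed (simp add: not_in_supp)
    then have "(\<integral>y. \<eta> y * F y \<partial>lborel) = (\<integral>y. (\<Sum>y'\<in>Y. indicator (B y') y * (\<eta> y * (F y - F y'))) + (\<Sum>y'\<in>Y. (indicator (B y') y * \<eta> y) * F y') \<partial>lborel)"
      by simp
    also have "\<dots> = (\<integral>y. (\<Sum>y'\<in>Y. indicator (B y') y * (\<eta> y * (F y - F y'))) \<partial>lborel) + (\<Sum>y'\<in>Y. w y' * F y')"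
      using i i0 by (subst Bochner_Integration.integral_add) (auto intro!: Bochner_Integration.integrable_sum simp: w_def Bochner_Integration.integral_sum)
    finally have "(\<integral>y. \<eta> y * F y \<partial>lborel) - (\<Sum>y'\<in>Y. w y' * F y') = (\<integral>y. (\<Sum>y'\<in>Y. indicator (B y') y * (\<eta> y * (F y - F y'))) \<partial>lborel)"
      by simp
    also have "cmod \<dots> \<le> (\<integral>y. cmod (\<Sum>y'\<in>Y. indicator (B y') y * (\<eta> y * (F y - F y'))) \<partial>lborel)"
      by (rule integral_norm_bound)
    also have "\<dots> \<le> (\<integral>y. \<epsilon> * cmod (\<eta> y) \<partial>lborel)"
    proof (rule integral_mono)
      fix y
      show "cmod (\<Sum>y'\<in>Y. indicator (B y') y * (\<eta> y * (F y - F y'))) \<le> \<epsilon> * cmod (\<eta> y)"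
      proof (cases "y \<in> supp \<eta>")
        case True
        from True have "y \<in> (\<Union>y\<in>Y. B y)" unfolding B(4) by (rule subsetD[OF Y(2)])
        then obtain y0 where y0: "y0 \<in> Y" "y \<in> B y0" by (rule UN_E)
        have "(\<Sum>y'\<in>Y. indicator (B y') y * (\<eta> y * (F y - F y'))) = (\<Sum>z\<in>Y. if z = y0 then \<eta> y * (F y - F y0) else 0)"
          by (rule sum.cong[OF refl]) (simp add: sep[OF y0])
        also have "\<dots> = \<eta> y * (F y - F y0)" using Y(1) y0 by simp
        finally have e: "(\<Sum>y'\<in>Y. indicator (B y') y * (\<eta> y * (F y - F y'))) = \<eta> y * (F y - F y0)" .
        have "cmod (F y - F y0) * cmod (\<eta> y) \<le> \<epsilon> * cmod (\<eta> y)"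
          using U(3)[OF F subsetD[OF B(2)[OF y0(1)] y0(2)]] by (rule mult_right_mono) simp
        then show ?thesis unfolding e norm_mult by (simp only: mult.commute)
      qed (simp add: not_in_supp)
    qed (use i Cc_integrable[OF \<eta>] in \<open>auto intro!: integrable_norm Bochner_Integration.integrable_sum\<close>)
    finally show ?thesis by simp
  qed
  then show ?thesis using Y(1) Ys by blast
qed

section \<open>Polarised forms\<close>

text \<open>The identities satisfied by \<open>M \<mapsto> iter_pol M D f \<phi>\<close>, and by the mixed discriminants that arise from the
  \<open>k \<times> k\<close> minors of a symmetric matrix: a form that is symmetric and bilinear in each of \<open>k\<close> pairs, symmetric
  under permutations of the pairs, and whose symmetrisation over four entries vanishes.\<close>

definition polarized :: "nat \<Rightarrow> (('a::euclidean_space \<times> 'a) multiset \<Rightarrow> complex) \<Rightarrow> bool" where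
  "polarized k T \<longleftrightarrow>
     (\<forall>M u u' v. Suc (size M) = k \<longrightarrow> T (add_mset (u + u', v) M) = T (add_mset (u, v) M) + T (add_mset (u', v) M)) \<and>
     (\<forall>M c u v. Suc (size M) = k \<longrightarrow> T (add_mset (c *\<^sub>R u, v) M) = of_real c * T (add_mset (u, v) M)) \<and>
     (\<forall>M u v. Suc (size M) = k \<longrightarrow> T (add_mset (u, v) M) = T (add_mset (v, u) M)) \<and>
     (\<forall>M x y z. Suc (Suc (size M)) = k \<longrightarrow>
        T (add_mset (x, y) (add_mset (x, z) M)) = - 1 / 2 * T (add_mset (x, x) (add_mset (y, z) M)))"

lemma polarizedD:
  assumes "polarized k T"
  shows "Suc (size M) = k \<Longrightarrow> T (add_mset (u + u', v) M) = T (add_mset (u, v) M) + T (add_mset (u', v) M)"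
    "Suc (size M) = k \<Longrightarrow> T (add_mset (c *\<^sub>R u, v) M) = of_real c * T (add_mset (u, v) M)"
    "Suc (size M) = k \<Longrightarrow> T (add_mset (u, v) M) = T (add_mset (v, u) M)"
    "Suc (Suc (size M)) = k \<Longrightarrow> T (add_mset (x, y) (add_mset (x, z) M)) = - 1 / 2 * T (add_mset (x, x) (add_mset (y, z) M))"
  using assms unfolding polarized_def by blast+

lemma polarized_add2:
  assumes "polarized k T" "Suc (size M) = k"
  shows "T (add_mset (v, u + u') M) = T (add_mset (v, u) M) + T (add_mset (v, u') M)"
  by (simp only: polarizedD(3)[OF assms, of v] polarizedD(1)[OF assms])

lemma polarized_scale2:
  assumes "polarized k T" "Suc (size M) = k"
  shows "T (add_mset (v, c *\<^sub>R u) M) = of_real c * T (add_mset (v, u) M)"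
  by (simp only: polarizedD(3)[OF assms, of v] polarizedD(2)[OF assms])

lemma polarized_sum:
  assumes "polarized k T" "Suc (size M) = k" "finite A"
  shows "T (add_mset (\<Sum>a\<in>A. c a *\<^sub>R w a, v) M) = (\<Sum>a\<in>A. of_real (c a) * T (add_mset (w a, v) M))"
  using assms(3)
proof (induction A)
  case empty
  have "T (add_mset (0 *\<^sub>R 0, v) M) = 0" by (subst polarizedD(2)[OF assms(1,2)]) simp
  then show ?case by simp
qed (simp add: polarizedD(1,2)[OF assms(1,2)])

lemma polarized_square:
  assumes "polarized k T" "Suc (size M) = k"
  shows "T (add_mset (u, v) M) = (T (add_mset (u + v, u + v) M) - T (add_mset (u, u) M) - T (add_mset (v, v) M)) / 2"
  using polarizedD(3)[OF assms, of u v]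
  by (simp add: polarizedD(1)[OF assms] polarized_add2[OF assms])

definition diagonals :: "'a multiset \<Rightarrow> ('a \<times> 'a) multiset" where
  "diagonals N = image_mset (\<lambda>x. (x, x)) N"

lemma diagonals_simps [simp]: "diagonals {#} = {#}" "diagonals (add_mset x N) = add_mset (x, x) (diagonals N)" "size (diagonals N) = size N"
  by (simp_all add: diagonals_def)

text \<open>By the polarisation formula a form is determined by diagonal pairs, and by bilinearity it suffices
  to take these from the basis vectors and their pairwise sums. Finitely many values therefore decide.\<close>

lemma polarized_diagonal_grid:
  assumes T: "polarized k T"
    and 0: "\<And>N. size N = k \<Longrightarrow> set_mset N \<subseteq> (\<lambda>(b, b'). b + b') ` (Basis \<times> Basis) \<union> Basis \<Longrightarrow> T (diagonals N) = 0"
    and M: "size M = k"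
  shows "T M = 0"
proof -
  define F :: "'a set" where "F = (\<lambda>(b, b'). b + b') ` (Basis \<times> Basis) \<union> Basis"
  have "T (diagonals N + M) = 0" if "size N + size M = k" "set_mset N \<subseteq> F" for N
    using that
  proof (induction M arbitrary: N)
    case (add p M)
    obtain u v where p: "p = (u, v)" by (cases p)
    have sz: "Suc (size (diagonals N + M)) = k" using add.prems by simp
    have F: "T (add_mset (x, x) (diagonals N + M)) = 0" if "x \<in> F" for x
      using add.IH[of "add_mset x N"] add.prems that by simp
    have b: "T (add_mset (b, b') (diagonals N + M)) = 0" if "b \<in> Basis" "b' \<in> Basis" for b b'
    proof -
      have "b + b' \<in> F" "b \<in> F" "b' \<in> F" using that by (auto simp: F_def)
      then show ?thesis unfolding polarized_square[OF T sz, of b b'] by (simp add: F)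
    qed
    have "T (add_mset (b, v) (diagonals N + M)) = 0" if "b \<in> Basis" for b
    proof -
      have "T (add_mset (\<Sum>e\<in>Basis. (v \<bullet> e) *\<^sub>R e, b) (diagonals N + M)) = 0"
        unfolding polarized_sum[OF T sz finite_Basis] using b that by simp
      then show ?thesis by (simp add: euclidean_representation polarizedD(3)[OF T sz, of b])
    qed
    then have "T (add_mset (\<Sum>e\<in>Basis. (u \<bullet> e) *\<^sub>R e, v) (diagonals N + M)) = 0"
      unfolding polarized_sum[OF T sz finite_Basis] by simp
    then show ?case by (simp add: euclidean_representation p)
  qed (use 0 in \<open>simp add: F_def\<close>)
  from this[of "{#}"] M show ?thesis by simp
qed

definition pairing :: "nat \<Rightarrow> (nat \<Rightarrow> 'a) \<Rightarrow> (nat \<Rightarrow> 'a) \<Rightarrow> ('a \<times> 'a) multiset" where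
  "pairing k X Y = image_mset (\<lambda>b. (X b, Y b)) (mset_set {..<k})"

lemma size_pairing [simp]: "size (pairing k X Y) = k"
  by (simp add: pairing_def)

lemma pairing_cong: "(\<And>b. b < k \<Longrightarrow> X b = X' b) \<Longrightarrow> (\<And>b. b < k \<Longrightarrow> Y b = Y' b) \<Longrightarrow> pairing k X Y = pairing k X' Y'"
  unfolding pairing_def by (rule image_mset_cong) simp

lemma pairing_permute:
  assumes "\<tau> permutes {..<k}"
  shows "pairing k (X \<circ> \<tau>) (Y \<circ> \<tau>) = pairing k X Y"
proof -
  have "mset_set {..<k} = image_mset \<tau> (mset_set {..<k})"
    using assms by (simp add: image_mset_mset_set permutes_inj_on permutes_image)
  then have "pairing k X Y = image_mset (\<lambda>b. (X b, Y b)) (image_mset \<tau> (mset_set {..<k}))"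
    unfolding pairing_def by simp
  then show ?thesis by (simp add: pairing_def multiset.map_comp comp_def)
qed

lemma pairing_slot:
  assumes "b < k"
  shows "pairing k X Y = add_mset (X b, Y b) (image_mset (\<lambda>b. (X b, Y b)) (mset_set ({..<k} - {b})))"
  unfolding pairing_def using assms by (subst mset_set.remove[of _ b]) auto

lemma pairing_two_slots:
  assumes "a < k" "b < k" "a \<noteq> b"
  shows "pairing k X Y = add_mset (X a, Y a) (add_mset (X b, Y b) (image_mset (\<lambda>b. (X b, Y b)) (mset_set ({..<k} - {a} - {b}))))"
  unfolding pairing_slot[OF assms(1)] using assms by (subst mset_set.remove[of _ b]) auto

text \<open>If \<open>\<sigma>\<close> moves \<open>a\<close> and \<open>\<sigma> b = a\<close>, the vector \<open>X a\<close> occurs in the two pairs \<open>(X a, X (\<sigma> a))\<close> and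
  \<open>(X b, X a)\<close>. The quadratic identity of polarised forms trades them for \<open>(X a, X a)\<close> and
  \<open>(X b, X (\<sigma> a))\<close> at the cost of a factor \<open>- 1 / 2\<close>. This composes \<open>\<sigma>\<close> with a
  transposition and reduces the number of moved points.\<close>

lemma polarized_permutation:
  assumes "\<sigma> permutes {..<k}"
  shows "\<exists>\<rho>>0. \<forall>(T :: ('a::euclidean_space \<times> 'a) multiset \<Rightarrow> complex) X. polarized k T \<longrightarrow> T (pairing k X (X \<circ> \<sigma>)) = of_int (sign \<sigma>) * of_real \<rho> * T (pairing k X X)"
  using assms
proof (induction "card {a. \<sigma> a \<noteq> a}" arbitrary: \<sigma> rule: less_induct)
  case less
  have sub: "{a. \<sigma> a \<noteq> a} \<subseteq> {..<k}" using less.prems by (auto simp: permutes_def)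
  then have fin: "finite {a. \<sigma> a \<noteq> a}" by (rule finite_subset) simp
  show ?case
  proof (cases "\<sigma> = id")
    case True
    then show ?thesis by (intro exI[of _ 1]) simp
  next
    case False
    then obtain a where a: "\<sigma> a \<noteq> a" by (auto simp: fun_eq_iff)
    define b where "b = inv \<sigma> a"
    have bij: "bij \<sigma>" using less.prems by (rule permutes_bij)
    have b: "\<sigma> b = a" unfolding b_def using bij by (simp add: bij_is_surj surj_f_inv_f)
    have "a \<noteq> b" using a b by auto
    moreover have "\<sigma> b \<noteq> b" using b calculation by simp
    ultimately have ab: "a \<noteq> b" "a < k" "b < k" using a sub by auto
    define \<sigma>' where "\<sigma>' = \<sigma> \<circ> Transposition.transpose a b"
    have \<sigma>': "\<sigma>' a = a" "\<sigma>' b = \<sigma> a" "\<And>c. c \<noteq> a \<Longrightarrow> c \<noteq> b \<Longrightarrow> \<sigma>' c = \<sigma> c"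
      by (simp_all add: \<sigma>'_def b)
    have tr: "Transposition.transpose a b permutes {..<k}" using ab by (intro permutes_swap_id) auto
    have perm: "\<sigma>' permutes {..<k}" unfolding \<sigma>'_def by (rule permutes_compose[OF tr less.prems])
    have "{c. \<sigma>' c \<noteq> c} \<subseteq> {c. \<sigma> c \<noteq> c} - {a}"
    proof
      fix c assume c: "c \<in> {c. \<sigma>' c \<noteq> c}"
      have "c \<noteq> a" using c \<sigma>'(1) by auto
      moreover have "\<sigma> c \<noteq> c" using c \<sigma>'(3)[of c] b ab(1) \<open>c \<noteq> a\<close> by (cases "c = b") auto
      ultimately show "c \<in> {c. \<sigma> c \<noteq> c} - {a}" by simp
    qed
    then have "card {c. \<sigma>' c \<noteq> c} < card {c. \<sigma> c \<noteq> c}"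
      using fin a by (intro psubset_card_mono) auto
    from less.hyps[OF this perm] obtain \<rho> where \<rho>: "\<rho> > 0"
      "\<And>(T :: ('a \<times> 'a) multiset \<Rightarrow> complex) X. polarized k T \<Longrightarrow>
        T (pairing k X (X \<circ> \<sigma>')) = of_int (sign \<sigma>') * of_real \<rho> * T (pairing k X X)" by blast
    have pp: "permutation \<sigma>" "permutation (Transposition.transpose a b)"
      using less.prems tr by (auto intro: permutes_imp_permutation[of "{..<k}"])
    have sg: "sign \<sigma>' = - sign \<sigma>"
      using ab by (simp add: \<sigma>'_def sign_compose[OF pp] sign_swap_id)
    have "T (pairing k X (X \<circ> \<sigma>)) = of_int (sign \<sigma>) * of_real (\<rho> / 2) * T (pairing k X X)"
      if T: "polarized k T" for T :: "('a \<times> 'a) multiset \<Rightarrow> complex" and X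
    proof -
      define R where "R = image_mset (\<lambda>c. (X c, X (\<sigma> c))) (mset_set ({..<k} - {a} - {b}))"
      have R': "R = image_mset (\<lambda>c. (X c, X (\<sigma>' c))) (mset_set ({..<k} - {a} - {b}))"
        unfolding R_def by (rule image_mset_cong) (auto simp: \<sigma>')
      have szR: "Suc (Suc (size R)) = k" using ab by (simp add: R_def card_Diff_singleton_if)
      have 1: "pairing k X (X \<circ> \<sigma>) = add_mset (X a, X (\<sigma> a)) (add_mset (X b, X a) R)"
        using pairing_two_slots[OF ab(2,3,1), of X "X \<circ> \<sigma>"] by (simp add: R_def b)
      have 2: "pairing k X (X \<circ> \<sigma>') = add_mset (X a, X a) (add_mset (X b, X (\<sigma> a)) R)"
        using pairing_two_slots[OF ab(2,3,1), of X "X \<circ> \<sigma>'"] by (simp add: R' \<sigma>')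
      have "T (pairing k X (X \<circ> \<sigma>)) = T (add_mset (X b, X a) (add_mset (X a, X (\<sigma> a)) R))"
        unfolding 1 by (simp add: add_mset_commute)
      also have "\<dots> = T (add_mset (X a, X b) (add_mset (X a, X (\<sigma> a)) R))"
        using szR by (intro polarizedD(3)[OF T]) simp
      also have "\<dots> = - 1 / 2 * T (add_mset (X a, X a) (add_mset (X b, X (\<sigma> a)) R))"
        using szR by (intro polarizedD(4)[OF T])
      also have "\<dots> = - 1 / 2 * (of_int (sign \<sigma>') * of_real \<rho> * T (pairing k X X))"
        by (simp only: 2[symmetric] \<rho>(2)[OF T])
      finally show ?thesis by (simp add: sg)
    qed
    then show ?thesis using \<rho>(1) by (intro exI[of _ "\<rho> / 2"]) auto
  qed
qed

definition altsum :: "nat \<Rightarrow> (('a \<times> 'a) multiset \<Rightarrow> complex) \<Rightarrow> (nat \<Rightarrow> 'a) \<Rightarrow> (nat \<Rightarrow> 'a) \<Rightarrow> complex" where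
  "altsum k T X Y = (\<Sum>\<sigma> | \<sigma> permutes {..<k}. of_int (sign \<sigma>) * T (pairing k X (Y \<circ> \<sigma>)))"

lemma finite_perms: "finite {\<sigma>. \<sigma> permutes {..<k::nat}}"
  by (rule finite_permutations) simp

lemma sign_square: "(of_int (sign \<sigma>) :: complex) * of_int (sign \<sigma>) = 1"
  by (simp add: sign_def)

text \<open>All terms of the alternating sum are positive multiples of the term for the identity, because the
  signs cancel; hence \<open>\<gamma>\<close> is positive.\<close>

lemma altsum_diagonal:
  "\<exists>\<gamma>>0. \<forall>(T :: ('a::euclidean_space \<times> 'a) multiset \<Rightarrow> complex) X. polarized k T \<longrightarrow>
     altsum k T X X = of_real \<gamma> * T (pairing k X X)"
proof -
  have "\<forall>\<sigma>\<in>{\<sigma>. \<sigma> permutes {..<k}}. \<exists>\<rho>. \<rho> > 0 \<and> (\<forall>(T :: ('a \<times> 'a) multiset \<Rightarrow> complex) X. polarized k T \<longrightarrow>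
      T (pairing k X (X \<circ> \<sigma>)) = of_int (sign \<sigma>) * of_real \<rho> * T (pairing k X X))"
    using polarized_permutation[of _ k, where ?'a = 'a] by simp
  then obtain \<rho> where *: "\<forall>\<sigma>\<in>{\<sigma>. \<sigma> permutes {..<k}}. \<rho> \<sigma> > 0 \<and> (\<forall>(T :: ('a \<times> 'a) multiset \<Rightarrow> complex) X. polarized k T \<longrightarrow>
      T (pairing k X (X \<circ> \<sigma>)) = of_int (sign \<sigma>) * of_real (\<rho> \<sigma>) * T (pairing k X X))"
    by (rule bchoice[THEN exE])
  have \<rho>: "\<rho> \<sigma> > 0" if "\<sigma> permutes {..<k}" for \<sigma>
    using * that by blast
  have \<rho>2: "T (pairing k X (X \<circ> \<sigma>)) = of_int (sign \<sigma>) * of_real (\<rho> \<sigma>) * T (pairing k X X)"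
    if "\<sigma> permutes {..<k}" "polarized k T" for \<sigma> and T :: "('a \<times> 'a) multiset \<Rightarrow> complex" and X
    using * that by blast
  define \<gamma> where "\<gamma> = (\<Sum>\<sigma> | \<sigma> permutes {..<k}. \<rho> \<sigma>)"
  have "\<gamma> > 0"
    unfolding \<gamma>_def using finite_perms[of k] permutes_id[of "{..<k}"] by (intro sum_pos \<rho>) blast+
  moreover have "altsum k T X X = of_real \<gamma> * T (pairing k X X)" if "polarized k T"
    for T :: "('a \<times> 'a) multiset \<Rightarrow> complex" and X
  proof -
    have "altsum k T X X = (\<Sum>\<sigma> | \<sigma> permutes {..<k}. (of_int (sign \<sigma>) * of_int (sign \<sigma>)) * of_real (\<rho> \<sigma>) * T (pairing k X X))"
      unfolding altsum_def by (rule sum.cong) (simp_all add: \<rho>2[OF _ that])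
    then show ?thesis by (simp add: sign_square \<gamma>_def sum_distrib_right)
  qed
  ultimately show ?thesis by blast
qed

lemma sign_compose_perms:
  assumes "\<sigma> permutes {..<k::nat}" "\<tau> permutes {..<k}"
  shows "sign (\<sigma> \<circ> \<tau>) = sign \<sigma> * sign \<tau>"
  using assms by (intro sign_compose permutes_imp_permutation) auto

lemma altsum_permute_left:
  assumes \<tau>: "\<tau> permutes {..<k}"
  shows "altsum k T (X \<circ> \<tau>) Y = of_int (sign \<tau>) * altsum k T X Y"
proof -
  have "altsum k T (X \<circ> \<tau>) Y = (\<Sum>\<sigma> | \<sigma> permutes {..<k}. of_int (sign (\<sigma> \<circ> \<tau>)) * T (pairing k (X \<circ> \<tau>) (Y \<circ> (\<sigma> \<circ> \<tau>))))"
    unfolding altsum_def by (rule sum_permutations_compose_right[OF \<tau>])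
  also have "\<dots> = of_int (sign \<tau>) * altsum k T X Y"
    unfolding altsum_def sum_distrib_left
    by (rule sum.cong) (simp_all add: sign_compose_perms[OF _ \<tau>] pairing_permute[OF \<tau>] flip: comp_assoc)
  finally show ?thesis .
qed

subsection \<open>Multilinear expansion\<close>

text \<open>Multilinearity in the slots \<open>b < k\<close>; the first condition makes \<open>f\<close> a function of these slots.\<close>

definition multilin :: "nat \<Rightarrow> ((nat \<Rightarrow> 'a::real_vector) \<Rightarrow> complex) \<Rightarrow> bool" where
  "multilin k f \<longleftrightarrow>
     (\<forall>X Y. (\<forall>b<k. X b = Y b) \<longrightarrow> f X = f Y) \<and>
     (\<forall>X b u v. b < k \<longrightarrow> f (X(b := u + v)) = f (X(b := u)) + f (X(b := v))) \<and>
     (\<forall>X b c u. b < k \<longrightarrow> f (X(b := c *\<^sub>R u)) = of_real c * f (X(b := u)))"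

lemma multilinD:
  assumes "multilin k f"
  shows "(\<And>b. b < k \<Longrightarrow> X b = Y b) \<Longrightarrow> f X = f Y"
    "b < k \<Longrightarrow> f (X(b := u + v)) = f (X(b := u)) + f (X(b := v))"
    "b < k \<Longrightarrow> f (X(b := c *\<^sub>R u)) = of_real c * f (X(b := u))"
  using assms unfolding multilin_def by blast+

lemma multilin_sum_slot:
  assumes "multilin k f" "b < k" "finite A"
  shows "f (X(b := \<Sum>a\<in>A. c a *\<^sub>R w a)) = (\<Sum>a\<in>A. of_real (c a) * f (X(b := w a)))"
  using assms(3)
proof (induction A)
  case empty
  have "f (X(b := 0 *\<^sub>R 0)) = 0" by (subst multilinD(3)[OF assms(1,2)]) simp
  then show ?case by (simp only: sum.empty scaleR_zero_left)
next
  case (insert a A)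
  show ?case
    by (simp only: sum.insert[OF insert.hyps] multilinD(2,3)[OF assms(1,2)] insert.IH)
qed

lemma sum_PiE_Suc:
  fixes F :: "(nat \<Rightarrow> 'a) \<Rightarrow> 'b::comm_monoid_add"
  shows "(\<Sum>s\<in>{..<Suc r} \<rightarrow>\<^sub>E A. F s) = (\<Sum>a\<in>A. \<Sum>s\<in>{..<r} \<rightarrow>\<^sub>E A. F (s(r := a)))"
proof -
  have inj: "inj_on (\<lambda>(a, s). s(r := a)) (A \<times> ({..<r} \<rightarrow>\<^sub>E A))"
  proof (rule inj_onI, clarsimp)
    fix a s a' s' assume h: "s \<in> {..<r} \<rightarrow>\<^sub>E A" "s' \<in> {..<r} \<rightarrow>\<^sub>E A" "s(r := a) = s'(r := a')"
    have "s b = s' b" for b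
      using fun_cong[OF h(3), of b] PiE_arb[OF h(1), of b] PiE_arb[OF h(2), of b] by (cases "b = r") auto
    then show "a = a' \<and> s = s'" using fun_cong[OF h(3), of r] by auto
  qed
  have "(\<Sum>s\<in>{..<Suc r} \<rightarrow>\<^sub>E A. F s) = sum F ((\<lambda>(a, s). s(r := a)) ` (A \<times> ({..<r} \<rightarrow>\<^sub>E A)))"
    by (simp add: lessThan_Suc PiE_insert_eq)
  also have "\<dots> = (\<Sum>(a, s)\<in>A \<times> ({..<r} \<rightarrow>\<^sub>E A). F (s(r := a)))"
    by (subst sum.reindex[OF inj]) (simp add: case_prod_beta' comp_def)
  finally show ?thesis by (simp add: sum.cartesian_product)
qed

lemma multilin_expand:
  assumes f: "multilin k f" and A: "finite A"
  shows "f (\<lambda>b. \<Sum>a\<in>A. m b a *\<^sub>R w a) = (\<Sum>s\<in>{..<k} \<rightarrow>\<^sub>E A. of_real (\<Prod>b<k. m b (s b)) * f (\<lambda>b. w (s b)))"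
proof -
  have "f (\<lambda>b. if b < r then \<Sum>a\<in>A. m b a *\<^sub>R w a else X b)
     = (\<Sum>s\<in>{..<r} \<rightarrow>\<^sub>E A. of_real (\<Prod>b<r. m b (s b)) * f (\<lambda>b. if b < r then w (s b) else X b))"
    if "r \<le> k" for r X
    using that
  proof (induction r arbitrary: X)
    case (Suc r)
    have r: "r < k" using Suc.prems by simp
    have "f (\<lambda>b. if b < Suc r then \<Sum>a\<in>A. m b a *\<^sub>R w a else X b)
      = f (\<lambda>b. if b < r then \<Sum>a\<in>A. m b a *\<^sub>R w a else (X(r := \<Sum>a\<in>A. m r a *\<^sub>R w a)) b)"
      by (rule arg_cong[of _ _ f]) (auto simp: fun_eq_iff less_Suc_eq)
    also have "\<dots> = (\<Sum>s\<in>{..<r} \<rightarrow>\<^sub>E A. of_real (\<Prod>b<r. m b (s b))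
        * f ((\<lambda>b. if b < r then w (s b) else X b)(r := \<Sum>a\<in>A. m r a *\<^sub>R w a)))"
    proof -
      have e: "(\<lambda>b. if b < r then w (s b) else (X(r := Z)) b) = (\<lambda>b. if b < r then w (s b) else X b)(r := Z)" for s Z
        by (rule ext) simp
      show ?thesis using Suc.prems unfolding e[symmetric] by (intro Suc.IH) simp
    qed
    also have "\<dots> = (\<Sum>s\<in>{..<r} \<rightarrow>\<^sub>E A. \<Sum>a\<in>A. of_real (\<Prod>b<r. m b (s b)) *
         (of_real (m r a) * f ((\<lambda>b. if b < r then w (s b) else X b)(r := w a))))"
      by (simp add: multilin_sum_slot[OF f r A] sum_distrib_left)
    also have "\<dots> = (\<Sum>a\<in>A. \<Sum>s\<in>{..<r} \<rightarrow>\<^sub>E A. of_real (\<Prod>b<r. m b (s b)) *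
         (of_real (m r a) * f ((\<lambda>b. if b < r then w (s b) else X b)(r := w a))))"
      by (rule sum.swap)
    also have "\<dots> = (\<Sum>a\<in>A. \<Sum>s\<in>{..<r} \<rightarrow>\<^sub>E A. of_real (\<Prod>b<Suc r. m b ((s(r := a)) b)) *
         f (\<lambda>b. if b < Suc r then w ((s(r := a)) b) else X b))"
    proof (intro sum.cong refl)
      fix a s
      have "(\<Prod>b<Suc r. m b ((s(r := a)) b)) = (\<Prod>b<r. m b (s b)) * m r a" by simp
      moreover have "((\<lambda>b. if b < r then w (s b) else X b)(r := w a))
          = (\<lambda>b. if b < Suc r then w ((s(r := a)) b) else X b)" by (auto simp: fun_eq_iff)
      ultimately show "of_real (\<Prod>b<r. m b (s b)) * (of_real (m r a) * f ((\<lambda>b. if b < r then w (s b) else X b)(r := w a)))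
        = of_real (\<Prod>b<Suc r. m b ((s(r := a)) b)) * f (\<lambda>b. if b < Suc r then w ((s(r := a)) b) else X b)"
        by (simp only: of_real_mult mult.assoc)
    qed
    finally show ?case unfolding sum_PiE_Suc .
  qed simp
  from this[of k "\<lambda>_. 0"] have "f (\<lambda>b. if b < k then \<Sum>a\<in>A. m b a *\<^sub>R w a else 0)
     = (\<Sum>s\<in>{..<k} \<rightarrow>\<^sub>E A. of_real (\<Prod>b<k. m b (s b)) * f (\<lambda>b. if b < k then w (s b) else 0))" by simp
  moreover have "f (\<lambda>b. if b < k then Z b else 0) = f Z" for Z by (rule multilinD(1)[OF f]) simp
  ultimately show ?thesis by simp
qed

text \<open>The determinant of the matrix \<open>z\<^sub>a \<bullet> X\<^sub>b\<close>.\<close>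

definition gram_det :: "nat \<Rightarrow> (nat \<Rightarrow> 'a::real_inner) \<Rightarrow> (nat \<Rightarrow> 'a) \<Rightarrow> real" where
  "gram_det k z X = (\<Sum>\<sigma> | \<sigma> permutes {..<k}. of_int (sign \<sigma>) * (\<Prod>b<k. z (\<sigma> b) \<bullet> X b))"

lemma gram_det_alt: "gram_det k z X = (\<Sum>\<sigma> | \<sigma> permutes {..<k}. of_int (sign \<sigma>) * (\<Prod>a<k. z a \<bullet> X (\<sigma> a)))"
proof -
  have "gram_det k z X = (\<Sum>\<sigma> | \<sigma> permutes {..<k}. of_int (sign (inv \<sigma>)) * (\<Prod>b<k. z (inv \<sigma> b) \<bullet> X b))"
    unfolding gram_det_def by (rule sum_permutations_inverse)
  also have "\<dots> = (\<Sum>\<sigma> | \<sigma> permutes {..<k}. of_int (sign \<sigma>) * (\<Prod>a<k. z a \<bullet> X (\<sigma> a)))"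
  proof (rule sum.cong[OF refl])
    fix \<sigma> assume "\<sigma> \<in> {\<sigma>. \<sigma> permutes {..<k}}"
    then have \<sigma>: "\<sigma> permutes {..<k}" by simp
    have "(\<Prod>b<k. z (inv \<sigma> b) \<bullet> X b) = (\<Prod>a<k. z (inv \<sigma> (\<sigma> a)) \<bullet> X (\<sigma> a))"
      using prod.permute[OF \<sigma>, of "\<lambda>b. z (inv \<sigma> b) \<bullet> X b"] by (simp add: comp_def)
    moreover have "sign (inv \<sigma>) = sign \<sigma>"
      using \<sigma> by (intro sign_inverse permutes_imp_permutation) auto
    ultimately show "of_int (sign (inv \<sigma>)) * (\<Prod>b<k. z (inv \<sigma> b) \<bullet> X b) = of_int (sign \<sigma>) * (\<Prod>a<k. z a \<bullet> X (\<sigma> a))"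
      using permutes_inverses(2)[OF \<sigma>] by simp
  qed
  finally show ?thesis .
qed

text \<open>The Cauchy-Binet mechanism for square matrices: noninjective choices vanish, and the remaining ones are permutations
  of \<open>y\<close>, whose signs build up the determinant.\<close>

lemma alternating_expand:
  assumes f: "multilin k f" and alt: "\<And>X \<tau>. \<tau> permutes {..<k} \<Longrightarrow> f (X \<circ> \<tau>) = of_int (sign \<tau>) * f X"
  shows "f (\<lambda>b. \<Sum>a<k. (z a \<bullet> X b) *\<^sub>R y a) = of_real (gram_det k z X) * f y"
proof -
  define P where "P = {\<sigma>. \<sigma> permutes {..<k}}"
  define I where "I = {s \<in> {..<k} \<rightarrow>\<^sub>E {..<k}. inj_on s {..<k}}"
  have notinj: "f (\<lambda>b. y (s b)) = 0" if s: "\<not> inj_on s {..<k}" for s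
  proof -
    obtain a b where ab: "a < k" "b < k" "a \<noteq> b" "s a = s b" using s by (auto simp: inj_on_def)
    have tr: "Transposition.transpose a b permutes {..<k}" using ab by (intro permutes_swap_id) auto
    have "f ((\<lambda>b. y (s b)) \<circ> Transposition.transpose a b) = f (\<lambda>b. y (s b))"
      by (rule arg_cong[of _ _ f]) (auto simp: fun_eq_iff Transposition.transpose_def ab(4))
    moreover have "f ((\<lambda>b. y (s b)) \<circ> Transposition.transpose a b) = - f (\<lambda>b. y (s b))"
      using alt[OF tr] ab by (simp add: sign_swap_id)
    ultimately show ?thesis by simp
  qed
  have "f (\<lambda>b. \<Sum>a<k. (z a \<bullet> X b) *\<^sub>R y a)
      = (\<Sum>s\<in>{..<k} \<rightarrow>\<^sub>E {..<k}. of_real (\<Prod>b<k. z (s b) \<bullet> X b) * f (\<lambda>b. y (s b)))"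
    by (rule multilin_expand[OF f]) simp
  also have "\<dots> = (\<Sum>s\<in>I. of_real (\<Prod>b<k. z (s b) \<bullet> X b) * f (\<lambda>b. y (s b)))"
    by (rule sum.mono_neutral_right) (auto simp: I_def notinj intro!: finite_PiE)
  also have "\<dots> = (\<Sum>\<sigma>\<in>P. of_real (\<Prod>b<k. z (\<sigma> b) \<bullet> X b) * f (\<lambda>b. y (\<sigma> b)))"
  proof (rule sum.reindex_bij_witness[of _ "\<lambda>\<sigma>. restrict \<sigma> {..<k}" "\<lambda>s b. if b < k then s b else b"])
    fix s assume s: "s \<in> I"
    then have "s ` {..<k} = {..<k}" by (intro endo_inj_surj) (auto simp: I_def)
    then have "bij_betw s {..<k} {..<k}" using s by (simp add: I_def bij_betw_def)
    then have "bij_betw (\<lambda>b. if b < k then s b else b) {..<k} {..<k}" by (rule bij_betw_cong[THEN iffD1, rotated]) simp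
    then show "(\<lambda>b. if b < k then s b else b) \<in> P" unfolding P_def mem_Collect_eq by (rule bij_imp_permutes) simp
    show "restrict (\<lambda>b. if b < k then s b else b) {..<k} = s"
    proof
      fix b
      have "s \<in> {..<k} \<rightarrow>\<^sub>E {..<k}" using s by (simp add: I_def)
      then show "restrict (\<lambda>b. if b < k then s b else b) {..<k} b = s b"
        using PiE_arb[of s "{..<k}" _ b] by (cases "b < k") simp_all
    qed
    have "f (\<lambda>b. y (if b < k then s b else b)) = f (\<lambda>b. y (s b))" by (rule multilinD(1)[OF f]) simp
    then show "of_real (\<Prod>b<k. z (if b < k then s b else b) \<bullet> X b) * f (\<lambda>b. y (if b < k then s b else b))
      = of_real (\<Prod>b<k. z (s b) \<bullet> X b) * f (\<lambda>b. y (s b))" by simp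
  next
    fix \<sigma> assume "\<sigma> \<in> P"
    then have \<sigma>: "\<sigma> permutes {..<k}" by (simp add: P_def)
    show "(\<lambda>b. if b < k then restrict \<sigma> {..<k} b else b) = \<sigma>"
    proof
      fix b show "(if b < k then restrict \<sigma> {..<k} b else b) = \<sigma> b"
        using permutes_not_in[OF \<sigma>, of b] by (cases "b < k") simp_all
    qed
    have "inj_on (restrict \<sigma> {..<k}) {..<k}"
      using permutes_inj_on[OF \<sigma>, of "{..<k}"] by (simp add: inj_on_restrict_eq)
    moreover have "\<sigma> b < k" if "b < k" for b using permutes_in_image[OF \<sigma>, of b] that by simp
    ultimately show "restrict \<sigma> {..<k} \<in> I" by (auto simp: I_def)
  qed
  also have "\<dots> = (\<Sum>\<sigma>\<in>P. of_real (of_int (sign \<sigma>) * (\<Prod>b<k. z (\<sigma> b) \<bullet> X b)) * f y)"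
  proof (rule sum.cong[OF refl])
    fix \<sigma> assume "\<sigma> \<in> P"
    then have "f (\<lambda>b. y (\<sigma> b)) = of_int (sign \<sigma>) * f y"
      using alt[of \<sigma> y] by (simp add: P_def comp_def)
    then show "of_real (\<Prod>b<k. z (\<sigma> b) \<bullet> X b) * f (\<lambda>b. y (\<sigma> b))
        = of_real (of_int (sign \<sigma>) * (\<Prod>b<k. z (\<sigma> b) \<bullet> X b)) * f y"
      by (simp only: of_real_mult of_real_of_int_eq mult_ac)
  qed
  finally show ?thesis by (simp add: gram_det_def P_def sum_distrib_right)
qed

lemma pairing_multilin_left:
  assumes T: "polarized k T"
  shows "multilin k (\<lambda>X. T (pairing k X Y))"
  unfolding multilin_def
proof (intro conjI allI impI)
  fix X X' :: "nat \<Rightarrow> 'a" assume "\<forall>b<k. X b = X' b"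
  then show "T (pairing k X Y) = T (pairing k X' Y)" using pairing_cong[of k X X' Y Y] by simp
next
  fix X :: "nat \<Rightarrow> 'a" and b assume b: "b < k"
  define R where "R = image_mset (\<lambda>b. (X b, Y b)) (mset_set ({..<k} - {b}))"
  have sz: "Suc (size R) = k" using b by (simp add: R_def)
  have R: "pairing k (X(b := u)) Y = add_mset (u, Y b) R" for u
    unfolding pairing_slot[OF b] R_def by (simp, rule image_mset_cong) auto
  show "T (pairing k (X(b := u + v)) Y) = T (pairing k (X(b := u)) Y) + T (pairing k (X(b := v)) Y)" for u v
    unfolding R by (rule polarizedD(1)[OF T sz])
  show "T (pairing k (X(b := c *\<^sub>R u)) Y) = of_real c * T (pairing k (X(b := u)) Y)" for c u
    unfolding R by (rule polarizedD(2)[OF T sz])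
qed

lemma pairing_swap_slot:
  assumes T: "polarized k T" and b: "b < k"
  shows "T (pairing k (X(b := u)) (Y(b := v))) = T (pairing k (X(b := v)) (Y(b := u)))"
proof -
  define R where "R = image_mset (\<lambda>b. (X b, Y b)) (mset_set ({..<k} - {b}))"
  have sz: "Suc (size R) = k" using b by (simp add: R_def)
  have R: "pairing k (X(b := u)) (Y(b := v)) = add_mset (u, v) R" for u v
    unfolding pairing_slot[OF b] R_def by (simp, rule image_mset_cong) auto
  show ?thesis unfolding R by (rule polarizedD(3)[OF T sz])
qed

lemma pairing_swap:
  assumes T: "polarized k T"
  shows "T (pairing k X Y) = T (pairing k Y X)"
proof -
  have "T (pairing k X Y) = T (pairing k (\<lambda>b. if b < r then Y b else X b) (\<lambda>b. if b < r then X b else Y b))" if "r \<le> k" for r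
    using that
  proof (induction r)
    case (Suc r)
    define X' where "X' = (\<lambda>b. if b < r then Y b else X b)"
    define Y' where "Y' = (\<lambda>b. if b < r then X b else Y b)"
    have "T (pairing k (X'(r := X r)) (Y'(r := Y r))) = T (pairing k (X'(r := Y r)) (Y'(r := X r)))"
      using Suc.prems by (intro pairing_swap_slot[OF T]) simp
    moreover have "X'(r := X r) = X'" "Y'(r := Y r) = Y'"
      "X'(r := Y r) = (\<lambda>b. if b < Suc r then Y b else X b)" "Y'(r := X r) = (\<lambda>b. if b < Suc r then X b else Y b)"
      by (auto simp: X'_def Y'_def fun_eq_iff less_Suc_eq)
    ultimately show ?case using Suc by (simp add: X'_def Y'_def)
  qed simp
  from this[of k] show ?thesis
    using pairing_cong[of k "\<lambda>b. if b < k then Y b else X b" Y "\<lambda>b. if b < k then X b else Y b" X] by simp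
qed

lemma pairing_multilin_right:
  assumes T: "polarized k T"
  shows "multilin k (\<lambda>Y. T (pairing k X Y))"
  using pairing_multilin_left[OF T, of X] unfolding pairing_swap[OF T, of _ X] .

lemma altsum_multilin_left:
  assumes T: "polarized k T"
  shows "multilin k (\<lambda>X. altsum k T X Y)"
  unfolding multilin_def
proof (intro conjI allI impI)
  note m = pairing_multilin_left[OF T]
  show "altsum k T X Y = altsum k T X' Y" if "\<forall>b<k. X b = X' b" for X X'
    unfolding altsum_def by (intro sum.cong refl arg_cong2[of _ _ _ _ "(*)"] multilinD(1)[OF m]) (use that in auto)
  show "altsum k T (X(b := u + v)) Y = altsum k T (X(b := u)) Y + altsum k T (X(b := v)) Y" if "b < k" for X b u v
    unfolding altsum_def by (simp only: multilinD(2)[OF m that] distrib_left sum.distrib)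
  show "altsum k T (X(b := c *\<^sub>R u)) Y = of_real c * altsum k T (X(b := u)) Y" if "b < k" for X b c u
    unfolding altsum_def by (simp only: multilinD(3)[OF m that] sum_distrib_left mult.left_commute)
qed

lemma altsum_swap:
  assumes T: "polarized k T"
  shows "altsum k T X Y = altsum k T Y X"
proof -
  have "altsum k T X Y = (\<Sum>\<sigma> | \<sigma> permutes {..<k}. of_int (sign (inv \<sigma>)) * T (pairing k X (Y \<circ> inv \<sigma>)))"
    unfolding altsum_def by (rule sum_permutations_inverse)
  also have "\<dots> = altsum k T Y X"
    unfolding altsum_def
  proof (rule sum.cong[OF refl])
    fix \<sigma> assume "\<sigma> \<in> {\<sigma>. \<sigma> permutes {..<k}}"
    then have \<sigma>: "\<sigma> permutes {..<k}" by simp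
    have "pairing k X (Y \<circ> inv \<sigma>) = pairing k (X \<circ> \<sigma>) (Y \<circ> inv \<sigma> \<circ> \<sigma>)" by (rule pairing_permute[OF \<sigma>, symmetric])
    also have "Y \<circ> inv \<sigma> \<circ> \<sigma> = Y" using permutes_inverses(2)[OF \<sigma>] by (auto simp: fun_eq_iff)
    finally have e: "pairing k X (Y \<circ> inv \<sigma>) = pairing k (X \<circ> \<sigma>) Y" .
    have "T (pairing k X (Y \<circ> inv \<sigma>)) = T (pairing k Y (X \<circ> \<sigma>))" unfolding e by (rule pairing_swap[OF T])
    moreover have "sign (inv \<sigma>) = sign \<sigma>"
      using \<sigma> by (intro sign_inverse permutes_imp_permutation) auto
    ultimately show "of_int (sign (inv \<sigma>)) * T (pairing k X (Y \<circ> inv \<sigma>)) = of_int (sign \<sigma>) * T (pairing k Y (X \<circ> \<sigma>))" by simp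
  qed
  finally show ?thesis .
qed

text \<open>On linear maps of rank \<open>k\<close> the action on a form is explicit. The alternating sum is alternating in
  both arguments, so each argument contributes one determinant.\<close>

lemma polarized_rank_k_image:
  fixes T :: "('a::euclidean_space \<times> 'a) multiset \<Rightarrow> complex"
  assumes T: "polarized k T"
  defines "g z y \<equiv> \<lambda>x. \<Sum>a<k. (z a \<bullet> x) *\<^sub>R y a"
  shows "T (pairing k (g z y \<circ> X) (g z y \<circ> X)) = of_real ((gram_det k z X)\<^sup>2) * T (pairing k y y)"
proof -
  obtain \<gamma> where \<gamma>: "\<gamma> > 0"
    "\<And>(T :: ('a \<times> 'a) multiset \<Rightarrow> complex) X. polarized k T \<Longrightarrow> altsum k T X X = of_real \<gamma> * T (pairing k X X)"
    using altsum_diagonal[of k, where ?'a = 'a] by blast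
  have e: "g z y \<circ> X = (\<lambda>b. \<Sum>a<k. (z a \<bullet> X b) *\<^sub>R y a)" by (auto simp: g_def)
  have l: "altsum k T (g z y \<circ> X) Y = of_real (gram_det k z X) * altsum k T y Y" for Y
    unfolding e by (rule alternating_expand[OF altsum_multilin_left[OF T] altsum_permute_left])
  have "of_real \<gamma> * T (pairing k (g z y \<circ> X) (g z y \<circ> X)) = altsum k T (g z y \<circ> X) (g z y \<circ> X)"
    by (rule \<gamma>(2)[OF T, symmetric])
  also have "\<dots> = of_real (gram_det k z X) * (of_real (gram_det k z X) * altsum k T y y)"
    using l[of "g z y \<circ> X"] l[of y] altsum_swap[OF T, of y "g z y \<circ> X"] by simp
  also have "\<dots> = of_real \<gamma> * (of_real ((gram_det k z X)\<^sup>2) * T (pairing k y y))"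
    by (simp add: \<gamma>(2)[OF T] power2_eq_square)
  finally show ?thesis using \<gamma>(1) by simp
qed


subsection \<open>Every form is a combination of squares of determinants\<close>

text \<open>The alternating sum is expanded in the standard basis in both arguments. This displays each form as a combination
  of products of two determinants, with its own values as coefficients.\<close>

lemma gram_det_expansion_of_form:
  fixes d :: "('a::euclidean_space \<times> 'a) multiset \<Rightarrow> complex"
  shows "\<exists>\<gamma>>0. \<forall>(d :: ('a::euclidean_space \<times> 'a) multiset \<Rightarrow> complex) X. polarized k d \<longrightarrow>
    (\<Sum>i\<in>{..<k} \<rightarrow>\<^sub>E Basis. \<Sum>j\<in>{..<k} \<rightarrow>\<^sub>E Basis. d (pairing k i j) * of_real (gram_det k i X * gram_det k j X)) = of_real \<gamma> * d (pairing k X X)"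
proof -
  obtain \<gamma> where \<gamma>: "\<gamma> > 0"
    "\<And>(T :: ('a \<times> 'a) multiset \<Rightarrow> complex) X. polarized k T \<Longrightarrow> altsum k T X X = of_real \<gamma> * T (pairing k X X)"
    using altsum_diagonal[of k, where ?'a = 'a] by blast
  define P where "P = {\<sigma>. \<sigma> permutes {..<k}}"
  define I where "I = {..<k} \<rightarrow>\<^sub>E (Basis :: 'a set)"
  have exp: "f (X \<circ> \<sigma>) = (\<Sum>i\<in>I. of_real (\<Prod>b<k. i b \<bullet> X (\<sigma> b)) * f i)"
    if f: "multilin k f" for f and X :: "nat \<Rightarrow> 'a" and \<sigma>
  proof -
    have "(\<Sum>e\<in>Basis. (e \<bullet> X (\<sigma> b)) *\<^sub>R e) = X (\<sigma> b)" for b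
      unfolding inner_commute[of _ "X (\<sigma> b)"] by (rule euclidean_representation)
    then have "f (X \<circ> \<sigma>) = f (\<lambda>b. \<Sum>e\<in>Basis. (e \<bullet> X (\<sigma> b)) *\<^sub>R e)"
      by (simp add: comp_def)
    also have "\<dots> = (\<Sum>i\<in>I. of_real (\<Prod>b<k. i b \<bullet> X (\<sigma> b)) * f (\<lambda>b. i b))"
      unfolding I_def by (rule multilin_expand[OF f finite_Basis])
    finally show ?thesis .
  qed
  have "(\<Sum>i\<in>I. \<Sum>j\<in>I. d (pairing k i j) * of_real (gram_det k i X * gram_det k j X)) = of_real (fact k * \<gamma>) * d (pairing k X X)"
    if d: "polarized k d" for d and X :: "nat \<Rightarrow> 'a"
  proof -
    have J: "(\<Sum>j\<in>I. d (pairing k i j) * of_real (gram_det k j X)) = (\<Sum>\<tau>\<in>P. of_int (sign \<tau>) * d (pairing k i (X \<circ> \<tau>)))" for i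
    proof -
      have "(\<Sum>\<tau>\<in>P. of_int (sign \<tau>) * d (pairing k i (X \<circ> \<tau>)))
         = (\<Sum>\<tau>\<in>P. \<Sum>j\<in>I. of_int (sign \<tau>) * (of_real (\<Prod>b<k. j b \<bullet> X (\<tau> b)) * d (pairing k i j)))"
        by (simp only: exp[OF pairing_multilin_right[OF d]] sum_distrib_left)
      also have "\<dots> = (\<Sum>j\<in>I. \<Sum>\<tau>\<in>P. of_int (sign \<tau>) * (of_real (\<Prod>b<k. j b \<bullet> X (\<tau> b)) * d (pairing k i j)))"
        by (rule sum.swap)
      also have "\<dots> = (\<Sum>j\<in>I. d (pairing k i j) * of_real (gram_det k j X))"
        unfolding gram_det_alt P_def of_real_sum sum_distrib_left by (intro sum.cong refl) simp
      finally show ?thesis by simp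
    qed
    have "(\<Sum>\<sigma>\<in>P. of_int (sign \<sigma>) * altsum k d (X \<circ> \<sigma>) X)
       = (\<Sum>\<sigma>\<in>P. \<Sum>i\<in>I. of_int (sign \<sigma>) * (of_real (\<Prod>b<k. i b \<bullet> X (\<sigma> b)) * altsum k d i X))"
      by (simp only: exp[OF altsum_multilin_left[OF d]] sum_distrib_left)
    also have "\<dots> = (\<Sum>i\<in>I. \<Sum>\<sigma>\<in>P. of_int (sign \<sigma>) * (of_real (\<Prod>b<k. i b \<bullet> X (\<sigma> b)) * altsum k d i X))"
      by (rule sum.swap)
    also have "\<dots> = (\<Sum>i\<in>I. of_real (gram_det k i X) * altsum k d i X)"
      unfolding gram_det_alt P_def of_real_sum sum_distrib_right by (intro sum.cong refl) simp
    also have "\<dots> = (\<Sum>i\<in>I. of_real (gram_det k i X) * (\<Sum>j\<in>I. d (pairing k i j) * of_real (gram_det k j X)))"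
      by (simp add: J altsum_def P_def)
    also have "\<dots> = (\<Sum>i\<in>I. \<Sum>j\<in>I. d (pairing k i j) * of_real (gram_det k i X * gram_det k j X))"
      by (simp add: sum_distrib_left mult_ac)
    finally have "(\<Sum>i\<in>I. \<Sum>j\<in>I. d (pairing k i j) * of_real (gram_det k i X * gram_det k j X))
       = (\<Sum>\<sigma>\<in>P. of_int (sign \<sigma>) * altsum k d (X \<circ> \<sigma>) X)" ..
    also have "\<dots> = (\<Sum>\<sigma>\<in>P. altsum k d X X)"
    proof (rule sum.cong[OF refl])
      fix \<sigma> assume "\<sigma> \<in> P"
      then show "of_int (sign \<sigma>) * altsum k d (X \<circ> \<sigma>) X = altsum k d X X"
        using altsum_permute_left[of \<sigma> k d X X] sign_square[of \<sigma>] by (simp add: P_def flip: mult.assoc)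
    qed
    also have "\<dots> = of_real (fact k * \<gamma>) * d (pairing k X X)"
      by (simp add: \<gamma>(2)[OF d] P_def card_permutations[of "{..<k}" k])
    finally show ?thesis .
  qed
  then show ?thesis using \<gamma>(1) unfolding I_def by (intro exI[of _ "fact k * \<gamma>"]) auto
qed

text \<open>Induction on the number of slots summed over, with \<open>w\<close> filling the other slots of both arguments. In a
  new slot, the sum over the previous ones is bilinear in the two entries and vanishes when they agree,
  so it is antisymmetric in them, while \<open>d'\<close> is symmetric there.\<close>

lemma symmetric_antisymmetric_contraction:
  fixes \<Lambda> d' :: "(nat \<Rightarrow> 'a::real_vector) \<Rightarrow> (nat \<Rightarrow> 'a) \<Rightarrow> complex"
  assumes ml: "\<And>j. multilin k (\<lambda>i. \<Lambda> i j)" "\<And>i. multilin k (\<lambda>j. \<Lambda> i j)"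
    and zero: "\<And>z. \<Lambda> z z = 0"
    and sym: "\<And>b i j e e'. b < k \<Longrightarrow> d' (i(b := e)) (j(b := e')) = d' (i(b := e')) (j(b := e))"
  shows "(\<Sum>i\<in>{..<k} \<rightarrow>\<^sub>E B. \<Sum>j\<in>{..<k} \<rightarrow>\<^sub>E B. d' i j * \<Lambda> i j) = 0"
proof -
  define ext where "ext r i w b = (if b < r then i b else w b)" for r i and w :: "nat \<Rightarrow> 'a" and b :: nat
  have "(\<Sum>i\<in>{..<r} \<rightarrow>\<^sub>E B. \<Sum>j\<in>{..<r} \<rightarrow>\<^sub>E B. d' i j * \<Lambda> (ext r i w) (ext r j w)) = 0"
    if "r \<le> k" "\<And>b i j e e'. b < r \<Longrightarrow> d' (i(b := e)) (j(b := e')) = d' (i(b := e')) (j(b := e))" for r w d'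
    using that
  proof (induction r arbitrary: w d')
    case 0
    have "ext 0 i w = w" for i by (auto simp: ext_def)
    then show ?case by (simp add: zero)
  next
    case (Suc r)
    have r: "r < k" using Suc.prems by simp
    have ext: "ext (Suc r) (i(r := e)) w = (ext r i w)(r := e)" "ext r i (w(r := e)) = (ext r i w)(r := e)" for i e w
      by (auto simp: ext_def fun_eq_iff less_Suc_eq)
    define Q where "Q e e' u v = (\<Sum>i\<in>{..<r} \<rightarrow>\<^sub>E B. \<Sum>j\<in>{..<r} \<rightarrow>\<^sub>E B.
       d' (i(r := e)) (j(r := e')) * \<Lambda> ((ext r i w)(r := u)) ((ext r j w)(r := v)))" for e e' u v
    have Qd: "Q e e' u u = 0" for e e' u
    proof -
      have "(\<Sum>i\<in>{..<r} \<rightarrow>\<^sub>E B. \<Sum>j\<in>{..<r} \<rightarrow>\<^sub>E B.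
         (\<lambda>i j. d' (i(r := e)) (j(r := e'))) i j * \<Lambda> (ext r i (w(r := u))) (ext r j (w(r := u)))) = 0"
      proof (rule Suc.IH)
        fix b i j c c' assume b: "b < r"
        show "d' ((i(b := c))(r := e)) ((j(b := c'))(r := e')) = d' ((i(b := c'))(r := e)) ((j(b := c))(r := e'))"
        proof -
          have tw: "(i(b := x))(r := y) = (i(r := y))(b := x)" for i :: "nat \<Rightarrow> 'a" and x y
            using b by (intro fun_upd_twist) simp
          show ?thesis unfolding tw using b by (intro Suc.prems(2)) simp
        qed
      qed (use r in simp)
      then show ?thesis by (simp add: Q_def ext)
    qed
    have Qadd: "Q e e' (u + v) (u + v) = (Q e e' u u + Q e e' u v) + (Q e e' v u + Q e e' v v)" for e e' u v
      unfolding Q_def multilinD(2)[OF ml(1) r] multilinD(2)[OF ml(2) r] by (simp add: distrib_left sum.distrib algebra_simps)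
    have Qanti: "Q e e' u v + Q e e' v u = 0" for e e' u v
      using Qadd[of e e' u v] by (simp add: Qd)
    have Qsym: "Q e e' u v = Q e' e u v" for e e' u v
      unfolding Q_def by (intro sum.cong refl arg_cong2[where f = "(*)"] Suc.prems(2)) simp
    define S where "S = (\<Sum>e\<in>B. \<Sum>e'\<in>B. Q e e' e e')"
    have "(\<Sum>i\<in>{..<Suc r} \<rightarrow>\<^sub>E B. \<Sum>j\<in>{..<Suc r} \<rightarrow>\<^sub>E B. d' i j * \<Lambda> (ext (Suc r) i w) (ext (Suc r) j w))
      = (\<Sum>e\<in>B. \<Sum>i\<in>{..<r} \<rightarrow>\<^sub>E B. \<Sum>e'\<in>B. \<Sum>j\<in>{..<r} \<rightarrow>\<^sub>E B.
          d' (i(r := e)) (j(r := e')) * \<Lambda> ((ext r i w)(r := e)) ((ext r j w)(r := e')))"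
      unfolding sum_PiE_Suc ext ..
    also have "\<dots> = S"
      unfolding S_def Q_def by (rule sum.cong[OF refl], rule sum.swap)
    finally have eq: "(\<Sum>i\<in>{..<Suc r} \<rightarrow>\<^sub>E B. \<Sum>j\<in>{..<Suc r} \<rightarrow>\<^sub>E B. d' i j * \<Lambda> (ext (Suc r) i w) (ext (Suc r) j w)) = S" .
    have "S = (\<Sum>e'\<in>B. \<Sum>e\<in>B. Q e e' e e')" unfolding S_def by (rule sum.swap)
    also have "\<dots> = (\<Sum>e\<in>B. \<Sum>e'\<in>B. Q e e' e' e)"
      by (intro sum.cong refl) (rule Qsym)
    finally have "S + S = (\<Sum>e\<in>B. \<Sum>e'\<in>B. Q e e' e e' + Q e e' e' e)"
      by (simp add: sum.distrib S_def)
    then have "S = 0" by (simp add: Qanti)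
    then show ?case using eq by simp
  qed
  from this[of k d' "\<lambda>_. 0"] sym have *: "(\<Sum>i\<in>{..<k} \<rightarrow>\<^sub>E B. \<Sum>j\<in>{..<k} \<rightarrow>\<^sub>E B. d' i j * \<Lambda> (ext k i (\<lambda>_. 0)) (ext k j (\<lambda>_. 0))) = 0"
    by blast
  have "\<Lambda> (ext k i (\<lambda>_. 0)) (ext k j (\<lambda>_. 0)) = \<Lambda> i j" for i j
  proof -
    have "\<Lambda> (ext k i (\<lambda>_. 0)) (ext k j (\<lambda>_. 0)) = \<Lambda> i (ext k j (\<lambda>_. 0))"
      by (rule multilinD(1)[OF ml(1)]) (simp add: ext_def)
    also have "\<dots> = \<Lambda> i j" by (rule multilinD(1)[OF ml(2)]) (simp add: ext_def)
    finally show ?thesis .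
  qed
  with * show ?thesis by simp
qed

lemma gram_det_multilin: "multilin k (\<lambda>z. of_real (gram_det k z X))"
proof -
  have slot: "gram_det k (z(b := u)) X = (\<Sum>\<sigma> | \<sigma> permutes {..<k}. of_int (sign \<sigma>) * ((u \<bullet> X (\<sigma> b)) * (\<Prod>a\<in>{..<k} - {b}. z a \<bullet> X (\<sigma> a))))"
    if "b < k" for z b u
    unfolding gram_det_alt
  proof (intro sum.cong refl arg_cong2[where f = "(*)"])
    fix \<sigma>
    show "(\<Prod>a<k. (z(b := u)) a \<bullet> X (\<sigma> a)) = (u \<bullet> X (\<sigma> b)) * (\<Prod>a\<in>{..<k} - {b}. z a \<bullet> X (\<sigma> a))"
      using that by (subst prod.remove[of _ b]) (auto intro!: prod.cong)
  qed
  show ?thesis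
    unfolding multilin_def
  proof (intro conjI allI impI)
    show "of_real (gram_det k z X) = of_real (gram_det k z' X)" if "\<forall>b<k. z b = z' b" for z z'
      unfolding gram_det_alt using that by (intro arg_cong[of _ _ of_real] sum.cong prod.cong arg_cong2[where f = "(*)"]) auto
    show "of_real (gram_det k (z(b := u + v)) X) = of_real (gram_det k (z(b := u)) X) + of_real (gram_det k (z(b := v)) X)" if "b < k" for z b u v
      unfolding slot[OF that] of_real_add[symmetric] by (simp only: inner_add_left distrib_left distrib_right sum.distrib)
    show "of_real (gram_det k (z(b := c *\<^sub>R u)) X) = of_real c * of_real (gram_det k (z(b := u)) X)" if "b < k" for z b c u
      unfolding slot[OF that] of_real_mult[symmetric] sum_distrib_left
      by (simp only: inner_scaleR_left mult.assoc mult.left_commute[of c])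
  qed
qed

lemma nonzero_on_diagonal:
  assumes T: "polarized k T" and M: "size M = k" "T M \<noteq> 0"
  obtains N where "size N = k" "T (diagonals N) \<noteq> 0"
  using polarized_diagonal_grid[OF T _ M(1)] M(2) by blast

lemma image_diagonals: "image_mset (map_prod g g) (diagonals N) = diagonals (image_mset g N)"
  by (simp add: diagonals_def multiset.map_comp comp_def)

lemma pairing_diag: "pairing k X X = diagonals (image_mset X (mset_set {..<k}))"
  by (simp add: pairing_def diagonals_def multiset.map_comp comp_def)

lemma multiset_as_family:
  assumes "size N = k"
  obtains X where "N = image_mset X (mset_set {..<k})"
proof -
  obtain xs where xs: "mset xs = N" using ex_mset by blast
  have "length xs = k" using xs assms by auto
  then have "N = image_mset (nth xs) (mset [0..<k])"
    using xs by (metis map_nth mset_map)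
  then show ?thesis using that by (simp add: lessThan_atLeast0)
qed

text \<open>Used to pass from invertible maps to all linear maps: \<open>g + \<epsilon> id\<close> is invertible for all large \<open>\<epsilon>\<close>.\<close>

lemma perturbation_polynomial:
  assumes T: "polarized k T" and "size M + size N = k"
  shows "\<exists>p. \<forall>\<epsilon>::real. T (M + diagonals (image_mset (\<lambda>x. g x + \<epsilon> *\<^sub>R x) N)) = poly p (of_real \<epsilon>)"
  using assms(2)
proof (induction N arbitrary: M)
  case empty
  show ?case by (intro exI[of _ "[:T M:]"]) simp
next
  case (add x N)
  define R where "R \<epsilon> = M + diagonals (image_mset (\<lambda>x. g x + \<epsilon> *\<^sub>R x) N)" for \<epsilon>
  have sz: "Suc (size (R \<epsilon>)) = k" for \<epsilon> using add.prems by (simp add: R_def)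
  have "\<exists>p. \<forall>\<epsilon>. T (add_mset q (R \<epsilon>)) = poly p (of_real \<epsilon>)" for q
    using add.IH[of "add_mset q M"] add.prems by (simp add: R_def)
  then obtain p where p: "\<And>q \<epsilon>. T (add_mset q (R \<epsilon>)) = poly (p q) (of_real \<epsilon>)" by metis
  have "T (M + diagonals (image_mset (\<lambda>x. g x + \<epsilon> *\<^sub>R x) (add_mset x N)))
      = poly (p (g x, g x) + [:0, 1:] * (p (g x, x) + p (x, g x)) + [:0, 0, 1:] * p (x, x)) (of_real \<epsilon>)" for \<epsilon>
  proof -
    have "T (M + diagonals (image_mset (\<lambda>x. g x + \<epsilon> *\<^sub>R x) (add_mset x N))) = T (add_mset (g x + \<epsilon> *\<^sub>R x, g x + \<epsilon> *\<^sub>R x) (R \<epsilon>))"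
      by (simp add: R_def)
    also have "\<dots> = poly (p (g x, g x)) (of_real \<epsilon>) + of_real \<epsilon> * poly (p (g x, x)) (of_real \<epsilon>)
       + of_real \<epsilon> * (poly (p (x, g x)) (of_real \<epsilon>) + of_real \<epsilon> * poly (p (x, x)) (of_real \<epsilon>))"
      by (simp only: polarizedD(1,2)[OF T sz] polarized_add2[OF T sz] polarized_scale2[OF T sz]) (simp add: p algebra_simps)
    finally show ?thesis by (simp add: algebra_simps)
  qed
  then show ?case by blast
qed

text \<open>The linear combination of evaluations annihilates all images of \<open>T\<close> under invertible maps, hence, by
  polynomial dependence, under all linear maps. Maps of rank \<open>k\<close> turn this into \<open>\<Lambda> z z = 0\<close>, where
  \<open>\<Lambda>\<close> applies the combination to a product of two determinants. Every form \<open>d\<close> is a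
  contraction of such products with coefficients that are symmetric in each slot, so it is annihilated
  as well.\<close>

theorem polarized_irreducible:
  fixes T d :: "('a::euclidean_space \<times> 'a) multiset \<Rightarrow> complex" and N :: "'b \<Rightarrow> 'a multiset"
  assumes T: "polarized k T" "size M0 = k" "T M0 \<noteq> 0" and J: "finite J" "\<And>j. j \<in> J \<Longrightarrow> size (N j) = k"
    and zero: "\<And>g. linear g \<Longrightarrow> bij g \<Longrightarrow> (\<Sum>j\<in>J. c j * T (diagonals (image_mset g (N j)))) = 0"
    and d: "polarized k d"
  shows "(\<Sum>j\<in>J. c j * d (diagonals (N j))) = 0"
proof -
  have zero': "(\<Sum>j\<in>J. c j * T (diagonals (image_mset g (N j)))) = 0" if g: "linear g" for g :: "'a \<Rightarrow> 'a"
  proof -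
    have "\<exists>p. \<forall>j\<in>J. \<forall>\<epsilon>::real. T ({#} + diagonals (image_mset (\<lambda>x. g x + \<epsilon> *\<^sub>R x) (N j))) = poly (p j) (of_real \<epsilon>)"
      by (rule bchoice) (intro ballI perturbation_polynomial[OF T(1)], simp add: J)
    then obtain p where p: "\<And>j \<epsilon>. j \<in> J \<Longrightarrow> T (diagonals (image_mset (\<lambda>x. g x + \<epsilon> *\<^sub>R x) (N j))) = poly (p j) (of_real \<epsilon>)"
      by auto
    define q where "q = (\<Sum>j\<in>J. smult (c j) (p j))"
    have q: "(\<Sum>j\<in>J. c j * T (diagonals (image_mset (\<lambda>x. g x + \<epsilon> *\<^sub>R x) (N j)))) = poly q (of_real \<epsilon>)" for \<epsilon>
      by (simp add: q_def poly_sum p)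
    obtain B where B: "\<And>x. norm (g x) \<le> B * norm x" using linear_bounded[OF g] by blast
    have "poly q (of_real \<epsilon>) = 0" if "\<epsilon> > \<bar>B\<bar>" for \<epsilon>
    proof -
      have lin: "linear (\<lambda>x. g x + \<epsilon> *\<^sub>R x)"
        by (intro linear_compose_add g) (simp add: linear_iff scaleR_add_right)
      have "x = 0" if "g x + \<epsilon> *\<^sub>R x = 0" for x
      proof (rule ccontr)
        assume "x \<noteq> 0"
        have "\<epsilon> * norm x = norm (g x)"
          using that \<open>\<epsilon> > \<bar>B\<bar>\<close> by (metis abs_of_pos abs_ge_zero add.commute add_eq_0_iff le_less_trans norm_minus_cancel norm_scaleR)
        also have "\<dots> \<le> \<bar>B\<bar> * norm x" using B[of x] mult_right_mono[OF abs_ge_self norm_ge_zero, of B x] by linarith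
        also have "\<dots> < \<epsilon> * norm x" using \<open>\<epsilon> > \<bar>B\<bar>\<close> \<open>x \<noteq> 0\<close> by simp
        finally show False by simp
      qed
      then have "inj (\<lambda>x. g x + \<epsilon> *\<^sub>R x)" using linear_injective_0[OF lin] by blast
      then have "bij (\<lambda>x. g x + \<epsilon> *\<^sub>R x)" using linear_injective_imp_surjective[OF lin] by (simp add: bij_def)
      from zero[OF lin this] show ?thesis by (simp add: q)
    qed
    then have "of_real ` {\<bar>B\<bar><..} \<subseteq> {x. poly q x = 0}" by auto
    moreover have "infinite (complex_of_real ` {\<bar>B\<bar><..})"
      by (subst finite_image_iff) (auto simp: inj_on_def infinite_Ioi)
    ultimately have "q = 0" using poly_roots_finite[of q] finite_subset by blast
    then show ?thesis using q[of 0] by simp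
  qed
  have "\<forall>j\<in>J. \<exists>X. N j = image_mset X (mset_set {..<k})"
    using multiset_as_family[OF J(2)] by metis
  then obtain X where X: "\<And>j. j \<in> J \<Longrightarrow> N j = image_mset (X j) (mset_set {..<k})" by metis
  obtain N0 where N0: "size N0 = k" "T (diagonals N0) \<noteq> 0" using nonzero_on_diagonal[OF T] .
  obtain y where "N0 = image_mset y (mset_set {..<k})" using multiset_as_family[OF N0(1)] .
  with N0 have y: "T (pairing k y y) \<noteq> 0" by (simp add: pairing_diag)
  define \<Lambda> where "\<Lambda> i z = (\<Sum>j\<in>J. c j * of_real (gram_det k i (X j) * gram_det k z (X j)))" for i z
  have \<Lambda>0: "\<Lambda> z z = 0" for z
  proof -
    define g where "g = (\<lambda>x. \<Sum>a<k. (z a \<bullet> x) *\<^sub>R y a)"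
    have g: "linear g"
      unfolding g_def by (intro linear_compose_sum ballI) (simp add: linear_iff inner_add_right scaleR_add_left)
    have "T (diagonals (image_mset g (N j))) = of_real ((gram_det k z (X j))\<^sup>2) * T (pairing k y y)" if "j \<in> J" for j
    proof -
      have "diagonals (image_mset g (N j)) = pairing k (g \<circ> X j) (g \<circ> X j)"
        by (simp add: X[OF that] pairing_diag multiset.map_comp)
      then show ?thesis unfolding g_def by (simp only: polarized_rank_k_image[OF T(1)])
    qed
    then have "(\<Sum>j\<in>J. c j * T (diagonals (image_mset g (N j)))) = \<Lambda> z z * T (pairing k y y)"
      by (simp add: \<Lambda>_def sum_distrib_right power2_eq_square mult.assoc)
    then show ?thesis using zero'[OF g] y by simp
  qed
  have ml: "multilin k (\<lambda>i. \<Lambda> i z)" for z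
    unfolding multilin_def
  proof (intro conjI allI impI)
    note m = gram_det_multilin
    show "\<Lambda> i z = \<Lambda> i' z" if "\<forall>b<k. i b = i' b" for i i'
    proof -
      have "complex_of_real (gram_det k i (X j)) = of_real (gram_det k i' (X j))" for j
        by (rule multilinD(1)[OF m]) (use that in auto)
      then show ?thesis by (simp add: \<Lambda>_def)
    qed
    show "\<Lambda> (i(b := u + v)) z = \<Lambda> (i(b := u)) z + \<Lambda> (i(b := v)) z" if "b < k" for i b u v
      unfolding \<Lambda>_def of_real_mult multilinD(2)[OF m that] by (simp only: distrib_left distrib_right sum.distrib)
    show "\<Lambda> (i(b := e *\<^sub>R u)) z = of_real e * \<Lambda> (i(b := u)) z" if "b < k" for i b e u
      unfolding \<Lambda>_def of_real_mult multilinD(3)[OF m that] sum_distrib_left by (simp only: mult_ac)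
  qed
  have sy: "\<Lambda> i z = \<Lambda> z i" for i z by (simp add: \<Lambda>_def mult.commute)
  have "multilin k (\<lambda>j. \<Lambda> i j)" for i using ml[of i] by (simp add: sy[of i])
  from symmetric_antisymmetric_contraction[where d' = "\<lambda>i z. d (pairing k i z)" and B = Basis, OF ml this \<Lambda>0 pairing_swap_slot[OF d]]
  have C: "(\<Sum>i\<in>{..<k} \<rightarrow>\<^sub>E Basis. \<Sum>z\<in>{..<k} \<rightarrow>\<^sub>E Basis. d (pairing k i z) * \<Lambda> i z) = 0" .
  obtain \<gamma> where \<gamma>: "\<gamma> > 0" "\<And>(d :: ('a \<times> 'a) multiset \<Rightarrow> complex) X. polarized k d \<Longrightarrow>
    (\<Sum>i\<in>{..<k} \<rightarrow>\<^sub>E Basis. \<Sum>j\<in>{..<k} \<rightarrow>\<^sub>E Basis. d (pairing k i j) * of_real (gram_det k i X * gram_det k j X)) = of_real \<gamma> * d (pairing k X X)"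
    using gram_det_expansion_of_form[of k, where ?'a = 'a] by blast
  have "of_real \<gamma> * (\<Sum>j\<in>J. c j * d (diagonals (N j))) = (\<Sum>j\<in>J. c j * (of_real \<gamma> * d (pairing k (X j) (X j))))"
    unfolding sum_distrib_left by (rule sum.cong) (simp_all add: X pairing_diag)
  also have "\<dots> = (\<Sum>j\<in>J. \<Sum>i\<in>{..<k} \<rightarrow>\<^sub>E Basis. \<Sum>z\<in>{..<k} \<rightarrow>\<^sub>E Basis. c j * (d (pairing k i z) * of_real (gram_det k i (X j) * gram_det k z (X j))))"
    unfolding \<gamma>(2)[OF d, symmetric] sum_distrib_left ..
  also have "\<dots> = (\<Sum>i\<in>{..<k} \<rightarrow>\<^sub>E Basis. \<Sum>j\<in>J. \<Sum>z\<in>{..<k} \<rightarrow>\<^sub>E Basis. c j * (d (pairing k i z) * of_real (gram_det k i (X j) * gram_det k z (X j))))"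
    by (rule sum.swap)
  also have "\<dots> = (\<Sum>i\<in>{..<k} \<rightarrow>\<^sub>E Basis. \<Sum>z\<in>{..<k} \<rightarrow>\<^sub>E Basis. d (pairing k i z) * \<Lambda> i z)"
    by (rule sum.cong[OF refl], subst sum.swap) (simp add: \<Lambda>_def sum_distrib_left mult.left_commute)
  finally show ?thesis using C \<gamma>(1) by simp
qed

section \<open>Densities of mollified functionals\<close>

lemma Radon_sum:
  assumes \<mu>: "\<mu> \<in> Radon" and "finite Y" and "\<And>y. y \<in> Y \<Longrightarrow> \<Theta> y \<in> Cc"
  shows "(\<lambda>z. \<Sum>y\<in>Y. w y * \<Theta> y z) \<in> Cc \<and> \<mu> (\<lambda>z. \<Sum>y\<in>Y. w y * \<Theta> y z) = (\<Sum>y\<in>Y. w y * \<mu> (\<Theta> y))"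
  using assms(2,3)
proof (induction Y rule: finite_induct)
  case empty
  show ?case by (simp add: zero_in_Cc Radon_zero[OF \<mu>])
next
  case (insert y Y)
  have \<Theta>: "\<Theta> y \<in> Cc" by (rule insert.prems) simp
  have IH: "(\<lambda>z. \<Sum>y\<in>Y. w y * \<Theta> y z) \<in> Cc \<and> \<mu> (\<lambda>z. \<Sum>y\<in>Y. w y * \<Theta> y z) = (\<Sum>y\<in>Y. w y * \<mu> (\<Theta> y))"
    by (rule insert.IH) (rule insert.prems, erule insertI2)
  have e: "(\<lambda>z. \<Sum>y\<in>insert y Y. w y * \<Theta> y z) = (\<lambda>z. w y * \<Theta> y z + (\<Sum>y\<in>Y. w y * \<Theta> y z))"
    by (simp only: sum.insert[OF insert.hyps])
  show ?case unfolding e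
    by (intro conjI Cc_add Cc_cmult \<Theta> conjunct1[OF IH])
      (simp only: RadonD(1)[OF \<mu> Cc_cmult[OF \<Theta>] conjunct1[OF IH]] RadonD(2)[OF \<mu> \<Theta>] conjunct2[OF IH] sum.insert[OF insert.hyps])
qed

text \<open>Exchanging a Radon measure with an integral over a parameter, by Riemann sums: the same weights
  approximate the integral of \<open>\<mu> (\<Theta> y)\<close> and, uniformly in \<open>z\<close>, the integral of \<open>\<Theta> y z\<close>.\<close>

lemma Radon_integral:
  fixes \<mu> :: "'a::euclidean_space functional" and \<eta> :: "'b::euclidean_space \<Rightarrow> complex"
  assumes \<mu>: "\<mu> \<in> Radon" and \<eta>: "\<eta> \<in> Cc" and \<Theta>: "\<And>y. \<Theta> y \<in> Cc"
    and support: "\<And>S. compact S \<Longrightarrow> \<exists>K. compact K \<and> (\<forall>y\<in>S. supp (\<Theta> y) \<subseteq> K)"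
    and unif: "\<And>\<epsilon>. \<epsilon> > 0 \<Longrightarrow> \<exists>\<delta>>0. \<forall>y y' z. dist y y' < \<delta> \<longrightarrow> cmod (\<Theta> y z - \<Theta> y' z) < \<epsilon>"
  shows Radon_parameter_continuous: "continuous_on UNIV (\<lambda>y. \<mu> (\<Theta> y))"
    and "(\<integral>y. \<eta> y * \<mu> (\<Theta> y) \<partial>lborel) = \<mu> (\<lambda>z. \<integral>y. \<eta> y * \<Theta> y z \<partial>lborel)"
proof -
  have near: "\<exists>U. open U \<and> y0 \<in> U \<and> (\<forall>y\<in>U. (\<forall>z. cmod (\<Theta> y z - \<Theta> y0 z) \<le> \<epsilon>) \<and> cmod (\<mu> (\<Theta> y) - \<mu> (\<Theta> y0)) \<le> \<epsilon>)"
    if \<epsilon>: "\<epsilon> > 0" for y0 \<epsilon>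
  proof -
    obtain K where K: "compact K" "\<And>y. y \<in> cball y0 1 \<Longrightarrow> supp (\<Theta> y) \<subseteq> K"
      using support[OF compact_cball[of y0 1]] by blast
    obtain C where C: "\<And>\<phi> b. \<phi> \<in> Cc \<Longrightarrow> supp \<phi> \<subseteq> K \<Longrightarrow> (\<And>x. cmod (\<phi> x) \<le> b) \<Longrightarrow> cmod (\<mu> \<phi>) \<le> C * b"
      using Radon_bounded[OF \<mu> K(1)] by metis
    define e where "e = \<epsilon> / (\<bar>C\<bar> + 1)"
    have e: "e > 0" "e \<le> \<epsilon>" "\<bar>C\<bar> * e \<le> \<epsilon>"
    proof -
      show "e > 0" using \<epsilon> by (simp add: e_def)
      have "\<epsilon> = e * (\<bar>C\<bar> + 1)" using abs_ge_zero[of C] by (simp add: e_def)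
      then have "\<epsilon> = \<bar>C\<bar> * e + e" by (simp add: algebra_simps)
      moreover have "0 \<le> \<bar>C\<bar> * e" using \<open>e > 0\<close> by simp
      ultimately show "e \<le> \<epsilon>" "\<bar>C\<bar> * e \<le> \<epsilon>" using \<open>e > 0\<close> by linarith+
    qed
    obtain \<delta> where \<delta>: "\<delta> > 0" "\<And>y y' z. dist y y' < \<delta> \<Longrightarrow> cmod (\<Theta> y z - \<Theta> y' z) < e"
      using unif[OF e(1)] by blast
    have "(\<forall>z. cmod (\<Theta> y z - \<Theta> y0 z) \<le> \<epsilon>) \<and> cmod (\<mu> (\<Theta> y) - \<mu> (\<Theta> y0)) \<le> \<epsilon>" if y: "y \<in> ball y0 (min \<delta> 1)" for y
    proof
      have d: "dist y y0 < \<delta>" "y \<in> cball y0 1" using y by (auto simp: dist_commute)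
      have c: "cmod (\<Theta> y z - \<Theta> y0 z) \<le> e" for z using \<delta>(2)[OF d(1), of z] by simp
      show "\<forall>z. cmod (\<Theta> y z - \<Theta> y0 z) \<le> \<epsilon>" using c e(2) order_trans by blast
      have s: "supp (\<lambda>z. \<Theta> y z - \<Theta> y0 z) \<subseteq> K"
      proof (rule supp_minimal[OF compact_imp_closed[OF K(1)]])
        fix z assume "z \<notin> K"
        then have "z \<notin> supp (\<Theta> y)" "z \<notin> supp (\<Theta> y0)" using K(2)[OF d(2)] K(2)[of y0] by auto
        then show "\<Theta> y z - \<Theta> y0 z = 0" by (simp add: not_in_supp)
      qed
      have "cmod (\<mu> (\<lambda>z. \<Theta> y z - \<Theta> y0 z)) \<le> C * e" by (rule C[OF Cc_diff[OF \<Theta> \<Theta>] s c])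
      also have "\<dots> \<le> \<bar>C\<bar> * e" using e(1) by (intro mult_right_mono) auto
      finally show "cmod (\<mu> (\<Theta> y) - \<mu> (\<Theta> y0)) \<le> \<epsilon>"
        unfolding Radon_diff[OF \<mu> \<Theta> \<Theta>] using e(3) by linarith
    qed
    then show ?thesis using \<delta>(1) by (intro exI[of _ "ball y0 (min \<delta> 1)"]) simp
  qed
  have contI: "continuous_on UNIV F" if nr: "\<And>y0 \<epsilon>. \<epsilon> > 0 \<Longrightarrow> \<exists>U. open U \<and> y0 \<in> U \<and> (\<forall>y\<in>U. cmod (F y - F y0) \<le> \<epsilon>)" for F :: "'b \<Rightarrow> complex"
    unfolding continuous_on_def
  proof (intro ballI tendstoI)
    fix y0 and \<epsilon> :: real assume \<epsilon>: "\<epsilon> > 0"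
    obtain U where U: "open U" "y0 \<in> U" "\<forall>y\<in>U. cmod (F y - F y0) \<le> \<epsilon> / 2" using nr[of "\<epsilon> / 2" y0] \<epsilon> by auto
    show "eventually (\<lambda>y. dist (F y) (F y0) < \<epsilon>) (at y0)"
      unfolding eventually_at_topological
    proof (intro exI[of _ U] conjI U ballI impI)
      fix y assume "y \<in> U"
      with U(3) have "cmod (F y - F y0) \<le> \<epsilon> / 2" by blast
      then show "dist (F y) (F y0) < \<epsilon>" using \<epsilon> by (simp add: dist_norm)
    qed
  qed
  show cont: "continuous_on UNIV (\<lambda>y. \<mu> (\<Theta> y))"
  proof (rule contI)
    fix y0 and \<epsilon> :: real assume "\<epsilon> > 0"
    from near[OF this, of y0] show "\<exists>U. open U \<and> y0 \<in> U \<and> (\<forall>y\<in>U. cmod (\<mu> (\<Theta> y) - \<mu> (\<Theta> y0)) \<le> \<epsilon>)" by blast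
  qed
  have cont\<Theta>: "continuous_on UNIV (\<lambda>y. \<Theta> y z)" for z
  proof (rule contI)
    fix y0 and \<epsilon> :: real assume "\<epsilon> > 0"
    from near[OF this, of y0] show "\<exists>U. open U \<and> y0 \<in> U \<and> (\<forall>y\<in>U. cmod (\<Theta> y z - \<Theta> y0 z) \<le> \<epsilon>)" by blast
  qed
  define N where "N = (\<integral>y. cmod (\<eta> y) \<partial>lborel)"
  have N: "N \<ge> 0" unfolding N_def by simp
  define I where "I z = (\<integral>y. \<eta> y * \<Theta> y z \<partial>lborel)" for z
  define J where "J = (\<integral>y. \<eta> y * \<mu> (\<Theta> y) \<partial>lborel)"
  have approx: "\<exists>Y w. finite Y \<and> Y \<subseteq> supp \<eta> \<and> cmod (J - (\<Sum>y\<in>Y. w y * \<mu> (\<Theta> y))) \<le> \<epsilon> * N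
      \<and> (\<forall>z. cmod (I z - (\<Sum>y\<in>Y. w y * \<Theta> y z)) \<le> \<epsilon> * N)" if \<epsilon>: "\<epsilon> > 0" for \<epsilon>
  proof -
    define \<F> where "\<F> = insert (\<lambda>y. \<mu> (\<Theta> y)) (range (\<lambda>z y. \<Theta> y z))"
    have 1: "continuous_on UNIV F" if "F \<in> \<F>" for F
      using that cont cont\<Theta> unfolding \<F>_def by blast
    have 2: "\<exists>U. open U \<and> y0 \<in> U \<and> (\<forall>F\<in>\<F>. \<forall>y\<in>U. cmod (F y - F y0) \<le> \<epsilon>)" for y0
    proof -
      obtain U where "open U" "y0 \<in> U" "\<forall>y\<in>U. (\<forall>z. cmod (\<Theta> y z - \<Theta> y0 z) \<le> \<epsilon>) \<and> cmod (\<mu> (\<Theta> y) - \<mu> (\<Theta> y0)) \<le> \<epsilon>"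
        using near[OF \<epsilon>, of y0] by blast
      then show ?thesis by (intro exI[of _ U]) (simp add: \<F>_def)
    qed
    from integral_discretization[OF \<eta> \<epsilon> 1 2] show ?thesis by (simp add: \<F>_def I_def J_def N_def)
  qed
  obtain K where K: "compact K" "\<And>y. y \<in> supp \<eta> \<Longrightarrow> supp (\<Theta> y) \<subseteq> K" using support[OF CcD(2)[OF \<eta>]] by blast
  have zero: "\<Theta> y z = 0" if "y \<in> supp \<eta>" "z \<notin> K" for y z using K(2)[OF that(1)] that(2) by (intro not_in_supp) blast
  have cI: "continuous_on UNIV I"
  proof -
    have "\<exists>g. continuous_on UNIV g \<and> (\<forall>z. cmod (g z - I z) \<le> inverse (real (Suc n)) * N)" for n
    proof -
      obtain Y w where Y: "finite Y" "\<forall>z. cmod (I z - (\<Sum>y\<in>Y. w y * \<Theta> y z)) \<le> inverse (real (Suc n)) * N"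
        using approx[of "inverse (real (Suc n))"] by auto
      then show ?thesis
        by (intro exI[of _ "\<lambda>z. \<Sum>y\<in>Y. w y * \<Theta> y z"] conjI)
          (intro continuous_on_sum continuous_on_mult continuous_on_const CcD(1)[OF \<Theta>], simp add: norm_minus_commute)
    qed
    then obtain g where g: "\<And>n. continuous_on UNIV (g n)" "\<And>n z. cmod (g n z - I z) \<le> inverse (real (Suc n)) * N" by metis
    have lim: "(\<lambda>n. inverse (real (Suc n)) * N) \<longlonglongrightarrow> 0"
      using tendsto_mult_left_zero[OF LIMSEQ_inverse_real_of_nat] by simp
    have "uniform_limit UNIV g I sequentially"
    proof (rule uniform_limitI)
      fix e :: real assume "e > 0"
      from order_tendstoD(2)[OF lim this] show "eventually (\<lambda>n. \<forall>z\<in>UNIV. dist (g n z) (I z) < e) sequentially"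
        by eventually_elim (simp only: dist_norm ball_UNIV, intro allI, rule le_less_trans[OF g(2)])
    qed
    from uniform_limit_theorem[OF always_eventually[OF allI[OF g(1)]] this] show ?thesis by simp
  qed
  have I0: "I z = 0" if z: "z \<notin> K" for z
  proof -
    have "\<eta> y * \<Theta> y z = 0" for y using zero[OF _ z, of y] not_in_supp[of y \<eta>] by (cases "y \<in> supp \<eta>") auto
    then show ?thesis by (simp only: I_def Bochner_Integration.integral_zero)
  qed
  have sI: "supp I \<subseteq> K" by (rule supp_minimal[OF compact_imp_closed[OF K(1)] I0])
  have ICc: "I \<in> Cc" by (rule CcI[OF cI K(1) sI])
  obtain C where C: "\<And>\<phi> b. \<phi> \<in> Cc \<Longrightarrow> supp \<phi> \<subseteq> K \<Longrightarrow> (\<And>x. cmod (\<phi> x) \<le> b) \<Longrightarrow> cmod (\<mu> \<phi>) \<le> C * b"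
    using Radon_bounded[OF \<mu> K(1)] by metis
  have "cmod (J - \<mu> I) \<le> \<epsilon> * (N + \<bar>C\<bar> * N)" if \<epsilon>: "\<epsilon> > 0" for \<epsilon>
  proof -
    obtain Y w where Y: "finite Y" "Y \<subseteq> supp \<eta>" "\<And>z. cmod (I z - (\<Sum>y\<in>Y. w y * \<Theta> y z)) \<le> \<epsilon> * N"
      "cmod (J - (\<Sum>y\<in>Y. w y * \<mu> (\<Theta> y))) \<le> \<epsilon> * N" using approx[OF \<epsilon>] by blast
    define S where "S z = (\<Sum>y\<in>Y. w y * \<Theta> y z)" for z
    have S: "S \<in> Cc" "\<mu> S = (\<Sum>y\<in>Y. w y * \<mu> (\<Theta> y))"
      using Radon_sum[OF \<mu> Y(1) \<Theta>, of w] by (simp_all add: S_def[abs_def])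
    have "supp (\<lambda>z. I z - S z) \<subseteq> K"
    proof (rule supp_minimal[OF compact_imp_closed[OF K(1)]])
      fix z assume z: "z \<notin> K"
      then have "z \<notin> supp I" using sI by blast
      moreover have "S z = 0" unfolding S_def by (rule sum.neutral) (use zero[OF subsetD[OF Y(2)] z] in simp)
      ultimately show "I z - S z = 0" by (simp add: not_in_supp)
    qed
    from C[OF Cc_diff[OF ICc S(1)] this, of "\<epsilon> * N"] Y(3)
    have "cmod (\<mu> (\<lambda>z. I z - S z)) \<le> C * (\<epsilon> * N)" by (simp add: S_def)
    also have "\<dots> \<le> \<bar>C\<bar> * (\<epsilon> * N)" using \<epsilon> N by (intro mult_right_mono) auto
    finally have "cmod (\<mu> I - \<mu> S) \<le> \<bar>C\<bar> * (\<epsilon> * N)" unfolding Radon_diff[OF \<mu> ICc S(1)] .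
    moreover have "cmod (J - \<mu> S) \<le> \<epsilon> * N" unfolding S(2) by (rule Y(4))
    moreover have "cmod (J - \<mu> I) \<le> cmod (J - \<mu> S) + cmod (\<mu> I - \<mu> S)"
      using norm_triangle_ineq4[of "J - \<mu> S" "\<mu> I - \<mu> S"] by simp
    ultimately show ?thesis by (simp add: algebra_simps)
  qed
  note est = this
  define B where "B = N + \<bar>C\<bar> * N"
  have B: "B \<ge> 0" unfolding B_def using N by (intro add_nonneg_nonneg mult_nonneg_nonneg) simp_all
  have "cmod (J - \<mu> I) \<le> 0"
  proof (rule field_le_epsilon)
    fix e :: real assume e: "e > 0"
    have "e / (B + 1) > 0" using e B by simp
    from est[OF this] have "cmod (J - \<mu> I) \<le> e / (B + 1) * B" unfolding B_def .
    also have "\<dots> \<le> 0 + e" using e B by (simp add: field_simps)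
    finally show "cmod (J - \<mu> I) \<le> 0 + e" .
  qed
  then have JI: "J = \<mu> I" by simp
  show "(\<integral>y. \<eta> y * \<mu> (\<Theta> y) \<partial>lborel) = \<mu> (\<lambda>z. \<integral>y. \<eta> y * \<Theta> y z \<partial>lborel)"
    using JI unfolding J_def I_def .
qed

section \<open>Modules of fields of polarised forms\<close>

lemma polarizedI:
  assumes "\<And>M u u' v. Suc (size M) = k \<Longrightarrow> T (add_mset (u + u', v) M) = T (add_mset (u, v) M) + T (add_mset (u', v) M)"
    "\<And>M c u v. Suc (size M) = k \<Longrightarrow> T (add_mset (c *\<^sub>R u, v) M) = of_real c * T (add_mset (u, v) M)"
    "\<And>M u v. Suc (size M) = k \<Longrightarrow> T (add_mset (u, v) M) = T (add_mset (v, u) M)"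
    "\<And>M x y z. Suc (Suc (size M)) = k \<Longrightarrow>
        T (add_mset (x, y) (add_mset (x, z) M)) = - 1 / 2 * T (add_mset (x, x) (add_mset (y, z) M))"
  shows "polarized k T"
  unfolding polarized_def by (intro conjI allI impI) (rule assms, assumption)+

lemma polarized_zero: "polarized k (\<lambda>M. 0)"
  by (rule polarizedI) simp_all

lemma polarized_lincomb:
  assumes d: "polarized k d" and e: "polarized k e"
  shows "polarized k (\<lambda>M. a * d M + b * e M)"
proof (rule polarizedI, goal_cases)
  case (1 M u u' v)
  show ?case by (simp only: polarizedD(1)[OF d 1] polarizedD(1)[OF e 1] algebra_simps)
next
  case (2 M c u v)
  show ?case by (simp only: polarizedD(2)[OF d 2] polarizedD(2)[OF e 2] algebra_simps)
next
  case (3 M u v)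
  show ?case by (simp only: polarizedD(3)[OF d 3, of u v] polarizedD(3)[OF e 3, of u v])
next
  case (4 M x y z)
  show ?case by (simp only: polarizedD(4)[OF d 4] polarizedD(4)[OF e 4] algebra_simps)
qed

lemma polarized_sum_forms:
  assumes "finite J" "\<And>j. j \<in> J \<Longrightarrow> polarized k (d j)"
  shows "polarized k (\<lambda>M. \<Sum>j\<in>J. a j * d j M)"
  using assms
proof (induction J rule: finite_induct)
  case (insert j J)
  have "polarized k (\<lambda>M. a j * d j M + 1 * (\<Sum>j\<in>J. a j * d j M))"
    by (intro polarized_lincomb insert.IH insert.prems) simp_all
  then show ?case by (simp only: sum.insert[OF insert.hyps] mult_1_left)
qed (simp add: polarized_zero)

context
  fixes \<T> :: "('a::euclidean_space \<Rightarrow> ('a \<times> 'a) multiset \<Rightarrow> complex) set" and k :: nat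
  assumes form: "\<And>t x. t \<in> \<T> \<Longrightarrow> polarized k (t x)"
    and continuous_field: "\<And>t M. t \<in> \<T> \<Longrightarrow> size M = k \<Longrightarrow> continuous_on UNIV (\<lambda>x. t x M)"
    and zero_field: "(\<lambda>x M. 0) \<in> \<T>"
    and add_field: "\<And>t s. t \<in> \<T> \<Longrightarrow> s \<in> \<T> \<Longrightarrow> (\<lambda>x M. t x M + s x M) \<in> \<T>"
    and mult_field: "\<And>\<psi> t. continuous_on UNIV \<psi> \<Longrightarrow> t \<in> \<T> \<Longrightarrow> (\<lambda>x M. \<psi> x * t x M) \<in> \<T>"
    and spanning: "\<And>x J c d. finite J \<Longrightarrow> (\<And>N. N \<in> J \<Longrightarrow> size N = k) \<Longrightarrow>
        (\<And>t. t \<in> \<T> \<Longrightarrow> (\<Sum>N\<in>J. c N * t x (diagonals N)) = 0) \<Longrightarrow> polarized k d \<Longrightarrow> (\<Sum>N\<in>J. c N * d (diagonals N)) = 0"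
begin

lemma sum_field:
  assumes "finite J" "\<And>j. j \<in> J \<Longrightarrow> t j \<in> \<T>"
  shows "(\<lambda>x M. \<Sum>j\<in>J. t j x M) \<in> \<T>"
  using assms
proof (induction J rule: finite_induct)
  case empty
  show ?case using zero_field by (simp only: sum.empty)
next
  case (insert j J)
  have "(\<lambda>x M. t j x M + (\<Sum>j\<in>J. t j x M)) \<in> \<T>"
    by (rule add_field) (simp_all only: insert.prems insertI1 insert.IH insertI2)
  then show ?case by (simp only: sum.insert[OF insert.hyps])
qed

text \<open>Gaussian elimination over the ring of continuous functions, locally at \<open>x1\<close>. The members \<open>t j\<close> serve
  as a dual basis: on \<open>U\<close> every form is reproduced, at the grid points treated so far, from its values at \<open>J\<close>.
  For a new point \<open>a\<close>, \<open>lam x d\<close> is the error made at \<open>a\<close>. If the error at \<open>x1\<close> is nonzero for the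
  value of some field, that field is normalised and added. Otherwise the spanning hypothesis shows that the error
  vanishes for all forms, so \<open>a\<close> depends on \<open>J\<close> with constant coefficients, and then there is no error
  anywhere on \<open>U\<close>.\<close>

lemma elimination:
  assumes "finite S" "\<forall>N\<in>S. size N = k"
  shows "\<exists>U J t. open U \<and> x1 \<in> U \<and> J \<subseteq> S \<and> (\<forall>j\<in>J. t j \<in> \<T>) \<and>
    (\<forall>x\<in>U. \<forall>d. polarized k d \<longrightarrow> (\<forall>l\<in>S. d (diagonals l) = (\<Sum>j\<in>J. d (diagonals j) * t j x (diagonals l))))"
  using assms
proof (induction S rule: finite_induct)
  case empty
  show ?case by (intro exI[of _ UNIV] exI[of _ "{}"]) simp
next
  case (insert a S)
  have "\<exists>U J t. open U \<and> x1 \<in> U \<and> J \<subseteq> S \<and> (\<forall>j\<in>J. t j \<in> \<T>) \<and>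
    (\<forall>x\<in>U. \<forall>d. polarized k d \<longrightarrow> (\<forall>l\<in>S. d (diagonals l) = (\<Sum>j\<in>J. d (diagonals j) * t j x (diagonals l))))"
    using insert.prems by (intro insert.IH) simp
  then obtain U J t where U: "open U" "x1 \<in> U" and J: "J \<subseteq> S" and t: "\<forall>j\<in>J. t j \<in> \<T>"
    and rep: "\<forall>x\<in>U. \<forall>d. polarized k d \<longrightarrow> (\<forall>l\<in>S. d (diagonals l) = (\<Sum>j\<in>J. d (diagonals j) * t j x (diagonals l)))"
    by (elim exE conjE) (rule that)
  note repD = rep[rule_format]
  have fJ: "finite J" by (rule finite_subset[OF J insert.hyps(1)])
  have aJ: "a \<notin> J" using J insert.hyps(2) by (rule contra_subsetD)
  have sz: "size N = k" if "N \<in> insert a J" for N using that J by (intro bspec[OF insert.prems]) blast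
  define lam where "lam x d = d (diagonals a) - (\<Sum>j\<in>J. d (diagonals j) * t j x (diagonals a))" for x and d :: "('a \<times> 'a) multiset \<Rightarrow> complex"
  show ?case
  proof (cases "\<exists>\<tau>\<in>\<T>. lam x1 (\<tau> x1) \<noteq> 0")
    case False
    \<comment> \<open>the value at \<open>a\<close> is a fixed combination of those at \<open>J\<close>\<close>
    have R: "d (diagonals a) = (\<Sum>j\<in>J. d (diagonals j) * t j x1 (diagonals a))" if d: "polarized k d" for d
    proof -
      define c where "c N = (if N = a then 1 else - t N x1 (diagonals a))" for N
      have c: "(\<Sum>N\<in>insert a J. c N * d (diagonals N)) = lam x1 d" for d :: "('a \<times> 'a) multiset \<Rightarrow> complex"
      proof -
        have "(\<Sum>N\<in>J. c N * d (diagonals N)) = (\<Sum>N\<in>J. - (d (diagonals N) * t N x1 (diagonals a)))"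
          by (rule sum.cong[OF refl]) (use aJ in \<open>auto simp: c_def\<close>)
        then show ?thesis using fJ aJ by (simp add: lam_def c_def[of a] sum_negf)
      qed
      have "(\<Sum>N\<in>insert a J. c N * d (diagonals N)) = 0"
      proof (rule spanning[OF _ sz _ d])
        show "finite (insert a J)" using fJ by simp
        show "(\<Sum>N\<in>insert a J. c N * s x1 (diagonals N)) = 0" if "s \<in> \<T>" for s
          unfolding c using False that by blast
      qed
      then show ?thesis unfolding c lam_def by simp
    qed
    have "d (diagonals a) = (\<Sum>j\<in>J. d (diagonals j) * t j x (diagonals a))" if x: "x \<in> U" and d: "polarized k d" for x d
    proof -
      have "(\<Sum>j\<in>J. d (diagonals j) * t j x (diagonals a)) = (\<Sum>j\<in>J. d (diagonals j) * (\<Sum>i\<in>J. t j x (diagonals i) * t i x1 (diagonals a)))"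
        by (rule sum.cong[OF refl]) (simp only: R[OF form[OF bspec[OF t]], symmetric])
      also have "\<dots> = (\<Sum>i\<in>J. \<Sum>j\<in>J. (d (diagonals j) * t j x (diagonals i)) * t i x1 (diagonals a))"
        unfolding sum_distrib_left by (subst sum.swap) (simp only: mult.assoc)
      also have "\<dots> = (\<Sum>i\<in>J. d (diagonals i) * t i x1 (diagonals a))"
        by (rule sum.cong[OF refl]) (simp only: sum_distrib_right[symmetric] repD[OF x d subsetD[OF J], symmetric])
      finally show ?thesis using R[OF d] by simp
    qed
    then have "\<forall>x\<in>U. \<forall>d. polarized k d \<longrightarrow> (\<forall>l\<in>insert a S. d (diagonals l) = (\<Sum>j\<in>J. d (diagonals j) * t j x (diagonals l)))"
      using rep by simp
    then show ?thesis using U J t by (intro exI[of _ U] exI[of _ J] exI[of _ t]) blast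
  next
    case True
    then obtain \<tau> where \<tau>: "\<tau> \<in> \<T>" "lam x1 (\<tau> x1) \<noteq> 0" by blast
    define \<epsilon> where "\<epsilon> x = lam x (\<tau> x)" for x
    define m where "m = (cmod (\<epsilon> x1))\<^sup>2 / 4"
    have m: "m > 0" using \<tau>(2) by (simp add: m_def \<epsilon>_def)
    have cf: "continuous_on UNIV (\<lambda>x. s x (diagonals N))" if "s \<in> \<T>" "N \<in> insert a J" for s N
      by (rule continuous_field[OF that(1)]) (simp add: sz[OF that(2)])
    have c\<epsilon>: "continuous_on UNIV \<epsilon>"
      unfolding \<epsilon>_def[abs_def] lam_def
      by (intro continuous_intros cf \<tau>(1) bspec[OF t]) simp_all
    \<comment> \<open>a continuous function on the whole space that inverts \<open>\<epsilon>\<close> near \<open>x1\<close>\<close>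
    define h where "h x = cnj (\<epsilon> x) / of_real (max ((cmod (\<epsilon> x))\<^sup>2) m)" for x
    have ch: "continuous_on UNIV h"
      unfolding h_def[abs_def] using m by (intro continuous_intros c\<epsilon>) auto
    define U' where "U' = U \<inter> {x. m < (cmod (\<epsilon> x))\<^sup>2}"
    have U': "open U'" "x1 \<in> U'"
      unfolding U'_def using m U by (auto intro!: open_Int open_Collect_less continuous_intros c\<epsilon>) (simp add: m_def)
    have h1: "h x * \<epsilon> x = 1" if "x \<in> U'" for x
    proof -
      have "max ((cmod (\<epsilon> x))\<^sup>2) m = (cmod (\<epsilon> x))\<^sup>2" "\<epsilon> x \<noteq> 0" using that m by (auto simp: U'_def)
      then show ?thesis
        by (simp add: h_def mult.commute[of "cnj _"] complex_norm_square[symmetric] del: of_real_power)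
    qed
    \<comment> \<open>\<open>ta\<close> vanishes at the old grid points and is one at \<open>a\<close>\<close>
    define ta where "ta = (\<lambda>x M. h x * (\<tau> x M + (\<Sum>j\<in>J. (- \<tau> x (diagonals j)) * t j x M)))"
    have ta: "ta \<in> \<T>" unfolding ta_def
      by (intro mult_field[OF ch] add_field \<tau>(1) sum_field fJ mult_field continuous_intros cf bspec[OF t]) simp_all
    \<comment> \<open>the old dual basis is corrected so as to vanish at \<open>a\<close>\<close>
    define t' where "t' = (\<lambda>j x M. if j = a then ta x M else t j x M + (- t j x (diagonals a)) * ta x M)"
    have t'J: "t' j = (\<lambda>x M. t j x M + (- t j x (diagonals a)) * ta x M)" if "j \<in> J" for j
    proof -
      have "j \<noteq> a" using that aJ by blast
      then show ?thesis unfolding t'_def by (simp only: if_False)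
    qed
    have t'a: "t' a = ta" by (simp add: t'_def)
    have t': "t' j \<in> \<T>" if "j \<in> insert a J" for j
    proof (cases "j = a")
      case False
      then have j: "j \<in> J" using that by simp
      show ?thesis unfolding t'J[OF j]
        by (intro add_field mult_field ta continuous_intros cf bspec[OF t] j) simp_all
    qed (simp only: t'a ta)
    have taa: "ta x (diagonals a) = 1" if "x \<in> U'" for x
      using h1[OF that] by (simp add: ta_def \<epsilon>_def lam_def sum_negf)
    have taS: "ta x (diagonals l) = 0" if "x \<in> U'" "l \<in> S" for x l
    proof -
      have "x \<in> U" using that(1) by (simp add: U'_def)
      from repD[OF this form[OF \<tau>(1)] that(2)] show ?thesis by (simp add: ta_def sum_negf)
    qed
    have "d (diagonals l) = (\<Sum>j\<in>insert a J. d (diagonals j) * t' j x (diagonals l))" if x: "x \<in> U'" and d: "polarized k d" and l: "l \<in> insert a S" for x d l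
    proof (cases "l = a")
      case True
      have "(\<Sum>j\<in>J. d (diagonals j) * t' j x (diagonals a)) = 0"
        by (rule sum.neutral) (simp add: t'J taa[OF x])
      then show ?thesis using fJ aJ True by (simp add: t'a taa[OF x])
    next
      case False
      then have lS: "l \<in> S" using l by simp
      have "x \<in> U" using x by (simp add: U'_def)
      have "(\<Sum>j\<in>J. d (diagonals j) * t' j x (diagonals l)) = (\<Sum>j\<in>J. d (diagonals j) * t j x (diagonals l))"
        by (rule sum.cong[OF refl]) (simp add: t'J taS[OF x lS])
      then show ?thesis using fJ aJ repD[OF \<open>x \<in> U\<close> d lS] by (simp add: t'a taS[OF x lS])
    qed
    then show ?thesis using U' J t'
      by (intro exI[of _ U'] exI[of _ "insert a J"] exI[of _ t'] conjI) blast+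
  qed
qed

definition grid :: "'a multiset set" where
  "grid = {N. size N = k \<and> set_mset N \<subseteq> (\<lambda>(b, b'). b + b') ` (Basis \<times> Basis) \<union> Basis}"

lemma finite_grid: "finite grid"
proof -
  have "finite ((\<lambda>(b, b'). b + b') ` (Basis \<times> Basis) \<union> (Basis :: 'a set))" by simp
  from finite_lists_length_eq[OF this, of k]
  have "finite (mset ` {xs. set xs \<subseteq> (\<lambda>(b, b'). b + b') ` (Basis \<times> Basis) \<union> (Basis :: 'a set) \<and> length xs = k})"
    by (rule finite_imageI)
  moreover have "grid \<subseteq> mset ` {xs. set xs \<subseteq> (\<lambda>(b, b'). b + b') ` (Basis \<times> Basis) \<union> (Basis :: 'a set) \<and> length xs = k}"
  proof
    fix N assume N: "N \<in> grid"
    obtain xs where "mset xs = N" using ex_mset by blast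
    then show "N \<in> mset ` {xs. set xs \<subseteq> (\<lambda>(b, b'). b + b') ` (Basis \<times> Basis) \<union> (Basis :: 'a set) \<and> length xs = k}"
      using N by (intro image_eqI[of _ _ xs]) (auto simp: grid_def)
  qed
  ultimately show ?thesis by (rule finite_subset[rotated])
qed

text \<open>Elimination over the whole grid reproduces a form completely, since a form is determined by its values
  there. Multiplying with a function that vanishes off \<open>U\<close> makes the identity global.\<close>

theorem local_generation:
  obtains U where "open U" "x1 \<in> U"
    "\<And>d \<rho>. (\<And>x. polarized k (d x)) \<Longrightarrow> (\<And>M. size M = k \<Longrightarrow> continuous_on UNIV (\<lambda>x. d x M)) \<Longrightarrow> continuous_on UNIV \<rho> \<Longrightarrow>
      (\<And>x. x \<notin> U \<Longrightarrow> \<rho> x = 0) \<Longrightarrow> \<exists>t\<in>\<T>. \<forall>x M. size M = k \<longrightarrow> t x M = \<rho> x * d x M"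
proof -
  have gsz: "\<forall>N\<in>grid. size N = k" by (simp add: grid_def)
  obtain U J t where U: "open U" "x1 \<in> U" and J: "J \<subseteq> grid" and t: "\<forall>j\<in>J. t j \<in> \<T>"
    and rep: "\<forall>x\<in>U. \<forall>d. polarized k d \<longrightarrow> (\<forall>l\<in>grid. d (diagonals l) = (\<Sum>j\<in>J. d (diagonals j) * t j x (diagonals l)))"
    using elimination[OF finite_grid gsz, of x1] by (elim exE conjE) (rule that)
  show thesis
  proof (rule that[OF U])
    fix d :: "'a \<Rightarrow> ('a \<times> 'a) multiset \<Rightarrow> complex" and \<rho> :: "'a \<Rightarrow> complex"
    assume d: "\<And>x. polarized k (d x)" "\<And>M. size M = k \<Longrightarrow> continuous_on UNIV (\<lambda>x. d x M)"
      and \<rho>: "continuous_on UNIV \<rho>" "\<And>x. x \<notin> U \<Longrightarrow> \<rho> x = 0"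
    define s where "s = (\<lambda>x M. \<Sum>j\<in>J. (\<rho> x * d x (diagonals j)) * t j x M)"
    have "s \<in> \<T>" unfolding s_def
      by (intro sum_field finite_subset[OF J finite_grid] mult_field bspec[OF t] continuous_on_mult \<rho> d(2))
        (simp_all add: bspec[OF gsz subsetD[OF J]])
    moreover have "s x M = \<rho> x * d x M" if M: "size M = k" for x M
    proof (cases "x \<in> U")
      case True
      define e where "e M = 1 * d x M + (- 1) * (\<Sum>j\<in>J. d x (diagonals j) * t j x M)" for M
      have "polarized k e" unfolding e_def[abs_def]
        by (intro polarized_lincomb d(1) polarized_sum_forms finite_subset[OF J finite_grid] form bspec[OF t])
      then have "e M = 0"
      proof (rule polarized_diagonal_grid[OF _ _ M])
        fix N :: "'a multiset" assume "size N = k" "set_mset N \<subseteq> (\<lambda>(b, b'). b + b') ` (Basis \<times> Basis) \<union> Basis"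
        then have "N \<in> grid" by (simp add: grid_def)
        from rep[rule_format, OF True d(1) this] show "e (diagonals N) = 0" by (simp add: e_def)
      qed
      then have "d x M = (\<Sum>j\<in>J. d x (diagonals j) * t j x M)" by (simp add: e_def sum_negf)
      then show ?thesis by (simp add: s_def sum_distrib_left mult.assoc)
    qed (simp add: s_def \<rho>(2))
    ultimately show "\<exists>t\<in>\<T>. \<forall>x M. size M = k \<longrightarrow> t x M = \<rho> x * d x M" by (intro bexI[of _ s]) auto
  qed
qed

end

lemma reflect_supp_bound:
  fixes \<eta> :: "'a::euclidean_space \<Rightarrow> complex"
  assumes \<eta>: "\<eta> \<in> Cc" and S: "compact S"
  obtains K where "compact K" "\<And>x. x \<in> S \<Longrightarrow> supp (\<lambda>z. \<eta> (x - z)) \<subseteq> K"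
proof (rule that)
  show K: "compact {x + y | x y. x \<in> S \<and> y \<in> uminus ` supp \<eta>}"
    by (intro compact_sums S compact_continuous_image continuous_intros CcD(2)[OF \<eta>])
  fix x assume x: "x \<in> S"
  show "supp (\<lambda>z. \<eta> (x - z)) \<subseteq> {x + y | x y. x \<in> S \<and> y \<in> uminus ` supp \<eta>}"
  proof (rule supp_minimal[OF compact_imp_closed[OF K]], rule ccontr)
    fix z assume z: "z \<notin> {x + y | x y. x \<in> S \<and> y \<in> uminus ` supp \<eta>}" and nz: "\<eta> (x - z) \<noteq> 0"
    have "x - z \<in> supp \<eta>" using nz not_in_supp[of "x - z" \<eta>] by blast
    then have "z - x \<in> uminus ` supp \<eta>" by (rule rev_image_eqI) simp
    then have "z \<in> {x + y | x y. x \<in> S \<and> y \<in> uminus ` supp \<eta>}"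
      by (intro CollectI exI[of _ x] exI[of _ "z - x"]) (simp add: x)
    with z show False ..
  qed
qed

lemma reflect_Cc:
  fixes \<eta> :: "'a::euclidean_space \<Rightarrow> complex"
  assumes \<eta>: "\<eta> \<in> Cc"
  shows "(\<lambda>z. \<eta> (x - z)) \<in> Cc"
proof -
  obtain K where K: "compact K" "\<And>y. y \<in> {x} \<Longrightarrow> supp (\<lambda>z. \<eta> (y - z)) \<subseteq> K"
    using reflect_supp_bound[OF \<eta>, of "{x}"] by (metis compact_sing)
  show ?thesis
  proof (rule CcI[OF _ K(1) K(2)])
    show "continuous_on UNIV (\<lambda>z. \<eta> (x - z))"
      by (intro continuous_on_compose2[OF CcD(1)[OF \<eta>, of UNIV]] continuous_intros subset_UNIV)
  qed simp
qed

lemma reflect_family: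
  fixes \<eta> :: "'a::euclidean_space \<Rightarrow> complex"
  assumes \<eta>: "\<eta> \<in> Cc"
  shows "compact S \<Longrightarrow> \<exists>K. compact K \<and> (\<forall>x\<in>S. supp (\<lambda>z. \<eta> (x - z)) \<subseteq> K)"
    and "\<epsilon> > 0 \<Longrightarrow> \<exists>\<delta>>0. \<forall>x x' z. dist x x' < \<delta> \<longrightarrow> cmod (\<eta> (x - z) - \<eta> (x' - z)) < \<epsilon>"
proof -
  show "\<exists>K. compact K \<and> (\<forall>x\<in>S. supp (\<lambda>z. \<eta> (x - z)) \<subseteq> K)" if "compact S"
    using reflect_supp_bound[OF \<eta> that] by metis
  show "\<exists>\<delta>>0. \<forall>x x' z. dist x x' < \<delta> \<longrightarrow> cmod (\<eta> (x - z) - \<eta> (x' - z)) < \<epsilon>" if \<epsilon>: "\<epsilon> > 0"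
  proof -
    obtain \<delta> where \<delta>: "\<delta> > 0" "\<And>x y. dist x y < \<delta> \<Longrightarrow> cmod (\<eta> x - \<eta> y) < \<epsilon>"
      using Cc_uniformly_continuous[OF \<eta> \<epsilon>] by metis
    show ?thesis by (intro exI[of _ \<delta>] conjI \<delta>(1) allI impI \<delta>(2)) (simp add: dist_norm)
  qed
qed

text \<open>Both sides are the measure of the convolution \<open>z \<mapsto> \<integral> \<eta>(y) \<phi>(z + y) dy\<close>. The right hand side shows
  that the averaged measure has a continuous density.\<close>

lemma Radon_convolution:
  assumes \<mu>: "\<mu> \<in> Radon" and \<eta>: "\<eta> \<in> Cc" and \<phi>: "\<phi> \<in> Cc"
  shows "(\<integral>y. \<eta> y * \<mu> (tr y \<phi>) \<partial>lborel) = (\<integral>x. \<phi> x * \<mu> (\<lambda>z. \<eta> (x - z)) \<partial>lborel)"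
proof -
  have "(\<integral>y. \<eta> y * \<mu> (tr y \<phi>) \<partial>lborel) = \<mu> (\<lambda>z. \<integral>y. \<eta> y * tr y \<phi> z \<partial>lborel)"
  proof (rule Radon_integral(2)[OF \<mu> \<eta> tr_Cc[OF \<phi>]])
    fix S :: "'a set" assume S: "compact S"
    obtain K where "compact K" "\<And>y \<theta> :: 'a \<Rightarrow> complex. y \<in> S \<Longrightarrow> supp \<theta> \<subseteq> supp \<phi> \<Longrightarrow> supp (tr y \<theta>) \<subseteq> K"
      using supp_tr_bound[OF S CcD(2)[OF \<phi>]] by (metis (no_types))
    then show "\<exists>K. compact K \<and> (\<forall>y\<in>S. supp (tr y \<phi>) \<subseteq> K)" by blast
  next
    fix \<epsilon> :: real assume \<epsilon>: "\<epsilon> > 0"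
    show "\<exists>\<delta>>0. \<forall>y y' z. dist y y' < \<delta> \<longrightarrow> cmod (tr y \<phi> z - tr y' \<phi> z) < \<epsilon>"
      using tr_uniformly_close[OF \<phi> \<epsilon>] by metis
  qed
  also have "(\<lambda>z. \<integral>y. \<eta> y * tr y \<phi> z \<partial>lborel) = (\<lambda>z. \<integral>x. \<phi> x * \<eta> (x - z) \<partial>lborel)"
  proof
    fix z
    have "continuous_on UNIV (\<lambda>x. \<phi> x * \<eta> (x - z))"
      by (intro continuous_on_mult CcD(1)[OF \<phi>] continuous_on_compose2[OF CcD(1)[OF \<eta>, of UNIV]] continuous_intros subset_UNIV)
    from lborel_integral_shift[OF this, of z]
    show "(\<integral>y. \<eta> y * tr y \<phi> z \<partial>lborel) = (\<integral>x. \<phi> x * \<eta> (x - z) \<partial>lborel)"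
      by (simp add: tr_def add.commute mult.commute[of "\<eta> _"])
  qed
  also have "\<mu> \<dots> = (\<integral>x. \<phi> x * \<mu> (\<lambda>z. \<eta> (x - z)) \<partial>lborel)"
    by (rule Radon_integral(2)[OF \<mu> \<phi> reflect_Cc[OF \<eta>], symmetric]) (rule reflect_family[OF \<eta>], assumption)+
  finally show ?thesis .
qed

subsection \<open>Polarisation commutes with the natural operations\<close>

lemma tr_add_sqf: "\<exists>l. affine_map l \<and> tr y (\<lambda>x. f x + sqf u x) = (\<lambda>x. (tr y f x + sqf u x) + l x)"
proof (intro exI conjI)
  show "affine_map (\<lambda>x. ((u \<bullet> y) *\<^sub>R u) \<bullet> x + sqf u y)"
    unfolding affine_map_def by (intro exI[of _ "\<lambda>x. ((u \<bullet> y) *\<^sub>R u) \<bullet> x"] exI[of _ "sqf u y"] conjI refl bounded_linear.linear bounded_linear_inner_right)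
  show "tr y (\<lambda>x. f x + sqf u x) = (\<lambda>x. (tr y f x + sqf u x) + (((u \<bullet> y) *\<^sub>R u) \<bullet> x + sqf u y))"
    by (rule ext) (simp add: tr_def sqf_def inner_add_right power2_eq_square field_simps)
qed

text \<open>A translate of \<open>s\<^sub>u\<close> differs from \<open>s\<^sub>u\<close> by an affine function.\<close>

lemma dir_mollify:
  assumes D: "D \<in> P0LV_hom k" and \<eta>: "\<eta> \<in> Cc"
  shows "dir u (mollify \<eta> D) = mollify \<eta> (dir u D)"
proof (intro ext)
  fix f \<phi>
  note D0 = P0LV_homD(1)[OF D]
  show "dir u (mollify \<eta> D) f \<phi> = mollify \<eta> (dir u D) f \<phi>"
  proof (cases "f \<in> Conv \<and> \<phi> \<in> Cc")
    case True
    then have f: "f \<in> Conv" and \<phi>: "\<phi> \<in> Cc" by simp_all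
    have sq: "D (tr y (\<lambda>x. f x + sqf u x)) = D (\<lambda>x. tr y f x + sqf u x)" for y
    proof -
      obtain l where l: "affine_map l" "tr y (\<lambda>x. f x + sqf u x) = (\<lambda>x. (tr y f x + sqf u x) + l x)"
        using tr_add_sqf by blast
      show ?thesis unfolding l(2) by (rule P0LV_D(3)[OF D0 Conv_add_sqf[OF tr_Conv[OF f]] l(1)])
    qed
    have "dir u (mollify \<eta> D) f \<phi> = (\<integral>y. \<eta> y * D (tr y (\<lambda>x. f x + sqf u x)) (tr y \<phi>) \<partial>lborel) - (\<integral>y. \<eta> y * D (tr y f) (tr y \<phi>) \<partial>lborel)"
      by (simp only: dir_Conv[OF f] mollify_def f Conv_add_sqf[OF f] \<phi> simp_thms if_True)
    also have "\<dots> = (\<integral>y. \<eta> y * D (tr y (\<lambda>x. f x + sqf u x)) (tr y \<phi>) - \<eta> y * D (tr y f) (tr y \<phi>) \<partial>lborel)"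
      by (rule Bochner_Integration.integral_diff[symmetric]) (intro mollify_integrable D0 \<eta> \<phi> f Conv_add_sqf)+
    also have "\<dots> = mollify \<eta> (dir u D) f \<phi>"
      by (simp only: sq dir_Conv[OF tr_Conv[OF f]] mollify_def f \<phi> simp_thms if_True right_diff_distrib)
    finally show ?thesis .
  next
    case False
    then show ?thesis by (auto simp: dir_def mollify_def)
  qed
qed

lemma pol_mollify:
  assumes D: "D \<in> P0LV_hom (Suc k)" and \<eta>: "\<eta> \<in> Cc"
  shows "pol p (mollify \<eta> D) = mollify \<eta> (pol p D)"
proof (intro ext)
  fix f \<phi>
  show "pol p (mollify \<eta> D) f \<phi> = mollify \<eta> (pol p D) f \<phi>"
  proof (cases "f \<in> Conv \<and> \<phi> \<in> Cc")
    case True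
    then have f: "f \<in> Conv" and \<phi>: "\<phi> \<in> Cc" by simp_all
    note int = mollify_integrable[OF P0LV_homD(1)[OF dir_P0LV_hom[OF D]] \<eta> f \<phi>]
    have "(\<integral>y. (\<eta> y * dir (fst p + snd p) D (tr y f) (tr y \<phi>) - \<eta> y * dir (fst p) D (tr y f) (tr y \<phi>)
         - \<eta> y * dir (snd p) D (tr y f) (tr y \<phi>)) / 2 \<partial>lborel)
       = (mollify \<eta> (dir (fst p + snd p) D) f \<phi> - mollify \<eta> (dir (fst p) D) f \<phi> - mollify \<eta> (dir (snd p) D) f \<phi>) / 2"
      by (simp only: mollify_def f \<phi> simp_thms if_True integral_divide_zero
          Bochner_Integration.integral_diff[OF Bochner_Integration.integrable_diff[OF int int] int]
          Bochner_Integration.integral_diff[OF int int])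
    moreover have "pol p (mollify \<eta> D) f \<phi>
       = (mollify \<eta> (dir (fst p + snd p) D) f \<phi> - mollify \<eta> (dir (fst p) D) f \<phi> - mollify \<eta> (dir (snd p) D) f \<phi>) / 2"
      by (simp only: pol_def dir_mollify[OF D \<eta>])
    moreover have "mollify \<eta> (pol p D) f \<phi> = (\<integral>y. (\<eta> y * dir (fst p + snd p) D (tr y f) (tr y \<phi>)
         - \<eta> y * dir (fst p) D (tr y f) (tr y \<phi>) - \<eta> y * dir (snd p) D (tr y f) (tr y \<phi>)) / 2 \<partial>lborel)"
      by (simp only: mollify_def pol_def f \<phi> simp_thms if_True right_diff_distrib times_divide_eq_right)
    ultimately show ?thesis by (simp only:)
  next
    case False
    then show ?thesis by (auto simp: pol_def dir_def mollify_def)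
  qed
qed

lemma iter_pol_mollify:
  assumes "D \<in> P0LV_hom (size M + k)" "\<eta> \<in> Cc"
  shows "iter_pol M (mollify \<eta> D) = mollify \<eta> (iter_pol M D)"
  using assms
proof (induction M arbitrary: D)
  case (add p M)
  have D: "D \<in> P0LV_hom (Suc (size M + k))" using add.prems(1) by simp
  show ?case
    by (simp only: iter_pol_add' pol_mollify[OF D add.prems(2)] add.IH[OF pol_P0LV_hom[OF D] add.prems(2)])
qed simp

lemma iter_pol_module: "iter_pol M (module_action \<psi> D) = module_action \<psi> (iter_pol M D)"
proof -
  have "pol p (module_action \<psi> D) = module_action \<psi> (pol p D)" for p and D :: "'a local_functional"
    by (intro ext) (simp add: pol_def dir_def module_action_def radon_scale_def)
  then show ?thesis by (induction M) (simp_all add: iter_pol_add)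
qed

lemma iter_pol_lincomb:
  "iter_pol M (\<lambda>f \<phi>. a * D f \<phi> + b * E f \<phi>) = (\<lambda>f \<phi>. a * iter_pol M D f \<phi> + b * iter_pol M E f \<phi>)"
proof -
  have "pol p (\<lambda>f \<phi>. a * D f \<phi> + b * E f \<phi>) = (\<lambda>f \<phi>. a * pol p D f \<phi> + b * pol p E f \<phi>)" for p and D E :: "'a local_functional"
    by (intro ext) (simp add: pol_def dir_def field_simps)
  then show ?thesis by (induction M) (simp_all add: iter_pol_add)
qed

text \<open>Composing \<open>s\<^sub>u\<close> with \<open>L\<close> gives \<open>s\<^sub>v\<close> for \<open>v = adjoint L u\<close>.\<close>

lemma iter_pol_linear_image:
  fixes L :: "'a::euclidean_space \<Rightarrow> 'a"
  assumes L: "linear L" "bij L"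
  shows "iter_pol M (aff_action L D) = aff_action L (iter_pol (image_mset (map_prod (adjoint L) (adjoint L)) M) D)"
proof -
  have lin': "linear (adjoint L)" by (rule adjoint_linear[OF L(1)])
  have am: "affine_map L" unfolding affine_map_def by (intro exI[of _ L] exI[of _ 0] conjI L(1)) simp
  have ami: "affine_map (inv L)" unfolding affine_map_def
    using inj_linear_imp_inv_linear[OF L(1) bij_is_inj[OF L(2)]] by (intro exI[of _ "inv L"] exI[of _ 0]) simp
  have Conv_iff: "f \<circ> L \<in> Conv \<longleftrightarrow> f \<in> Conv" for f
  proof
    assume "f \<circ> L \<in> Conv"
    from Conv_comp_affine[OF this ami] show "f \<in> Conv" by (simp add: surj_f_inv_f[OF bij_is_surj[OF L(2)]])
  next
    assume "f \<in> Conv"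
    from Conv_comp_affine[OF this am] show "f \<circ> L \<in> Conv" by (simp add: comp_def)
  qed
  have sq: "(\<lambda>x. f x + sqf u x) \<circ> L = (\<lambda>x. (f \<circ> L) x + sqf (adjoint L u) x)" for f u
  proof
    fix x
    have "u \<bullet> L x = adjoint L u \<bullet> x" using adjoint_works[OF L(1), of x u] by (simp add: inner_commute)
    then show "((\<lambda>x. f x + sqf u x) \<circ> L) x = (f \<circ> L) x + sqf (adjoint L u) x" by (simp add: sqf_def)
  qed
  have "dir u (aff_action L D) = aff_action L (dir (adjoint L u) D)" for u and D :: "'a local_functional"
    by (intro ext) (simp add: dir_def aff_action_def radon_push_def sq Conv_iff)
  then have "pol p (aff_action L D) = aff_action L (pol (map_prod (adjoint L) (adjoint L) p) D)" for p and D :: "'a local_functional"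
    by (intro ext) (simp add: pol_def aff_action_def radon_push_def linear_add[OF lin'])
  then show ?thesis by (induction M) (simp_all add: iter_pol_add)
qed

lemma polarized_iter_pol:
  assumes D: "D \<in> P0LV_hom k" and f: "f \<in> Conv" and \<phi>: "\<phi> \<in> Cc"
  shows "polarized k (\<lambda>M. iter_pol M D f \<phi>)"
proof (rule polarizedI, goal_cases)
  case (1 M u u' v)
  then have "D \<in> P0LV_hom (size M + 1)" using D by simp
  from pol_add[OF P0LV_homD(1)[OF iter_pol_P0LV_hom[OF this]] f \<phi>] show ?case by (simp only: iter_pol_add)
next
  case (2 M c u v)
  then have "D \<in> P0LV_hom (size M + 1)" using D by simp
  from pol_scale[OF P0LV_homD(1)[OF iter_pol_P0LV_hom[OF this]] f \<phi>] show ?case by (simp only: iter_pol_add)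
next
  case (3 M u v)
  show ?case by (simp only: iter_pol_add pol_sym[of u v])
next
  case (4 M x y z)
  then have "size M + Suc (Suc 0) = k" by simp
  then have "D \<in> P0LV_hom (size M + Suc (Suc 0))" using D by simp
  from pol_pol_relation[OF iter_pol_P0LV_hom[OF this] f \<phi>] show ?case by (simp only: iter_pol_add)
qed

subsection \<open>Densities\<close>

text \<open>\<^term>\<open>t x\<close> collects the values at \<^term>\<open>x\<close> of the densities of the measures \<^term>\<open>iter_pol M D (\<lambda>x. 0)\<close>.\<close>

definition has_density :: "nat \<Rightarrow> 'a::euclidean_space local_functional \<Rightarrow> ('a \<Rightarrow> ('a \<times> 'a) multiset \<Rightarrow> complex) \<Rightarrow> bool" where
  "has_density k D t \<longleftrightarrow> D \<in> P0LV_hom k \<and> (\<forall>x. polarized k (t x)) \<and>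
     (\<forall>M. size M = k \<longrightarrow> continuous_on UNIV (\<lambda>x. t x M)) \<and>
     (\<forall>M \<phi>. size M = k \<longrightarrow> \<phi> \<in> Cc \<longrightarrow> iter_pol M D (\<lambda>x. 0) \<phi> = (\<integral>x. \<phi> x * t x M \<partial>lborel))"

lemma has_densityI:
  assumes "D \<in> P0LV_hom k" "\<And>x. polarized k (t x)" "\<And>M. size M = k \<Longrightarrow> continuous_on UNIV (\<lambda>x. t x M)"
    "\<And>M \<phi>. size M = k \<Longrightarrow> \<phi> \<in> Cc \<Longrightarrow> iter_pol M D (\<lambda>x. 0) \<phi> = (\<integral>x. \<phi> x * t x M \<partial>lborel)"
  shows "has_density k D t"
  unfolding has_density_def using assms by (intro conjI allI impI)

lemma has_densityD:
  assumes "has_density k D t"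
  shows "D \<in> P0LV_hom k" "polarized k (t x)" "size M = k \<Longrightarrow> continuous_on UNIV (\<lambda>x. t x M)"
    "size M = k \<Longrightarrow> \<phi> \<in> Cc \<Longrightarrow> iter_pol M D (\<lambda>x. 0) \<phi> = (\<integral>x. \<phi> x * t x M \<partial>lborel)"
  using assms unfolding has_density_def by (elim conjE; simp only:)+

lemma mollify_has_density:
  assumes D: "D \<in> P0LV_hom k" and \<eta>: "\<eta> \<in> Cc"
  shows "has_density k (mollify \<eta> D) (\<lambda>x M. iter_pol M D (\<lambda>x. 0) (\<lambda>z. \<eta> (x - z)))"
proof (rule has_densityI)
  show "mollify \<eta> D \<in> P0LV_hom k" by (rule mollify_P0LV_hom[OF D \<eta>])
  show "polarized k (\<lambda>M. iter_pol M D (\<lambda>x. 0) (\<lambda>z. \<eta> (x - z)))" for x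
    by (rule polarized_iter_pol[OF D Conv_const reflect_Cc[OF \<eta>]])
  fix M :: "('a \<times> 'a) multiset" assume M: "size M = k"
  then have D': "D \<in> P0LV_hom (size M + 0)" using D by simp
  have R: "iter_pol M D (\<lambda>x. 0) \<in> Radon"
    by (rule P0LV_D(1)[OF P0LV_homD(1)[OF iter_pol_P0LV_hom[OF D']] Conv_const])
  show "continuous_on UNIV (\<lambda>x. iter_pol M D (\<lambda>x. 0) (\<lambda>z. \<eta> (x - z)))"
    by (rule Radon_parameter_continuous[OF R \<eta> reflect_Cc[OF \<eta>]]) (rule reflect_family[OF \<eta>], assumption)+
  fix \<phi> :: "'a \<Rightarrow> complex" assume \<phi>: "\<phi> \<in> Cc"
  have tr0: "tr y (\<lambda>x. 0 :: real) = (\<lambda>x. 0)" for y :: 'a by (simp add: tr_def)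
  have "iter_pol M (mollify \<eta> D) (\<lambda>x. 0) \<phi> = (\<integral>y. \<eta> y * iter_pol M D (\<lambda>x. 0) (tr y \<phi>) \<partial>lborel)"
    unfolding iter_pol_mollify[OF D' \<eta>] by (simp only: mollify_def Conv_const \<phi> tr0 simp_thms if_True)
  also have "\<dots> = (\<integral>x. \<phi> x * iter_pol M D (\<lambda>x. 0) (\<lambda>z. \<eta> (x - z)) \<partial>lborel)"
    by (rule Radon_convolution[OF R \<eta> \<phi>])
  finally show "iter_pol M (mollify \<eta> D) (\<lambda>x. 0) \<phi> = (\<integral>x. \<phi> x * iter_pol M D (\<lambda>x. 0) (\<lambda>z. \<eta> (x - z)) \<partial>lborel)" .
qed

lemma density_unique:
  assumes D: "has_density k D t" and E: "has_density k E s" and eq: "\<And>x M. size M = k \<Longrightarrow> t x M = s x M"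
  shows "D = E"
proof (intro ext)
  fix f \<phi>
  note D0 = P0LV_homD(1)[OF has_densityD(1)[OF D]] and E0 = P0LV_homD(1)[OF has_densityD(1)[OF E]]
  show "D f \<phi> = E f \<phi>"
  proof (cases "f \<in> Conv \<and> \<phi> \<in> Cc")
    case True
    then have f: "f \<in> Conv" and \<phi>: "\<phi> \<in> Cc" by simp_all
    have "1 * D f \<phi> + (- 1) * E f \<phi> = 0"
    proof (rule eq_0_if_iter_pol_eq_0[OF P0LV_hom_lincomb[OF has_densityD(1)[OF D] has_densityD(1)[OF E], of 1 "- 1"] _ f \<phi>])
      fix M :: "('a \<times> 'a) multiset" and \<theta> :: "'a \<Rightarrow> complex" assume M: "size M = k" and \<theta>: "\<theta> \<in> Cc"
      show "iter_pol M (\<lambda>f \<phi>. 1 * D f \<phi> + (- 1) * E f \<phi>) (\<lambda>x. 0) \<theta> = 0"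
        unfolding iter_pol_lincomb has_densityD(4)[OF D M \<theta>] has_densityD(4)[OF E M \<theta>] by (simp add: eq[OF M])
    qed
    then show ?thesis by simp
  next
    case False
    then show ?thesis using eq_off_Cc[OF D0, of \<phi> f] eq_off_Cc[OF E0, of \<phi> f] P0LV_D(2)[OF D0, of f] P0LV_D(2)[OF E0, of f]
      by (metis (no_types))
  qed
qed

lemma module_P0LV_hom:
  assumes D: "D \<in> P0LV_hom k" and \<psi>: "continuous_on UNIV \<psi>"
  shows "module_action \<psi> D \<in> P0LV_hom k"
proof (rule P0LV_hom_I)
  note D0 = P0LV_homD(1)[OF D]
  note Cc = Cc_mult[OF _ \<psi>]
  have e: "module_action \<psi> D f \<phi> = D f (\<lambda>x. \<psi> x * \<phi> x)" if "\<phi> \<in> Cc" for f \<phi>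
    using that by (simp add: module_action_def radon_scale_def)
  show "module_action \<psi> D f \<in> Radon" if f: "f \<in> Conv" for f
  proof (rule RadonI)
    note R = P0LV_D(1)[OF D0 f]
    show "module_action \<psi> D f (\<lambda>x. \<phi> x + \<theta> x) = module_action \<psi> D f \<phi> + module_action \<psi> D f \<theta>" if "\<phi> \<in> Cc" "\<theta> \<in> Cc" for \<phi> \<theta>
      by (simp only: e that Cc_add distrib_left RadonD(1)[OF R Cc[OF that(1)] Cc[OF that(2)]])
    show "module_action \<psi> D f (\<lambda>x. c * \<phi> x) = c * module_action \<psi> D f \<phi>" if "\<phi> \<in> Cc" for c \<phi>
      by (simp only: e that Cc_cmult mult.left_commute[of "\<psi> _"] RadonD(2)[OF R Cc[OF that]])
    show "module_action \<psi> D f \<phi> = 0" if "\<phi> \<notin> Cc" for \<phi>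
      using that by (simp add: module_action_def radon_scale_def)
    fix K :: "'a set" assume K: "compact K"
    obtain C where C: "\<And>\<phi> b. \<phi> \<in> Cc \<Longrightarrow> supp \<phi> \<subseteq> K \<Longrightarrow> (\<And>x. cmod (\<phi> x) \<le> b) \<Longrightarrow> cmod (D f \<phi>) \<le> C * b"
      using Radon_bounded[OF R K] by metis
    have "bounded (\<psi> ` K)" by (intro compact_imp_bounded compact_continuous_image continuous_on_subset[OF \<psi>] K subset_UNIV)
    then obtain B where B: "\<And>x. x \<in> K \<Longrightarrow> cmod (\<psi> x) \<le> B" "B > 0" unfolding bounded_pos by blast
    have "cmod (module_action \<psi> D f \<phi>) \<le> (C * B) * b" if \<phi>: "\<phi> \<in> Cc" "supp \<phi> \<subseteq> K" "\<forall>x. cmod (\<phi> x) \<le> b" for \<phi> b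
    proof -
      have "cmod (D f (\<lambda>x. \<psi> x * \<phi> x)) \<le> C * (B * b)"
      proof (rule C[OF Cc[OF \<phi>(1)] order_trans[OF supp_mult \<phi>(2)]])
        fix x
        show "cmod (\<psi> x * \<phi> x) \<le> B * b"
        proof (cases "x \<in> K")
          case True
          show ?thesis unfolding norm_mult
            by (rule mult_mono[OF B(1)[OF True] spec[OF \<phi>(3)]]) (use B(2) in simp_all)
        next
          case False
          then have "\<phi> x = 0" using \<phi>(2) by (intro not_in_supp) blast
          moreover have "b \<ge> 0" using spec[OF \<phi>(3), of x] norm_ge_zero order_trans by blast
          ultimately show ?thesis using B(2) by simp
        qed
      qed
      then show ?thesis by (simp only: e[OF \<phi>(1)] mult.assoc)
    qed
    then show "\<exists>C. \<forall>\<phi> b. \<phi> \<in> Cc \<longrightarrow> supp \<phi> \<subseteq> K \<longrightarrow> (\<forall>x. cmod (\<phi> x) \<le> b) \<longrightarrow> cmod (module_action \<psi> D f \<phi>) \<le> C * b"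
      by (intro exI[of _ "C * B"] allI impI)
  qed
  show "module_action \<psi> D f = (\<lambda>\<phi>. 0)" if "f \<notin> Conv" for f
    by (rule ext) (simp add: module_action_def radon_scale_def P0LV_D(2)[OF D0 that])
  show "continuous_on Conv (\<lambda>f. module_action \<psi> D f \<phi>)" if "\<phi> \<in> Cc" for \<phi>
    unfolding e[OF that] by (rule P0LV_continuous[OF D0])
  show "module_action \<psi> D f \<phi> = module_action \<psi> D h \<phi>"
    if h: "f \<in> Conv" "h \<in> Conv" "open U" "\<And>x. x \<in> U \<Longrightarrow> f x = h x" "\<phi> \<in> Cc" "supp \<phi> \<subseteq> U" for f h U \<phi>
    unfolding e[OF h(5)] by (rule P0LV_D(4)[OF D0 h(1-4) Cc[OF h(5)] order_trans[OF supp_mult h(6)]])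
  show "module_action \<psi> D (\<lambda>x. f x + l x) \<phi> = module_action \<psi> D f \<phi>" if "f \<in> Conv" "affine_map l" "\<phi> \<in> Cc" for f l \<phi>
    by (simp only: module_action_def P0LV_D(3)[OF D0 that(1,2)])
  show "module_action \<psi> D (\<lambda>x. t * f x) \<phi> = of_real (t ^ k) * module_action \<psi> D f \<phi>" if "f \<in> Conv" "t \<ge> 0" "\<phi> \<in> Cc" for f t \<phi>
    unfolding e[OF that(3)] by (rule P0LV_homD(2)[OF D that(1,2)])
qed

lemma module_has_density:
  assumes D: "has_density k D t" and \<psi>: "continuous_on UNIV \<psi>"
  shows "has_density k (module_action \<psi> D) (\<lambda>x M. \<psi> x * t x M)"
proof (rule has_densityI)
  show "module_action \<psi> D \<in> P0LV_hom k" by (rule module_P0LV_hom[OF has_densityD(1)[OF D] \<psi>])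
  show "polarized k (\<lambda>M. \<psi> x * t x M)" for x
    using polarized_lincomb[OF has_densityD(2)[OF D] polarized_zero, of "\<psi> x" _ 0] by simp
  show "continuous_on UNIV (\<lambda>x. \<psi> x * t x M)" if "size M = k" for M
    by (intro continuous_on_mult \<psi> has_densityD(3)[OF D that])
  show "iter_pol M (module_action \<psi> D) (\<lambda>x. 0) \<phi> = (\<integral>x. \<phi> x * (\<psi> x * t x M) \<partial>lborel)" if "size M = k" "\<phi> \<in> Cc" for M \<phi>
  proof -
    have "iter_pol M (module_action \<psi> D) (\<lambda>x. 0) \<phi> = (\<integral>x. (\<psi> x * \<phi> x) * t x M \<partial>lborel)"
      unfolding iter_pol_module
      by (simp only: module_action_def radon_scale_def that(2) if_True has_densityD(4)[OF D that(1) Cc_mult[OF that(2) \<psi>]])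
    also have "\<dots> = (\<integral>x. \<phi> x * (\<psi> x * t x M) \<partial>lborel)"
      by (rule Bochner_Integration.integral_cong[OF refl]) (simp only: mult_ac)
    finally show ?thesis .
  qed
qed

lemma add_has_density:
  assumes D: "has_density k D t" and E: "has_density k E s"
  shows "has_density k (\<lambda>f \<phi>. D f \<phi> + E f \<phi>) (\<lambda>x M. t x M + s x M)"
proof (rule has_densityI)
  show "(\<lambda>f \<phi>. D f \<phi> + E f \<phi>) \<in> P0LV_hom k"
    using P0LV_hom_lincomb[OF has_densityD(1)[OF D] has_densityD(1)[OF E], of 1 1] by (simp only: mult_1_left)
  show "polarized k (\<lambda>M. t x M + s x M)" for x
    using polarized_lincomb[OF has_densityD(2)[OF D] has_densityD(2)[OF E], of 1 x 1 x] by (simp only: mult_1_left)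
  show "continuous_on UNIV (\<lambda>x. t x M + s x M)" if "size M = k" for M
    by (intro continuous_on_add has_densityD(3)[OF D that] has_densityD(3)[OF E that])
  show "iter_pol M (\<lambda>f \<phi>. D f \<phi> + E f \<phi>) (\<lambda>x. 0) \<phi> = (\<integral>x. \<phi> x * (t x M + s x M) \<partial>lborel)" if M: "size M = k" and \<phi>: "\<phi> \<in> Cc" for M \<phi>
    using iter_pol_lincomb[of M 1 D 1 E]
    by (simp only: mult_1_left has_densityD(4)[OF D M \<phi>] has_densityD(4)[OF E M \<phi>] distrib_left
        Bochner_Integration.integral_add[OF Cc_integrable_mult[OF \<phi> has_densityD(3)[OF D M]] Cc_integrable_mult[OF \<phi> has_densityD(3)[OF E M]]])
qed

section \<open>Approximation by elements of an affine invariant module\<close>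

text \<open>The closure in the topology of uniform convergence on compact sets of convex functions, stated with finitely
  many test functions at a time.\<close>

definition approximable :: "'a::euclidean_space local_functional set \<Rightarrow> nat \<Rightarrow> 'a local_functional set" where
  "approximable W k = {D \<in> P0LV_hom k. \<forall>K \<Phi> \<epsilon>. compact K \<longrightarrow> K \<subseteq> Conv \<longrightarrow> finite \<Phi> \<longrightarrow> \<Phi> \<subseteq> Cc \<longrightarrow> \<epsilon> > 0 \<longrightarrow>
     (\<exists>E\<in>W. \<forall>f\<in>K. \<forall>\<phi>\<in>\<Phi>. cmod (D f \<phi> - E f \<phi>) \<le> \<epsilon>)}"

lemma approximableI:
  assumes "D \<in> P0LV_hom k"
    and "\<And>K \<Phi> \<epsilon>. compact K \<Longrightarrow> K \<subseteq> Conv \<Longrightarrow> finite \<Phi> \<Longrightarrow> \<Phi> \<subseteq> Cc \<Longrightarrow> \<epsilon> > 0 \<Longrightarrow>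
      \<exists>E\<in>W. \<forall>f\<in>K. \<forall>\<phi>\<in>\<Phi>. cmod (D f \<phi> - E f \<phi>) \<le> \<epsilon>"
  shows "D \<in> approximable W k"
  unfolding approximable_def mem_Collect_eq by (intro conjI allI impI assms(1)) (rule assms(2))

lemma approximableD:
  assumes "D \<in> approximable W k"
  shows "D \<in> P0LV_hom k"
    "compact K \<Longrightarrow> K \<subseteq> Conv \<Longrightarrow> finite \<Phi> \<Longrightarrow> \<Phi> \<subseteq> Cc \<Longrightarrow> \<epsilon> > 0 \<Longrightarrow>
      \<exists>E\<in>W. \<forall>f\<in>K. \<forall>\<phi>\<in>\<Phi>. cmod (D f \<phi> - E f \<phi>) \<le> \<epsilon>"
  using assms unfolding approximable_def mem_Collect_eq by (elim conjE; simp only:)+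

lemma approximable_approximable: "approximable (approximable W k) k \<subseteq> approximable W k"
proof
  fix D assume D: "D \<in> approximable (approximable W k) k"
  show "D \<in> approximable W k"
  proof (rule approximableI[OF approximableD(1)[OF D]])
    fix K :: "('a \<Rightarrow> real) set" and \<Phi> :: "('a \<Rightarrow> complex) set" and \<epsilon> :: real
    assume h: "compact K" "K \<subseteq> Conv" "finite \<Phi>" "\<Phi> \<subseteq> Cc" and \<epsilon>: "\<epsilon> > 0"
    have \<epsilon>2: "\<epsilon> / 2 > 0" using \<epsilon> by simp
    obtain E where E: "E \<in> approximable W k" "\<forall>f\<in>K. \<forall>\<phi>\<in>\<Phi>. cmod (D f \<phi> - E f \<phi>) \<le> \<epsilon> / 2"
      using approximableD(2)[OF D h \<epsilon>2] by blast
    obtain F where F: "F \<in> W" "\<forall>f\<in>K. \<forall>\<phi>\<in>\<Phi>. cmod (E f \<phi> - F f \<phi>) \<le> \<epsilon> / 2"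
      using approximableD(2)[OF E(1) h \<epsilon>2] by blast
    have "cmod (D f \<phi> - F f \<phi>) \<le> \<epsilon>" if "f \<in> K" "\<phi> \<in> \<Phi>" for f \<phi>
      using norm_triangle_ineq[of "D f \<phi> - E f \<phi>" "E f \<phi> - F f \<phi>"] E(2)[rule_format, OF that] F(2)[rule_format, OF that]
      by simp
    then show "\<exists>E\<in>W. \<forall>f\<in>K. \<forall>\<phi>\<in>\<Phi>. cmod (D f \<phi> - E f \<phi>) \<le> \<epsilon>" using F(1) by (intro bexI[of _ F]) simp_all
  qed
qed

lemma submodule_ofD:
  assumes "submodule_of W X"
  shows "W \<subseteq> X" "(\<lambda>f \<phi>. 0) \<in> W" "\<Psi> \<in> W \<Longrightarrow> \<Phi> \<in> W \<Longrightarrow> (\<lambda>f \<phi>. \<Psi> f \<phi> + \<Phi> f \<phi>) \<in> W"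
    "continuous_on UNIV \<psi> \<Longrightarrow> \<Psi> \<in> W \<Longrightarrow> module_action \<psi> \<Psi> \<in> W"
  using assms unfolding submodule_of_def by (elim conjE; simp only:)+

lemma submodule_sum:
  assumes W: "submodule_of W X" and "finite Y" "\<forall>y\<in>Y. E y \<in> W"
  shows "(\<lambda>f \<phi>. \<Sum>y\<in>Y. E y f \<phi>) \<in> W"
  using assms(2,3)
proof (induction Y rule: finite_induct)
  case empty
  show ?case using submodule_ofD(2)[OF W] by (simp only: sum.empty)
next
  case (insert y Y)
  have "(\<lambda>f \<phi>. E y f \<phi> + (\<Sum>y\<in>Y. E y f \<phi>)) \<in> W"
    using insert.prems by (intro submodule_ofD(3)[OF W] insert.IH) simp_all
  then show ?case by (simp only: sum.insert[OF insert.hyps])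
qed

lemma module_action_Cc: "\<phi> \<in> Cc \<Longrightarrow> module_action \<psi> D f \<phi> = D f (\<lambda>x. \<psi> x * \<phi> x)"
  by (simp add: module_action_def radon_scale_def)

lemma approximable_submodule:
  assumes W: "submodule_of W (P0LV_hom k)"
  shows "submodule_of (approximable W k) (P0LV_hom k)" "W \<subseteq> approximable W k"
proof -
  show sub: "W \<subseteq> approximable W k"
  proof
    fix D assume D: "D \<in> W"
    show "D \<in> approximable W k"
    proof (rule approximableI)
      show "D \<in> P0LV_hom k" by (rule subsetD[OF submodule_ofD(1)[OF W] D])
      show "\<exists>E\<in>W. \<forall>f\<in>K. \<forall>\<phi>\<in>\<Phi>. cmod (D f \<phi> - E f \<phi>) \<le> \<epsilon>" if "\<epsilon> > 0" for K \<Phi> and \<epsilon> :: real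
        using that by (intro bexI[of _ D] D) simp
    qed
  qed
  show "submodule_of (approximable W k) (P0LV_hom k)"
    unfolding submodule_of_def
  proof (intro conjI ballI allI impI)
    show "approximable W k \<subseteq> P0LV_hom k" by (auto simp: approximable_def)
    show "(\<lambda>f \<phi>. 0) \<in> approximable W k" by (rule subsetD[OF sub submodule_ofD(2)[OF W]])
    fix D E assume D: "D \<in> approximable W k" and E: "E \<in> approximable W k"
    show "(\<lambda>f \<phi>. D f \<phi> + E f \<phi>) \<in> approximable W k"
    proof (rule approximableI)
      show "(\<lambda>f \<phi>. D f \<phi> + E f \<phi>) \<in> P0LV_hom k"
        using P0LV_hom_lincomb[OF approximableD(1)[OF D] approximableD(1)[OF E], of 1 1] by (simp only: mult_1_left)
      fix K :: "('a \<Rightarrow> real) set" and \<Phi> :: "('a \<Rightarrow> complex) set" and \<epsilon> :: real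
      assume h: "compact K" "K \<subseteq> Conv" "finite \<Phi>" "\<Phi> \<subseteq> Cc" and \<epsilon>: "\<epsilon> > 0"
      have \<epsilon>2: "\<epsilon> / 2 > 0" using \<epsilon> by simp
      obtain D' where D': "D' \<in> W" "\<forall>f\<in>K. \<forall>\<phi>\<in>\<Phi>. cmod (D f \<phi> - D' f \<phi>) \<le> \<epsilon> / 2"
        using approximableD(2)[OF D h \<epsilon>2] by blast
      obtain E' where E': "E' \<in> W" "\<forall>f\<in>K. \<forall>\<phi>\<in>\<Phi>. cmod (E f \<phi> - E' f \<phi>) \<le> \<epsilon> / 2"
        using approximableD(2)[OF E h \<epsilon>2] by blast
      have "cmod ((D f \<phi> + E f \<phi>) - (D' f \<phi> + E' f \<phi>)) \<le> \<epsilon>" if "f \<in> K" "\<phi> \<in> \<Phi>" for f \<phi>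
        using norm_triangle_ineq[of "D f \<phi> - D' f \<phi>" "E f \<phi> - E' f \<phi>"] D'(2)[rule_format, OF that] E'(2)[rule_format, OF that]
        by (simp add: add_diff_add)
      then show "\<exists>F\<in>W. \<forall>f\<in>K. \<forall>\<phi>\<in>\<Phi>. cmod ((D f \<phi> + E f \<phi>) - F f \<phi>) \<le> \<epsilon>"
        by (intro bexI[OF _ submodule_ofD(3)[OF W D'(1) E'(1)]]) simp
    qed
  next
    fix \<psi> :: "'a \<Rightarrow> complex" and D assume \<psi>: "continuous_on UNIV \<psi>" and D: "D \<in> approximable W k"
    show "module_action \<psi> D \<in> approximable W k"
    proof (rule approximableI)
      show "module_action \<psi> D \<in> P0LV_hom k" by (rule module_P0LV_hom[OF approximableD(1)[OF D] \<psi>])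
      fix K :: "('a \<Rightarrow> real) set" and \<Phi> :: "('a \<Rightarrow> complex) set" and \<epsilon> :: real
      assume h: "compact K" "K \<subseteq> Conv" "finite \<Phi>" "\<Phi> \<subseteq> Cc" and \<epsilon>: "\<epsilon> > 0"
      have f: "finite ((\<lambda>\<phi> x. \<psi> x * \<phi> x) ` \<Phi>)" using h(3) by (rule finite_imageI)
      have c: "(\<lambda>\<phi> x. \<psi> x * \<phi> x) ` \<Phi> \<subseteq> Cc" using h(4) by (intro image_subsetI Cc_mult[OF _ \<psi>]) (rule subsetD)
      obtain E where E: "E \<in> W" "\<forall>f\<in>K. \<forall>\<theta>\<in>(\<lambda>\<phi> x. \<psi> x * \<phi> x) ` \<Phi>. cmod (D f \<theta> - E f \<theta>) \<le> \<epsilon>"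
        using approximableD(2)[OF D h(1,2) f c \<epsilon>] by blast
      have "cmod (module_action \<psi> D f \<phi> - module_action \<psi> E f \<phi>) \<le> \<epsilon>" if "f \<in> K" "\<phi> \<in> \<Phi>" for f \<phi>
        unfolding module_action_Cc[OF subsetD[OF h(4) that(2)]] by (rule E(2)[rule_format, OF that(1) imageI[OF that(2)]])
      then show "\<exists>F\<in>W. \<forall>f\<in>K. \<forall>\<phi>\<in>\<Phi>. cmod (module_action \<psi> D f \<phi> - F f \<phi>) \<le> \<epsilon>"
        by (intro bexI[OF _ submodule_ofD(4)[OF W \<psi> E(1)]]) simp
    qed
  qed
qed

lemma translates_equicontinuous:
  assumes D: "D \<in> P0LV" and K: "compact K" "K \<subseteq> Conv" and \<Phi>: "finite \<Phi>" "\<Phi> \<subseteq> Cc" and \<epsilon>: "\<epsilon> > 0"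
  shows "\<exists>U. open U \<and> y0 \<in> U \<and> (\<forall>f\<in>K. \<forall>\<phi>\<in>\<Phi>. \<forall>y\<in>U. cmod (D (tr y f) (tr y \<phi>) - D (tr y0 f) (tr y0 \<phi>)) \<le> \<epsilon>)"
proof -
  have "\<exists>U. open U \<and> y0 \<in> U \<and> (\<forall>f\<in>K. \<forall>y\<in>U. cmod (D (tr y f) (tr y \<phi>) - D (tr y0 f) (tr y0 \<phi>)) \<le> \<epsilon>)" if \<phi>: "\<phi> \<in> \<Phi>" for \<phi>
  proof -
    obtain U where U: "y0 \<in> U" "open U"
      "\<forall>y\<in>U \<inter> UNIV. \<forall>f\<in>K. dist (D (tr (fst (y, f)) (snd (y, f))) (tr (fst (y, f)) \<phi>)) (D (tr (fst (y0, f)) (snd (y0, f))) (tr (fst (y0, f)) \<phi>)) \<le> \<epsilon>"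
      by (rule continuous_on_prod_compactE[OF joint_continuity[OF D K subsetD[OF \<Phi>(2) \<phi>]] K(1) UNIV_I \<epsilon>])
    then show ?thesis by (intro exI[of _ U]) (simp add: dist_norm)
  qed
  then have "\<forall>\<phi>\<in>\<Phi>. \<exists>U. open U \<and> y0 \<in> U \<and> (\<forall>f\<in>K. \<forall>y\<in>U. cmod (D (tr y f) (tr y \<phi>) - D (tr y0 f) (tr y0 \<phi>)) \<le> \<epsilon>)"
    by (rule ballI)
  then obtain U where UA: "\<forall>\<phi>\<in>\<Phi>. open (U \<phi>) \<and> y0 \<in> U \<phi> \<and> (\<forall>f\<in>K. \<forall>y\<in>U \<phi>. cmod (D (tr y f) (tr y \<phi>) - D (tr y0 f) (tr y0 \<phi>)) \<le> \<epsilon>)"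
    unfolding bchoice_iff by (elim exE) (rule that)
  have U: "\<phi> \<in> \<Phi> \<Longrightarrow> open (U \<phi>)" "\<phi> \<in> \<Phi> \<Longrightarrow> y0 \<in> U \<phi>"
    "\<phi> \<in> \<Phi> \<Longrightarrow> f \<in> K \<Longrightarrow> y \<in> U \<phi> \<Longrightarrow> cmod (D (tr y f) (tr y \<phi>) - D (tr y0 f) (tr y0 \<phi>)) \<le> \<epsilon>" for \<phi> f y
    by (drule bspec[OF UA], elim conjE, assumption, drule bspec[OF UA], elim conjE, assumption,
        drule bspec[OF UA], elim conjE, drule bspec, assumption, drule bspec, assumption, assumption)
  show ?thesis
  proof (intro exI[of _ "\<Inter>\<phi>\<in>\<Phi>. U \<phi>"] conjI ballI)
    show "open (\<Inter>\<phi>\<in>\<Phi>. U \<phi>)" using \<Phi>(1) U(1) by (intro open_INT ballI)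
    show "y0 \<in> (\<Inter>\<phi>\<in>\<Phi>. U \<phi>)" using U(2) by (rule INT_I)
    fix f \<phi> y assume f: "f \<in> K" and \<phi>: "\<phi> \<in> \<Phi>" and y: "y \<in> (\<Inter>\<phi>\<in>\<Phi>. U \<phi>)"
    show "cmod (D (tr y f) (tr y \<phi>) - D (tr y0 f) (tr y0 \<phi>)) \<le> \<epsilon>" by (rule U(3)[OF \<phi> f INT_D[OF y \<phi>]])
  qed
qed

lemma translation_Aff: "(\<lambda>x. x + y) \<in> Aff"
proof -
  have "bij (\<lambda>x. x + y)" by (rule o_bij[of "\<lambda>x. x - y"]) (simp_all add: fun_eq_iff)
  then show ?thesis using affine_map_ridge(2) by (simp add: Aff_def)
qed

text \<open>The integral over translates is replaced by a finite combination of translates, uniformly over the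
  compact set of convex functions. Constants act through the module structure.\<close>

lemma mollify_approximable:
  assumes W: "submodule_of W (P0LV_hom k)" and aff: "affine_invariant W" and D: "D \<in> W" and \<eta>: "\<eta> \<in> Cc"
  shows "mollify \<eta> D \<in> approximable W k"
proof (rule approximableI)
  have Dk: "D \<in> P0LV_hom k" by (rule subsetD[OF submodule_ofD(1)[OF W] D])
  note D0 = P0LV_homD(1)[OF Dk]
  show "mollify \<eta> D \<in> P0LV_hom k" by (rule mollify_P0LV_hom[OF Dk \<eta>])
  fix K :: "('a \<Rightarrow> real) set" and \<Phi> :: "('a \<Rightarrow> complex) set" and \<epsilon> :: real
  assume K: "compact K" "K \<subseteq> Conv" and \<Phi>: "finite \<Phi>" "\<Phi> \<subseteq> Cc" and \<epsilon>: "\<epsilon> > 0"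
  define N where "N = (\<integral>y. cmod (\<eta> y) \<partial>lborel)"
  have N: "N \<ge> 0" unfolding N_def by simp
  define e where "e = \<epsilon> / (N + 1)"
  have e: "e > 0" using \<epsilon> N by (simp add: e_def)
  have eN: "e * N \<le> \<epsilon>" using \<epsilon> N by (simp add: e_def field_simps)
  define \<F> where "\<F> = (\<lambda>(f, \<phi>) y. D (tr y f) (tr y \<phi>)) ` (K \<times> \<Phi>)"
  have 1: "continuous_on UNIV F" if F: "F \<in> \<F>" for F
  proof -
    obtain f \<phi> where f: "f \<in> K" "\<phi> \<in> \<Phi>" "F = (\<lambda>y. D (tr y f) (tr y \<phi>))"
      using F unfolding \<F>_def by auto
    show ?thesis unfolding f(3) by (rule translate_continuous[OF D0 subsetD[OF K(2) f(1)] subsetD[OF \<Phi>(2) f(2)]])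
  qed
  have 2: "\<exists>U. open U \<and> y0 \<in> U \<and> (\<forall>F\<in>\<F>. \<forall>y\<in>U. cmod (F y - F y0) \<le> e)" for y0
    using translates_equicontinuous[OF D0 K \<Phi> e, of y0] unfolding \<F>_def by simp
  obtain Y w where Y: "finite Y" "\<forall>F\<in>\<F>. cmod ((\<integral>y. \<eta> y * F y \<partial>lborel) - (\<Sum>y\<in>Y. w y * F y)) \<le> e * N"
    using integral_discretization[OF \<eta> e 1 2] unfolding N_def by blast
  define E where "E = (\<lambda>f \<phi>. \<Sum>y\<in>Y. module_action (\<lambda>x. w y) (aff_action (\<lambda>x. x + y) D) f \<phi>)"
  have "E \<in> W" unfolding E_def
    by (intro submodule_sum[OF W Y(1)] ballI submodule_ofD(4)[OF W continuous_on_const]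
        bspec[OF bspec[OF aff[unfolded affine_invariant_def] translation_Aff] D])
  moreover have "cmod (mollify \<eta> D f \<phi> - E f \<phi>) \<le> \<epsilon>" if f: "f \<in> K" and \<phi>: "\<phi> \<in> \<Phi>" for f \<phi>
  proof -
    have C: "f \<in> Conv" "\<phi> \<in> Cc" using f \<phi> K \<Phi> by auto
    have "module_action (\<lambda>x. w y) (aff_action (\<lambda>x. x + y) D) f \<phi> = w y * D (tr y f) (tr y \<phi>)" for y
    proof -
      have "module_action (\<lambda>x. w y) (aff_action (\<lambda>x. x + y) D) f \<phi> = D (tr y f) (\<lambda>x. w y * tr y \<phi> x)"
        unfolding module_action_Cc[OF C(2)] by (simp add: aff_action_def radon_push_def tr_def comp_def)
      then show ?thesis using RadonD(2)[OF P0LV_D(1)[OF D0 tr_Conv[OF C(1)]] tr_Cc[OF C(2)]] by simp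
    qed
    then have "E f \<phi> = (\<Sum>y\<in>Y. w y * D (tr y f) (tr y \<phi>))" by (simp only: E_def)
    moreover have "(\<lambda>y. D (tr y f) (tr y \<phi>)) \<in> \<F>" unfolding \<F>_def using f \<phi> by (intro image_eqI[of _ _ "(f, \<phi>)"]) simp_all
    moreover have "mollify \<eta> D f \<phi> = (\<integral>y. \<eta> y * D (tr y f) (tr y \<phi>) \<partial>lborel)"
      by (simp only: mollify_def C simp_thms if_True)
    ultimately have "cmod (mollify \<eta> D f \<phi> - E f \<phi>) \<le> e * N" using bspec[OF Y(2)] by (simp only:)
    then show ?thesis using eN by (rule order_trans)
  qed
  ultimately show "\<exists>E\<in>W. \<forall>f\<in>K. \<forall>\<phi>\<in>\<Phi>. cmod (mollify \<eta> D f \<phi> - E f \<phi>) \<le> \<epsilon>" by (intro bexI[of _ E]) simp_all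
qed

lemma approximation_by_mollify:
  fixes D :: "'a::euclidean_space local_functional"
  assumes D: "D \<in> P0LV" and K: "compact K" "K \<subseteq> Conv" and \<Phi>: "finite \<Phi>" "\<Phi> \<subseteq> Cc" and \<epsilon>: "\<epsilon> > 0"
  obtains \<eta> where "\<eta> \<in> Cc" "\<And>f \<phi>. f \<in> K \<Longrightarrow> \<phi> \<in> \<Phi> \<Longrightarrow> cmod (D f \<phi> - mollify \<eta> D f \<phi>) \<le> \<epsilon>"
proof -
  obtain U where U: "open U" "0 \<in> U" "\<And>f \<phi> y. f \<in> K \<Longrightarrow> \<phi> \<in> \<Phi> \<Longrightarrow> y \<in> U \<Longrightarrow> cmod (D (tr y f) (tr y \<phi>) - D f \<phi>) \<le> \<epsilon>"
    using translates_equicontinuous[OF D K \<Phi> \<epsilon>, of 0] unfolding tr_0 by blast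
  obtain r where r: "r > 0" "cball 0 r \<subseteq> U" using U(1,2) open_contains_cball by blast
  \<comment> \<open>then the bump is supported in the ball of radius \<open>r\<close>\<close>
  define C where "C = r\<^sup>2 / 2"
  have C: "C > 0" "sqrt (2 * C) = r" using r(1) by (simp_all add: C_def)
  define I where "I = (\<integral>y. bump C 1 y \<partial>(lborel :: 'a measure))"
  have I: "I > 0" unfolding I_def by (rule bump_integral_pos[OF C(1)]) simp
  define \<eta> where "\<eta> y = complex_of_real (bump C 1 y / I)" for y :: 'a
  have out: "\<eta> y = 0" if "y \<notin> cball 0 r" for y
    using bump_eq_0[OF C(1), of 1 y] that by (simp add: \<eta>_def C(2))
  have \<eta>: "\<eta> \<in> Cc"
  proof (rule CcI[OF _ compact_cball supp_minimal[OF closed_cball out]])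
    show "continuous_on UNIV \<eta>" unfolding \<eta>_def[abs_def] using I by (intro continuous_intros bump_continuous C(1)) simp
  qed
  have nb: "cmod (\<eta> y) = bump C 1 y / I" for y using I bump_nonneg[of C 1 y] by (simp add: \<eta>_def norm_divide)
  have bi: "integrable lborel (bump C 1 :: 'a \<Rightarrow> real)" using bump_integrable[OF C(1), of 1 "\<lambda>y. 1 :: real"] by simp
  have i\<eta>: "(\<integral>y. \<eta> y \<partial>lborel) = 1" "(\<integral>y. cmod (\<eta> y) \<partial>lborel) = 1"
  proof -
    have "(\<integral>y. bump C 1 y / I \<partial>(lborel :: 'a measure)) = 1" using I by (simp add: I_def)
    then show "(\<integral>y. \<eta> y \<partial>lborel) = 1" "(\<integral>y. cmod (\<eta> y) \<partial>lborel) = 1"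
      by (simp_all only: nb) (simp_all only: \<eta>_def integral_complex_of_real of_real_1)
  qed
  show thesis
  proof (rule that[OF \<eta>])
    fix f \<phi> assume f: "f \<in> K" and \<phi>: "\<phi> \<in> \<Phi>"
    have Cc: "f \<in> Conv" "\<phi> \<in> Cc" using f \<phi> K \<Phi> by auto
    note int = mollify_integrable[OF D \<eta> Cc]
    have ic: "integrable lborel (\<lambda>y. \<eta> y * D f \<phi>)" by (rule Cc_integrable_mult[OF \<eta> continuous_on_const])
    have "D f \<phi> - mollify \<eta> D f \<phi> = (\<integral>y. \<eta> y * D f \<phi> \<partial>lborel) - (\<integral>y. \<eta> y * D (tr y f) (tr y \<phi>) \<partial>lborel)"
      by (simp add: mollify_def Cc i\<eta>(1))
    also have "\<dots> = (\<integral>y. \<eta> y * D f \<phi> - \<eta> y * D (tr y f) (tr y \<phi>) \<partial>lborel)"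
      by (rule Bochner_Integration.integral_diff[OF ic int, symmetric])
    also have "cmod \<dots> \<le> (\<integral>y. cmod (\<eta> y * D f \<phi> - \<eta> y * D (tr y f) (tr y \<phi>)) \<partial>lborel)"
      by (rule integral_norm_bound)
    also have "\<dots> \<le> (\<integral>y. \<epsilon> * cmod (\<eta> y) \<partial>lborel)"
    proof (rule integral_mono)
      show "integrable lborel (\<lambda>y. cmod (\<eta> y * D f \<phi> - \<eta> y * D (tr y f) (tr y \<phi>)))"
        by (intro integrable_norm Bochner_Integration.integrable_diff ic int)
      show "integrable lborel (\<lambda>y. \<epsilon> * cmod (\<eta> y))" by (intro integrable_mult_right integrable_norm Cc_integrable \<eta>)
      fix y
      show "cmod (\<eta> y * D f \<phi> - \<eta> y * D (tr y f) (tr y \<phi>)) \<le> \<epsilon> * cmod (\<eta> y)"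
      proof (cases "y \<in> cball 0 r")
        case True
        have "cmod (D (tr y f) (tr y \<phi>) - D f \<phi>) \<le> \<epsilon>" by (rule U(3)[OF f \<phi> subsetD[OF r(2) True]])
        then have "cmod (D f \<phi> - D (tr y f) (tr y \<phi>)) * cmod (\<eta> y) \<le> \<epsilon> * cmod (\<eta> y)"
          by (intro mult_right_mono) (simp_all add: norm_minus_commute)
        then show ?thesis by (simp add: norm_mult mult.commute flip: right_diff_distrib)
      qed (simp add: out)
    qed
    finally show "cmod (D f \<phi> - mollify \<eta> D f \<phi>) \<le> \<epsilon>" by (simp add: i\<eta>(2))
  qed
qed

section \<open>Density of the module\<close>

lemma zero_has_density:
  assumes "(\<lambda>f \<phi>. 0) \<in> (P0LV_hom k :: 'a::euclidean_space local_functional set)"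
  shows "has_density k ((\<lambda>f \<phi>. 0) :: 'a local_functional) (\<lambda>x M. 0)"
proof (rule has_densityI[OF assms])
  show "polarized k (\<lambda>M :: ('a \<times> 'a) multiset. 0)" by (rule polarized_zero)
  show "continuous_on UNIV (\<lambda>x :: 'a. 0 :: complex)" by (rule continuous_on_const)
  show "iter_pol M (\<lambda>f \<phi>. 0) (\<lambda>x. 0) \<phi> = (\<integral>x. \<phi> x * 0 \<partial>lborel)" for M and \<phi> :: "'a \<Rightarrow> complex"
    using iter_pol_lincomb[of M 0 "\<lambda>f \<phi>. 0" 0 "\<lambda>f \<phi>. 0"] by simp
qed

lemma Cc_comp_linear:
  fixes L :: "'a::euclidean_space \<Rightarrow> 'a"
  assumes \<phi>: "\<phi> \<in> Cc" and L: "linear L" "bij L"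
  shows "(\<lambda>y. \<phi> (inv L y)) \<in> Cc"
proof (rule CcI)
  have li: "linear (inv L)" by (rule inj_linear_imp_inv_linear[OF L(1) bij_is_inj[OF L(2)]])
  show "continuous_on UNIV (\<lambda>y. \<phi> (inv L y))"
    by (intro continuous_on_compose2[OF CcD(1)[OF \<phi>, of UNIV]] linear_continuous_on linear_conv_bounded_linear[THEN iffD1] li subset_UNIV)
  show c: "compact (L ` supp \<phi>)"
    by (intro compact_continuous_image CcD(2)[OF \<phi>] linear_continuous_on linear_conv_bounded_linear[THEN iffD1] L(1))
  show "supp (\<lambda>y. \<phi> (inv L y)) \<subseteq> L ` supp \<phi>"
  proof (rule supp_minimal[OF compact_imp_closed[OF c]], rule ccontr)
    fix y assume y: "y \<notin> L ` supp \<phi>" and "\<phi> (inv L y) \<noteq> 0"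
    then have "inv L y \<in> supp \<phi>" using not_in_supp[of "inv L y" \<phi>] by blast
    then have "L (inv L y) \<in> L ` supp \<phi>" by (rule imageI)
    with y show False by (simp add: surj_f_inv_f[OF bij_is_surj[OF L(2)]])
  qed
qed

lemma linear_Aff: "linear L \<Longrightarrow> bij L \<Longrightarrow> L \<in> Aff"
  unfolding Aff_def affine_map_def by (intro CollectI conjI exI[of _ L] exI[of _ 0]) simp_all

context
  fixes W :: "'a::euclidean_space local_functional set" and k :: nat
  assumes W: "submodule_of W (P0LV_hom k)" and aff: "affine_invariant W" and nz: "W \<noteq> {\<lambda>f \<phi>. 0}"
begin

lemma nonzero_form:
  obtains \<Phi> M0 \<phi> where "\<Phi> \<in> W" "size M0 = k" "\<phi> \<in> Cc" "iter_pol M0 \<Phi> (\<lambda>x. 0) \<phi> \<noteq> 0"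
proof -
  obtain \<Phi> where \<Phi>: "\<Phi> \<in> W" "\<Phi> \<noteq> (\<lambda>f \<phi>. 0)" using nz submodule_ofD(2)[OF W] by blast
  have k: "\<Phi> \<in> P0LV_hom k" by (rule subsetD[OF submodule_ofD(1)[OF W] \<Phi>(1)])
  note P = P0LV_homD(1)[OF k]
  have "\<exists>M0 \<phi>. size M0 = k \<and> \<phi> \<in> Cc \<and> iter_pol M0 \<Phi> (\<lambda>x. 0) \<phi> \<noteq> 0"
  proof (rule ccontr)
    assume "\<nexists>M0 \<phi>. size M0 = k \<and> \<phi> \<in> Cc \<and> iter_pol M0 \<Phi> (\<lambda>x. 0) \<phi> \<noteq> 0"
    then have 0: "size M = k \<Longrightarrow> \<phi> \<in> Cc \<Longrightarrow> iter_pol M \<Phi> (\<lambda>x. 0) \<phi> = 0" for M \<phi> by blast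
    have "\<Phi> f \<phi> = 0" for f \<phi>
    proof (cases "f \<in> Conv \<and> \<phi> \<in> Cc")
      case True
      then show ?thesis by (intro eq_0_if_iter_pol_eq_0[OF k 0]) simp_all
    next
      case False
      then show ?thesis using eq_off_Cc[OF P, of \<phi> f] P0LV_D(2)[OF P, of f] by (metis (no_types))
    qed
    then have "\<Phi> = (\<lambda>f \<phi>. 0)" by (intro ext)
    with \<Phi>(2) show False ..
  qed
  then show thesis using \<Phi>(1) by (elim exE conjE) (rule that)
qed

text \<open>The densities of the functionals in the closure of \<open>W\<close>, a module over the continuous functions.\<close>

definition fields :: "('a \<Rightarrow> ('a \<times> 'a) multiset \<Rightarrow> complex) set" where
  "fields = {t. \<exists>D\<in>approximable W k. has_density k D t}"

text \<open>For a given point \<open>x\<close> and a linear map \<open>g\<close>, the weight \<open>\<eta> y = \<phi> (inv L (x - y))\<close> with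
  \<open>L = adjoint g\<close> is chosen such that the density at \<open>x\<close> of the average of \<open>aff_action L \<Phi>\<close> is exactly the image
  under \<open>g\<close> of the form of \<open>\<Phi>\<close> at \<open>\<phi>\<close>. So the fields attain at \<open>x\<close> all images of one nonzero form.\<close>

lemma fields_span:
  assumes J: "finite J" "\<And>N. N \<in> J \<Longrightarrow> size N = k"
    and zero: "\<And>t. t \<in> fields \<Longrightarrow> (\<Sum>N\<in>J. c N * t x (diagonals N)) = 0" and d: "polarized k d"
  shows "(\<Sum>N\<in>J. c N * d (diagonals N)) = 0"
proof -
  obtain \<Phi> M0 \<phi> where \<Phi>: "\<Phi> \<in> W" and M0: "size M0 = k" and \<phi>: "\<phi> \<in> Cc" and ne: "iter_pol M0 \<Phi> (\<lambda>x. 0) \<phi> \<noteq> 0"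
    by (rule nonzero_form)
  have k: "\<Phi> \<in> P0LV_hom k" by (rule subsetD[OF submodule_ofD(1)[OF W] \<Phi>])
  define T where "T M = iter_pol M \<Phi> (\<lambda>x. 0) \<phi>" for M
  have T: "polarized k T" unfolding T_def[abs_def] by (rule polarized_iter_pol[OF k Conv_const \<phi>])
  have T0: "T M0 \<noteq> 0" using ne by (simp only: T_def not_False_eq_True)
  have "(\<Sum>N\<in>J. c N * T (diagonals (image_mset g N))) = 0" if g: "linear g" "bij g" for g
  proof -
    define L where "L = adjoint g"
    have L: "linear L" "bij L" "adjoint L = g"
      unfolding L_def bij_def using g by (simp_all add: adjoint_linear adjoint_adjoint bij_is_inj bij_is_surj)
    define \<eta> where "\<eta> y = \<phi> (inv L (x - y))" for y
    have \<eta>: "\<eta> \<in> Cc" unfolding \<eta>_def[abs_def] by (rule reflect_Cc[OF Cc_comp_linear[OF \<phi> L(1,2)]])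
    have \<Phi>L: "aff_action L \<Phi> \<in> W"
      by (rule bspec[OF bspec[OF aff[unfolded affine_invariant_def] linear_Aff[OF L(1,2)]] \<Phi>])
    define t where "t = (\<lambda>x M. iter_pol M (aff_action L \<Phi>) (\<lambda>x. 0) (\<lambda>z. \<eta> (x - z)))"
    have "has_density k (mollify \<eta> (aff_action L \<Phi>)) t"
      unfolding t_def by (rule mollify_has_density[OF subsetD[OF submodule_ofD(1)[OF W] \<Phi>L] \<eta>])
    then have tf: "t \<in> fields" unfolding fields_def using mollify_approximable[OF W aff \<Phi>L \<eta>] by blast
    have "t x (diagonals N) = T (diagonals (image_mset g N))" for N
    proof -
      have "(\<lambda>z. \<eta> (x - z)) \<circ> L = \<phi>" by (rule ext) (simp add: \<eta>_def inv_f_f[OF bij_is_inj[OF L(2)]])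
      moreover have "(\<lambda>x. 0 :: real) \<circ> L = (\<lambda>x. 0)" by (simp add: comp_def)
      moreover have "t x (diagonals N) = iter_pol (diagonals (image_mset g N)) \<Phi> ((\<lambda>x. 0) \<circ> L) ((\<lambda>z. \<eta> (x - z)) \<circ> L)"
        unfolding t_def iter_pol_linear_image[OF L(1,2)] L(3) image_diagonals by (simp only: aff_action_def radon_push_def)
      ultimately show ?thesis by (simp only: T_def)
    qed
    then show ?thesis using zero[OF tf] by (simp only:)
  qed
  from polarized_irreducible[where N = "\<lambda>N. N" and J = J and c = c, OF T M0 T0 J this d] show ?thesis .
qed

lemma fields_closed:
  shows "t \<in> fields \<Longrightarrow> polarized k (t x)"
    and "t \<in> fields \<Longrightarrow> size M = k \<Longrightarrow> continuous_on UNIV (\<lambda>x. t x M)"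
    and "(\<lambda>x M. 0) \<in> fields"
    and "t \<in> fields \<Longrightarrow> s \<in> fields \<Longrightarrow> (\<lambda>x M. t x M + s x M) \<in> fields"
    and "continuous_on UNIV \<psi> \<Longrightarrow> t \<in> fields \<Longrightarrow> (\<lambda>x M. \<psi> x * t x M) \<in> fields"
proof -
  note A = approximable_submodule(1)[OF W]
  show "polarized k (t x)" if t: "t \<in> fields"
  proof -
    obtain D where D: "has_density k D t" using t unfolding fields_def by blast
    show ?thesis by (rule has_densityD(2)[OF D])
  qed
  show "continuous_on UNIV (\<lambda>x. t x M)" if t: "t \<in> fields" and M: "size M = k"
  proof -
    obtain D where D: "has_density k D t" using t unfolding fields_def by blast
    show ?thesis by (rule has_densityD(3)[OF D M])
  qed
  have z: "(\<lambda>f \<phi>. 0) \<in> approximable W k" by (rule submodule_ofD(2)[OF A])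
  show "(\<lambda>x M. 0) \<in> fields"
    unfolding fields_def by (intro CollectI bexI[OF _ z] zero_has_density submodule_ofD(2)[OF A, THEN approximableD(1)])
  show "(\<lambda>x M. t x M + s x M) \<in> fields" if t: "t \<in> fields" and s: "s \<in> fields"
  proof -
    obtain D where D: "D \<in> approximable W k" "has_density k D t" using t unfolding fields_def by blast
    obtain E where E: "E \<in> approximable W k" "has_density k E s" using s unfolding fields_def by blast
    show ?thesis unfolding fields_def
      by (rule CollectI, rule bexI[OF _ submodule_ofD(3)[OF A D(1) E(1)]], rule add_has_density[OF D(2) E(2)])
  qed
  show "(\<lambda>x M. \<psi> x * t x M) \<in> fields" if \<psi>: "continuous_on UNIV \<psi>" and t: "t \<in> fields"
  proof -
    obtain D where D: "D \<in> approximable W k" "has_density k D t" using t unfolding fields_def by blast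
    show ?thesis unfolding fields_def
      by (rule CollectI, rule bexI[OF _ submodule_ofD(4)[OF A \<psi> D(1)]], rule module_has_density[OF D(2) \<psi>])
  qed
qed

text \<open>The density of an average is generated locally by the densities of approximable functionals,
  and equal densities mean equal functionals.\<close>

lemma mollify_locally_approximable:
  fixes x1 :: 'a
  assumes \<Psi>: "\<Psi> \<in> P0LV_hom k" and \<eta>: "\<eta> \<in> Cc"
  shows "\<exists>U. open U \<and> x1 \<in> U \<and> (\<forall>\<rho>. continuous_on UNIV \<rho> \<longrightarrow> (\<forall>x. x \<notin> U \<longrightarrow> \<rho> x = 0) \<longrightarrow>
     module_action \<rho> (mollify \<eta> \<Psi>) \<in> approximable W k)"
proof -
  define d where "d = (\<lambda>x M. iter_pol M \<Psi> (\<lambda>x. 0) (\<lambda>z. \<eta> (x - z)))"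
  have den: "has_density k (mollify \<eta> \<Psi>) d" unfolding d_def by (rule mollify_has_density[OF \<Psi> \<eta>])
  obtain U where U: "open U" "x1 \<in> U"
    "\<And>d \<rho>. (\<And>x. polarized k (d x)) \<Longrightarrow> (\<And>M. size M = k \<Longrightarrow> continuous_on UNIV (\<lambda>x. d x M)) \<Longrightarrow> continuous_on UNIV \<rho> \<Longrightarrow>
      (\<And>x. x \<notin> U \<Longrightarrow> \<rho> x = 0) \<Longrightarrow> \<exists>t\<in>fields. \<forall>x M. size M = k \<longrightarrow> t x M = \<rho> x * d x M"
  proof (rule local_generation[of fields k x1])
    show "polarized k (t x)" if "t \<in> fields" for t x by (rule fields_closed(1)[OF that])
    show "continuous_on UNIV (\<lambda>x. t x M)" if "t \<in> fields" "size M = k" for t M by (rule fields_closed(2)[OF that])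
    show "(\<lambda>x M. 0) \<in> fields" by (rule fields_closed(3))
    show "(\<lambda>x M. t x M + s x M) \<in> fields" if "t \<in> fields" "s \<in> fields" for t s by (rule fields_closed(4)[OF that])
    show "(\<lambda>x M. \<psi> x * t x M) \<in> fields" if "continuous_on UNIV \<psi>" "t \<in> fields" for \<psi> t by (rule fields_closed(5)[OF that])
    show "(\<Sum>N\<in>J. c N * d (diagonals N)) = 0" if "finite J" "\<And>N. N \<in> J \<Longrightarrow> size N = k"
      "\<And>t. t \<in> fields \<Longrightarrow> (\<Sum>N\<in>J. c N * t x (diagonals N)) = 0" "polarized k d" for x J c d
      by (rule fields_span[OF that])
  next
    fix U assume "open U" "x1 \<in> U"
      "\<And>d \<rho>. (\<And>x. polarized k (d x)) \<Longrightarrow> (\<And>M. size M = k \<Longrightarrow> continuous_on UNIV (\<lambda>x. d x M)) \<Longrightarrow> continuous_on UNIV \<rho> \<Longrightarrow>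
        (\<And>x. x \<notin> U \<Longrightarrow> \<rho> x = 0) \<Longrightarrow> \<exists>t\<in>fields. \<forall>x M. size M = k \<longrightarrow> t x M = \<rho> x * d x M"
    then show thesis by (rule that)
  qed
  show ?thesis
  proof (intro exI[of _ U] conjI U(1,2) allI impI)
    fix \<rho> :: "'a \<Rightarrow> complex" assume \<rho>: "continuous_on UNIV \<rho>" "\<forall>x. x \<notin> U \<longrightarrow> \<rho> x = 0"
    have "\<exists>t\<in>fields. \<forall>x M. size M = k \<longrightarrow> t x M = \<rho> x * d x M"
    proof (rule U(3)[OF has_densityD(2)[OF den] _ \<rho>(1)])
      show "continuous_on UNIV (\<lambda>x. d x M)" if "size M = k" for M by (rule has_densityD(3)[OF den that])
      show "\<rho> x = 0" if "x \<notin> U" for x using \<rho>(2) that by simp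
    qed
    then obtain t where t: "t \<in> fields" "\<forall>x M. size M = k \<longrightarrow> t x M = \<rho> x * d x M"
      by (elim bexE) (rule that)
    obtain D where D: "D \<in> approximable W k" "has_density k D t" using t(1) unfolding fields_def by blast
    have "D = module_action \<rho> (mollify \<eta> \<Psi>)"
      by (rule density_unique[OF D(2) module_has_density[OF den \<rho>(1)] t(2)[rule_format]])
    then show "module_action \<rho> (mollify \<eta> \<Psi>) \<in> approximable W k" using D(1) by simp
  qed
qed

text \<open>A functional is close to its average, and near the supports of the given test functions the average
  is the sum of its localisations by a partition of unity.\<close>

theorem approximable_everything: "P0LV_hom k \<subseteq> approximable W k"
proof
  note A = approximable_submodule(1)[OF W]
  fix \<Psi> :: "'a local_functional" assume \<Psi>: "\<Psi> \<in> P0LV_hom k"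
  have "\<Psi> \<in> approximable (approximable W k) k"
  proof (rule approximableI[OF \<Psi>])
    fix K :: "('a \<Rightarrow> real) set" and \<Phi> :: "('a \<Rightarrow> complex) set" and \<epsilon> :: real
    assume K: "compact K" "K \<subseteq> Conv" and \<Phi>: "finite \<Phi>" "\<Phi> \<subseteq> Cc" and \<epsilon>: "\<epsilon> > 0"
    obtain \<eta> where \<eta>: "\<eta> \<in> Cc" "\<And>f \<phi>. f \<in> K \<Longrightarrow> \<phi> \<in> \<Phi> \<Longrightarrow> cmod (\<Psi> f \<phi> - mollify \<eta> \<Psi> f \<phi>) \<le> \<epsilon>"
      using approximation_by_mollify[OF P0LV_homD(1)[OF \<Psi>] K \<Phi> \<epsilon>] by (metis (no_types))
    define C where "C = (\<Union>\<phi>\<in>\<Phi>. supp \<phi>)"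
    have C: "compact C" unfolding C_def using \<Phi> by (intro compact_UN CcD(2)) auto
    have "\<forall>x. \<exists>U. open U \<and> x \<in> U \<and> (\<forall>\<rho>. continuous_on UNIV \<rho> \<longrightarrow> (\<forall>x. x \<notin> U \<longrightarrow> \<rho> x = 0) \<longrightarrow>
       module_action \<rho> (mollify \<eta> \<Psi>) \<in> approximable W k)"
      by (intro allI mollify_locally_approximable[OF \<Psi> \<eta>(1)])
    then obtain U where U: "\<forall>x. open (U x) \<and> x \<in> U x \<and> (\<forall>\<rho>. continuous_on UNIV \<rho> \<longrightarrow> (\<forall>z. z \<notin> U x \<longrightarrow> \<rho> z = 0) \<longrightarrow>
       module_action \<rho> (mollify \<eta> \<Psi>) \<in> approximable W k)"
      unfolding choice_iff by (elim exE) (rule that)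
    have oU: "open (U x)" for x by (rule conjunct1[OF spec[OF U]])
    have xU: "x \<in> U x" for x by (rule conjunct1[OF conjunct2[OF spec[OF U]]])
    have "C \<subseteq> (\<Union>x\<in>C. U x)" using xU by (intro subsetI UN_I)
    then obtain P where P: "P \<subseteq> C" "finite P" "C \<subseteq> (\<Union>x\<in>P. U x)"
      by (rule compactE_image[OF C oU])
    \<comment> \<open>the complement of \<open>C\<close> makes this an open cover of the whole space; its member of the partition vanishes on \<open>C\<close>\<close>
    define \<C> where "\<C> = insert (- C) (U ` P)"
    have fC: "finite \<C>" using P(2) by (simp add: \<C>_def)
    have "\<exists>F. (\<forall>V\<in>\<C>. continuous_on UNIV (F V)) \<and> (\<forall>V\<in>\<C>. \<forall>x. x \<notin> V \<longrightarrow> F V x = 0) \<and>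
        (\<forall>x. supp_sum (\<lambda>V. F V x) \<C> = (1 :: real))"
    proof (rule subordinate_partition_of_unity[of UNIV \<C>])
      show "UNIV \<subseteq> \<Union>\<C>" using P(3) unfolding \<C>_def by blast
      show "open T" if "T \<in> \<C>" for T 
      proof (cases "T = - C")
        case True
        then show ?thesis using compact_imp_closed[OF C] by (simp add: open_Compl)
      next
        case False
        then show ?thesis using that oU unfolding \<C>_def by blast
      qed
      show "\<exists>V. open V \<and> x \<in> V \<and> finite {U \<in> \<C>. U \<inter> V \<noteq> {}}" for x
        using fC by (intro exI[of _ UNIV]) simp
    next
      fix F :: "'a set \<Rightarrow> 'a \<Rightarrow> real"
      assume F: "\<And>U. U \<in> \<C> \<Longrightarrow> continuous_on UNIV (F U) \<and> (\<forall>x\<in>UNIV. 0 \<le> F U x)"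
        "\<And>x U. U \<in> \<C> \<Longrightarrow> x \<in> UNIV \<Longrightarrow> x \<notin> U \<Longrightarrow> F U x = 0" "\<And>x. x \<in> UNIV \<Longrightarrow> supp_sum (\<lambda>W. F W x) \<C> = 1"
      show ?thesis
      proof (intro exI[of _ F] conjI ballI allI impI)
        show "continuous_on UNIV (F V)" if "V \<in> \<C>" for V by (rule conjunct1[OF F(1)[OF that]])
        show "F V x = 0" if "V \<in> \<C>" "x \<notin> V" for V x by (rule F(2)[OF that(1) UNIV_I that(2)])
        show "supp_sum (\<lambda>W. F W x) \<C> = 1" for x by (rule F(3)[OF UNIV_I])
      qed
    qed
    then obtain F :: "'a set \<Rightarrow> 'a \<Rightarrow> real" where F: "\<forall>V\<in>\<C>. continuous_on UNIV (F V)"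
      "\<forall>V\<in>\<C>. \<forall>x. x \<notin> V \<longrightarrow> F V x = 0" "\<forall>x. supp_sum (\<lambda>V. F V x) \<C> = 1"
      by (elim exE conjE) (rule that)
    have sumF: "(\<Sum>V\<in>U ` P - {- C}. F V x) = 1" if x: "x \<in> C" for x
    proof -
      have "(\<Sum>V\<in>\<C>. F V x) = supp_sum (\<lambda>W. F W x) \<C>"
        unfolding supp_sum_def support_on_def using fC by (intro sum.mono_neutral_right) auto
      also have "\<dots> = 1" by (rule spec[OF F(3)])
      finally have "(\<Sum>V\<in>\<C>. F V x) = 1" .
      moreover have "(\<Sum>V\<in>\<C>. F V x) = F (- C) x + (\<Sum>V\<in>\<C> - {- C}. F V x)"
        by (rule sum.remove[OF fC]) (simp add: \<C>_def)
      moreover have "F (- C) x = 0" by (rule F(2)[rule_format]) (simp_all add: \<C>_def x)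
      moreover have "\<C> - {- C} = U ` P - {- C}" by (auto simp: \<C>_def)
      ultimately show ?thesis by simp
    qed
    define E where "E = (\<lambda>f \<phi>. \<Sum>V\<in>U ` P - {- C}. module_action (\<lambda>x. of_real (F V x)) (mollify \<eta> \<Psi>) f \<phi>)"
    have "E \<in> approximable W k" unfolding E_def
    proof (rule submodule_sum[OF A], simp add: P(2), rule ballI)
      fix V assume V: "V \<in> U ` P - {- C}"
      then have VC: "V \<in> \<C>" by (simp add: \<C>_def)
      obtain x where x: "V = U x" using V by blast
      have "continuous_on UNIV (\<lambda>x. complex_of_real (F V x))"
        by (intro continuous_on_of_real bspec[OF F(1) VC])
      moreover have "\<forall>z. z \<notin> U x \<longrightarrow> complex_of_real (F V z) = 0" using bspec[OF F(2) VC] unfolding x by simp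
      ultimately show "module_action (\<lambda>x. of_real (F V x)) (mollify \<eta> \<Psi>) \<in> approximable W k"
        by (rule conjunct2[OF conjunct2[OF spec[OF U, of x]], THEN spec, THEN mp, THEN mp])
    qed
    moreover have "E f \<phi> = mollify \<eta> \<Psi> f \<phi>" if f: "f \<in> K" and \<phi>: "\<phi> \<in> \<Phi>" for f \<phi>
    proof -
      have fC: "f \<in> Conv" and \<phi>C: "\<phi> \<in> Cc" using f \<phi> K \<Phi> by auto
      have R: "mollify \<eta> \<Psi> f \<in> Radon" by (rule P0LV_D(1)[OF P0LV_homD(1)[OF mollify_P0LV_hom[OF \<Psi> \<eta>(1)]] fC])
      have FC: "(\<lambda>x. of_real (F V x) * \<phi> x) \<in> Cc" if V: "V \<in> U ` P - {- C}" for V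
      proof -
        have "V \<in> \<C>" using V by (simp add: \<C>_def)
        then show ?thesis by (intro Cc_mult[OF \<phi>C] continuous_on_of_real bspec[OF F(1)])
      qed
      have fin: "finite (U ` P - {- C})" using P(2) by simp
      have "E f \<phi> = (\<Sum>V\<in>U ` P - {- C}. 1 * mollify \<eta> \<Psi> f (\<lambda>x. of_real (F V x) * \<phi> x))"
        by (simp only: E_def module_action_Cc[OF \<phi>C] mult_1_left)
      also have "\<dots> = mollify \<eta> \<Psi> f (\<lambda>z. \<Sum>V\<in>U ` P - {- C}. 1 * (of_real (F V z) * \<phi> z))"
        using Radon_sum[OF R fin FC, where w = "\<lambda>V. 1"] by (simp only:)
      also have "(\<lambda>z. \<Sum>V\<in>U ` P - {- C}. 1 * (of_real (F V z) * \<phi> z)) = \<phi>"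
      proof
        fix z
        have "(\<Sum>V\<in>U ` P - {- C}. 1 * (of_real (F V z) * \<phi> z)) = of_real (\<Sum>V\<in>U ` P - {- C}. F V z) * \<phi> z"
          by (simp only: mult_1_left sum_distrib_right of_real_sum)
        also have "\<dots> = \<phi> z"
        proof (cases "z \<in> C")
          case True
          then show ?thesis by (simp only: sumF of_real_1 mult_1_left)
        next
          case False
          then have "z \<notin> supp \<phi>" using \<phi> unfolding C_def by blast
          then show ?thesis by (simp add: not_in_supp)
        qed
        finally show "(\<Sum>V\<in>U ` P - {- C}. 1 * (of_real (F V z) * \<phi> z)) = \<phi> z" .
      qed
      finally show ?thesis .
    qed
    ultimately show "\<exists>E\<in>approximable W k. \<forall>f\<in>K. \<forall>\<phi>\<in>\<Phi>. cmod (\<Psi> f \<phi> - E f \<phi>) \<le> \<epsilon>"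
      using \<eta>(2) by (intro bexI[of _ E]) simp_all
  qed
  then show "\<Psi> \<in> approximable W k" by (rule subsetD[OF approximable_approximable])
qed

end

text \<open>The subbasic sets are balls around arbitrary centers; the triangle inequality recenters them.\<close>

lemma compact_to_weak_star_neighbourhood:
  assumes "openin compact_to_weak_star T" "\<Psi> \<in> T"
  shows "\<exists>K \<Phi> \<epsilon>. compact K \<and> K \<subseteq> Conv \<and> finite \<Phi> \<and> \<Phi> \<subseteq> Cc \<and> \<epsilon> > 0 \<and>
     (\<forall>E\<in>P0LV. (\<forall>f\<in>K. \<forall>\<phi>\<in>\<Phi>. cmod (\<Psi> f \<phi> - E f \<phi>) \<le> \<epsilon>) \<longrightarrow> E \<in> T)"
proof -
  let ?near = "\<lambda>T K \<Phi> \<epsilon>. compact K \<and> K \<subseteq> Conv \<and> finite \<Phi> \<and> \<Phi> \<subseteq> Cc \<and> \<epsilon> > 0 \<and>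
     (\<forall>E\<in>P0LV. (\<forall>f\<in>K. \<forall>\<phi>\<in>\<Phi>. cmod (\<Psi> f \<phi> - E f \<phi>) \<le> \<epsilon>) \<longrightarrow> E \<in> T)"
  have "generate_topology_on {{\<Phi> \<in> P0LV. cw_seminorm K \<phi> (\<lambda>f \<eta>. \<Phi> f \<eta> - \<Psi> f \<eta>) < \<epsilon>} | \<Psi> K \<phi> \<epsilon>.
        \<Psi> \<in> P0LV \<and> compact K \<and> K \<subseteq> Conv \<and> K \<noteq> {} \<and> \<phi> \<in> Cc \<and> 0 < \<epsilon>} T"
    using assms(1) unfolding compact_to_weak_star_def openin_topology_generated_by_iff .
  from this assms(2) have "\<exists>K \<Phi> \<epsilon>. ?near T K \<Phi> \<epsilon>"
  proof (induction T rule: generate_topology_on.induct)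
    case Empty
    then show ?case by simp
  next
    case (Int a b)
    obtain K \<Phi> \<epsilon> where a: "compact K" "K \<subseteq> Conv" "finite \<Phi>" "\<Phi> \<subseteq> Cc" "\<epsilon> > 0"
      "\<forall>E\<in>P0LV. (\<forall>f\<in>K. \<forall>\<phi>\<in>\<Phi>. cmod (\<Psi> f \<phi> - E f \<phi>) \<le> \<epsilon>) \<longrightarrow> E \<in> a"
      using Int.IH(1)[OF IntD1[OF Int.prems]] by (elim exE conjE) (rule that)
    obtain K' \<Phi>' \<epsilon>' where b: "compact K'" "K' \<subseteq> Conv" "finite \<Phi>'" "\<Phi>' \<subseteq> Cc" "\<epsilon>' > 0"
      "\<forall>E\<in>P0LV. (\<forall>f\<in>K'. \<forall>\<phi>\<in>\<Phi>'. cmod (\<Psi> f \<phi> - E f \<phi>) \<le> \<epsilon>') \<longrightarrow> E \<in> b"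
      using Int.IH(2)[OF IntD2[OF Int.prems]] by (elim exE conjE) (rule that)
    show ?case
    proof (intro exI[of _ "K \<union> K'"] exI[of _ "\<Phi> \<union> \<Phi>'"] exI[of _ "min \<epsilon> \<epsilon>'"] conjI ballI impI)
      fix E assume E: "E \<in> P0LV" "\<forall>f\<in>K \<union> K'. \<forall>\<phi>\<in>\<Phi> \<union> \<Phi>'. cmod (\<Psi> f \<phi> - E f \<phi>) \<le> min \<epsilon> \<epsilon>'"
      have "E \<in> a" by (rule a(6)[rule_format, OF E(1)]) (use E(2) in simp)
      moreover have "E \<in> b" by (rule b(6)[rule_format, OF E(1)]) (use E(2) in simp)
      ultimately show "E \<in> a \<inter> b" ..
    qed (use a b in auto)
  next
    case (UN \<K>)
    then obtain T where T: "T \<in> \<K>" "\<Psi> \<in> T" by blast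
    obtain K \<Phi> \<epsilon> where a: "compact K" "K \<subseteq> Conv" "finite \<Phi>" "\<Phi> \<subseteq> Cc" "\<epsilon> > 0"
      "\<forall>E\<in>P0LV. (\<forall>f\<in>K. \<forall>\<phi>\<in>\<Phi>. cmod (\<Psi> f \<phi> - E f \<phi>) \<le> \<epsilon>) \<longrightarrow> E \<in> T"
      using UN.IH[OF T] by (elim exE conjE) (rule that)
    have "\<forall>E\<in>P0LV. (\<forall>f\<in>K. \<forall>\<phi>\<in>\<Phi>. cmod (\<Psi> f \<phi> - E f \<phi>) \<le> \<epsilon>) \<longrightarrow> E \<in> \<Union>\<K>"
      by (intro ballI impI UnionI[OF T(1)]) (erule a(6)[rule_format], blast)
    then show ?case using a(1-5) by (intro exI[of _ K] exI[of _ \<Phi>] exI[of _ \<epsilon>] conjI)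
  next
    case (Basis s)
    then obtain \<Psi>' K \<phi> \<epsilon>' where s: "s = {\<Phi> \<in> P0LV. cw_seminorm K \<phi> (\<lambda>f \<eta>. \<Phi> f \<eta> - \<Psi>' f \<eta>) < \<epsilon>'}"
      and h: "\<Psi>' \<in> P0LV" "compact K" "K \<subseteq> Conv" "K \<noteq> {}" "\<phi> \<in> Cc"
      by blast
    have \<Psi>: "\<Psi> \<in> P0LV" "cw_seminorm K \<phi> (\<lambda>f \<eta>. \<Psi> f \<eta> - \<Psi>' f \<eta>) < \<epsilon>'" using Basis.prems unfolding s by blast+
    define c where "c = cw_seminorm K \<phi> (\<lambda>f \<eta>. \<Psi> f \<eta> - \<Psi>' f \<eta>)"
    define \<epsilon> where "\<epsilon> = (\<epsilon>' - c) / 2"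
    have \<epsilon>: "\<epsilon> > 0" using \<Psi>(2) by (simp add: \<epsilon>_def c_def)
    have "bounded ((\<lambda>f. \<Psi> f \<phi> - \<Psi>' f \<phi>) ` K)"
      by (intro compact_imp_bounded compact_continuous_image h(2) continuous_on_diff
          continuous_on_subset[OF P0LV_continuous[OF \<Psi>(1)] h(3)] continuous_on_subset[OF P0LV_continuous[OF h(1)] h(3)])
    then have bdd: "bdd_above ((\<lambda>f. cmod (\<Psi> f \<phi> - \<Psi>' f \<phi>)) ` K)"
      unfolding bounded_iff by (elim exE) (rule bdd_aboveI2, auto)
    have "E \<in> s" if E: "E \<in> P0LV" "\<forall>f\<in>K. \<forall>\<theta>\<in>{\<phi>}. cmod (\<Psi> f \<theta> - E f \<theta>) \<le> \<epsilon>" for E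
    proof -
      have "cw_seminorm K \<phi> (\<lambda>f \<eta>. E f \<eta> - \<Psi>' f \<eta>) \<le> c + \<epsilon>"
        unfolding cw_seminorm_def
      proof (rule cSUP_least[OF h(4)])
        fix f assume f: "f \<in> K"
        have "cmod (\<Psi> f \<phi> - \<Psi>' f \<phi>) \<le> c" unfolding c_def cw_seminorm_def by (rule cSUP_upper[OF f bdd])
        moreover have "cmod (\<Psi> f \<phi> - E f \<phi>) \<le> \<epsilon>" using E(2) f by simp
        moreover have "cmod (E f \<phi> - \<Psi>' f \<phi>) \<le> cmod (\<Psi> f \<phi> - \<Psi>' f \<phi>) + cmod (\<Psi> f \<phi> - E f \<phi>)"
          using norm_triangle_ineq4[of "\<Psi> f \<phi> - \<Psi>' f \<phi>" "\<Psi> f \<phi> - E f \<phi>"] by simp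
        ultimately show "cmod (E f \<phi> - \<Psi>' f \<phi>) \<le> c + \<epsilon>" by linarith
      qed
      also have "c + \<epsilon> < \<epsilon>'" using \<epsilon> by (simp add: \<epsilon>_def field_simps)
      finally show ?thesis unfolding s using E(1) by simp
    qed
    then show ?case using h \<epsilon>
      by (intro exI[of _ K] exI[of _ "{\<phi>}"] exI[of _ \<epsilon>] conjI ballI impI) simp_all
  qed
  then show ?thesis .
qed

theorem theorem3:
  fixes W :: "(real ^ 'n) local_functional set" and k :: nat
  assumes "k \<le> CARD('n)"
    and "submodule_of W (P0LV_hom k)"
    and "affine_invariant W"
    and "W \<noteq> {\<lambda>f \<phi>. 0}"
  shows "subtopology compact_to_weak_star (P0LV_hom k) closure_of W = P0LV_hom k"
proof
  have WS: "W \<subseteq> P0LV_hom k" by (rule submodule_ofD(1)[OF assms(2)])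
  have sub: "P0LV_hom k \<subseteq> (P0LV :: (real ^ 'n) local_functional set)" using P0LV_homD(1) by (rule subsetI)
  then have top: "topspace (subtopology compact_to_weak_star (P0LV_hom k)) = (P0LV_hom k :: (real ^ 'n) local_functional set)"
    unfolding topspace_subtopology topspace_compact_to_weak_star by (rule Int_absorb1)
  show "subtopology compact_to_weak_star (P0LV_hom k) closure_of W \<subseteq> P0LV_hom k"
    using closure_of_subset_topspace[of "subtopology compact_to_weak_star (P0LV_hom k)" W] unfolding top .
  show "P0LV_hom k \<subseteq> subtopology compact_to_weak_star (P0LV_hom k) closure_of W"
  proof
    fix \<Psi> :: "(real ^ 'n) local_functional" assume \<Psi>: "\<Psi> \<in> P0LV_hom k"
    have app: "\<Psi> \<in> approximable W k" by (rule subsetD[OF approximable_everything[OF assms(2-4)] \<Psi>])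
    show "\<Psi> \<in> subtopology compact_to_weak_star (P0LV_hom k) closure_of W"
      unfolding in_closure_of top
    proof (intro conjI \<Psi> allI impI)
      fix S assume S: "\<Psi> \<in> S \<and> openin (subtopology compact_to_weak_star (P0LV_hom k)) S"
      then obtain T where T: "openin compact_to_weak_star T" "S = T \<inter> P0LV_hom k"
        unfolding openin_subtopology by blast
      then have "\<Psi> \<in> T" using S by blast
      obtain K \<Phi> \<epsilon> where n: "compact K" "K \<subseteq> Conv" "finite \<Phi>" "\<Phi> \<subseteq> Cc" "\<epsilon> > 0"
        and near: "\<forall>E\<in>P0LV. (\<forall>f\<in>K. \<forall>\<phi>\<in>\<Phi>. cmod (\<Psi> f \<phi> - E f \<phi>) \<le> \<epsilon>) \<longrightarrow> E \<in> T"
        using compact_to_weak_star_neighbourhood[OF T(1) \<open>\<Psi> \<in> T\<close>] by (elim exE conjE) (rule that)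
      obtain E where E: "E \<in> W" "\<forall>f\<in>K. \<forall>\<phi>\<in>\<Phi>. cmod (\<Psi> f \<phi> - E f \<phi>) \<le> \<epsilon>"
        using approximableD(2)[OF app n] by blast
      have "E \<in> T" using near[THEN bspec, OF subsetD[OF sub subsetD[OF WS E(1)]]] E(2) by (rule mp)
      then show "\<exists>E. E \<in> W \<and> E \<in> S" using E(1) WS T(2) by blast
    qed
  qed
qed

end
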